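(* Let $m\ge1$ and let $n\ge 2$ be even, and consider a positively weighted Fisher graph on an infinite band of height $m$ and period $n$. For $l\ge1$ let $\mu_l$ be the Boltzmann measure of the dimer model on the cylindrical quotient of height $m$ and circumference $2ln$. Then the weak limit of the measures $\mu_l$ as $l\to\infty$ exists as a probability measure on dimer configurations of the infinite band graph. For any finite collection of distinct edges $e_1=u_1v_1,\dots,e_k=u_kv_k$ with weights $w_{e_1},\dots,w_{e_k}$, the probability under the limit measure that all of $e_1,\dots,e_k$ occur in the dimer configuration is $$\Pr(e_1\,\&\,e_2\,\&\cdots\&\,e_k)=\lim_{l\to\infty}\ \prod_{j=1}^k w_{e_j}\ \sqrt{\det\left[K_{m\times 2ln}^{-1}(-1)\begin{pmatrix}u_1&v_1&\cdots&u_k&v_k\\ u_1&v_1&\cdots&u_k&v_k\end{pmatrix}\right]},$$ where $M\begin{pmatrix}u_1&v_1&\cdots\\ u_1&v_1&\cdots\end{pmatrix}$ denotes the submatrix of $M$ with rows and columns indexed by $u_1,v_1,\dots,u_k,v_k$.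
   Context: The Fisher graph is the honeycomb lattice with every vertex replaced by a triangle. The infinite band graph of height $m$ has vertices $\beta_s(x,y),\omega_s(x,y)$, $s\in\{a,b,c\}$, $x\in\mathbb{Z}$, $y\in\{0,\dots,m-1\}$, and oriented edges: $\beta_a\to\beta_b\to\beta_c\to\beta_a$ and $\omega_a\to\omega_b\to\omega_c\to\omega_a$ at each $(x,y)$; $\beta_a(x,y)\to\omega_a(x,y)$; $\beta_b(x,y)\to\omega_b(x+1,y)$; $\beta_c(x,y)\to\omega_c(x,y+1)$ for $0\le y\le m-2$. Edge weights $W(e)>0$ are invariant under $x\mapsto x+n$. The cylindrical quotient of height $m$ and circumference $N$ (a multiple of $n$) is obtained by taking $x$ modulo $N$; its $z$-edges are the $m$ edges $\beta_b(N-1,y)\to\omega_b(0,y)$. A finite set of edges of the band is viewed in the cylinder of circumference $2ln$ for $l$ large by reducing $x$ modulo $2ln$. $K_{m\times N}(z)$ is the $6mN\times 6mN$ matrix on the vertices of this cylinder such that for each oriented edge $u\to v$, the $(u,v)$ entry is $W(uv)$ and the $(v,u)$ entry is $-W(uv)$ for non-$z$-edges, and these entries are $zW(uv)$ and $-z^{-1}W(uv)$ respectively for $z$-edges; all other entries are $0$. A dimer configuration (perfect matching) of a graph is a set of edges such that each vertex is incident to exactly one of them. The Boltzmann measure on the dimer configurations of a finite weighted graph gives configuration $D$ probability proportional to $\prod_{e\in D}W(e)$. Weak convergence means convergence of the probabilities of all cylindrical events "$e_1,\dots,e_k$ all occur". *)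

theory Defs
  imports "HOL-Probability.Probability_Measure" "Jordan_Normal_Form.Gauss_Jordan_Elimination"
    "Jordan_Normal_Form.Determinant"
begin

section \<open>The Fisher graph on a band and its cylindrical quotients\<close>

datatype corner = Ca | Cb | Cc

datatype vertex = BetaV corner int nat | OmegaV corner int nat

fun next_corner :: "corner \<Rightarrow> corner" where
  "next_corner Ca = Cb"
| "next_corner Cb = Cc"
| "next_corner Cc = Ca"

primrec map_x :: "(int \<Rightarrow> int) \<Rightarrow> vertex \<Rightarrow> vertex" where
  "map_x f (BetaV s x y) = BetaV s (f x) y"
| "map_x f (OmegaV s x y) = OmegaV s (f x) y"

abbreviation translate :: "int \<Rightarrow> vertex \<Rightarrow> vertex" where
  "translate d \<equiv> map_x (\<lambda>x. x + d)"

abbreviation reduce :: "nat \<Rightarrow> vertex \<Rightarrow> vertex" where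
  "reduce N \<equiv> map_x (\<lambda>x. x mod int N)"

definition band_vertices :: "nat \<Rightarrow> vertex set" where
  "band_vertices m = {BetaV s x y | s x y. y < m} \<union> {OmegaV s x y | s x y. y < m}"

definition band_arcs :: "nat \<Rightarrow> (vertex \<times> vertex) set" where
  "band_arcs m =
     {(BetaV s x y, BetaV (next_corner s) x y) | s x y. y < m}
   \<union> {(OmegaV s x y, OmegaV (next_corner s) x y) | s x y. y < m}
   \<union> {(BetaV Ca x y, OmegaV Ca x y) | x y. y < m}
   \<union> {(BetaV Cb x y, OmegaV Cb (x + 1) y) | x y. y < m}
   \<union> {(BetaV Cc x y, OmegaV Cc x (y + 1)) | x y. y + 1 < m}"

definition edges_of :: "('v \<times> 'v) set \<Rightarrow> 'v set set" where
  "edges_of A = {{u, v} | u v. (u, v) \<in> A}"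

abbreviation band_edges :: "nat \<Rightarrow> vertex set set" where
  "band_edges m \<equiv> edges_of (band_arcs m)"

definition fisher_band_weight :: "nat \<Rightarrow> nat \<Rightarrow> (vertex set \<Rightarrow> real) \<Rightarrow> bool" where
  "fisher_band_weight m n W \<longleftrightarrow>
     (\<forall>e \<in> band_edges m. W e > 0 \<and> W (translate (int n) ` e) = W e)"

definition cyl_vertices :: "nat \<Rightarrow> nat \<Rightarrow> vertex set" where
  "cyl_vertices m N = reduce N ` band_vertices m"

definition cyl_arcs :: "nat \<Rightarrow> nat \<Rightarrow> (vertex \<times> vertex) set" where
  "cyl_arcs m N = map_prod (reduce N) (reduce N) ` band_arcs m"

abbreviation cyl_edges :: "nat \<Rightarrow> nat \<Rightarrow> vertex set set" where
  "cyl_edges m N \<equiv> edges_of (cyl_arcs m N)"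

definition z_arcs :: "nat \<Rightarrow> nat \<Rightarrow> (vertex \<times> vertex) set" where
  "z_arcs m N = {(BetaV Cb (int N - 1) y, OmegaV Cb 0 y) | y. y < m}"

text \<open>The weight of an edge of the cylinder is the common weight of all its lifts to the band;
  it is well defined when the period of the weights divides \<open>N\<close>
  (lemma \<open>cyl_weight_reduce\<close> below).\<close>

definition cyl_weight :: "nat \<Rightarrow> nat \<Rightarrow> (vertex set \<Rightarrow> real) \<Rightarrow> vertex set \<Rightarrow> real" where
  "cyl_weight m N W e = the_elem (W ` {e' \<in> band_edges m. reduce N ` e' = e})"


section \<open>Dimer configurations and Boltzmann measures\<close>

definition dimer_configs :: "'v set \<Rightarrow> 'v set set \<Rightarrow> 'v set set set" where
  "dimer_configs V E = {D. D \<subseteq> E \<and> (\<forall>v \<in> V. \<exists>!e. e \<in> D \<and> v \<in> e)}"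

definition boltzmann_measure ::
    "'v set \<Rightarrow> 'v set set \<Rightarrow> ('v set \<Rightarrow> real) \<Rightarrow> 'v set set measure" where
  "boltzmann_measure V E w =
     point_measure (dimer_configs V E)
       (\<lambda>D. ennreal ((\<Prod>e\<in>D. w e) / (\<Sum>D'\<in>dimer_configs V E. \<Prod>e\<in>D'. w e)))"

definition cyl_boltzmann ::
    "nat \<Rightarrow> nat \<Rightarrow> (vertex set \<Rightarrow> real) \<Rightarrow> vertex set set measure" where
  "cyl_boltzmann m N W =
     boltzmann_measure (cyl_vertices m N) (cyl_edges m N) (cyl_weight m N W)"

text \<open>The set of dimer configurations of the band with the \<open>\<sigma>\<close>-algebra generated by the events
  ``the edge \<open>e\<close> occurs'', hence by all cylindrical events.\<close>

definition band_dimer_space :: "nat \<Rightarrow> vertex set set measure" where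
  "band_dimer_space m =
     (let \<Omega> = dimer_configs (band_vertices m) (band_edges m)
      in sigma \<Omega> {{D \<in> \<Omega>. e \<in> D} | e. e \<in> band_edges m})"

definition all_occur :: "'e set measure \<Rightarrow> 'e set \<Rightarrow> 'e set set" where
  "all_occur M F = {D \<in> space M. F \<subseteq> D}"

text \<open>\<open>P\<close> is the weak limit of a sequence \<open>\<mu>\<close> of measures on dimer configurations of the
  cylinders of height \<open>m\<close> and circumferences \<open>N l\<close>, where \<open>N l\<close> tends to infinity: a finite
  set \<open>F\<close> of edges of the band is viewed in the cylinder by reducing \<open>x\<close> modulo \<open>N l\<close>,
  which is injective on \<open>F\<close> for large \<open>l\<close>.\<close>

definition weak_limit ::
    "nat \<Rightarrow> (nat \<Rightarrow> nat) \<Rightarrow> (nat \<Rightarrow> vertex set set measure) \<Rightarrow> vertex set set measure \<Rightarrow> bool" where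
  "weak_limit m N \<mu> P \<longleftrightarrow>
     prob_space P \<and> space P = space (band_dimer_space m) \<and> sets P = sets (band_dimer_space m) \<and>
     (\<forall>F. finite F \<longrightarrow> F \<subseteq> band_edges m \<longrightarrow>
        (\<lambda>l. measure (\<mu> l) (all_occur (\<mu> l) ((\<lambda>e. reduce (N l) ` e) ` F)))
          \<longlonglongrightarrow> measure P (all_occur P F))"


section \<open>The Kasteleyn matrix\<close>

definition kast_entry ::
    "nat \<Rightarrow> nat \<Rightarrow> (vertex set \<Rightarrow> real) \<Rightarrow> 'a::real_field \<Rightarrow> vertex \<Rightarrow> vertex \<Rightarrow> 'a" where
  "kast_entry m N W z u v =
     (if (u, v) \<in> cyl_arcs m N then
        (if (u, v) \<in> z_arcs m N then z else 1) * of_real (cyl_weight m N W {u, v})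
      else if (v, u) \<in> cyl_arcs m N then
        - (if (v, u) \<in> z_arcs m N then inverse z else 1) * of_real (cyl_weight m N W {v, u})
      else 0)"

primrec corner_index :: "corner \<Rightarrow> nat" where
  "corner_index Ca = 0"
| "corner_index Cb = 1"
| "corner_index Cc = 2"

text \<open>Matrices are indexed by natural numbers, so the \<open>6 m N\<close> vertices of the cylinder are
  numbered (lemma \<open>bij_betw_vertex_index\<close> below); the choice of the numbering is immaterial.\<close>

primrec vertex_index :: "nat \<Rightarrow> vertex \<Rightarrow> nat" where
  "vertex_index m (BetaV s x y) = 6 * (nat x * m + y) + corner_index s"
| "vertex_index m (OmegaV s x y) = 6 * (nat x * m + y) + 3 + corner_index s"

definition vertex_at :: "nat \<Rightarrow> nat \<Rightarrow> nat \<Rightarrow> vertex" where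
  "vertex_at m N = the_inv_into (cyl_vertices m N) (vertex_index m)"

definition kast_mat ::
    "nat \<Rightarrow> nat \<Rightarrow> (vertex set \<Rightarrow> real) \<Rightarrow> 'a::real_field \<Rightarrow> 'a mat" where
  "kast_mat m N W z = Matrix.mat (6 * m * N) (6 * m * N)
     (\<lambda>(i, j). kast_entry m N W z (vertex_at m N i) (vertex_at m N j))"

definition inv_mat :: "'a::field mat \<Rightarrow> 'a mat" where
  "inv_mat A = the (mat_inverse A)"

text \<open>The submatrix with rows and columns indexed by a list of vertices (repetitions allowed).\<close>

definition vertex_submatrix :: "nat \<Rightarrow> 'a mat \<Rightarrow> vertex list \<Rightarrow> 'a mat" where
  "vertex_submatrix m A vs = Matrix.mat (length vs) (length vs)
     (\<lambda>(i, j). A $$ (vertex_index m (vs ! i), vertex_index m (vs ! j)))"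

text \<open>The list \<open>u\<^sub>1, v\<^sub>1, \<dots>, u\<^sub>k, v\<^sub>k\<close>.\<close>

definition endpoints :: "('v \<times> 'v) list \<Rightarrow> 'v list" where
  "endpoints ps = concat (map (\<lambda>(u, v). [u, v]) ps)"


section \<open>Well-definedness\<close>

lemma translate_translate: "translate a ` translate b ` e = translate (a + b) ` e"
proof -
  have "translate a (translate b u) = translate (a + b) u" for u by (cases u) auto
  then show ?thesis by (auto simp: image_image)
qed

lemma map_x_ident [simp]: "map_x (\<lambda>x. x) = (\<lambda>u. u)"
proof
  show "map_x (\<lambda>x. x) u = u" for u by (cases u) auto
qed

lemma translate_arc: "(u, v) \<in> band_arcs m \<Longrightarrow> (translate d u, translate d v) \<in> band_arcs m"
  by (auto simp: band_arcs_def)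

lemma translate_edge: "e \<in> band_edges m \<Longrightarrow> translate d ` e \<in> band_edges m"
  unfolding edges_of_def using translate_arc by fastforce

lemma weight_translate_nat:
  assumes "fisher_band_weight m n W" "e \<in> band_edges m"
  shows "W (translate (int k * int n) ` e) = W e"
proof (induction k)
  case 0 then show ?case by simp
next
  case (Suc k)
  have "W (translate (int n) ` translate (int k * int n) ` e) = W (translate (int k * int n) ` e)"
    using assms translate_edge[OF assms(2)] unfolding fisher_band_weight_def by blast
  with Suc show ?case unfolding translate_translate by (simp add: algebra_simps)
qed

lemma weight_translate:
  assumes "fisher_band_weight m n W" "e \<in> band_edges m" "int n dvd d"
  shows "W (translate d ` e) = W e"
proof -
  obtain k where d: "d = int n * k" using assms(3) by blast
  show ?thesis
  proof (cases "k \<ge> 0")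
    case True
    then show ?thesis using weight_translate_nat[OF assms(1,2), of "nat k"] d by (simp add: mult.commute)
  next
    case False
    have "W (translate (int (nat (-k)) * int n) ` translate d ` e) = W (translate d ` e)"
      by (rule weight_translate_nat[OF assms(1) translate_edge[OF assms(2)]])
    then show ?thesis using False d unfolding translate_translate
      by (simp add: algebra_simps)
  qed
qed

lemma reduce_eqD:
  assumes "reduce N u = reduce N v"
  shows "\<exists>d. int N dvd d \<and> v = translate d u"
proof -
  have *: "\<exists>d. int N dvd d \<and> x' = x + d" if "x mod int N = x' mod int N" for x x' :: int
    using that by (intro exI[of _ "x' - x"]) (metis add.commute diff_add_cancel mod_eq_dvd_iff)
  show ?thesis
  proof (cases u)
    case (BetaV s x y)
    then obtain x' where "v = BetaV s x' y" "x mod int N = x' mod int N" using assms by (cases v) auto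
    then show ?thesis using *[of x x'] BetaV by auto
  next
    case (OmegaV s x y)
    then obtain x' where "v = OmegaV s x' y" "x mod int N = x' mod int N" using assms by (cases v) auto
    then show ?thesis using *[of x x'] OmegaV by auto
  qed
qed

abbreviation shape :: "vertex \<Rightarrow> vertex" where
  "shape \<equiv> map_x (\<lambda>_. 0)"

lemma shape_cong: "reduce N u = reduce N v \<Longrightarrow> shape u = shape v"
  by (cases u; cases v) auto

lemma next_corner_simps:
  "next_corner s \<noteq> s" "s \<noteq> next_corner s" "next_corner (next_corner s) \<noteq> s"
  "next_corner s = next_corner t \<longleftrightarrow> s = t"
  by (cases s; cases t; simp)+

lemma arc_target_unique:
  assumes "(u, v) \<in> band_arcs m" "(translate d u, v') \<in> band_arcs m" "shape v = shape v'"
  shows "v' = translate d v"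
  using assms unfolding band_arcs_def by (auto 0 0)

lemma arcs_not_opposite:
  assumes "(u, v) \<in> band_arcs m" "(u', v') \<in> band_arcs m" "shape u = shape v'" "shape v = shape u'"
  shows False
  using assms unfolding band_arcs_def by (auto simp: next_corner_simps)

lemma arc_lift_unique:
  assumes "(u, v) \<in> band_arcs m" "(u', v') \<in> band_arcs m"
    "{reduce N u, reduce N v} = {reduce N u', reduce N v'}"
  shows "\<exists>d. int N dvd d \<and> u' = translate d u \<and> v' = translate d v"
proof -
  consider "reduce N u = reduce N u'" "reduce N v = reduce N v'"
    | "reduce N u = reduce N v'" "reduce N v = reduce N u'"
    using assms(3) unfolding doubleton_eq_iff by blast
  then show ?thesis
  proof cases
    case 1
    obtain d where d: "int N dvd d" "u' = translate d u" using reduce_eqD[OF 1(1)] by blast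
    then have "v' = translate d v"
      using arc_target_unique[OF assms(1)] assms(2) shape_cong[OF 1(2)] by simp
    with d show ?thesis by blast
  next
    case 2
    then show ?thesis using arcs_not_opposite[OF assms(1,2)] shape_cong[OF 2(1)] shape_cong[OF 2(2)] by simp
  qed
qed

lemma cyl_weight_reduce:
  assumes "fisher_band_weight m n W" "n dvd N" "e \<in> band_edges m"
  shows "cyl_weight m N W (reduce N ` e) = W e"
proof -
  have "W e' = W e" if e': "e' \<in> band_edges m" "reduce N ` e' = reduce N ` e" for e'
  proof -
    obtain u v where uv: "e = {u, v}" "(u, v) \<in> band_arcs m" using assms(3) unfolding edges_of_def by blast
    obtain u' v' where uv': "e' = {u', v'}" "(u', v') \<in> band_arcs m" using e'(1) unfolding edges_of_def by blast
    obtain d where d: "int N dvd d" "u' = translate d u" "v' = translate d v"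
      using arc_lift_unique[OF uv(2) uv'(2)] e'(2) uv(1) uv'(1) by auto
    have "e' = translate d ` e" using d uv uv' by simp
    moreover have "int n dvd d" using assms(2) d(1) by (meson dvd_trans int_dvd_int_iff)
    ultimately show ?thesis using weight_translate[OF assms(1,3)] by simp
  qed
  then have "W ` {e' \<in> band_edges m. reduce N ` e' = reduce N ` e} = {W e}" using assms(3) by blast
  then show ?thesis unfolding cyl_weight_def by simp
qed

lemma cyl_vertices_eq:
  assumes "N > 0"
  shows "cyl_vertices m N = {BetaV s x y | s x y. 0 \<le> x \<and> x < int N \<and> y < m}
                          \<union> {OmegaV s x y | s x y. 0 \<le> x \<and> x < int N \<and> y < m}" (is "_ = ?R")
proof
  show "cyl_vertices m N \<subseteq> ?R"
    using assms unfolding cyl_vertices_def band_vertices_def by auto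
  show "?R \<subseteq> cyl_vertices m N"
  proof
    fix v assume v: "v \<in> ?R"
    then have "v = reduce N v" by auto
    moreover have "v \<in> band_vertices m" using v unfolding band_vertices_def by blast
    ultimately show "v \<in> cyl_vertices m N" unfolding cyl_vertices_def by blast
  qed
qed

lemma vertex_index_less:
  fixes k m N y r :: nat
  assumes "k < N" "y < m" "r < 6"
  shows "6 * (k * m + y) + r < 6 * m * N"
proof -
  have "Suc (k * m + y) \<le> Suc k * m" using assms(2) by simp
  also have "\<dots> \<le> N * m" using assms(1) by (intro mult_le_mono1) simp
  finally show ?thesis using assms(3) by (simp add: mult.commute)
qed

lemma vertex_index_eqD:
  fixes k k' m y y' r r' :: nat
  assumes "6 * (k * m + y) + r = 6 * (k' * m + y') + r'" "r < 6" "r' < 6" "y < m" "y' < m"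
  shows "k = k' \<and> y = y' \<and> r = r'"
proof -
  have "r = r'" using arg_cong[OF assms(1), of "\<lambda>t. t mod 6"] assms(2,3)
    unfolding mod_mult_self4 by simp
  then have eq: "k * m + y = k' * m + y'" using assms(1) by simp
  have "y = y'" using arg_cong[OF eq, of "\<lambda>t. t mod m"] assms(4,5)
    unfolding mod_mult_self3 by simp
  with eq \<open>r = r'\<close> assms(4) show ?thesis by simp
qed

lemma bij_betw_vertex_index:
  assumes "N > 0"
  shows "bij_betw (vertex_index m) (cyl_vertices m N) {..<6 * m * N}"
proof -
  have ci: "corner_index s < 3" for s by (cases s) auto
  have ci6: "corner_index s < 6" for s by (cases s) auto
  have ci_inj: "corner_index s = corner_index t \<longleftrightarrow> s = t" for s t by (cases s; cases t) auto
  have form: "\<exists>r k y. vertex_index m v = 6 * (k * m + y) + r \<and> k < N \<and> y < m \<and> r < 6"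
    if v: "v \<in> cyl_vertices m N" for v
  proof (cases v)
    case (BetaV s x y)
    then have "vertex_index m v = 6 * (nat x * m + y) + corner_index s" "nat x < N" "y < m"
      using v by (auto simp: cyl_vertices_eq[OF assms])
    then show ?thesis using ci[of s] by (intro exI conjI) (assumption | simp)+
  next
    case (OmegaV s x y)
    then have "vertex_index m v = 6 * (nat x * m + y) + (3 + corner_index s)" "nat x < N" "y < m"
      using v by (auto simp: cyl_vertices_eq[OF assms])
    moreover have "3 + corner_index s < 6" using ci[of s] by simp
    ultimately show ?thesis by blast
  qed
  have inj: "inj_on (vertex_index m) (cyl_vertices m N)"
  proof (rule inj_onI)
    fix u v assume u: "u \<in> cyl_vertices m N" and v: "v \<in> cyl_vertices m N"
      and eq: "vertex_index m u = vertex_index m v"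
    define rem where "rem = (\<lambda>w. case w of BetaV s _ _ \<Rightarrow> corner_index s | OmegaV s _ _ \<Rightarrow> 3 + corner_index s)"
    define xx where "xx = (\<lambda>w. case w of BetaV _ x _ \<Rightarrow> x | OmegaV _ x _ \<Rightarrow> x)"
    define yy where "yy = (\<lambda>w. case w of BetaV _ _ y \<Rightarrow> y | OmegaV _ _ y \<Rightarrow> y)"
    have *: "vertex_index m w = 6 * (nat (xx w) * m + yy w) + rem w \<and> rem w < 6 \<and> yy w < m \<and> xx w \<ge> 0"
      if "w \<in> cyl_vertices m N" for w
      using that ci ci6 by (auto simp: cyl_vertices_eq[OF assms] rem_def xx_def yy_def)
    have "nat (xx u) = nat (xx v) \<and> yy u = yy v \<and> rem u = rem v"
      using vertex_index_eqD[of "nat (xx u)" m "yy u" "rem u" "nat (xx v)" "yy v" "rem v"]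
        *[OF u] *[OF v] eq by metis
    then have "xx u = xx v" "yy u = yy v" "rem u = rem v" using *[OF u] *[OF v] by auto
    moreover have "3 + corner_index s \<noteq> corner_index t" "corner_index t \<noteq> 3 + corner_index s" for s t
      using ci[of t] by auto
    ultimately show "u = v"
      by (cases u; cases v) (auto simp: rem_def xx_def yy_def ci_inj)
  qed
  have "{..<6 * m * N} \<subseteq> vertex_index m ` cyl_vertices m N"
  proof
    fix i assume "i \<in> {..<6 * m * N}"
    then have i: "i < 6 * m * N" by simp
    then have m: "m > 0" by (cases m) auto
    define r q y k where "r = i mod 6" and "q = i div 6" and "y = q mod m" and "k = q div m"
    have q: "q < N * m" using i unfolding q_def by (simp add: less_mult_imp_div_less mult.commute mult.left_commute)
    have k: "k < N" using q unfolding k_def by (simp add: less_mult_imp_div_less)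
    have y: "y < m" using m unfolding y_def by simp
    have ieq: "i = 6 * (k * m + y) + r" unfolding r_def q_def y_def k_def by simp
    have V: "BetaV s (int k) y \<in> cyl_vertices m N" "OmegaV s (int k) y \<in> cyl_vertices m N" for s
      using k y by (auto simp: cyl_vertices_eq[OF assms])
    have "r < 6" unfolding r_def by simp
    have small: "\<exists>s. t = corner_index s" if "t < 3" for t :: nat
    proof -
      have "t = 0 \<or> t = 1 \<or> t = 2" using that by auto
      then show ?thesis using corner_index.simps by metis
    qed
    have "(\<exists>s. r = corner_index s) \<or> (\<exists>s. r = 3 + corner_index s)"
    proof (cases "r < 3")
      case True
      then show ?thesis using small by blast
    next
      case False
      then have "r = 3 + (r - 3)" "r - 3 < 3" using \<open>r < 6\<close> by auto
      then show ?thesis using small by metis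
    qed
    then consider s where "r = corner_index s" | s where "r = 3 + corner_index s"
      by blast
    then show "i \<in> vertex_index m ` cyl_vertices m N"
    proof cases
      case 1
      then have "i = vertex_index m (BetaV s (int k) y)" using ieq by simp
      then show ?thesis using V by blast
    next
      case 2
      then have "i = vertex_index m (OmegaV s (int k) y)" using ieq by simp
      then show ?thesis using V by blast
    qed
  qed
  moreover have "vertex_index m ` cyl_vertices m N \<subseteq> {..<6 * m * N}"
    using form vertex_index_less by fastforce
  ultimately show ?thesis using inj unfolding bij_betw_def by blast
qed

end

theory Submission
  imports Defs "HOL-Probability.Probability_Mass_Function" "HOL-Probability.Projective_Limit"
begin

text \<open>
  In the Fisher graph a dimer configuration is determined by its set of legs, the edges outside the
  triangles: every triangle meets one or three occupied legs. Any two configurations of the cylinder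
  are connected by flips along hexagons and along a loop around the cylinder. Such a flip changes a
  matching along an even ring of triangles, and the Kasteleyn signs, with the factor \<open>-1\<close> on the
  \<open>z\<close>-edges and \<open>N\<close> even, make it preserve the signed Pfaffian term of the matching. Hence the
  Pfaffian of \<open>K\<close> is up to sign the partition function, and likewise for the submatrix of the
  vertices not covered by prescribed edges; Jacobi's complementary minor formula turns the ratio of
  the two into the minor of the inverse. So the expression on the right is exactly the Boltzmann
  probability on the cylinder as soon as reduction modulo the circumference is injective on the edges.

  For the limit, the state of a column is the set of occupied legs leaving it. The partition function
  is the trace of a power of a transfer matrix which preserves the parity of the number of occupied
  legs and is positive on either parity class; a Perron argument on the two blocks gives convergence
  of the probabilities of local events. Kolmogorov extension yields a random set of edges, which is
  almost surely a dimer configuration because each of the countably many vertex conditions is local.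
\<close>

section \<open>Pfaffian sums and determinants of skew matrices\<close>

text \<open>Triangles are odd cycles, so the graph is not bipartite and the matching sum is a
  Pfaffian; determinants give only its square, whence the square root in the formula. Neither faces
  nor a planar embedding enter: sign consistency is checked on just two kinds of rings, by explicit
  products of signs. The determinant theorem is needed twice on the same vertex set, once for the
  given weights and once for weights annihilated on every edge that touches a prescribed edge
  without being prescribed. Therefore signs (\<open>kast_sign\<close>) are kept apart from weights,
  and the weights may vanish.

  For the limit the obstacle is that the two parity classes do not communicate and nothing decides
  which block has the larger Perron eigenvalue. The argument has to cover either one winning as well
  as a tie; in all cases the trace, divided by the power of the larger eigenvalue, has a positive
  limit. Extension to a measure needs the joint law of finitely many edges, including absences, so
  local events prescribe a Boolean for each edge.\<close>

definition swaps :: "('a \<Rightarrow> 'b) \<Rightarrow> ('a \<Rightarrow> 'b) \<Rightarrow> 'a set \<Rightarrow> 'b \<Rightarrow> 'b" where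
  "swaps f g A v =
     (if v \<in> f ` A then g (the_inv_into A f v) else if v \<in> g ` A then f (the_inv_into A g v) else v)"

lemma swaps_simps:
  assumes "inj_on f A" "inj_on g A" "f ` A \<inter> g ` A = {}"
  shows "t \<in> A \<Longrightarrow> swaps f g A (f t) = g t"
    and "t \<in> A \<Longrightarrow> swaps f g A (g t) = f t"
    and "v \<notin> f ` A \<Longrightarrow> v \<notin> g ` A \<Longrightarrow> swaps f g A v = v"
proof -
  show "t \<in> A \<Longrightarrow> swaps f g A (f t) = g t"
    using assms by (simp add: swaps_def the_inv_into_f_f)
  show "t \<in> A \<Longrightarrow> swaps f g A (g t) = f t"
  proof -
    assume t: "t \<in> A"
    then have "g t \<notin> f ` A" using assms(3) by blast
    then show ?thesis using t assms by (simp add: swaps_def the_inv_into_f_f)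
  qed
  show "v \<notin> f ` A \<Longrightarrow> v \<notin> g ` A \<Longrightarrow> swaps f g A v = v"
    by (simp add: swaps_def)
qed

text \<open>The map is a product of \<open>card A\<close> disjoint transpositions; the induction
  peels off one of them.\<close>

lemma swaps_permutes_sign:
  assumes "finite A" "inj_on f A" "inj_on g A" "f ` A \<inter> g ` A = {}"
  shows "swaps f g A permutes (f ` A \<union> g ` A) \<and> sign (swaps f g A) = (-1) ^ card A"
  using assms
proof (induction A rule: finite_induct)
  case empty
  have "swaps f g {} = id" by (auto simp: swaps_def)
  then show ?case by (simp add: id_def)
next
  case (insert a A)
  have A: "inj_on f A" "inj_on g A" "f ` A \<inter> g ` A = {}" using insert.prems by auto
  have IH: "swaps f g A permutes (f ` A \<union> g ` A)" "sign (swaps f g A) = (-1) ^ card A"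
    using insert.IH[OF A] by auto
  have eq: "swaps f g (insert a A) = Transposition.transpose (f a) (g a) \<circ> swaps f g A"
  proof
    fix v
    have fa: "f a \<notin> f ` A" "g a \<notin> g ` A" "f a \<notin> g ` A" "g a \<notin> f ` A" "f a \<noteq> g a"
      using insert by auto
    consider "v = f a" | "v = g a" | t where "t \<in> A" "v = f t" | t where "t \<in> A" "v = g t"
      | "v \<notin> f ` insert a A" "v \<notin> g ` insert a A" by blast
    then show "swaps f g (insert a A) v = (Transposition.transpose (f a) (g a) \<circ> swaps f g A) v"
    proof cases
      case 1
      then show ?thesis using swaps_simps(1)[OF insert.prems, of a] swaps_simps(3)[OF A, of v] fa by simp
    next
      case 2
      then show ?thesis using swaps_simps(2)[OF insert.prems, of a] swaps_simps(3)[OF A, of v] fa by simp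
    next
      case 3
      have "g t \<noteq> f a" "g t \<noteq> g a" using fa 3(1) by (metis imageI)+
      then show ?thesis using swaps_simps(1)[OF insert.prems, of t] swaps_simps(1)[OF A, of t] 3 by simp
    next
      case 4
      have "f t \<noteq> f a" "f t \<noteq> g a" using fa 4(1) by (metis imageI)+
      then show ?thesis using swaps_simps(2)[OF insert.prems, of t] swaps_simps(2)[OF A, of t] 4 by simp
    next
      case 5
      then show ?thesis using swaps_simps(3)[OF insert.prems, of v] swaps_simps(3)[OF A, of v] by simp
    qed
  qed
  have fg: "f a \<noteq> g a" using insert.prems by auto
  have "swaps f g (insert a A) permutes (f ` insert a A \<union> g ` insert a A)"
    unfolding eq by (intro permutes_compose permutes_subset[OF IH(1)] permutes_swap_id) auto
  moreover have "sign (swaps f g (insert a A)) = (-1) ^ card (insert a A)"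
    unfolding eq using IH(2) insert.hyps fg permutes_imp_permutation[OF _ IH(1)]
    by (subst sign_compose) (auto simp: permutation_swap_id sign_swap_id)
  ultimately show ?case by blast
qed

definition cyclic_shift :: "nat \<Rightarrow> nat \<Rightarrow> nat" where
  "cyclic_shift r t = (if t < r then Suc t mod r else t)"

text \<open>Composing a cycle with the transposition of \<open>0\<close> and the next index inserts
  that index into the cycle, so each step changes the sign once.\<close>

lemma cyclic_shift_permutes_sign:
  "cyclic_shift (Suc r) permutes {..<Suc r} \<and> sign (cyclic_shift (Suc r)) = (-1) ^ r"
proof (induction r)
  case 0
  have "cyclic_shift (Suc 0) = id" by (auto simp: cyclic_shift_def)
  then show ?case by (simp add: permutes_id[unfolded id_def])
next
  case (Suc r)
  have eq: "cyclic_shift (Suc (Suc r)) = Transposition.transpose 0 (Suc r) \<circ> cyclic_shift (Suc r)"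
  proof
    fix t
    consider "t < r" | "t = r" | "t = Suc r" | "t > Suc r" by linarith
    then show "cyclic_shift (Suc (Suc r)) t = (Transposition.transpose 0 (Suc r) \<circ> cyclic_shift (Suc r)) t"
      by cases (auto simp: cyclic_shift_def Transposition.transpose_def)
  qed
  have "cyclic_shift (Suc (Suc r)) permutes {..<Suc (Suc r)}"
    unfolding eq by (intro permutes_compose permutes_subset[OF conjunct1[OF Suc]] permutes_swap_id) auto
  moreover have "sign (cyclic_shift (Suc (Suc r))) = (-1) ^ Suc r"
    unfolding eq using Suc
    by (subst sign_compose) (auto simp: permutation_swap_id sign_swap_id intro: permutes_imp_permutation)
  ultimately show ?case by blast
qed

section \<open>The Pfaffian as a sum over listings of perfect matchings\<close>

definition pf_term :: "nat \<Rightarrow> (nat \<Rightarrow> nat \<Rightarrow> real) \<Rightarrow> (nat \<Rightarrow> nat) \<Rightarrow> real" where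
  "pf_term M a p = of_int (sign p) * (\<Prod>i<M. a (p (2 * i)) (p (2 * i + 1)))"

text \<open>This is \<open>2\<^sup>M M!\<close> times the Pfaffian.\<close>

definition pf_sum :: "nat \<Rightarrow> (nat \<Rightarrow> nat \<Rightarrow> real) \<Rightarrow> real" where
  "pf_sum M a = (\<Sum>p | p permutes {0..<2 * M}. pf_term M a p)"

definition pairing :: "nat \<Rightarrow> (nat \<Rightarrow> 'a) \<Rightarrow> 'a set set" where
  "pairing M p = (\<lambda>i. {p (2 * i), p (2 * i + 1)}) ` {..<M}"

lemma pairing_compose: "pairing M (p \<circ> q) = (`) p ` pairing M q"
  by (simp add: pairing_def image_image)

lemma pairing_disjoint:
  fixes p :: "nat \<Rightarrow> 'a"
  assumes "inj_on p {0..<2 * M}" "i < M" "j < M" "{p (2 * i), p (2 * i + 1)} \<inter> {p (2 * j), p (2 * j + 1)} \<noteq> {}"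
  shows "i = j"
proof -
  have "2 * i \<in> {0..<2*M}" "2 * i + 1 \<in> {0..<2*M}" "2 * j \<in> {0..<2*M}" "2 * j + 1 \<in> {0..<2*M}"
    using assms(2,3) by auto
  note inj = inj_on_eq_iff[OF assms(1)]
  have "2 * i = 2 * j \<or> 2 * i = 2 * j + 1 \<or> 2 * i + 1 = 2 * j \<or> 2 * i + 1 = 2 * j + 1"
    using assms(4) \<open>2 * i \<in> _\<close> \<open>2 * i + 1 \<in> _\<close> \<open>2 * j \<in> _\<close> \<open>2 * j + 1 \<in> _\<close>
    by (auto simp: inj)
  then show ?thesis by presburger
qed

lemma prod_pairing:
  assumes "inj_on p {0..<2 * M}"
  shows "(\<Prod>e\<in>pairing M p. w e) = (\<Prod>i<M. w {p (2 * i), p (2 * i + 1)})"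
  unfolding pairing_def
proof (subst prod.reindex)
  show "inj_on (\<lambda>i. {p (2 * i), p (2 * i + 1)}) {..<M}"
    using pairing_disjoint[OF assms] by (intro inj_onI) auto
qed simp

lemma prod_even_odd:
  fixes F :: "nat \<Rightarrow> 'a :: comm_monoid_mult"
  shows "(\<Prod>j = 0..<2 * M. F j) = (\<Prod>i<M. F (2 * i) * F (2 * i + 1))"
  by (induction M) (simp_all add: mult.assoc)

text \<open>Moving whole pairs acts as the same permutation on the even and on the odd positions, so
  its sign is a square. This is why the order of the pairs in a listing does not matter.\<close>

lemma block_permutation:
  fixes \<rho> :: "nat \<Rightarrow> nat"
  assumes "\<rho> permutes {..<M}"
  obtains \<beta> where "\<beta> permutes {0..<2 * M}" "sign \<beta> = 1"
    "\<And>i. i < M \<Longrightarrow> \<beta> (2 * i) = 2 * \<rho> i" "\<And>i. i < M \<Longrightarrow> \<beta> (2 * i + 1) = 2 * \<rho> i + 1"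
proof -
  let ?e = "\<lambda>i::nat. 2 * i" and ?o = "\<lambda>i::nat. 2 * i + 1"
  define \<alpha> \<gamma> where "\<alpha> = map_permutation {..<M} ?e \<rho>" and "\<gamma> = map_permutation {..<M} ?o \<rho>"
  have inj: "inj_on ?e {..<M}" "inj_on ?o {..<M}" by (auto intro: inj_onI)
  have be: "bij_betw ?e {..<M} (?e ` {..<M})" "bij_betw ?o {..<M} (?o ` {..<M})"
    using inj by (auto simp: bij_betw_def)
  have per: "\<alpha> permutes (?e ` {..<M})" "\<gamma> permutes (?o ` {..<M})"
    unfolding \<alpha>_def \<gamma>_def using be by (auto intro!: map_permutation_permutes assms)
  have sg: "sign \<alpha> = sign \<rho>" "sign \<gamma> = sign \<rho>"
    unfolding \<alpha>_def \<gamma>_def using inj assms by (auto intro!: sign_map_permutation)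
  have sub: "?e ` {..<M} \<subseteq> {0..<2*M}" "?o ` {..<M} \<subseteq> {0..<2*M}" by auto
  have P: "\<alpha> permutes {0..<2*M}" "\<gamma> permutes {0..<2*M}"
    using per sub by (auto intro: permutes_subset)
  show thesis
  proof (rule that)
    show "(\<alpha> \<circ> \<gamma>) permutes {0..<2*M}" using P by (intro permutes_compose)
    show "sign (\<alpha> \<circ> \<gamma>) = 1"
      using P sg by (subst sign_compose) (auto intro: permutes_imp_permutation)
    fix i assume i: "i < M"
    have "2 * i \<notin> ?o ` {..<M}" by (auto, presburger)
    moreover have "\<alpha> (2 * i) = 2 * \<rho> i" unfolding \<alpha>_def using map_permutation_apply[OF inj(1)] i by simp
    ultimately show "(\<alpha> \<circ> \<gamma>) (2 * i) = 2 * \<rho> i" using permutes_not_in[OF per(2)] by simp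
    have "\<gamma> (2 * i + 1) = 2 * \<rho> i + 1" unfolding \<gamma>_def using map_permutation_apply[OF inj(2), of i] i by simp
    moreover have "2 * \<rho> i + 1 \<notin> ?e ` {..<M}" by (auto, presburger)
    ultimately show "(\<alpha> \<circ> \<gamma>) (2 * i + 1) = 2 * \<rho> i + 1" using permutes_not_in[OF per(1)] by simp
  qed
qed

text \<open>Two listings of one matching differ by a permutation of the pairs, which is even, and by
  reversals inside some pairs. Each reversal changes the sign of the permutation and, by skew
  symmetry, the sign of one entry.\<close>

lemma pf_term_pairing_cong:
  assumes p: "p permutes {0..<2 * M}" and q: "q permutes {0..<2 * M}"
    and eq: "pairing M p = pairing M q"
    and skew: "\<And>i j. i < 2 * M \<Longrightarrow> j < 2 * M \<Longrightarrow> a j i = - a i j"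
  shows "pf_term M a p = pf_term M a q"
proof -
  have ip: "inj_on p {0..<2*M}" and iq: "inj_on q {0..<2*M}"
    using p q by (auto intro: permutes_inj_on)
  have "\<exists>j<M. {q (2 * i), q (2 * i + 1)} = {p (2 * j), p (2 * j + 1)}" if "i < M" for i
  proof -
    have "{q (2 * i), q (2 * i + 1)} \<in> pairing M p" unfolding eq using that by (auto simp: pairing_def)
    then show ?thesis by (auto simp: pairing_def)
  qed
  then obtain r where r: "\<And>i. i < M \<Longrightarrow> r i < M"
    "\<And>i. i < M \<Longrightarrow> {q (2 * i), q (2 * i + 1)} = {p (2 * r i), p (2 * r i + 1)}" by metis
  define \<rho> where "\<rho> i = (if i < M then r i else i)" for i
  have "inj_on r {..<M}"
  proof (rule inj_onI)
    fix i j assume ij: "i \<in> {..<M}" "j \<in> {..<M}" "r i = r j"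
    then have "{q (2 * i), q (2 * i + 1)} = {q (2 * j), q (2 * j + 1)}" using r by simp
    then show "i = j" using pairing_disjoint[OF iq, of i j] ij by auto
  qed
  moreover have "r ` {..<M} \<subseteq> {..<M}" using r(1) by auto
  ultimately have "bij_betw r {..<M} {..<M}" by (simp add: bij_betw_def endo_inj_surj)
  then have br: "bij_betw \<rho> {..<M} {..<M}" by (subst bij_betw_cong[of _ _ r]) (auto simp: \<rho>_def)
  then have \<rho>: "\<rho> permutes {..<M}" by (intro bij_imp_permutes) (auto simp: \<rho>_def)
  obtain \<beta> where \<beta>: "\<beta> permutes {0..<2 * M}" "sign \<beta> = 1"
    "\<And>i. i < M \<Longrightarrow> \<beta> (2 * i) = 2 * \<rho> i" "\<And>i. i < M \<Longrightarrow> \<beta> (2 * i + 1) = 2 * \<rho> i + 1"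
    using block_permutation[OF \<rho>] by metis
  \<comment> \<open>The pairs that \<open>q\<close> lists in the opposite order; \<open>q\<close> is
    then \<open>p\<close> preceded by the block permutation and the swaps inside
    \<open>X\<close>.\<close>
  define X where "X = {i. i < M \<and> q (2 * i) \<noteq> p (2 * \<rho> i)}"
  have X: "q (2 * i) = p (2 * \<rho> i + 1)" "q (2 * i + 1) = p (2 * \<rho> i)" if "i \<in> X" for i
    using that r(2)[of i] by (auto simp: X_def \<rho>_def doubleton_eq_iff)
  have nX: "q (2 * i) = p (2 * \<rho> i)" "q (2 * i + 1) = p (2 * \<rho> i + 1)" if "i < M" "i \<notin> X" for i
    using that r(2)[of i] by (auto simp: X_def \<rho>_def doubleton_eq_iff)
  have fX: "finite X" and XM: "X \<subseteq> {..<M}" unfolding X_def by auto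
  let ?s = "swaps (\<lambda>i::nat. 2 * i) (\<lambda>i. 2 * i + 1) X"
  have inj: "inj_on (\<lambda>i::nat. 2 * i) X" "inj_on (\<lambda>i::nat. 2 * i + 1) X"
    "(\<lambda>i. 2 * i) ` X \<inter> (\<lambda>i. 2 * i + 1) ` X = {}" by (auto intro: inj_onI, presburger)
  note s = swaps_simps[OF inj]
  have sp: "?s permutes {0..<2*M}" "sign ?s = (-1) ^ card X"
    using swaps_permutes_sign[OF fX inj] XM by (auto elim!: permutes_subset)
  have "q = p \<circ> \<beta> \<circ> ?s"
  proof
    fix j
    show "q j = (p \<circ> \<beta> \<circ> ?s) j"
    proof (cases "j < 2 * M")
      case False
      then show ?thesis using permutes_not_in[OF p] permutes_not_in[OF q] permutes_not_in[OF \<beta>(1)]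
          permutes_not_in[OF sp(1)] by auto
    next
      case True
      then obtain i where i: "i < M" "j = 2 * i \<or> j = 2 * i + 1"
        by (metis less_mult_imp_div_less mult.commute odd_two_times_div_two_succ even_two_times_div_two)
      show ?thesis
      proof (cases "i \<in> X")
        case True
        then show ?thesis using s(1)[OF True] s(2)[OF True] X[OF True] i \<beta>(3,4) by auto
      next
        case False
        then have "?s (2 * i) = 2 * i" "?s (2 * i + 1) = 2 * i + 1"
          by (intro s(3); auto; presburger)+
        then show ?thesis using nX[OF i(1) False] i \<beta>(3,4) by auto
      qed
    qed
  qed
  then have "sign q = sign (p \<circ> \<beta>) * sign ?s" using p \<beta>(1) sp(1)
    by (metis permutes_compose permutes_imp_permutation finite_atLeastLessThan sign_compose)
  also have "sign (p \<circ> \<beta>) = sign p" using p \<beta>(1,2)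
    by (metis permutes_imp_permutation finite_atLeastLessThan sign_compose mult.right_neutral)
  finally have sq: "sign q = sign p * (-1) ^ card X" using sp(2) by simp
  have pl: "p i < 2 * M" if "i < 2 * M" for i using permutes_in_image[OF p, of i] that by simp
  have "(\<Prod>i<M. a (q (2 * i)) (q (2 * i + 1)))
      = (\<Prod>i<M. (if i \<in> X then -1 else 1) * a (p (2 * \<rho> i)) (p (2 * \<rho> i + 1)))"
  proof (rule prod.cong[OF refl])
    fix i assume "i \<in> {..<M}"
    then have "\<rho> i < M" "i < M" using r(1) by (auto simp: \<rho>_def)
    then have "a (p (2 * \<rho> i + 1)) (p (2 * \<rho> i)) = - a (p (2 * \<rho> i)) (p (2 * \<rho> i + 1))"
      by (intro skew pl) auto
    then show "a (q (2 * i)) (q (2 * i + 1)) = (if i \<in> X then -1 else 1) * a (p (2 * \<rho> i)) (p (2 * \<rho> i + 1))"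
      using X[of i] nX[of i] \<open>i < M\<close> by auto
  qed
  also have "\<dots> = (\<Prod>i<M. if i \<in> X then -1 else 1) * (\<Prod>i<M. a (p (2 * \<rho> i)) (p (2 * \<rho> i + 1)))"
    by (rule prod.distrib)
  also have "(\<Prod>i<M. if i \<in> X then -1 else (1::real)) = (-1) ^ card X"
    using XM by (simp add: prod.If_cases Int_absorb1)
  also have "(\<Prod>i<M. a (p (2 * \<rho> i)) (p (2 * \<rho> i + 1))) = (\<Prod>i<M. a (p (2 * i)) (p (2 * i + 1)))"
    by (rule prod.reindex_bij_betw[OF br])
  finally show ?thesis unfolding pf_term_def sq by (simp flip: power_mult_distrib)
qed

text \<open>The factor \<open>2^M M!\<close> left as a cardinality: what matters is that it is
  positive and common to all matchings, so that it cancels in the end.\<close>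

definition pairing_count :: "nat \<Rightarrow> nat" where
  "pairing_count M = card {q. q permutes {0..<2 * M} \<and> pairing M q = pairing M id}"

text \<open>Composition with \<open>p\<close> carries the listings of the standard matching
  bijectively to those of the matching of \<open>p\<close>.\<close>

lemma card_pairing_fibre:
  assumes p: "p permutes {0..<2 * M}"
  shows "card {q. q permutes {0..<2 * M} \<and> pairing M q = pairing M p} = pairing_count M"
  unfolding pairing_count_def
proof (rule bij_betw_same_card[symmetric])
  have ip: "inj ((`) p)" using permutes_inj[OF p] by (simp add: inj_image_eq_iff inj_def)
  have key: "pairing M (p \<circ> q) = pairing M p \<longleftrightarrow> pairing M q = pairing M id" for q
    using inj_image_eq_iff[OF ip, of "pairing M q" "pairing M id"] pairing_compose[of M p q]
      pairing_compose[of M p id] by simp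
  show "bij_betw (\<lambda>q. p \<circ> q) {q. q permutes {0..<2 * M} \<and> pairing M q = pairing M id}
          {q. q permutes {0..<2 * M} \<and> pairing M q = pairing M p}"
  proof (rule bij_betw_byWitness[where f' = "\<lambda>q. inv_into UNIV p \<circ> q"])
    show "\<forall>q\<in>{q. q permutes {0..<2 * M} \<and> pairing M q = pairing M id}. inv_into UNIV p \<circ> (p \<circ> q) = q"
      using permutes_inv_o[OF p] by (simp add: o_assoc)
    show "\<forall>q\<in>{q. q permutes {0..<2 * M} \<and> pairing M q = pairing M p}. p \<circ> (inv_into UNIV p \<circ> q) = q"
      using permutes_inv_o[OF p] by (simp add: o_assoc)
    show "(\<lambda>q. p \<circ> q) ` {q. q permutes {0..<2 * M} \<and> pairing M q = pairing M id}
       \<subseteq> {q. q permutes {0..<2 * M} \<and> pairing M q = pairing M p}"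
      using key p by (auto intro: permutes_compose)
    show "(\<lambda>q. inv_into UNIV p \<circ> q) ` {q. q permutes {0..<2 * M} \<and> pairing M q = pairing M p}
       \<subseteq> {q. q permutes {0..<2 * M} \<and> pairing M q = pairing M id}"
    proof (clarsimp, intro conjI)
      fix q assume q: "q permutes {0..<2 * M}" "pairing M q = pairing M p"
      show "(inv_into UNIV p \<circ> q) permutes {0..<2 * M}" using q p by (intro permutes_compose permutes_inv)
      have "p \<circ> (inv_into UNIV p \<circ> q) = q" using permutes_inv_o[OF p] by (simp add: o_assoc)
      then show "pairing M (inv_into UNIV p \<circ> q) = pairing M id" using key[of "inv_into UNIV p \<circ> q"] q by simp
    qed
  qed
qed

lemma pairing_count_pos: "pairing_count M > 0"
proof -
  have "id \<in> {q. q permutes {0..<2 * M} \<and> pairing M q = pairing M id}" by (simp only: mem_Collect_eq permutes_id)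
  moreover have "finite {q. q permutes {0..<2 * M} \<and> pairing M q = pairing M id}"
    by (rule finite_subset[OF _ finite_permutations[of "{0..<2*M}"]]) auto
  ultimately show ?thesis unfolding pairing_count_def card_gt_0_iff by blast
qed

text \<open>Interface between Pfaffians and matchings: permutations are grouped by the matching they
  list. The hypothesis with a single \<open>\<epsilon>\<close> for all of \<D> is exactly the
  Kasteleyn property.\<close>

lemma pf_sum_matchings:
  assumes "finite \<D>"
    and ex: "\<And>D. D \<in> \<D> \<Longrightarrow> \<exists>p. p permutes {0..<2 * M} \<and> pairing M p = D"
    and val: "\<And>p. p permutes {0..<2 * M} \<Longrightarrow> pairing M p \<in> \<D> \<Longrightarrow> pf_term M a p = \<epsilon> * h (pairing M p)"
    and zero: "\<And>p. p permutes {0..<2 * M} \<Longrightarrow> pairing M p \<notin> \<D> \<Longrightarrow> pf_term M a p = 0"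
  shows "pf_sum M a = real (pairing_count M) * \<epsilon> * (\<Sum>D\<in>\<D>. h D)"
proof -
  let ?P = "{p. p permutes {0..<2 * M}}"
  have "pf_sum M a = (\<Sum>p | p \<in> ?P \<and> pairing M p \<in> \<D>. pf_term M a p)"
    unfolding pf_sum_def by (rule sum.mono_neutral_right) (auto simp: finite_permutations zero)
  also have "\<dots> = (\<Sum>D\<in>\<D>. \<Sum>p | p \<in> {p. p \<in> ?P \<and> pairing M p \<in> \<D>} \<and> pairing M p = D. pf_term M a p)"
    by (rule sum.group[symmetric]) (use assms in \<open>auto simp: finite_permutations\<close>)
  also have "\<dots> = (\<Sum>D\<in>\<D>. real (pairing_count M) * (\<epsilon> * h D))"
  proof (rule sum.cong[OF refl])
    fix D assume D: "D \<in> \<D>"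
    obtain p where p: "p permutes {0..<2 * M}" "pairing M p = D" using ex[OF D] by blast
    have "(\<Sum>p | p \<in> {p. p \<in> ?P \<and> pairing M p \<in> \<D>} \<and> pairing M p = D. pf_term M a p)
       = (\<Sum>q | q permutes {0..<2 * M} \<and> pairing M q = pairing M p. \<epsilon> * h D)"
      using D p val by (intro sum.cong) auto
    also have "\<dots> = real (pairing_count M) * (\<epsilon> * h D)"
      using card_pairing_fibre[OF p(1)] by simp
    finally show "(\<Sum>p | p \<in> {p. p \<in> ?P \<and> pairing M p \<in> \<D>} \<and> pairing M p = D. pf_term M a p)
       = real (pairing_count M) * (\<epsilon> * h D)" .
  qed
  also have "\<dots> = real (pairing_count M) * \<epsilon> * (\<Sum>D\<in>\<D>. h D)"
    by (simp add: sum_distrib_left mult.assoc)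
  finally show ?thesis .
qed

section \<open>Behaviour of the Pfaffian under congruence\<close>

lemma det_select_rows:
  fixes C :: "real mat"
  assumes C: "C \<in> carrier_mat n n" and f: "\<And>j. j < n \<Longrightarrow> f j < n" "\<And>j. \<not> j < n \<Longrightarrow> f j = j"
  shows "Determinant.det (Matrix.mat n n (\<lambda>(j, r). C $$ (f j, r)))
       = (if f permutes {0..<n} then of_int (sign f) * Determinant.det C else 0)"
proof (cases "f permutes {0..<n}")
  case True
  then show ?thesis using det_permute_rows[OF C True] by simp
next
  case False
  have "\<not> inj_on f {0..<n}"
  proof
    assume inj: "inj_on f {0..<n}"
    have "f ` {0..<n} \<subseteq> {0..<n}" using f(1) by auto
    then have "bij_betw f {0..<n} {0..<n}" using inj by (simp add: bij_betw_def endo_inj_surj)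
    then show False using False f(2) by (auto intro!: bij_imp_permutes)
  qed
  then obtain i j where ij: "i < n" "j < n" "i \<noteq> j" "f i = f j" by (auto simp: inj_on_def)
  have "Determinant.det (Matrix.mat n n (\<lambda>(j, r). C $$ (f j, r))) = 0"
  proof (rule det_identical_rows[OF _ ij(3,1,2)])
    show "Matrix.row (Matrix.mat n n (\<lambda>(j, r). C $$ (f j, r))) i
        = Matrix.row (Matrix.mat n n (\<lambda>(j, r). C $$ (f j, r))) j"
      using ij by (intro eq_vecI) auto
  qed simp
  then show ?thesis using False by simp
qed

lemma congruence_entry:
  fixes A B :: "real mat"
  assumes A: "A \<in> carrier_mat n n" and B: "B \<in> carrier_mat n n" and "i < n" "j < n"
  shows "(B * A * transpose_mat B) $$ (i, j)
       = (\<Sum>(k, l)\<in>{0..<n} \<times> {0..<n}. A $$ (k, l) * (B $$ (i, k) * B $$ (j, l)))"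
proof -
  have "(B * A * transpose_mat B) $$ (i, j) = (\<Sum>k = 0..<n. B $$ (i, k) * (\<Sum>l = 0..<n. A $$ (k, l) * B $$ (j, l)))"
    using assms by (auto simp: scalar_prod_def intro!: sum.cong)
  also have "\<dots> = (\<Sum>k = 0..<n. \<Sum>l = 0..<n. A $$ (k, l) * (B $$ (i, k) * B $$ (j, l)))"
    unfolding sum_distrib_left by (intro sum.cong refl) (simp add: mult_ac)
  finally show ?thesis by (simp add: sum.cartesian_product)
qed

text \<open>The rule \<open>Pf (B A B^T) = det B * Pf A\<close>. After expanding every entry of the
  congruent matrix, the sum over \<open>p\<close> for fixed inner indices is a determinant of
  \<open>B\<close> with selected columns. It vanishes unless the selection is a permutation, and
  then contributes its sign times \<open>det B\<close>.\<close>

lemma pf_sum_congruence: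
  fixes A B :: "real mat"
  assumes A: "A \<in> carrier_mat (2 * M) (2 * M)" and B: "B \<in> carrier_mat (2 * M) (2 * M)"
  shows "pf_sum M (\<lambda>i j. (B * A * transpose_mat B) $$ (i, j))
       = Determinant.det B * pf_sum M (\<lambda>i j. A $$ (i, j))"
proof -
  define n where "n = 2 * M"
  note A = A[folded n_def] and B = B[folded n_def]
  let ?Q = "{0..<n} \<times> {0..<n}"
  let ?G = "PiE {..<M} (\<lambda>_. ?Q)"
  \<comment> \<open>A choice \<open>g\<close> of an index pair for each factor is flattened to one
    index function, the first components at even and the second ones at odd positions. Outside the
    range it is the identity, as \<open>permutes\<close> demands.\<close>
  define h where "h g j = (if j < n then if even j then fst (g (j div 2)) else snd (g (j div 2)) else j)"
    for g :: "nat \<Rightarrow> nat \<times> nat" and j :: nat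
  define F where "F f = (\<Prod>i<M. A $$ (f (2 * i), f (2 * i + 1)))" for f
  \<comment> \<open>The determinant of \<open>B\<close> with columns selected by
    \<open>f\<close>.\<close>
  define Dt where "Dt f = (\<Sum>p | p permutes {0..<n}. of_int (sign p) * (\<Prod>j = 0..<n. B $$ (p j, f j)))" for f
  have h_eo: "h g (2 * i) = fst (g i)" "h g (2 * i + 1) = snd (g i)" "h g (Suc (2 * i)) = snd (g i)" if "i < M" for g i
    using that by (auto simp: h_def n_def)
  have h_lt: "h g j < n" if g: "g \<in> ?G" and j: "j < n" for g j
  proof -
    have "j div 2 < M" using j unfolding n_def by auto
    then have "g (j div 2) \<in> ?Q" using g by (auto dest: PiE_mem)
    then show ?thesis using j by (auto simp: h_def mem_Times_iff)
  qed
  have Dt: "Dt f = (if f permutes {0..<n} then of_int (sign f) * Determinant.det B else 0)"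
    if f: "\<And>j. j < n \<Longrightarrow> f j < n" "\<And>j. \<not> j < n \<Longrightarrow> f j = j" for f
  proof -
    have pl: "p j < n" if "p permutes {0..<n}" "j < n" for p j
      using permutes_in_image[OF that(1), of j] that(2) by simp
    have "Dt f = Determinant.det (Matrix.mat n n (\<lambda>(j, r). transpose_mat B $$ (f j, r)))"
    proof -
      have "(\<Prod>j = 0..<n. B $$ (p j, f j)) = (\<Prod>j = 0..<n. Matrix.mat n n (\<lambda>(j, r). transpose_mat B $$ (f j, r)) $$ (j, p j))"
        if p: "p permutes {0..<n}" for p
        using B f(1) pl[OF p] by (intro prod.cong refl) simp
      then show ?thesis unfolding Dt_def Determinant.det_def by simp
    qed
    also have "\<dots> = (if f permutes {0..<n} then of_int (sign f) * Determinant.det (transpose_mat B) else 0)"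
      using B f by (intro det_select_rows) auto
    finally show ?thesis using det_transpose[OF B] by simp
  qed
  have Dth: "Dt (h g) = (if h g permutes {0..<n} then of_int (sign (h g)) * Determinant.det B else 0)"
    if "g \<in> ?G" for g
    by (rule Dt) (use h_lt[OF that] in \<open>simp_all add: h_def\<close>)
  have "pf_sum M (\<lambda>i j. (B * A * transpose_mat B) $$ (i, j))
      = (\<Sum>p | p permutes {0..<n}. of_int (sign p) *
          (\<Prod>i<M. \<Sum>kl\<in>?Q. A $$ kl * (B $$ (p (2 * i), fst kl) * B $$ (p (2 * i + 1), snd kl))))"
    unfolding pf_sum_def pf_term_def n_def[symmetric]
  proof (intro sum.cong refl arg_cong2[where f = "(*)"] prod.cong)
    fix p i assume "p \<in> {p. p permutes {0..<n}}" "i \<in> {..<M}"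
    then have "p (2 * i) < n" "p (2 * i + 1) < n"
      using permutes_in_image[of p "{0..<n}" "2 * i"] permutes_in_image[of p "{0..<n}" "2 * i + 1"]
      by (auto simp: n_def)
    then show "(B * A * transpose_mat B) $$ (p (2 * i), p (2 * i + 1))
        = (\<Sum>kl\<in>?Q. A $$ kl * (B $$ (p (2 * i), fst kl) * B $$ (p (2 * i + 1), snd kl)))"
      using congruence_entry[OF A B, of "p (2 * i)" "p (2 * i + 1)"] by (simp add: case_prod_beta)
  qed
  also have "\<dots> = (\<Sum>p | p permutes {0..<n}. of_int (sign p) *
          (\<Sum>g\<in>?G. \<Prod>i<M. A $$ g i * (B $$ (p (2 * i), fst (g i)) * B $$ (p (2 * i + 1), snd (g i)))))"
    by (intro sum.cong refl arg_cong2[where f = "(*)"] prod_sum_PiE) simp_all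
  also have "\<dots> = (\<Sum>p | p permutes {0..<n}. \<Sum>g\<in>?G. F (h g) * (of_int (sign p) * (\<Prod>j = 0..<n. B $$ (p j, h g j))))"
    unfolding sum_distrib_left
  proof (intro sum.cong refl)
    fix p g
    have "(\<Prod>i<M. A $$ g i * (B $$ (p (2 * i), fst (g i)) * B $$ (p (2 * i + 1), snd (g i))))
       = F (h g) * (\<Prod>j = 0..<n. B $$ (p j, h g j))"
      unfolding F_def n_def prod_even_odd prod.distrib[symmetric] by (rule prod.cong) (simp_all add: h_eo split_beta)
    then show "of_int (sign p) * (\<Prod>i<M. A $$ g i * (B $$ (p (2 * i), fst (g i)) * B $$ (p (2 * i + 1), snd (g i))))
       = F (h g) * (of_int (sign p) * (\<Prod>j = 0..<n. B $$ (p j, h g j)))" by simp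
  qed
  also have "\<dots> = (\<Sum>g\<in>?G. F (h g) * Dt (h g))"
    unfolding Dt_def sum_distrib_left by (rule sum.swap)
  also have "\<dots> = (\<Sum>g | g \<in> ?G \<and> h g permutes {0..<n}. F (h g) * Dt (h g))"
  proof (rule sum.mono_neutral_right)
    show "finite ?G" by (intro finite_PiE) auto
    show "\<forall>g\<in>?G - {g. g \<in> ?G \<and> h g permutes {0..<n}}. F (h g) * Dt (h g) = 0"
    proof
      fix g assume g: "g \<in> ?G - {g. g \<in> ?G \<and> h g permutes {0..<n}}"
      then have "Dt (h g) = 0" using Dth[of g] by simp
      then show "F (h g) * Dt (h g) = 0" by simp
    qed
  qed auto
  also have "\<dots> = (\<Sum>f | f permutes {0..<n}. F f * (of_int (sign f) * Determinant.det B))"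
  proof (rule sum.reindex_bij_witness[where i = "\<lambda>f. \<lambda>i\<in>{..<M}. (f (2 * i), f (2 * i + 1))" and j = h])
    fix g assume g: "g \<in> {g. g \<in> ?G \<and> h g permutes {0..<n}}"
    show "(\<lambda>i\<in>{..<M}. (h g (2 * i), h g (2 * i + 1))) = g"
    proof
      fix i
      show "(\<lambda>i\<in>{..<M}. (h g (2 * i), h g (2 * i + 1))) i = g i"
        using h_eo[of i g] PiE_arb[of g "{..<M}" "\<lambda>_. ?Q" i] g by (cases "i < M") simp_all
    qed
    show "h g \<in> {f. f permutes {0..<n}}" using g by simp
    show "F (h g) * (of_int (sign (h g)) * Determinant.det B) = F (h g) * Dt (h g)"
      using g Dth[of g] by simp
  next
    fix f assume f: "f \<in> {f. f permutes {0..<n}}"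
    show hf: "h (\<lambda>i\<in>{..<M}. (f (2 * i), f (2 * i + 1))) = f"
    proof
      fix j
      show "h (\<lambda>i\<in>{..<M}. (f (2 * i), f (2 * i + 1))) j = f j"
      proof (cases "j < n")
        case True
        then have "j div 2 < M" by (auto simp: n_def)
        then show ?thesis using True by (auto simp: h_def)
      next
        case False
        then show ?thesis using f permutes_not_in[of f "{0..<n}" j] by (auto simp: h_def)
      qed
    qed
    have "f i < n" if "i < n" for i using permutes_in_image[of f "{0..<n}" i] f that by simp
    then show "(\<lambda>i\<in>{..<M}. (f (2 * i), f (2 * i + 1))) \<in> {g. g \<in> ?G \<and> h g permutes {0..<n}}"
      using hf f by (simp add: n_def)
  qed
  also have "\<dots> = Determinant.det B * pf_sum M (\<lambda>i j. A $$ (i, j))"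
    unfolding pf_sum_def pf_term_def F_def n_def sum_distrib_left
    by (intro sum.cong refl) (simp only: mult_ac)
  finally show ?thesis .
qed

section \<open>Normal form of skew matrices; the determinant as the square of the Pfaffian\<close>

definition skew_mat :: "real mat \<Rightarrow> bool" where
  "skew_mat A \<longleftrightarrow> (\<forall>i < dim_row A. \<forall>j < dim_row A. A $$ (j, i) = - A $$ (i, j))"

lemma skew_matD: "skew_mat A \<Longrightarrow> A \<in> carrier_mat n n \<Longrightarrow> i < n \<Longrightarrow> j < n \<Longrightarrow> A $$ (j, i) = - A $$ (i, j)"
  unfolding skew_mat_def by (elim allE[of _ i] impE allE[of _ j]) auto

lemma skew_mat_congruence:
  assumes A: "A \<in> carrier_mat n n" and B: "B \<in> carrier_mat n n" and skew: "skew_mat A"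
  shows "skew_mat (B * A * transpose_mat B)"
  unfolding skew_mat_def
proof (intro allI impI)
  fix i j assume "i < dim_row (B * A * transpose_mat B)" "j < dim_row (B * A * transpose_mat B)"
  then have ij: "i < n" "j < n" using B by auto
  have "(\<Sum>(k, l)\<in>{0..<n} \<times> {0..<n}. A $$ (k, l) * (B $$ (j, k) * B $$ (i, l)))
      = (\<Sum>(k, l)\<in>{0..<n} \<times> {0..<n}. - (A $$ (k, l) * (B $$ (i, k) * B $$ (j, l))))"
  proof (rule sum.reindex_bij_witness[where i = prod.swap and j = prod.swap], goal_cases)
    case (5 kl)
    obtain k l where kl: "kl = (k, l)" "k < n" "l < n" using 5 by auto
    show ?case using skew_matD[OF skew A kl(3,2)] kl(1) by simp
  qed auto
  then show "(B * A * transpose_mat B) $$ (j, i) = - (B * A * transpose_mat B) $$ (i, j)"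
    unfolding congruence_entry[OF A B ij] congruence_entry[OF A B ij(2,1)]
    by (simp add: sum_negf case_prod_beta)
qed

text \<open>The normal form of a skew matrix under congruence, with \<open>2 * 2\<close> diagonal
  blocks. It reappears in \<open>det_inverse_minor\<close> as the block belonging to the prescribed
  edges.\<close>

definition block_skew :: "nat \<Rightarrow> (nat \<Rightarrow> real) \<Rightarrow> real mat" where
  "block_skew M c = Matrix.mat (2 * M) (2 * M) (\<lambda>(i, j).
     if i div 2 = j div 2 then if i < j then c (i div 2) else if j < i then - c (i div 2) else 0 else 0)"

lemma block_skew_Suc:
  "block_skew (Suc M) (case_nat a c) =
     four_block_mat (Matrix.mat 2 2 (\<lambda>(i, j). if i < j then a else if j < i then - a else 0))
       (0\<^sub>m 2 (2 * M)) (0\<^sub>m (2 * M) 2) (block_skew M c)" (is "?L = ?R")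
proof (rule eq_matI)
  fix i j assume "i < dim_row ?R" "j < dim_col ?R"
  then have ij: "i < 2 * M + 2" "j < 2 * M + 2" by (auto simp: block_skew_def)
  have red: "k div 2 = (if k < 2 then 0 else Suc ((k - 2) div 2))" for k :: nat
    by (cases "k < 2") (auto simp: le_div_geq)
  show "?L $$ (i, j) = ?R $$ (i, j)"
    using ij by (cases "i < 2"; cases "j < 2") (auto simp: block_skew_def red)
qed (auto simp: block_skew_def)

text \<open>Symplectic Gaussian elimination: a nonzero entry is moved to position
  \<open>(0, 1)\<close>, the invertible \<open>2 * 2\<close> corner clears its rows and columns, and
  the induction continues with the Schur complement.\<close>

lemma skew_mat_canonical:
  assumes "A \<in> carrier_mat (2 * M) (2 * M)" "skew_mat A"
  shows "\<exists>B c. B \<in> carrier_mat (2 * M) (2 * M) \<and> Determinant.det B \<noteq> 0 \<and> B * A * transpose_mat B = block_skew M c"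
  using assms
proof (induction M arbitrary: A)
  case 0
  have "1\<^sub>m 0 * A * transpose_mat (1\<^sub>m 0) = block_skew 0 c" for c
    using 0 by (intro eq_matI) (auto simp: block_skew_def)
  then show ?case by (intro exI[of _ "1\<^sub>m 0"] exI[of _ "\<lambda>_. 0"]) auto
next
  case (Suc M A)
  define n where "n = 2 * M"
  define N where "N = 2 + n"
  have A: "A \<in> carrier_mat N N" using Suc.prems(1) by (simp add: N_def n_def)
  have skA: "A $$ (j, i) = - A $$ (i, j)" if "i < N" "j < N" for i j
    using skew_matD[OF Suc.prems(2) A that] .
  have NM: "2 * Suc M = N" by (simp add: N_def n_def)
  show ?case
  proof (cases "\<exists>i j. i < N \<and> j < N \<and> A $$ (i, j) \<noteq> 0")
    case False
    have "1\<^sub>m N * A * transpose_mat (1\<^sub>m N) = block_skew (Suc M) (\<lambda>_. 0)"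
      using A False by (intro eq_matI) (auto simp: block_skew_def N_def n_def)
    then show ?thesis unfolding NM
      by (intro exI[of _ "1\<^sub>m N"] exI[of _ "\<lambda>_. 0"]) (auto simp: NM)
  next
    case True
    then obtain i j where ij: "i < N" "j < N" "A $$ (i, j) \<noteq> 0" by blast
    have "A $$ (i, i) = 0" using skA[of i i] ij by simp
    then have "i \<noteq> j" using ij by auto
    \<comment> \<open>The resulting \<pi> sends \<open>0\<close> to \<open>i\<close> and
      \<open>1\<close> to \<open>j\<close>; the outer \<tau> may already have displaced
      \<open>j\<close>, hence the second transposition uses \<open>\<tau> j\<close>.\<close>
    define \<tau> where "\<tau> = Transposition.transpose 0 i"
    define \<pi> where "\<pi> = \<tau> \<circ> Transposition.transpose 1 (\<tau> j)"
    have N2: "0 < N" "Suc 0 < N" unfolding N_def by auto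
    have \<tau>: "\<tau> permutes {0..<N}" unfolding \<tau>_def by (rule permutes_swap_id) (use ij N2 in auto)
    have \<tau>j: "\<tau> j \<noteq> 0" unfolding \<tau>_def using \<open>i \<noteq> j\<close> by (auto simp: Transposition.transpose_def)
    have "\<tau> j \<in> {0..<N}" using permutes_in_image[OF \<tau>] ij by simp
    then have \<pi>: "\<pi> permutes {0..<N}"
      unfolding \<pi>_def by (intro permutes_compose \<tau> permutes_swap_id) (use N2 in auto)
    have \<pi>0: "\<pi> 0 = i" unfolding \<pi>_def using \<tau>j by (simp add: \<tau>_def Transposition.transpose_def)
    have \<pi>1: "\<pi> 1 = j" unfolding \<pi>_def by (simp add: \<tau>_def)
    define B1 where "B1 = Matrix.mat N N (\<lambda>(i, j). (1\<^sub>m N :: real mat) $$ (\<pi> i, j))"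
    have B1: "B1 \<in> carrier_mat N N" unfolding B1_def by simp
    have "Determinant.det B1 = of_int (sign \<pi>)" unfolding B1_def
      using det_permute_rows[OF one_carrier_mat \<pi>, where 'a = real] by simp
    then have dB1: "Determinant.det B1 \<noteq> 0" by simp
    define A1 where "A1 = B1 * A * transpose_mat B1"
    have A1: "A1 \<in> carrier_mat N N" using A B1 unfolding A1_def by auto
    have sk1: "skew_mat A1" unfolding A1_def using A B1 Suc.prems(2) by (rule skew_mat_congruence)
    have sk1': "A1 $$ (j, i) = - A1 $$ (i, j)" if "i < N" "j < N" for i j
      using skew_matD[OF sk1 A1 that] .
    define a where "a = A1 $$ (0, 1)"
    have "a = (\<Sum>k = 0..<N. \<Sum>l = 0..<N. A $$ (k, l) * (B1 $$ (0, k) * B1 $$ (1, l)))"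
      unfolding a_def A1_def using congruence_entry[OF A B1, of 0 1] N2 by (simp add: sum.cartesian_product)
    also have "\<dots> = (\<Sum>k = 0..<N. \<Sum>l = 0..<N. if j = l then if i = k then A $$ (k, l) else 0 else 0)"
    proof (intro sum.cong refl)
      fix k l assume kl: "k \<in> {0..<N}" "l \<in> {0..<N}"
      have "B1 $$ (0, k) = (if i = k then 1 else 0)" "B1 $$ (1, l) = (if j = l then 1 else 0)"
        using kl N2 ij(1,2) \<pi>0 \<pi>1 by (simp_all add: B1_def)
      then show "A $$ (k, l) * (B1 $$ (0, k) * B1 $$ (1, l)) = (if j = l then if i = k then A $$ (k, l) else 0 else 0)"
        by simp
    qed
    also have "\<dots> = A $$ (i, j)" using ij by simp
    finally have a0: "a \<noteq> 0" using ij by simp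
    \<comment> \<open>\<open>P\<close> is the corner block and \<open>Pi\<close> its inverse,
      available because \<open>a\<close> is nonzero.\<close>
    define P Pi Q R where "P = Matrix.mat 2 2 (\<lambda>(i, j). if i < j then a else if j < i then - a else 0)"
      and "Pi = Matrix.mat 2 2 (\<lambda>(i, j). if i < j then - (1 / a) else if j < i then 1 / a else 0)"
      and "Q = Matrix.mat 2 n (\<lambda>(i, j). A1 $$ (i, j + 2))"
      and "R = Matrix.mat n n (\<lambda>(i, j). A1 $$ (i + 2, j + 2))"
    have car: "P \<in> carrier_mat 2 2" "Pi \<in> carrier_mat 2 2" "Q \<in> carrier_mat 2 n" "R \<in> carrier_mat n n"
      unfolding P_def Pi_def Q_def R_def by auto
    have l2: "k < 2 \<longleftrightarrow> k = 0 \<or> k = 1" for k :: nat by auto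
    have PiP: "Pi * P = 1\<^sub>m 2"
      using a0 by (intro eq_matI) (auto simp: P_def Pi_def scalar_prod_def l2 numeral_2_eq_2)
    have A1_blocks: "A1 = four_block_mat P Q (- transpose_mat Q) R" (is "_ = ?F")
    proof (rule eq_matI)
      fix r s assume "r < dim_row ?F" "s < dim_col ?F"
      then have rs: "r < N" "s < N" unfolding N_def using car by auto
      have d: "A1 $$ (t, t) = 0" if "t < N" for t using sk1'[of t t] that by simp
      have a': "A1 $$ (0, Suc 0) = a" unfolding a_def by simp
      have S2: "Suc (Suc (t - 2)) = t" if "\<not> t < 2" for t using that by simp
      have ma: "A1 $$ (Suc 0, 0) = - a" using sk1'[of 0 "Suc 0"] N2 a' by simp
      show "A1 $$ (r, s) = ?F $$ (r, s)"
      proof (cases "r < 2")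
        case True
        then show ?thesis using rs d[of 0] d[of 1] a' ma N2 S2[of s]
          by (cases "s < 2") (auto simp: P_def Q_def R_def N_def l2)
      next
        case False
        then show ?thesis using rs sk1'[of s r] S2[of s] S2[of r]
          by (cases "s < 2") (auto simp: P_def Q_def R_def N_def)
      qed
    qed (use A1 car in \<open>auto simp: N_def\<close>)
    \<comment> \<open>Chosen so that \<open>Y * P\<close> cancels the lower left block
      \<open>- transpose_mat Q\<close>; then \<open>R'\<close> below is the Schur
      complement.\<close>
    define Y where "Y = transpose_mat Q * Pi"
    have Y: "Y \<in> carrier_mat n 2" unfolding Y_def using car by auto
    have YP: "Y * P = transpose_mat Q" unfolding Y_def using car PiP
      by (subst assoc_mult_mat[of _ n 2 _ 2 _ 2]) auto
    define C where "C = four_block_mat (1\<^sub>m 2) (0\<^sub>m 2 n) Y (1\<^sub>m n)"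
    have C: "C \<in> carrier_mat N N" unfolding C_def N_def using Y by auto
    have dC: "Determinant.det C = 1" unfolding C_def
      by (subst det_four_block_mat_upper_right_zero[OF _ refl]) (use Y in auto)
    define A2 where "A2 = C * A1 * transpose_mat C"
    define R' where "R' = Y * Q + R"
    have R': "R' \<in> carrier_mat n n" unfolding R'_def using Y car by auto
    have z: "transpose_mat Q + - transpose_mat Q = 0\<^sub>m n 2"
      using car by (intro eq_matI) auto
    have CA1: "C * A1 = four_block_mat P Q (0\<^sub>m n 2) R'"
      unfolding C_def A1_blocks
      by (subst mult_four_block_mat[where ?nr1.0 = 2 and ?n1.0 = 2 and ?n2.0 = n and ?nr2.0 = n and ?nc1.0 = 2 and ?nc2.0 = n])
        (use car Y YP z in \<open>auto simp: R'_def\<close>)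
    have A2_eq: "A2 = four_block_mat P (P * transpose_mat Y + Q) (0\<^sub>m n 2) R'"
      unfolding A2_def CA1 unfolding C_def
      by (subst transpose_four_block_mat[of _ 2 2 _ n _ n], (use Y in auto)[4],
        subst mult_four_block_mat[where ?nr1.0 = 2 and ?n1.0 = 2 and ?n2.0 = n and ?nr2.0 = n and ?nc1.0 = 2 and ?nc2.0 = n])
        (use car Y R' in auto)
    have A2: "A2 \<in> carrier_mat N N" using A1 C unfolding A2_def by auto
    have sk2: "skew_mat A2" unfolding A2_def using A1 C sk1 by (rule skew_mat_congruence)
    have sk2': "A2 $$ (j, i) = - A2 $$ (i, j)" if "i < N" "j < N" for i j
      using skew_matD[OF sk2 A2 that] .
    \<comment> \<open>The upper right block need not be multiplied out: \<open>A2\<close> is skew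
      and its lower left block is already zero.\<close>
    have "P * transpose_mat Y + Q = 0\<^sub>m 2 n"
    proof (rule eq_matI)
      fix r s assume rs: "r < dim_row (0\<^sub>m 2 n :: real mat)" "s < dim_col (0\<^sub>m 2 n :: real mat)"
      have "A2 $$ (r, s + 2) = (P * transpose_mat Y + Q) $$ (r, s)"
        unfolding A2_eq using rs car Y R' by (subst index_mat_four_block) auto
      moreover have "A2 $$ (s + 2, r) = 0"
        unfolding A2_eq using rs car Y R' by (subst index_mat_four_block) auto
      ultimately show "(P * transpose_mat Y + Q) $$ (r, s) = 0\<^sub>m 2 n $$ (r, s)"
        using sk2'[of "s + 2" r] rs by (simp add: N_def)
    qed (use car Y in auto)
    then have A2_eq': "A2 = four_block_mat P (0\<^sub>m 2 n) (0\<^sub>m n 2) R'" using A2_eq by simp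
    have "skew_mat R'"
      unfolding skew_mat_def
    proof (intro allI impI)
      fix r s assume "r < dim_row R'" "s < dim_row R'"
      then have rs: "r < n" "s < n" using R' by auto
      have "A2 $$ (r + 2, s + 2) = R' $$ (r, s)" if "r < n" "s < n" for r s
        unfolding A2_eq' using that car R' by (subst index_mat_four_block) auto
      then show "R' $$ (s, r) = - R' $$ (r, s)" using sk2'[of "r + 2" "s + 2"] rs by (simp add: N_def)
    qed
    then obtain B3 c where B3: "B3 \<in> carrier_mat n n" "Determinant.det B3 \<noteq> 0"
      "B3 * R' * transpose_mat B3 = block_skew M c"
      using Suc.IH[of R'] R' unfolding n_def by blast
    define D where "D = four_block_mat (1\<^sub>m 2) (0\<^sub>m 2 n) (0\<^sub>m n 2) B3"
    have D: "D \<in> carrier_mat N N" unfolding D_def N_def using B3 by auto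
    have dD: "Determinant.det D = Determinant.det B3" unfolding D_def
      by (subst det_four_block_mat_upper_right_zero[OF _ refl]) (use B3 in auto)
    have DA2: "D * A2 = four_block_mat P (0\<^sub>m 2 n) (0\<^sub>m n 2) (B3 * R')"
      unfolding D_def A2_eq'
      by (subst mult_four_block_mat[where ?nr1.0 = 2 and ?n1.0 = 2 and ?n2.0 = n and ?nr2.0 = n and ?nc1.0 = 2 and ?nc2.0 = n])
        (use car B3 R' in auto)
    have DAD: "D * A2 * transpose_mat D = block_skew (Suc M) (case_nat a c)"
      unfolding DA2 unfolding D_def block_skew_Suc P_def[symmetric] B3(3)[symmetric] n_def[symmetric]
      by (subst transpose_four_block_mat[of _ 2 2 _ n _ n], (use B3 in auto)[4],
        subst mult_four_block_mat[where ?nr1.0 = 2 and ?n1.0 = 2 and ?n2.0 = n and ?nr2.0 = n and ?nc1.0 = 2 and ?nc2.0 = n])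
        (use car B3(1) R' in auto)
    let ?B = "D * (C * B1)"
    have "?B * A * transpose_mat ?B = D * A2 * transpose_mat D"
    proof -
      have t: "transpose_mat ?B = transpose_mat B1 * transpose_mat C * transpose_mat D"
        using D C B1 by (simp add: transpose_mult[of _ N N _ N])
      show ?thesis unfolding t A2_def A1_def using A B1 C D
        by (simp add: assoc_mult_mat[of _ N N _ N _ N])
    qed
    moreover have "Determinant.det ?B \<noteq> 0"
      using D C B1 dD dC dB1 B3(2) by (simp add: Determinant.det_mult[of _ N])
    moreover have "?B \<in> carrier_mat N N" using D C B1 by auto
    ultimately show ?thesis unfolding NM DAD by blast
  qed
qed

lemma card_pairing:
  assumes "inj_on p {0..<2 * M}"
  shows "card (pairing M p) = M"
proof -
  have "inj_on (\<lambda>i. {p (2 * i), p (2 * i + 1)}) {..<M}"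
  proof (rule inj_onI)
    fix i j assume ij: "i \<in> {..<M}" "j \<in> {..<M}" "{p (2 * i), p (2 * i + 1)} = {p (2 * j), p (2 * j + 1)}"
    have "{p (2 * i), p (2 * i + 1)} \<inter> {p (2 * j), p (2 * j + 1)} \<noteq> {}" unfolding ij(3) by simp
    then show "i = j" using ij(1,2) by (intro pairing_disjoint[OF assms]) simp_all
  qed
  then show ?thesis unfolding pairing_def by (simp add: card_image)
qed

lemma doubleton_same_half:
  fixes x y :: nat
  assumes "x div 2 = y div 2" "x \<noteq> y"
  shows "{x, y} = {2 * (x div 2), 2 * (x div 2) + 1}"
proof -
  have "x mod 2 \<noteq> y mod 2" using assms by (metis div_mult_mod_eq)
  then consider "x mod 2 = 0" "y mod 2 = 1" | "x mod 2 = 1" "y mod 2 = 0" by linarith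
  then show ?thesis
  proof cases
    case 1
    then have "2 * (x div 2) = x" "2 * (x div 2) + 1 = y"
      using div_mult_mod_eq[of x 2] div_mult_mod_eq[of y 2] assms(1) by linarith+
    then show ?thesis by simp
  next
    case 2
    then have "2 * (x div 2) = y" "2 * (x div 2) + 1 = x"
      using div_mult_mod_eq[of x 2] div_mult_mod_eq[of y 2] assms(1) by linarith+
    then show ?thesis by (simp add: insert_commute)
  qed
qed

text \<open>A term is nonzero only if every listed pair lies inside one diagonal block. Then the
  matching is contained in the standard one, and equals it because both have \<open>M\<close>
  pairs.\<close>

lemma pf_sum_block_skew:
  "pf_sum M (\<lambda>i j. block_skew M c $$ (i, j)) = real (pairing_count M) * (\<Prod>i<M. c i)"
proof -
  have trm: "pf_term M (\<lambda>i j. block_skew M c $$ (i, j)) id = (\<Prod>i<M. c i)"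
    unfolding pf_term_def by (auto simp: block_skew_def intro!: prod.cong)
  have sk: "block_skew M c $$ (j, i) = - block_skew M c $$ (i, j)" if "i < 2 * M" "j < 2 * M" for i j
    using that by (simp add: block_skew_def)
  have val: "pf_term M (\<lambda>i j. block_skew M c $$ (i, j)) p = 1 * (\<Prod>i<M. c i)"
    if "p permutes {0..<2 * M}" "pairing M p \<in> {pairing M id}" for p
    using pf_term_pairing_cong[where a = "\<lambda>i j. block_skew M c $$ (i, j)", OF that(1) permutes_id _ sk]
      that(2) trm by simp
  have zero: "pf_term M (\<lambda>i j. block_skew M c $$ (i, j)) p = 0"
    if p: "p permutes {0..<2 * M}" and ne: "pairing M p \<notin> {pairing M id}" for p
  proof (rule ccontr)
    assume nz: "pf_term M (\<lambda>i j. block_skew M c $$ (i, j)) p \<noteq> 0"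
    have "\<exists>k<M. {p (2 * i), p (2 * i + 1)} = {2 * k, 2 * k + 1}" if i: "i < M" for i
    proof -
      have lt: "p (2 * i) < 2 * M" "p (2 * i + 1) < 2 * M"
        using permutes_in_image[OF p, of "2 * i"] permutes_in_image[OF p, of "2 * i + 1"] i by auto
      have "block_skew M c $$ (p (2 * i), p (2 * i + 1)) \<noteq> 0"
        using nz i unfolding pf_term_def by (auto simp: prod_zero_iff)
      then have "p (2 * i) div 2 = p (2 * i + 1) div 2" "p (2 * i) \<noteq> p (2 * i + 1)"
        using lt by (auto simp: block_skew_def split: if_splits)
      then have "{p (2 * i), p (2 * i + 1)} = {2 * (p (2 * i) div 2), 2 * (p (2 * i) div 2) + 1}"
        by (rule doubleton_same_half)
      moreover have "p (2 * i) div 2 < M" using lt by linarith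
      ultimately show ?thesis by blast
    qed
    then have sub: "pairing M p \<subseteq> pairing M id" by (auto simp: pairing_def)
    have "finite (pairing M (id :: nat \<Rightarrow> nat))" by (simp add: pairing_def)
    then have "pairing M p = pairing M id"
      using sub card_pairing[OF permutes_inj_on[OF p]] card_pairing[of id M]
        card_subset_eq[of "pairing M id" "pairing M p"] by simp
    then show False using ne by simp
  qed
  have ex: "\<exists>p. p permutes {0..<2 * M} \<and> pairing M p = D" if "D \<in> {pairing M id}" for D :: "nat set set"
    by (rule exI[of _ id]) (use that permutes_id[of "{0..<2 * M}"] in simp)
  show ?thesis
    by (rule trans, rule pf_sum_matchings[where \<D> = "{pairing M id}" and h = "\<lambda>_. \<Prod>i<M. c i"
        and a = "\<lambda>i j. block_skew M c $$ (i, j)" and \<epsilon> = 1])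
      (simp, erule ex, erule (1) val, erule (1) zero, simp)
qed

lemma det_block_skew: "Determinant.det (block_skew M c) = (\<Prod>i<M. c i)\<^sup>2"
proof (induction M arbitrary: c)
  case 0
  show ?case by (subst det_dim_zero) (auto simp: block_skew_def)
next
  case (Suc M)
  have c: "c = case_nat (c 0) (\<lambda>i. c (Suc i))" by (auto split: nat.splits)
  let ?P = "Matrix.mat 2 2 (\<lambda>(i, j). if i < j then c 0 else if j < i then - c 0 else 0) :: real mat"
  have dP: "Determinant.det ?P = c 0 ^ 2"
  proof -
    have P: "?P \<in> carrier_mat 2 2" by simp
    have "Determinant.det (mat_delete ?P i 0) = ?P $$ (1 - i, 1)" if "i < 2" for i
      using that by (subst det_single) (auto simp: mat_delete_def insert_index_def)
    then have "Determinant.det ?P = ?P $$ (0,0) * ?P $$ (1,1) - ?P $$ (1,0) * ?P $$ (0,1)"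
      by (subst laplace_expansion_column[OF P, of 0]) (simp_all add: Determinant.cofactor_def numeral_2_eq_2)
    then show ?thesis by (simp add: power2_eq_square)
  qed
  have "Determinant.det (block_skew (Suc M) c) = Determinant.det ?P * Determinant.det (block_skew M (\<lambda>i. c (Suc i)))"
    by (subst c, subst block_skew_Suc, subst det_four_block_mat_upper_right_zero[OF _ refl])
      (auto simp: block_skew_def)
  also have "\<dots> = (\<Prod>i<Suc M. c i)\<^sup>2"
    unfolding Suc dP prod.lessThan_Suc_shift by (simp add: power_mult_distrib)
  finally show ?case .
qed

text \<open>Cancels the congruence: \<open>b\<close> stands for the determinant of \<open>B\<close>,
  \<open>p\<close> for the Pfaffian sum, \<open>c\<close> for \<open>pairing_count\<close> and
  \<open>t\<close> for the product of the block coefficients.\<close>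

lemma square_ratio:
  fixes b p t :: real
  assumes "b * p = c * t" "b\<^sup>2 * d = t\<^sup>2" "b \<noteq> 0"
  shows "c\<^sup>2 * d = p\<^sup>2"
proof -
  have "b\<^sup>2 * (c\<^sup>2 * d) = c\<^sup>2 * (b\<^sup>2 * d)" by (simp only: mult.left_commute)
  also have "\<dots> = (b * p)\<^sup>2" unfolding assms by (simp only: power_mult_distrib)
  finally show ?thesis using assms(3) by (simp add: power_mult_distrib)
qed

text \<open>A congruence by \<open>B\<close> multiplies the Pfaffian by \<open>det B\<close> and the
  determinant by its square, so the identity descends from the normal form, where both sides are
  explicit.\<close>

theorem det_eq_pf_sum_squared:
  assumes A: "A \<in> carrier_mat (2 * M) (2 * M)" and "skew_mat A"
  shows "(real (pairing_count M))\<^sup>2 * Determinant.det A = (pf_sum M (\<lambda>i j. A $$ (i, j)))\<^sup>2"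
proof -
  obtain B c where B: "B \<in> carrier_mat (2 * M) (2 * M)" "Determinant.det B \<noteq> 0"
    "B * A * transpose_mat B = block_skew M c"
    using skew_mat_canonical[OF assms] by blast
  have "Determinant.det B * pf_sum M (\<lambda>i j. A $$ (i, j)) = real (pairing_count M) * (\<Prod>i<M. c i)"
    using pf_sum_congruence[OF A B(1)] unfolding B(3) pf_sum_block_skew by simp
  moreover have "(Determinant.det B)\<^sup>2 * Determinant.det A = (\<Prod>i<M. c i)\<^sup>2"
  proof -
    have "Determinant.det (B * A * transpose_mat B) = Determinant.det (B * A) * Determinant.det (transpose_mat B)"
      using A B(1) by (intro Determinant.det_mult[of _ "2 * M"]) simp_all
    also have "\<dots> = (Determinant.det B)\<^sup>2 * Determinant.det A"
      using Determinant.det_mult[OF B(1) A] Determinant.det_transpose[OF B(1)] by (simp add: power2_eq_square)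
    finally show ?thesis unfolding B(3) det_block_skew by simp
  qed
  ultimately show ?thesis using B(2) square_ratio by blast
qed

corollary det_eq_matching_sum_squared:
  assumes A: "A \<in> carrier_mat (2 * M) (2 * M)" "skew_mat A" and "finite \<D>"
    and "\<And>D. D \<in> \<D> \<Longrightarrow> \<exists>p. p permutes {0..<2 * M} \<and> pairing M p = D"
    and "\<And>p. p permutes {0..<2 * M} \<Longrightarrow> pairing M p \<in> \<D> \<Longrightarrow> pf_term M (\<lambda>i j. A $$ (i, j)) p = \<epsilon> * h (pairing M p)"
    and "\<And>p. p permutes {0..<2 * M} \<Longrightarrow> pairing M p \<notin> \<D> \<Longrightarrow> pf_term M (\<lambda>i j. A $$ (i, j)) p = 0"
    and "\<epsilon>\<^sup>2 = 1"
  shows "Determinant.det A = (\<Sum>D\<in>\<D>. h D)\<^sup>2"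
proof -
  have "(real (pairing_count M))\<^sup>2 * Determinant.det A = (real (pairing_count M) * \<epsilon> * (\<Sum>D\<in>\<D>. h D))\<^sup>2"
    unfolding det_eq_pf_sum_squared[OF A] using assms by (subst pf_sum_matchings[of \<D> M _ \<epsilon> h]) auto
  also have "\<dots> = (real (pairing_count M))\<^sup>2 * (\<Sum>D\<in>\<D>. h D)\<^sup>2"
    using \<open>\<epsilon>\<^sup>2 = 1\<close> by (simp add: power_mult_distrib)
  finally show ?thesis using pairing_count_pos[of M] by simp
qed

section \<open>Minors of the inverse\<close>

lemma det_permute_both:
  fixes A :: "real mat"
  assumes A: "A \<in> carrier_mat n n" and p: "p permutes {0..<n}"
  shows "Determinant.det (Matrix.mat n n (\<lambda>(i, j). A $$ (p i, p j))) = Determinant.det A"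
proof -
  have pl: "p i < n" if "i < n" for i using permutes_in_image[OF p, of i] that by simp
  define B where "B = transpose_mat (Matrix.mat n n (\<lambda>(i, j). A $$ (p i, j)))"
  have B: "B \<in> carrier_mat n n" unfolding B_def by simp
  have "Matrix.mat n n (\<lambda>(i, j). A $$ (p i, p j)) = transpose_mat (Matrix.mat n n (\<lambda>(i, j). B $$ (p i, j)))"
    unfolding B_def using pl by (intro eq_matI) auto
  then have "Determinant.det (Matrix.mat n n (\<lambda>(i, j). A $$ (p i, p j)))
      = Determinant.det (Matrix.mat n n (\<lambda>(i, j). B $$ (p i, j)))"
    using Determinant.det_transpose[of "Matrix.mat n n (\<lambda>(i, j). B $$ (p i, j))" n] by simp
  also have "\<dots> = of_int (sign p) * Determinant.det B" by (rule det_permute_rows[OF B p])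
  also have "Determinant.det B = Determinant.det (Matrix.mat n n (\<lambda>(i, j). A $$ (p i, j)))"
    unfolding B_def by (rule Determinant.det_transpose[of _ n]) simp
  also have "\<dots> = of_int (sign p) * Determinant.det A" by (rule det_permute_rows[OF A p])
  finally show ?thesis by (simp flip: of_int_mult mult.assoc)
qed

lemma permuted_mult:
  fixes A B :: "real mat"
  assumes A: "A \<in> carrier_mat n n" and B: "B \<in> carrier_mat n n" and p: "p permutes {0..<n}"
  shows "Matrix.mat n n (\<lambda>(i, j). A $$ (p i, p j)) * Matrix.mat n n (\<lambda>(i, j). B $$ (p i, p j))
       = Matrix.mat n n (\<lambda>(i, j). (A * B) $$ (p i, p j))"
proof (rule eq_matI)
  have pl: "p i < n" if "i < n" for i using permutes_in_image[OF p, of i] that by simp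
  fix i j assume "i < dim_row (Matrix.mat n n (\<lambda>(i, j). (A * B) $$ (p i, p j)))"
    "j < dim_col (Matrix.mat n n (\<lambda>(i, j). (A * B) $$ (p i, p j)))"
  then have ij: "i < n" "j < n" by auto
  have "(\<Sum>k = 0..<n. A $$ (p i, p k) * B $$ (p k, p j)) = (\<Sum>k = 0..<n. A $$ (p i, k) * B $$ (k, p j))"
    by (rule sum.reindex_bij_betw[OF permutes_imp_bij[OF p]])
  moreover have "(A * B) $$ (p i, p j) = (\<Sum>k = 0..<n. A $$ (p i, k) * B $$ (k, p j))"
    using A B pl[OF ij(1)] pl[OF ij(2)] by (auto simp: scalar_prod_def intro!: sum.cong)
  ultimately show "(Matrix.mat n n (\<lambda>(i, j). A $$ (p i, p j)) * Matrix.mat n n (\<lambda>(i, j). B $$ (p i, p j))) $$ (i, j)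
       = Matrix.mat n n (\<lambda>(i, j). (A * B) $$ (p i, p j)) $$ (i, j)"
    using ij by (simp add: scalar_prod_def)
qed auto

text \<open>Replacing the second block column of the inverse by that of the identity turns the
  product into the block triangular matrix with rows \<open>(1, B)\<close> and
  \<open>(0, D)\<close>; determinants of both sides give the claim.\<close>

lemma jacobi_complementary_minor:
  fixes A B C D P Q R S :: "real mat"
  assumes A: "A \<in> carrier_mat k k" and B: "B \<in> carrier_mat k l" and C: "C \<in> carrier_mat l k"
    and D: "D \<in> carrier_mat l l" and P: "P \<in> carrier_mat k k" and Q: "Q \<in> carrier_mat k l"
    and R: "R \<in> carrier_mat l k" and S: "S \<in> carrier_mat l l"
    and one: "four_block_mat A B C D * four_block_mat P Q R S = 1\<^sub>m (k + l)"
  shows "Determinant.det (four_block_mat A B C D) * Determinant.det P = Determinant.det D"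
proof -
  have m: "four_block_mat A B C D * four_block_mat P Q R S
      = four_block_mat (A * P + B * R) (A * Q + B * S) (C * P + D * R) (C * Q + D * S)"
    by (rule mult_four_block_mat[OF A B C D P Q R S])
  have b1: "A * P + B * R = 1\<^sub>m k"
  proof (rule eq_matI)
    fix i j assume ij: "i < dim_row (1\<^sub>m k :: real mat)" "j < dim_col (1\<^sub>m k :: real mat)"
    have "(four_block_mat A B C D * four_block_mat P Q R S) $$ (i, j) = (A * P + B * R) $$ (i, j)"
      unfolding m using ij A P B R S D by (subst index_mat_four_block) auto
    then show "(A * P + B * R) $$ (i, j) = 1\<^sub>m k $$ (i, j)" unfolding one using ij by simp
  qed (use A P B R in auto)
  have b2: "C * P + D * R = 0\<^sub>m l k"
  proof (rule eq_matI)
    fix i j assume ij: "i < dim_row (0\<^sub>m l k :: real mat)" "j < dim_col (0\<^sub>m l k :: real mat)"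
    have "(four_block_mat A B C D * four_block_mat P Q R S) $$ (i + k, j) = (C * P + D * R) $$ (i, j)"
      unfolding m using ij A P B R S D C Q by (subst index_mat_four_block) auto
    then show "(C * P + D * R) $$ (i, j) = 0\<^sub>m l k $$ (i, j)" unfolding one using ij by simp
  qed (use C P D R in auto)
  have "four_block_mat A B C D * four_block_mat P (0\<^sub>m k l) R (1\<^sub>m l)
      = four_block_mat (A * P + B * R) (A * 0\<^sub>m k l + B * 1\<^sub>m l) (C * P + D * R) (C * 0\<^sub>m k l + D * 1\<^sub>m l)"
    by (rule mult_four_block_mat[OF A B C D P zero_carrier_mat R one_carrier_mat])
  also have "\<dots> = four_block_mat (1\<^sub>m k) B (0\<^sub>m l k) D"
    unfolding b1 b2 using A B C D by simp
  finally have "Determinant.det (four_block_mat A B C D) * Determinant.det (four_block_mat P (0\<^sub>m k l) R (1\<^sub>m l))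
      = Determinant.det (four_block_mat (1\<^sub>m k) B (0\<^sub>m l k) D)"
    using Determinant.det_mult[of "four_block_mat A B C D" "k + l" "four_block_mat P (0\<^sub>m k l) R (1\<^sub>m l)"]
      A D P by simp
  moreover have "Determinant.det (four_block_mat P (0\<^sub>m k l) R (1\<^sub>m l)) = Determinant.det P"
    by (subst det_four_block_mat_upper_right_zero[OF P refl R]) auto
  moreover have "Determinant.det (four_block_mat (1\<^sub>m k) B (0\<^sub>m l k) D) = Determinant.det D"
    by (subst det_four_block_mat_lower_left_zero[OF one_carrier_mat B refl D]) auto
  ultimately show ?thesis by simp
qed

lemma permutation_extending_list:
  assumes "distinct us" "set us \<subseteq> {0..<n}"
  obtains p where "p permutes {0..<n}" "\<And>i. i < length us \<Longrightarrow> p i = us ! i"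
proof -
  define ws where "ws = us @ filter (\<lambda>i. i \<notin> set us) [0..<n]"
  have d: "distinct ws" unfolding ws_def using assms(1) by auto
  have s: "set ws = {0..<n}" unfolding ws_def using assms(2) by auto
  have l: "length ws = n" using distinct_card[OF d] s by simp
  define p where "p i = (if i < n then ws ! i else i)" for i
  have "bij_betw (\<lambda>i. ws ! i) {..<length ws} (set ws)" by (rule bij_betw_nth[OF d refl refl])
  then have "bij_betw p {0..<n} {0..<n}"
    unfolding l s by (subst bij_betw_cong[of _ _ "\<lambda>i. ws ! i"]) (auto simp: p_def lessThan_atLeast0)
  then have "p permutes {0..<n}" by (rule bij_imp_permutes) (simp add: p_def)
  moreover have "p i = us ! i" if "i < length us" for i
  proof -
    have "length us \<le> n" using l unfolding ws_def by simp
    then show ?thesis using that by (simp add: p_def ws_def nth_append)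
  qed
  ultimately show thesis by (rule that)
qed

lemma inv_mat_right:
  fixes K :: "real mat"
  assumes K: "K \<in> carrier_mat n n" and "Determinant.det K \<noteq> 0"
  shows "inv_mat K \<in> carrier_mat n n \<and> K * inv_mat K = 1\<^sub>m n \<and> inv_mat K * K = 1\<^sub>m n"
proof (cases "mat_inverse K")
  case None
  then have "K \<notin> Units (ring_mat TYPE(real) n n)" by (rule mat_inverse(1)[OF K])
  moreover have "K \<in> Units (ring_mat TYPE(real) n n)" by (rule det_non_zero_imp_unit[OF assms])
  ultimately show ?thesis by contradiction
next
  case (Some B)
  then show ?thesis using mat_inverse(2)[OF K Some] by (simp add: inv_mat_def)
qed

text \<open>With the indices \<open>us\<close> moved to the front, \<open>K'\<close> is block
  diagonal: the pairs of \<open>us\<close> on top, the unchanged complementary block of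
  \<open>K\<close> below. Jacobi's formula expresses the latter through the minor of the
  inverse.\<close>

lemma det_inverse_minor:
  fixes K K' :: "real mat"
  assumes K: "K \<in> carrier_mat n n" "Determinant.det K \<noteq> 0"
    and us: "distinct us" "set us \<subseteq> {0..<n}" "length us = 2 * r"
    and K': "K' \<in> carrier_mat n n"
    and off: "\<And>i j. i < n \<Longrightarrow> j < n \<Longrightarrow> i \<notin> set us \<Longrightarrow> j \<notin> set us \<Longrightarrow> K' $$ (i, j) = K $$ (i, j)"
    and zero: "\<And>i j. i < n \<Longrightarrow> j < n \<Longrightarrow> (i \<in> set us) \<noteq> (j \<in> set us) \<Longrightarrow> K' $$ (i, j) = 0"
    and bl: "\<And>s t. s < 2 * r \<Longrightarrow> t < 2 * r \<Longrightarrow> K' $$ (us ! s, us ! t) = block_skew r w $$ (s, t)"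
  shows "Determinant.det K' = Determinant.det K * (\<Prod>t<r. w t)\<^sup>2 *
           Determinant.det (Matrix.mat (2 * r) (2 * r) (\<lambda>(i, j). inv_mat K $$ (us ! i, us ! j)))"
proof -
  define k where "k = 2 * r"
  obtain p where p: "p permutes {0..<n}" "\<And>i. i < k \<Longrightarrow> p i = us ! i"
    using permutation_extending_list[OF us(1,2)] us(3) unfolding k_def by metis
  have pl: "p i < n" if "i < n" for i using permutes_in_image[OF p(1), of i] that by simp
  have "card (set us) \<le> n" using card_mono[OF _ us(2)] by simp
  then have kn: "k \<le> n" using distinct_card[OF us(1)] us(3) k_def by simp
  define l where "l = n - k"
  have nkl: "n = k + l" using kn l_def by simp
  have p_in: "p i \<in> set us \<longleftrightarrow> i < k" if "i < n" for i
  proof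
    assume "p i \<in> set us"
    then obtain j where j: "j < k" "p i = us ! j" using us(3) unfolding in_set_conv_nth k_def by metis
    then have "p i = p j" using p(2) by simp
    then have "i = j" using permutes_inj[OF p(1)] by (simp add: inj_eq)
    then show "i < k" using j by simp
  next
    assume "i < k"
    then show "p i \<in> set us" using p(2) us(3) k_def by simp
  qed
  note Kinv = inv_mat_right[OF K]
  let ?\<pi> = "\<lambda>A. Matrix.mat n n (\<lambda>(i, j). A $$ (p i, p j)) :: real mat"
  let ?a = "\<lambda>A. Matrix.mat k k (\<lambda>(i, j). A $$ (p i, p j)) :: real mat"
  let ?b = "\<lambda>A. Matrix.mat k l (\<lambda>(i, j). A $$ (p i, p (j + k))) :: real mat"
  let ?c = "\<lambda>A. Matrix.mat l k (\<lambda>(i, j). A $$ (p (i + k), p j)) :: real mat"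
  let ?d = "\<lambda>A. Matrix.mat l l (\<lambda>(i, j). A $$ (p (i + k), p (j + k))) :: real mat"
  have blocks: "?\<pi> A = four_block_mat (?a A) (?b A) (?c A) (?d A)" for A :: "real mat"
    by (rule eq_matI) (auto simp: nkl)
  have "?\<pi> K * ?\<pi> (inv_mat K) = ?\<pi> (1\<^sub>m n)"
    using permuted_mult[OF K(1) _ p(1), of "inv_mat K"] Kinv by simp
  also have "\<dots> = 1\<^sub>m (k + l)"
    using pl permutes_inj[OF p(1)] by (intro eq_matI) (auto simp: nkl inj_eq)
  finally have "Determinant.det (?\<pi> K) * Determinant.det (?a (inv_mat K)) = Determinant.det (?d K)"
    unfolding blocks by (intro jacobi_complementary_minor) auto
  then have 1: "Determinant.det K * Determinant.det (?a (inv_mat K)) = Determinant.det (?d K)"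
    using det_permute_both[OF K(1) p(1)] by simp
  have "?\<pi> K' = four_block_mat (block_skew r w) (0\<^sub>m k l) (0\<^sub>m l k) (?d K)"
    (is "_ = ?F")
  proof (rule eq_matI)
    fix i j assume "i < dim_row ?F" "j < dim_col ?F"
    then have ij: "i < n" "j < n" by (auto simp: nkl block_skew_def k_def)
    have dims: "dim_row (block_skew r w) = k" "dim_col (block_skew r w) = k" by (auto simp: block_skew_def k_def)
    consider "i < k" "j < k" | "(i < k) \<noteq> (j < k)" | "\<not> i < k" "\<not> j < k" by blast
    then show "?\<pi> K' $$ (i, j) = ?F $$ (i, j)"
    proof cases
      case 1
      then show ?thesis using ij bl[of i j] p(2) dims by (simp add: k_def nkl)
    next
      case 2
      then have "K' $$ (p i, p j) = 0" using zero[OF pl[OF ij(1)] pl[OF ij(2)]] p_in ij by blast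
      then show ?thesis using 2 ij dims by (auto simp: nkl)
    next
      case 3
      then have "K' $$ (p i, p j) = K $$ (p i, p j)" using off[OF pl[OF ij(1)] pl[OF ij(2)]] p_in ij by blast
      then show ?thesis using 3 ij dims by (simp add: nkl)
    qed
  qed (auto simp: nkl block_skew_def k_def)
  then have "Determinant.det (?\<pi> K') = Determinant.det ?F" by simp
  also have "\<dots> = Determinant.det (block_skew r w) * Determinant.det (?d K)"
    by (rule det_four_block_mat_upper_right_zero[OF _ refl]) (auto simp: block_skew_def k_def)
  finally have "Determinant.det K' = Determinant.det (block_skew r w) * Determinant.det (?d K)"
    unfolding det_permute_both[OF K' p(1)] .
  moreover have "?a (inv_mat K) = Matrix.mat (2 * r) (2 * r) (\<lambda>(i, j). inv_mat K $$ (us ! i, us ! j))"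
    using p(2) by (intro eq_matI) (auto simp: k_def)
  ultimately show ?thesis unfolding det_block_skew 1[symmetric] by (simp only: mult_ac)
qed

section \<open>Changing a matching along a ring of triangles\<close>

text \<open>\<open>x \<circ> p\<close> lists the vertices so that the pairs matched by \<open>\<mu>\<close> sit at the positions \<open>2i, 2i + 1\<close>.\<close>

definition lists_matching :: "nat \<Rightarrow> (nat \<Rightarrow> 'v) \<Rightarrow> ('v \<Rightarrow> 'v) \<Rightarrow> (nat \<Rightarrow> nat) \<Rightarrow> bool" where
  "lists_matching M x \<mu> p \<longleftrightarrow> p permutes {0..<2 * M} \<and> (\<forall>i<M. x (p (2 * i + 1)) = \<mu> (x (p (2 * i))))"

text \<open>Every pair matched by \<open>\<mu>\<close> is either fixed by \<open>c\<close> or has the form \<open>{v, c v}\<close>, so that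
  \<open>c\<close> carries the matching \<open>\<mu>\<close> to its symmetric difference with the cycles of \<open>c\<close>.\<close>

lemma conjugate_matching:
  fixes x :: "nat \<Rightarrow> 'v" and S :: "'v \<Rightarrow> 'v \<Rightarrow> real"
  assumes x: "bij_betw x {0..<2 * M} V" and p: "lists_matching M x \<mu> p"
    and c: "c permutes V"
    and conj: "\<And>u. u \<in> V \<Longrightarrow> \<mu>' (c u) = c (\<mu> u)"
    and alt: "\<And>u. u \<in> V \<Longrightarrow> c u = u \<and> c (\<mu> u) = \<mu> u \<or> \<mu> u = c u \<or> u = c (\<mu> u)"
    and skew: "\<And>u v. S v u = - S u v"
    and unit: "\<And>u. u \<in> V \<Longrightarrow> S u (\<mu> u) * S u (\<mu> u) = 1"
  shows "\<exists>p'. lists_matching M x \<mu>' p' \<and>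
    pf_term M (\<lambda>i j. S (x i) (x j)) p * pf_term M (\<lambda>i j. S (x i) (x j)) p'
      = of_int (sign c) * (\<Prod>v\<in>V. if c v = v then 1 else S v (c v))"
proof -
  have pp: "p permutes {0..<2 * M}" and pm: "\<And>i. i < M \<Longrightarrow> x (p (2 * i + 1)) = \<mu> (x (p (2 * i)))"
    using p by (auto simp: lists_matching_def)
  have fV: "finite V" using bij_betw_finite[OF x] by simp
  define y where "y = inv_into {0..<2 * M} x"
  have y: "bij_betw y V {0..<2 * M}" unfolding y_def by (rule bij_betw_inv_into[OF x])
  have yx: "y (x i) = i" if "i < 2 * M" for i
    unfolding y_def using x that by (auto simp: bij_betw_def inv_into_f_f)
  have xy: "x (y v) = v" if "v \<in> V" for v
    unfolding y_def using x that by (auto simp: bij_betw_def f_inv_into_f)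
  \<comment> \<open>The vertex permutation \<open>c\<close> transported to positions, so that its
    sign can be compared with that of the listing.\<close>
  define d where "d = map_permutation V y c"
  have d: "d permutes {0..<2 * M}" unfolding d_def by (rule map_permutation_permutes[OF y c])
  have sd: "sign d = sign c" unfolding d_def
    using y c fV by (intro sign_map_permutation) (auto simp: bij_betw_def)
  have xV: "x i \<in> V" if "i < 2 * M" for i using x that by (auto simp: bij_betw_def)
  have xd: "x (d i) = c (x i)" if "i < 2 * M" for i
  proof -
    have "d (y (x i)) = y (c (x i))" unfolding d_def
      by (rule map_permutation_apply) (use y xV[OF that] in \<open>auto simp: bij_betw_def\<close>)
    then show ?thesis using xy yx[OF that] permutes_in_image[OF c] xV[OF that] by simp
  qed
  have pl: "p i < 2 * M" if "i < 2 * M" for i using permutes_in_image[OF pp, of i] that by simp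
  define p' where "p' = d \<circ> p"
  have p': "p' permutes {0..<2 * M}" unfolding p'_def by (intro permutes_compose pp d)
  have xp': "x (p' i) = c (x (p i))" if "i < 2 * M" for i
    unfolding p'_def using xd[OF pl[OF that]] by simp
  have "lists_matching M x \<mu>' p'" unfolding lists_matching_def
  proof (intro conjI allI impI p')
    fix i assume i: "i < M"
    have "x (p' (2 * i + 1)) = c (\<mu> (x (p (2 * i))))" using xp'[of "2 * i + 1"] pm[OF i] i by simp
    also have "\<dots> = \<mu>' (c (x (p (2 * i))))" using conj[of "x (p (2 * i))"] xV[OF pl[of "2 * i"]] i by simp
    also have "\<dots> = \<mu>' (x (p' (2 * i)))" using xp'[of "2 * i"] i by simp
    finally show "x (p' (2 * i + 1)) = \<mu>' (x (p' (2 * i)))" .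
  qed
  moreover have "pf_term M (\<lambda>i j. S (x i) (x j)) p * pf_term M (\<lambda>i j. S (x i) (x j)) p'
      = of_int (sign c) * (\<Prod>v\<in>V. if c v = v then 1 else S v (c v))"
  proof -
    define G where "G v = (if c v = v then 1 else S v (c v))" for v
    have c_inj: "c u = c v \<longleftrightarrow> u = v" for u v using permutes_inj[OF c] by (simp add: inj_eq)
    \<comment> \<open>A fixed pair contributes a squared sign. A moved pair has the form
      \<open>{v, c v}\<close> and its image is \<open>{c v, c (c v)}\<close>, so the two entries are
      two consecutive steps of a cycle of \<open>c\<close>. If the pair is listed backwards, skew
      symmetry gives two sign changes that cancel.\<close>
    have pair: "S u (\<mu> u) * S (c u) (c (\<mu> u)) = G u * G (\<mu> u)" if u: "u \<in> V" for u
    proof -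
      have ne: "\<mu> u \<noteq> u"
      proof
        assume "\<mu> u = u"
        then have "S u (\<mu> u) = 0" using skew[of u u] by simp
        then show False using unit[OF u] by simp
      qed
      consider "c u = u" "c (\<mu> u) = \<mu> u" | "\<mu> u = c u" | "u = c (\<mu> u)" using alt[OF u] by blast
      then show ?thesis
      proof cases
        case 1
        then show ?thesis using unit[OF u] by (simp add: G_def)
      next
        case 2
        then have "c u \<noteq> u" "c (c u) \<noteq> c u" using ne c_inj by auto
        then show ?thesis using 2 by (simp add: G_def)
      next
        case 3
        define v where "v = \<mu> u"
        have cv: "c v = u" using 3 v_def by simp
        have "c v \<noteq> v" using ne cv v_def by simp
        then have "c v \<noteq> v" "c (c v) \<noteq> c v" using c_inj by blast+
        then show ?thesis using cv skew[of u v] skew[of "c u" "c v"] unfolding v_def[symmetric]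
          by (simp add: G_def)
      qed
    qed
    have "(\<Prod>i<M. S (x (p (2 * i))) (x (p (2 * i + 1)))) * (\<Prod>i<M. S (x (p' (2 * i))) (x (p' (2 * i + 1))))
        = (\<Prod>i<M. G (x (p (2 * i))) * G (x (p (2 * i + 1))))"
      unfolding prod.distrib[symmetric]
    proof (rule prod.cong[OF refl])
      fix i assume "i \<in> {..<M}"
      then have i: "i < M" "2 * i < 2 * M" "2 * i + 1 < 2 * M" by auto
      show "S (x (p (2 * i))) (x (p (2 * i + 1))) * S (x (p' (2 * i))) (x (p' (2 * i + 1)))
          = G (x (p (2 * i))) * G (x (p (2 * i + 1)))"
        unfolding xp'[OF i(2)] xp'[OF i(3)] pm[OF i(1)] by (rule pair[OF xV[OF pl[OF i(2)]]])
    qed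
    also have "\<dots> = (\<Prod>j = 0..<2 * M. G (x (p j)))" by (rule prod_even_odd[symmetric])
    also have "\<dots> = (\<Prod>j = 0..<2 * M. G (x j))"
      by (rule prod.reindex_bij_betw[OF permutes_imp_bij[OF pp]])
    also have "\<dots> = (\<Prod>v\<in>V. G v)" by (rule prod.reindex_bij_betw[OF x])
    finally have 1: "(\<Prod>i<M. S (x (p (2 * i))) (x (p (2 * i + 1)))) * (\<Prod>i<M. S (x (p' (2 * i))) (x (p' (2 * i + 1))))
        = (\<Prod>v\<in>V. G v)" .
    have "sign p' = sign c * sign p" unfolding p'_def sd[symmetric]
      by (rule sign_compose) (use d pp in \<open>auto intro: permutes_imp_permutation[of "{0..<2 * M}"]\<close>)
    then have "sign p * sign p' = sign c" by (simp add: mult.left_commute)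
    then have 2: "(of_int (sign p) * of_int (sign p') :: real) = of_int (sign c)" by (metis of_int_mult)
    have "pf_term M (\<lambda>i j. S (x i) (x j)) p * pf_term M (\<lambda>i j. S (x i) (x j)) p'
       = (of_int (sign p) * of_int (sign p')) *
         ((\<Prod>i<M. S (x (p (2 * i))) (x (p (2 * i + 1)))) * (\<Prod>i<M. S (x (p' (2 * i))) (x (p' (2 * i + 1)))))"
      unfolding pf_term_def by (simp only: mult_ac)
    then show ?thesis unfolding 1 2 G_def .
  qed
  ultimately show ?thesis by blast
qed

text \<open>One cycle around the ring of triangles: from \<open>i t\<close> to \<open>j t\<close>,
  through \<open>k t\<close> if \<open>t\<close> lies in \<open>A\<close>, and on to the next
  triangle. Its length is \<open>2 r + card A\<close>, which explains the sign. It is composed of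
  two families of swaps followed by the rotation of the points \<open>i t\<close>.\<close>

lemma ring_permutation:
  fixes i j k :: "nat \<Rightarrow> 'v"
  assumes r: "r > 0" and inj: "inj_on i {..<r}" "inj_on j {..<r}" "inj_on k {..<r}"
    and dis: "i ` {..<r} \<inter> j ` {..<r} = {}" "i ` {..<r} \<inter> k ` {..<r} = {}" "j ` {..<r} \<inter> k ` {..<r} = {}"
    and A: "A \<subseteq> {..<r}"
  obtains c where "c permutes (i ` {..<r} \<union> j ` {..<r} \<union> k ` A)" "sign c = - ((-1) ^ card A)"
    "\<And>t. t \<in> A \<Longrightarrow> c (i t) = k t" "\<And>t. t < r \<Longrightarrow> t \<notin> A \<Longrightarrow> c (i t) = j t"
    "\<And>t. t \<in> A \<Longrightarrow> c (k t) = j t" "\<And>t. t < r \<Longrightarrow> c (j t) = i (Suc t mod r)"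
proof -
  obtain r' where r': "r = Suc r'" using r gr0_implies_Suc by blast
  define sh where "sh = map_permutation {..<r} i (cyclic_shift r)"
  have cs: "cyclic_shift r permutes {..<r}" "sign (cyclic_shift r) = (-1) ^ r'"
    using cyclic_shift_permutes_sign[of r'] r' by auto
  have sh: "sh permutes i ` {..<r}" "sign sh = (-1) ^ r'"
    unfolding sh_def using cs inj(1)
    by (auto intro!: map_permutation_permutes simp: bij_betw_def sign_map_permutation)
  have sh_i: "sh (i t) = i (Suc t mod r)" if "t < r" for t
    unfolding sh_def using map_permutation_apply[OF inj(1), of t "cyclic_shift r"] that
    by (simp add: cyclic_shift_def)
  have ne: "i s \<noteq> j t" "i s \<noteq> k t" "j s \<noteq> k t" if "s < r" "t < r" for s t
    using dis that unfolding disjoint_iff by (metis imageI lessThan_iff)+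
  have Ar: "t < r" if "t \<in> A" for t using that A by auto
  have fA: "finite A" using A finite_subset by blast
  have injA: "inj_on i A" "inj_on k A" "i ` A \<inter> k ` A = {}"
    using inj A ne(2)[OF Ar Ar] by (auto intro: inj_on_subset)
  note s1 = swaps_simps[OF inj(1,2) dis(1)] and s2 = swaps_simps[OF injA]
  have p1: "swaps i j {..<r} permutes (i ` {..<r} \<union> j ` {..<r})" "sign (swaps i j {..<r}) = (-1) ^ r"
    using swaps_permutes_sign[OF _ inj(1,2) dis(1)] by auto
  have p2: "swaps i k A permutes (i ` A \<union> k ` A)" "sign (swaps i k A) = (-1) ^ card A"
    using swaps_permutes_sign[OF fA injA] by auto
  let ?U = "i ` {..<r} \<union> j ` {..<r} \<union> k ` A"
  have fU: "finite ?U" using fA by simp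
  have P: "sh permutes ?U" "swaps i j {..<r} permutes ?U" "swaps i k A permutes ?U"
    by (rule permutes_subset[OF sh(1)] permutes_subset[OF p1(1)] permutes_subset[OF p2(1)]; use A in blast)+
  show thesis
  proof (rule that[of "sh \<circ> (swaps i j {..<r} \<circ> swaps i k A)"])
    show "(sh \<circ> (swaps i j {..<r} \<circ> swaps i k A)) permutes ?U"
      using P by (intro permutes_compose)
    have "sign (sh \<circ> (swaps i j {..<r} \<circ> swaps i k A)) = sign sh * (sign (swaps i j {..<r}) * sign (swaps i k A))"
      using P fU permutes_compose[OF P(3,2)]
      by (simp add: sign_compose permutes_imp_permutation[OF fU])
    also have "\<dots> = - ((-1) ^ card A)"
      unfolding sh(2) p1(2) p2(2) unfolding r' by (simp flip: power_mult_distrib mult.assoc)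
    finally show "sign (sh \<circ> (swaps i j {..<r} \<circ> swaps i k A)) = - ((-1) ^ card A)" .
  next
    fix t assume t: "t \<in> A"
    then have tr: "t < r" using A by auto
    have nk: "k t \<notin> i ` {..<r}" "k t \<notin> j ` {..<r}" using dis tr by blast+
    show "(sh \<circ> (swaps i j {..<r} \<circ> swaps i k A)) (i t) = k t"
      using s2(1)[OF t] s1(3)[OF nk] permutes_not_in[OF sh(1) nk(1)] by simp
    have nj: "j t \<notin> i ` {..<r}" using dis tr by blast
    show "(sh \<circ> (swaps i j {..<r} \<circ> swaps i k A)) (k t) = j t"
      using s2(2)[OF t] s1(1)[of t] permutes_not_in[OF sh(1) nj] tr by simp
  next
    fix t assume t: "t < r" "t \<notin> A"
    have "i t \<notin> i ` A" "i t \<notin> k ` A" using t Ar inj(1) ne(2) by (auto simp: inj_on_def)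
    moreover have nj: "j t \<notin> i ` {..<r}" using dis t by blast
    ultimately show "(sh \<circ> (swaps i j {..<r} \<circ> swaps i k A)) (i t) = j t"
      using s2(3) s1(1)[of t] permutes_not_in[OF sh(1) nj] t by simp
  next
    fix t assume t: "t < r"
    have "j t \<notin> i ` A" "j t \<notin> k ` A" using ne(1)[OF _ t] ne(3)[OF t] Ar by (metis imageE)+
    then show "(sh \<circ> (swaps i j {..<r} \<circ> swaps i k A)) (j t) = i (Suc t mod r)"
      using s2(3) s1(2)[of t] sh_i[OF t] t by simp
  qed
qed

text \<open>\<open>nxt\<close> rotates every triangle, \<open>leg\<close> is the involution along the remaining edges, and \<open>L\<close> selects the
  vertices matched along their leg; of the vertices of a triangle one or three have this property.\<close>

definition mate :: "('v \<Rightarrow> 'v) \<Rightarrow> ('v \<Rightarrow> 'v) \<Rightarrow> ('v \<Rightarrow> bool) \<Rightarrow> 'v \<Rightarrow> 'v" where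
  "mate nxt leg L v = (if L v then leg v else if L (nxt v) then nxt (nxt v) else nxt v)"

definition leg_config :: "'v set \<Rightarrow> ('v \<Rightarrow> 'v) \<Rightarrow> ('v \<Rightarrow> 'v) \<Rightarrow> ('v \<Rightarrow> bool) \<Rightarrow> bool" where
  "leg_config V nxt leg L \<longleftrightarrow>
     (\<forall>v\<in>V. (L v \<longrightarrow> leg v \<in> V \<and> leg (leg v) = v \<and> L (leg v)) \<and> (L v \<longleftrightarrow> (L (nxt v) \<longleftrightarrow> L (nxt (nxt v)))))"

definition triangle :: "('v \<Rightarrow> 'v) \<Rightarrow> 'v \<Rightarrow> 'v \<Rightarrow> 'v \<Rightarrow> bool" where
  "triangle nxt u v w \<longleftrightarrow> nxt u = v \<and> nxt v = w \<and> nxt w = u \<or> nxt u = w \<and> nxt w = v \<and> nxt v = u"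

lemma triangle_rotate: "triangle nxt u v w \<Longrightarrow> triangle nxt v u w" "triangle nxt u v w \<Longrightarrow> triangle nxt w u v"
  by (auto simp: triangle_def)

lemma mate_triangle:
  assumes "triangle nxt u v w" "L u \<longleftrightarrow> (L v \<longleftrightarrow> L w)"
  shows "mate nxt leg L u = (if L u then leg u else if L w then v else w)"
  using assms by (auto simp: mate_def triangle_def)

lemma leg_config_triangle:
  assumes "leg_config V nxt leg L" "u \<in> V" "triangle nxt u v w"
  shows "L u \<longleftrightarrow> (L v \<longleftrightarrow> L w)"
  using assms by (auto simp: leg_config_def triangle_def)

text \<open>Flipping exchanges occupied and empty legs along the ring and rematches inside its
  triangles. Let \<open>A\<close> be the triangles whose third vertex is not matched by its leg. The
  cycle has sign \<open>- (-1)^(card A)\<close>, the legs contribute \<open>-1\<close>, and the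
  direct edges \<open>(-1)^(r - card A)\<close>; detours contribute \<open>1\<close>. The total is
  \<open>(-1)^r\<close>, hence the requirement that \<open>r\<close> be even.\<close>

lemma ring_flip:
  fixes i j k :: "nat \<Rightarrow> 'v" and S :: "'v \<Rightarrow> 'v \<Rightarrow> real"
  assumes x: "bij_betw x {0..<2 * M} V" and p: "lists_matching M x (mate nxt leg L) p"
    and nxt: "\<And>v. v \<in> V \<Longrightarrow> nxt v \<in> V" "\<And>v. v \<in> V \<Longrightarrow> nxt (nxt (nxt v)) = v"
    and L: "leg_config V nxt leg L"
    and r: "r > 0" "even r" and inj: "inj_on i {..<r}" "inj_on j {..<r}" "inj_on k {..<r}"
    and dis: "i ` {..<r} \<inter> j ` {..<r} = {}" "i ` {..<r} \<inter> k ` {..<r} = {}" "j ` {..<r} \<inter> k ` {..<r} = {}"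
    and V: "\<And>t. t < r \<Longrightarrow> i t \<in> V" "\<And>t. t < r \<Longrightarrow> j t \<in> V" "\<And>t. t < r \<Longrightarrow> k t \<in> V"
    and tri: "\<And>t. t < r \<Longrightarrow> triangle nxt (i t) (j t) (k t)"
    and leg: "\<And>t. t < r \<Longrightarrow> leg (j t) = i (Suc t mod r)" "\<And>t. t < r \<Longrightarrow> leg (i (Suc t mod r)) = j t"
    and skew: "\<And>u v. S v u = - S u v"
    and unit: "\<And>u. u \<in> V \<Longrightarrow> S u (mate nxt leg L u) * S u (mate nxt leg L u) = 1"
    and Sk: "\<And>t. t < r \<Longrightarrow> \<not> L (k t) \<Longrightarrow> S (i t) (k t) * S (k t) (j t) = 1"
    and Sij: "\<And>t. t < r \<Longrightarrow> L (k t) \<Longrightarrow> S (i t) (j t) = -1"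
    and Sleg: "(\<Prod>t<r. S (j t) (i (Suc t mod r))) = -1"
  defines "L' \<equiv> \<lambda>v. L v \<noteq> (v \<in> i ` {..<r} \<union> j ` {..<r})"
  shows "leg_config V nxt leg L' \<and> (\<exists>p'. lists_matching M x (mate nxt leg L') p' \<and>
      pf_term M (\<lambda>i j. S (x i) (x j)) p * pf_term M (\<lambda>i j. S (x i) (x j)) p' = 1)"
proof -
  \<comment> \<open>In these triangles \<open>k t\<close> is matched inside the triangle, so the
    cycle has to pass through it.\<close>
  define A where "A = {t. t < r \<and> \<not> L (k t)}"
  have A: "A \<subseteq> {..<r}" by (auto simp: A_def)
  obtain c where c: "c permutes (i ` {..<r} \<union> j ` {..<r} \<union> k ` A)" "sign c = - ((-1) ^ card A)"
    "\<And>t. t \<in> A \<Longrightarrow> c (i t) = k t" "\<And>t. t < r \<Longrightarrow> t \<notin> A \<Longrightarrow> c (i t) = j t"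
    "\<And>t. t \<in> A \<Longrightarrow> c (k t) = j t" "\<And>t. t < r \<Longrightarrow> c (j t) = i (Suc t mod r)"
    using ring_permutation[OF r(1) inj dis A] by metis
  have ne: "i s \<noteq> j t" "i s \<noteq> k t" "j s \<noteq> k t" if "s < r" "t < r" for s t
    using dis that unfolding disjoint_iff by (metis imageI lessThan_iff)+
  have notH: "k t \<notin> i ` {..<r} \<union> j ` {..<r}" if "t < r" for t
  proof
    assume "k t \<in> i ` {..<r} \<union> j ` {..<r}"
    then obtain s where "s < r" "k t = i s \<or> k t = j s" by auto
    then show False using ne(2)[of s t] ne(3)[of s t] that by auto
  qed
  let ?R = "i ` {..<r} \<union> j ` {..<r} \<union> k ` {..<r}"
  have RV: "?R \<subseteq> V" using V by auto
  have cV: "c permutes V" by (rule permutes_subset[OF c(1)]) (use A RV in blast)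
  have ck: "c (k t) = k t" if "t < r" "t \<notin> A" for t
  proof (rule permutes_not_in[OF c(1)])
    have "k t \<notin> k ` A" using inj(3) that A by (auto simp: inj_on_def)
    then show "k t \<notin> i ` {..<r} \<union> j ` {..<r} \<union> k ` A" using notH[OF that(1)] by blast
  qed
  have cR: "c u = u" if "u \<notin> ?R" for u by (rule permutes_not_in[OF c(1)]) (use that A in blast)
  have L'_simps: "L' (i t) = (\<not> L (i t))" "L' (j t) = (\<not> L (j t))" "L' (k t) = L (k t)" if "t < r" for t
    using that notH[OF that] by (auto simp: L'_def)
  have L'R: "L' u = L u" if "u \<notin> ?R" for u using that by (auto simp: L'_def)
  have nxtR: "nxt u \<notin> ?R" if "u \<in> V" "u \<notin> ?R" for u
  proof
    assume "nxt u \<in> ?R"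
    then obtain t where t: "t < r" "nxt u = i t \<or> nxt u = j t \<or> nxt u = k t" by auto
    have "nxt (nxt (nxt u)) \<in> {i t, j t, k t}" using tri[OF t(1)] t(2) unfolding triangle_def by auto
    then have "u \<in> {i t, j t, k t}" using nxt(2)[OF that(1)] by simp
    then show False using that(2) t(1) by auto
  qed
  have par: "L (i t) \<longleftrightarrow> (L (j t) \<longleftrightarrow> L (k t))" if "t < r" for t
    by (rule leg_config_triangle[OF L V(1)[OF that] tri[OF that]])
  note tri' = tri triangle_rotate(1)[OF tri] triangle_rotate(2)[OF tri]
  have m: "mate nxt leg L (i t) = (if L (i t) then leg (i t) else if L (k t) then j t else k t)"
    "mate nxt leg L (j t) = (if L (j t) then leg (j t) else if L (k t) then i t else k t)"
    "mate nxt leg L (k t) = (if L (k t) then leg (k t) else if L (i t) then j t else i t)"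
    if "t < r" for t
    using par[OF that] mate_triangle[OF tri'(1)[OF that], of L leg] mate_triangle[OF tri'(2)[OF that], of L leg]
      mate_triangle[OF tri'(3)[OF that], of L leg] by presburger+
  have m': "mate nxt leg L' (i t) = (if L (i t) then if L (k t) then j t else k t else leg (i t))"
    "mate nxt leg L' (j t) = (if L (j t) then if L (k t) then i t else k t else leg (j t))"
    "mate nxt leg L' (k t) = (if L (k t) then leg (k t) else if L (i t) then i t else j t)"
    if "t < r" for t
    using par[OF that] mate_triangle[OF tri'(1)[OF that], of L' leg] mate_triangle[OF tri'(2)[OF that], of L' leg]
      mate_triangle[OF tri'(3)[OF that], of L' leg] unfolding L'_simps[OF that] by presburger+
  have Lleg: "leg v \<in> V" "leg (leg v) = v" "L (leg v)" if "v \<in> V" "L v" for v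
    using L that unfolding leg_config_def by blast+
  have pred: "\<exists>s<r. Suc s mod r = t" if "t < r" for t
  proof (cases t)
    case 0
    then show ?thesis using r(1) by (intro exI[of _ "r - 1"]) auto
  next
    case (Suc s)
    then show ?thesis using that by (intro exI[of _ s]) auto
  qed
  have Sr: "Suc s mod r < r" for s using r(1) by simp
  have leg_notin: "leg v \<notin> i ` {..<r} \<union> j ` {..<r}" if v: "v \<in> V" "L v" "v \<notin> i ` {..<r} \<union> j ` {..<r}" for v
  proof
    assume "leg v \<in> i ` {..<r} \<union> j ` {..<r}"
    then consider t where "t < r" "leg v = i t" | t where "t < r" "leg v = j t" by auto
    then have "leg (leg v) \<in> i ` {..<r} \<union> j ` {..<r}"
    proof cases
      case 1
      then obtain s where "s < r" "Suc s mod r = t" using pred by blast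
      then show ?thesis using leg(2)[of s] 1 by auto
    next
      case 2
      then show ?thesis using leg(1)[of t] Sr by auto
    qed
    then show False using Lleg(2)[OF v(1,2)] v(3) by simp
  qed
  have leg_fix: "c (leg v) = leg v" if v: "v \<in> V" "L v" "v \<notin> i ` {..<r} \<union> j ` {..<r}" for v
  proof (cases "leg v \<in> k ` {..<r}")
    case True
    then obtain s where s: "s < r" "leg v = k s" by auto
    then have "s \<notin> A" using Lleg(3)[OF v(1,2)] by (simp add: A_def)
    then show ?thesis using ck s by simp
  next
    case False
    then show ?thesis using leg_notin[OF v] by (intro cR) blast
  qed
  \<comment> \<open>The cycle carries the old matching to the new one, and moves a matched pair only
    along itself: the hypotheses of \<open>conjugate_matching\<close>.\<close>
  have main: "mate nxt leg L' (c u) = c (mate nxt leg L u) \<and>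
      (c u = u \<and> c (mate nxt leg L u) = mate nxt leg L u \<or> mate nxt leg L u = c u \<or> u = c (mate nxt leg L u))"
    if u: "u \<in> V" for u
  proof -
    consider t where "t < r" "u = i t" | t where "t < r" "u = j t" | t where "t < r" "u = k t" | "u \<notin> ?R" by auto
    then show ?thesis
    proof cases
      case (1 t)
      obtain s where s: "s < r" "Suc s mod r = t" using pred[OF 1(1)] by blast
      have l: "leg (i t) = j s" using leg(2)[OF s(1)] s(2) by simp
      have cs: "c (j s) = i t" using c(6)[OF s(1)] s(2) by simp
      show ?thesis
      proof (cases "L (k t)")
        case True
        then have tA: "t \<notin> A" by (simp add: A_def)
        show ?thesis unfolding 1(2) using True par[OF 1(1)] c(4)[OF 1(1) tA] l cs c(6)[OF 1(1)] leg(1)[OF 1(1)]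
          by (cases "L (i t)") (simp_all add: m[OF 1(1)] m'[OF 1(1)])
      next
        case False
        then have tA: "t \<in> A" using 1 by (simp add: A_def)
        show ?thesis unfolding 1(2) using False par[OF 1(1)] c(3,5)[OF tA] l cs c(6)[OF 1(1)] leg(1)[OF 1(1)]
          by (cases "L (i t)") (simp_all add: m[OF 1(1)] m'[OF 1(1)])
      qed
    next
      case (2 t)
      define s where "s = Suc t mod r"
      have s: "s < r" unfolding s_def by (rule Sr)
      have l: "leg (j t) = i s" "leg (i s) = j t" "c (j t) = i s" using leg[OF 2(1)] c(6)[OF 2(1)] unfolding s_def by auto
      have LL: "L (j t) \<longleftrightarrow> L (i s)" using Lleg(3)[OF V(2)[OF 2(1)]] Lleg(3)[OF V(1)[OF s]] l by metis
      have cj: "c (i s) = (if L (k s) then j s else k s)" using c(3)[of s] c(4)[OF s] s by (auto simp: A_def)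
      have ci: "c (i t) = (if L (k t) then j t else k t)" using c(3)[of t] c(4)[OF 2(1)] 2(1) by (auto simp: A_def)
      have ckt: "\<not> L (k t) \<Longrightarrow> c (k t) = j t" using c(5)[of t] 2(1) by (auto simp: A_def)
      show ?thesis unfolding 2(2) l(3) m(2)[OF 2(1)] m'(1)[OF s]
        using LL l cj ci ckt by auto
    next
      case (3 t)
      show ?thesis
      proof (cases "L (k t)")
        case True
        then have tA: "t \<notin> A" by (simp add: A_def)
        then show ?thesis unfolding 3(2) using True ck[OF 3(1) tA] leg_fix[OF V(3)[OF 3(1)] True notH[OF 3(1)]]
          by (simp add: m[OF 3(1)] m'[OF 3(1)])
      next
        case False
        then have tA: "t \<in> A" using 3 by (simp add: A_def)
        show ?thesis unfolding 3(2) using False par[OF 3(1)] c(3,5)[OF tA] c(6)[OF 3(1)] leg(1)[OF 3(1)]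
          by (cases "L (i t)") (simp_all add: m[OF 3(1)] m'[OF 3(1)])
      qed
    next
      case 4
      have n1: "nxt u \<notin> ?R" by (rule nxtR[OF u 4])
      have n2: "nxt (nxt u) \<notin> ?R" by (rule nxtR[OF nxt(1)[OF u] n1])
      have mm: "mate nxt leg L' u = mate nxt leg L u" unfolding mate_def L'R[OF 4] L'R[OF n1] ..
      have "c (mate nxt leg L u) = mate nxt leg L u"
        unfolding mate_def using leg_fix[OF u] 4 cR[OF n1] cR[OF n2] by auto
      then show ?thesis using mm cR[OF 4] by simp
    qed
  qed
  have conf: "leg_config V nxt leg L'"
    unfolding leg_config_def
  proof (intro ballI conjI impI)
    fix v assume v: "v \<in> V"
    show "L' v \<longleftrightarrow> (L' (nxt v) \<longleftrightarrow> L' (nxt (nxt v)))"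
    proof (cases "v \<in> ?R")
      case True
      then obtain t where t: "t < r" "v = i t \<or> v = j t \<or> v = k t" by auto
      then show ?thesis using tri[OF t(1)] par[OF t(1)] unfolding triangle_def
        by (elim disjE) (simp_all add: L'_simps[OF t(1)], blast+)
    next
      case False
      have n1: "nxt v \<notin> ?R" by (rule nxtR[OF v False])
      have n2: "nxt (nxt v) \<notin> ?R" by (rule nxtR[OF nxt(1)[OF v] n1])
      show ?thesis unfolding L'R[OF False] L'R[OF n1] L'R[OF n2] using L v unfolding leg_config_def by blast
    qed
    assume L'v: "L' v"
    have "leg v \<in> V \<and> leg (leg v) = v \<and> L' (leg v)"
    proof (cases "v \<in> i ` {..<r} \<union> j ` {..<r}")
      case True
      then consider t where "t < r" "v = i t" | t where "t < r" "v = j t" by auto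
      then show ?thesis
      proof cases
        case (1 t)
        obtain s where s: "s < r" "Suc s mod r = t" using pred[OF 1(1)] by blast
        have l: "leg (i t) = j s" "leg (j s) = i t" using leg[OF s(1)] s(2) by auto
        have "\<not> L (i t)" using L'v 1 L'_simps by simp
        then have "\<not> L (j s)" using Lleg(3)[OF V(2)[OF s(1)]] l by auto
        then show ?thesis using 1 l V(2)[OF s(1)] L'_simps(2)[OF s(1)] by simp
      next
        case (2 t)
        have l: "leg (j t) = i (Suc t mod r)" "leg (i (Suc t mod r)) = j t" using leg[OF 2(1)] by auto
        have "\<not> L (j t)" using L'v 2 L'_simps by simp
        then have "\<not> L (i (Suc t mod r))" using Lleg(3)[OF V(1)[OF Sr]] l by metis
        then show ?thesis using 2 l V(1)[OF Sr] L'_simps(1)[OF Sr] by simp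
      qed
    next
      case False
      then have Lv: "L v" using L'v by (simp add: L'_def)
      then show ?thesis using Lleg[OF v Lv] leg_notin[OF v Lv False] by (simp add: L'_def)
    qed
    then show "leg v \<in> V" "leg (leg v) = v" "L' (leg v)" by auto
  qed
  define G where "G v = (if c v = v then 1 else S v (c v))" for v
  obtain p' where p': "lists_matching M x (mate nxt leg L') p'"
    "pf_term M (\<lambda>i j. S (x i) (x j)) p * pf_term M (\<lambda>i j. S (x i) (x j)) p' = of_int (sign c) * (\<Prod>v\<in>V. G v)"
  proof -
    have "\<exists>p'. lists_matching M x (mate nxt leg L') p' \<and>
      pf_term M (\<lambda>i j. S (x i) (x j)) p * pf_term M (\<lambda>i j. S (x i) (x j)) p' = of_int (sign c) * (\<Prod>v\<in>V. G v)"
      unfolding G_def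
    proof (rule conjugate_matching[where \<mu> = "mate nxt leg L", OF x p cV])
      show "mate nxt leg L' (c u) = c (mate nxt leg L u)" if "u \<in> V" for u using main[OF that] by (rule conjunct1)
      show "c u = u \<and> c (mate nxt leg L u) = mate nxt leg L u \<or> mate nxt leg L u = c u \<or> u = c (mate nxt leg L u)"
        if "u \<in> V" for u using main[OF that] by (rule conjunct2)
    qed (fact skew unit)+
    then show thesis using that by blast
  qed
  have fV: "finite V" using bij_betw_finite[OF x] by simp
  have Gi: "G (i t) = (if t \<in> A then S (i t) (k t) else -1)" if "t < r" for t
    using c(3)[of t] c(4)[OF that] ne(1,2)[of t t] that Sij[OF that] by (auto simp: G_def A_def)
  have Gj: "G (j t) = S (j t) (i (Suc t mod r))" if "t < r" for t
    using c(6)[OF that] ne(1)[OF Sr that] by (simp add: G_def)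
  have Gk: "G (k t) = (if t \<in> A then S (k t) (j t) else 1)" if "t < r" for t
    using c(5)[of t] ck[OF that] ne(3)[of t t] that by (auto simp: G_def)
  have "(\<Prod>v\<in>V. G v) = (\<Prod>v\<in>?R. G v)"
    by (rule prod.mono_neutral_right[OF fV RV]) (simp add: G_def cR)
  also have "\<dots> = (\<Prod>v\<in>i ` {..<r} \<union> j ` {..<r}. G v) * (\<Prod>v\<in>k ` {..<r}. G v)"
    by (rule prod.union_disjoint) (use dis in auto)
  also have "(\<Prod>v\<in>i ` {..<r} \<union> j ` {..<r}. G v) = (\<Prod>v\<in>i ` {..<r}. G v) * (\<Prod>v\<in>j ` {..<r}. G v)"
    by (rule prod.union_disjoint) (use dis in auto)
  also have "(\<Prod>v\<in>i ` {..<r}. G v) * (\<Prod>v\<in>j ` {..<r}. G v) * (\<Prod>v\<in>k ` {..<r}. G v)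
      = (\<Prod>t<r. G (i t)) * (\<Prod>t<r. G (j t)) * (\<Prod>t<r. G (k t))"
    using inj by (simp add: prod.reindex)
  also have "(\<Prod>t<r. G (j t)) = -1" using Sleg Gj by simp
  also have "(\<Prod>t<r. G (i t)) * -1 * (\<Prod>t<r. G (k t)) = - (\<Prod>t<r. G (i t) * G (k t))"
    by (simp add: prod.distrib)
  \<comment> \<open>Triangle by triangle: a detour has two steps of product \<open>1\<close>, a
    direct passage one step of sign \<open>-1\<close>.\<close>
  also have "(\<Prod>t<r. G (i t) * G (k t)) = (\<Prod>t<r. if t \<in> A then 1 else -1)"
    by (rule prod.cong[OF refl]) (use Gi Gk Sk in \<open>auto simp: A_def\<close>)
  also have "\<dots> = (-1) ^ (r - card A)"
    using A by (simp add: prod.If_cases Int_absorb1 card_Diff_subset finite_subset[OF A] Diff_eq[symmetric])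
  finally have "of_int (sign c) * (\<Prod>v\<in>V. G v) = (-1 :: real) ^ card A * (-1) ^ (r - card A)"
    unfolding c(2) by simp
  also have "\<dots> = 1" using card_mono[OF _ A] r(2) by (simp flip: power_add)
  finally show ?thesis using p' conf by auto
qed

section \<open>Kasteleyn signs on the cylinder\<close>

primrec cnxt :: "vertex \<Rightarrow> vertex" where
  "cnxt (BetaV s x y) = BetaV (next_corner s) x y"
| "cnxt (OmegaV s x y) = OmegaV (next_corner s) x y"

text \<open>A total function; where \<open>has_leg\<close> fails its value is a dummy, in particular
  \<open>y - 1\<close> is truncated at the bottom row.\<close>

fun cleg :: "nat \<Rightarrow> vertex \<Rightarrow> vertex" where
  "cleg N (BetaV Ca x y) = OmegaV Ca x y"
| "cleg N (BetaV Cb x y) = OmegaV Cb ((x + 1) mod int N) y"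
| "cleg N (BetaV Cc x y) = OmegaV Cc x (y + 1)"
| "cleg N (OmegaV Ca x y) = BetaV Ca x y"
| "cleg N (OmegaV Cb x y) = BetaV Cb ((x - 1) mod int N) y"
| "cleg N (OmegaV Cc x y) = BetaV Cc x (y - 1)"

fun has_leg :: "nat \<Rightarrow> vertex \<Rightarrow> bool" where
  "has_leg m (BetaV Cc x y) = (y + 1 < m)"
| "has_leg m (OmegaV Cc x y) = (y \<ge> 1)"
| "has_leg m v = True"

primrec is_beta :: "vertex \<Rightarrow> bool" where
  "is_beta (BetaV s x y) = True"
| "is_beta (OmegaV s x y) = False"

lemma next_corner3 [simp]: "next_corner (next_corner (next_corner s)) = s"
  by (cases s) auto

lemma cnxt_simps [simp]: "cnxt (cnxt (cnxt v)) = v" "cnxt v \<noteq> v" "cnxt (cnxt v) \<noteq> v" "cnxt (cnxt v) \<noteq> cnxt v"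
    "is_beta (cnxt v) = is_beta v"
  by (cases v; simp add: next_corner_simps)+

lemma is_beta_cleg [simp]: "is_beta (cleg N v) = (\<not> is_beta v)"
proof (cases v)
  case (BetaV s x y) then show ?thesis by (cases s) auto
next
  case (OmegaV s x y) then show ?thesis by (cases s) auto
qed

lemma BetaV_in_cyl [simp]: "N > 0 \<Longrightarrow> BetaV s x y \<in> cyl_vertices m N \<longleftrightarrow> 0 \<le> x \<and> x < int N \<and> y < m"
  and OmegaV_in_cyl [simp]: "N > 0 \<Longrightarrow> OmegaV s x y \<in> cyl_vertices m N \<longleftrightarrow> 0 \<le> x \<and> x < int N \<and> y < m"
  by (auto simp: cyl_vertices_eq)

lemma cnxt_in_cyl [simp]: "N > 0 \<Longrightarrow> cnxt v \<in> cyl_vertices m N \<longleftrightarrow> v \<in> cyl_vertices m N"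
  by (cases v) auto

lemma mod_pred_succ: "0 \<le> (x :: int) \<Longrightarrow> x < k \<Longrightarrow> ((x + 1) mod k - 1) mod k = x"
    "0 \<le> x \<Longrightarrow> x < k \<Longrightarrow> ((x - 1) mod k + 1) mod k = x"
  by (simp_all add: mod_diff_left_eq mod_add_left_eq)

lemma cleg_in_cyl:
  assumes "N > 0" "v \<in> cyl_vertices m N" "has_leg m v"
  shows "cleg N v \<in> cyl_vertices m N" "has_leg m (cleg N v)" "cleg N (cleg N v) = v"
proof -
  have "cleg N v \<in> cyl_vertices m N \<and> has_leg m (cleg N v) \<and> cleg N (cleg N v) = v"
  proof (cases v)
    case (BetaV s x y) then show ?thesis using assms by (cases s) (auto simp: mod_pred_succ)
  next
    case (OmegaV s x y) then show ?thesis using assms by (cases s) (auto simp: mod_pred_succ)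
  qed
  then show "cleg N v \<in> cyl_vertices m N" "has_leg m (cleg N v)" "cleg N (cleg N v) = v" by auto
qed

lemma cyl_arcs_iff:
  assumes "N > 0"
  shows "(u, v) \<in> cyl_arcs m N \<longleftrightarrow> u \<in> cyl_vertices m N \<and> (v = cnxt u \<or> is_beta u \<and> has_leg m u \<and> v = cleg N u)"
proof
  assume "(u, v) \<in> cyl_arcs m N"
  then show "u \<in> cyl_vertices m N \<and> (v = cnxt u \<or> is_beta u \<and> has_leg m u \<and> v = cleg N u)"
    using assms unfolding cyl_arcs_def band_arcs_def by (auto simp: mod_add_left_eq)
next
  assume R: "u \<in> cyl_vertices m N \<and> (v = cnxt u \<or> is_beta u \<and> has_leg m u \<and> v = cleg N u)"
  have "\<exists>v'. (u, v') \<in> band_arcs m \<and> reduce N v' = v \<and> reduce N u = u"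
  proof (cases u)
    case (BetaV s x y)
    consider "v = cnxt u" | "has_leg m u" "v = cleg N u" using R by blast
    then show ?thesis
    proof cases
      case 1
      then show ?thesis using R BetaV assms by (intro exI[of _ "cnxt u"]) (auto simp: band_arcs_def)
    next
      case 2
      then show ?thesis using R BetaV assms
        by (intro exI[of _ "case s of Ca \<Rightarrow> OmegaV Ca x y | Cb \<Rightarrow> OmegaV Cb (x + 1) y | Cc \<Rightarrow> OmegaV Cc x (y + 1)"];
            cases s) (auto simp: band_arcs_def)
    qed
  next
    case (OmegaV s x y)
    then show ?thesis using R assms by (intro exI[of _ "cnxt u"]) (auto simp: band_arcs_def)
  qed
  then show "(u, v) \<in> cyl_arcs m N" unfolding cyl_arcs_def by (force simp: image_iff)
qed

lemma cyl_arcs_asym: "N > 0 \<Longrightarrow> (u, v) \<in> cyl_arcs m N \<Longrightarrow> (v, u) \<notin> cyl_arcs m N"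
  unfolding cyl_arcs_iff by (metis cnxt_simps(3,5) is_beta_cleg)

text \<open>The Kasteleyn matrix at \<open>z = -1\<close> stripped of its weights. Since the inverse
  of \<open>-1\<close> is \<open>-1\<close>, a reversed \<open>z\<close>-arc has sign
  \<open>1\<close>.\<close>

definition kast_sign :: "nat \<Rightarrow> nat \<Rightarrow> vertex \<Rightarrow> vertex \<Rightarrow> real" where
  "kast_sign m N u v =
     (if (u, v) \<in> cyl_arcs m N then if (u, v) \<in> z_arcs m N then -1 else 1
      else if (v, u) \<in> cyl_arcs m N then if (v, u) \<in> z_arcs m N then 1 else -1 else 0)"

lemma kast_entry_sign: "kast_entry m N W (-1) u v = kast_sign m N u v * cyl_weight m N W {u, v}"
  by (auto simp: kast_entry_def kast_sign_def insert_commute)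

lemma kast_sign_skew: "N > 0 \<Longrightarrow> kast_sign m N v u = - kast_sign m N u v"
  using cyl_arcs_asym[of N u v m] cyl_arcs_asym[of N v u m] unfolding kast_sign_def by auto

lemma kast_sign_cnxt:
  assumes "N > 0" "u \<in> cyl_vertices m N"
  shows "kast_sign m N u (cnxt u) = 1" "kast_sign m N (cnxt u) u = -1"
proof -
  have "(u, cnxt u) \<notin> z_arcs m N" by (cases u) (auto simp: z_arcs_def)
  then show 1: "kast_sign m N u (cnxt u) = 1" using assms by (simp add: kast_sign_def cyl_arcs_iff)
  then show "kast_sign m N (cnxt u) u = -1" using kast_sign_skew[OF assms(1), of m "cnxt u" u] by simp
qed

lemma kast_sign_cleg:
  assumes "N > 1" "u \<in> cyl_vertices m N" "has_leg m u" "is_beta u"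
  shows "kast_sign m N u (cleg N u) = (if \<exists>y. u = BetaV Cb (int N - 1) y then -1 else 1)"
    "kast_sign m N (cleg N u) u = - (if \<exists>y. u = BetaV Cb (int N - 1) y then -1 else 1)"
proof -
  have "(u, cleg N u) \<in> z_arcs m N \<longleftrightarrow> (\<exists>y. u = BetaV Cb (int N - 1) y)"
    using assms by (auto simp: z_arcs_def)
  then show 1: "kast_sign m N u (cleg N u) = (if \<exists>y. u = BetaV Cb (int N - 1) y then -1 else 1)"
    using assms by (simp add: kast_sign_def cyl_arcs_iff)
  show "kast_sign m N (cleg N u) u = - (if \<exists>y. u = BetaV Cb (int N - 1) y then -1 else 1)"
    using assms(1) 1 by (subst kast_sign_skew) simp_all
qed

section \<open>Leg configurations on the cylinder and their flips\<close>

abbreviation "cyl_config m N \<equiv> leg_config (cyl_vertices m N) cnxt (cleg N)"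
abbreviation "cyl_mate N \<equiv> mate cnxt (cleg N)"

text \<open>The dummy values of \<open>cleg\<close> are excluded by \<open>leg_config\<close>
  itself: at the top row they lie outside the cylinder, and at the bottom row applying
  \<open>cleg\<close> twice ends one row higher.\<close>

lemma cyl_config_has_leg:
  assumes "N > 0" "cyl_config m N L" "v \<in> cyl_vertices m N" "L v"
  shows "has_leg m v"
proof -
  have "cleg N v \<in> cyl_vertices m N" "cleg N (cleg N v) = v"
    using assms unfolding leg_config_def by blast+
  then show ?thesis using assms(1) by (cases "(m, v)" rule: has_leg.cases) auto
qed

lemma kast_sign_unit:
  assumes "N > 1" "cyl_config m N L" "v \<in> cyl_vertices m N"
  shows "kast_sign m N v (cyl_mate N L v) * kast_sign m N v (cyl_mate N L v) = 1"
proof -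
  have N0: "N > 0" using assms by simp
  have c2: "kast_sign m N v (cnxt (cnxt v)) = -1"
    using kast_sign_cnxt(2)[OF N0, of "cnxt (cnxt v)" m] assms N0 by simp
  show ?thesis
  proof (cases "L v")
    case True
    have h: "has_leg m v" by (rule cyl_config_has_leg[OF N0 assms(2,3) True])
    note l = cleg_in_cyl[OF N0 assms(3) h]
    have "kast_sign m N v (cleg N v) = 1 \<or> kast_sign m N v (cleg N v) = -1"
    proof (cases "is_beta v")
      case True
      then show ?thesis using kast_sign_cleg(1)[OF assms(1,3) h] by auto
    next
      case False
      then show ?thesis using kast_sign_cleg(2)[OF assms(1) l(1,2)] l(3) by auto
    qed
    then show ?thesis using True by (auto simp: mate_def)
  next
    case False
    then show ?thesis using c2 kast_sign_cnxt(1)[OF N0 assms(3)] by (simp add: mate_def)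
  qed
qed

lemma triangle_cnxt:
  "triangle cnxt (BetaV s x y) (BetaV s' x y) (BetaV s'' x y) \<longleftrightarrow> s \<noteq> s' \<and> s \<noteq> s'' \<and> s' \<noteq> s''"
  "triangle cnxt (OmegaV s x y) (OmegaV s' x y) (OmegaV s'' x y) \<longleftrightarrow> s \<noteq> s' \<and> s \<noteq> s'' \<and> s' \<noteq> s''"
  by (cases s; cases s'; cases s''; simp add: triangle_def)+

lemma kast_sign_corner:
  assumes "N > 0" "0 \<le> x" "x < int N" "y < m"
  shows "kast_sign m N (BetaV s x y) (BetaV s' x y) = (if s' = s then 0 else if s' = next_corner s then 1 else -1)"
    "kast_sign m N (OmegaV s x y) (OmegaV s' x y) = (if s' = s then 0 else if s' = next_corner s then 1 else -1)"
proof -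
  have z: "kast_sign m N v v = 0" for v using kast_sign_skew[OF assms(1), of m v v] by simp
  have B: "BetaV t x y \<in> cyl_vertices m N" "OmegaV t x y \<in> cyl_vertices m N" for t using assms by auto
  note k = kast_sign_cnxt[OF assms(1) B(1), simplified] kast_sign_cnxt[OF assms(1) B(2), simplified]
  show "kast_sign m N (BetaV s x y) (BetaV s' x y) = (if s' = s then 0 else if s' = next_corner s then 1 else -1)"
    using z k(1)[of s] k(2)[of s'] by (cases s; cases s') simp_all
  show "kast_sign m N (OmegaV s x y) (OmegaV s' x y) = (if s' = s then 0 else if s' = next_corner s then 1 else -1)"
    using z k(3)[of s] k(4)[of s'] by (cases s; cases s') simp_all
qed

lemma pf_term_kast_sign_square:
  assumes N: "N > 1" and x: "bij_betw x {0..<2 * M} (cyl_vertices m N)"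
    and L: "cyl_config m N L" and p: "lists_matching M x (cyl_mate N L) p"
  shows "(pf_term M (\<lambda>i j. kast_sign m N (x i) (x j)) p)\<^sup>2 = 1"
proof -
  have "(\<Prod>i<M. kast_sign m N (x (p (2 * i))) (x (p (2 * i + 1))) * kast_sign m N (x (p (2 * i))) (x (p (2 * i + 1)))) = 1"
  proof (rule prod.neutral, rule ballI)
    fix i assume "i \<in> {..<M}"
    then have i: "i < M" by simp
    have "p (2 * i) < 2 * M" using p permutes_in_image[of p "{0..<2 * M}" "2 * i"] i by (auto simp: lists_matching_def)
    then have "x (p (2 * i)) \<in> cyl_vertices m N" using x by (auto simp: bij_betw_def)
    moreover have "x (p (2 * i + 1)) = cyl_mate N L (x (p (2 * i)))" using p i by (simp add: lists_matching_def)
    ultimately show "kast_sign m N (x (p (2 * i))) (x (p (2 * i + 1))) * kast_sign m N (x (p (2 * i))) (x (p (2 * i + 1))) = 1"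
      using kast_sign_unit[OF N L] by simp
  qed
  then have "(\<Prod>i<M. kast_sign m N (x (p (2 * i))) (x (p (2 * i + 1))))\<^sup>2 = 1"
    by (simp add: power2_eq_square prod.distrib)
  then show ?thesis by (simp add: pf_term_def power_mult_distrib flip: of_int_power) (simp add: power2_eq_square)
qed

lemma real_unit_inverse: "(a :: real)\<^sup>2 = 1 \<Longrightarrow> a * b = 1 \<Longrightarrow> b = a"
  by (auto simp: power2_eq_1_iff)

text \<open>Detours are harmless, since both steps through \<open>k t\<close> run with the
  orientation of the triangle or both against it. Only the signs of direct edges and of the legs
  remain to be checked for a concrete ring. Both signed terms are \<open>1\<close> or
  \<open>-1\<close>, so product \<open>1\<close> means equality.\<close>

lemma cyl_ring_flip:
  fixes i j k :: "nat \<Rightarrow> vertex"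
  assumes N: "N > 1" and x: "bij_betw x {0..<2 * M} (cyl_vertices m N)" and p: "lists_matching M x (cyl_mate N L) p"
    and L: "cyl_config m N L"
    and r: "r > 0" "even r" and inj: "inj_on i {..<r}" "inj_on j {..<r}" "inj_on k {..<r}"
    and dis: "i ` {..<r} \<inter> j ` {..<r} = {}" "i ` {..<r} \<inter> k ` {..<r} = {}" "j ` {..<r} \<inter> k ` {..<r} = {}"
    and V: "\<And>t. t < r \<Longrightarrow> i t \<in> cyl_vertices m N"
    and tri: "\<And>t. t < r \<Longrightarrow> triangle cnxt (i t) (j t) (k t)"
    and leg: "\<And>t. t < r \<Longrightarrow> cleg N (j t) = i (Suc t mod r)" "\<And>t. t < r \<Longrightarrow> has_leg m (j t)"
    and Sij: "\<And>t. t < r \<Longrightarrow> L (k t) \<Longrightarrow> kast_sign m N (i t) (j t) = -1"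
    and Sleg: "(\<Prod>t<r. kast_sign m N (j t) (i (Suc t mod r))) = -1"
  shows "cyl_config m N (\<lambda>v. L v \<noteq> (v \<in> i ` {..<r} \<union> j ` {..<r})) \<and>
    (\<exists>p'. lists_matching M x (cyl_mate N (\<lambda>v. L v \<noteq> (v \<in> i ` {..<r} \<union> j ` {..<r}))) p' \<and>
      pf_term M (\<lambda>i j. kast_sign m N (x i) (x j)) p' = pf_term M (\<lambda>i j. kast_sign m N (x i) (x j)) p)"
proof -
  have N0: "N > 0" using N by simp
  have V': "j t \<in> cyl_vertices m N" "k t \<in> cyl_vertices m N" if "t < r" for t
    using tri[OF that] V[OF that] N0 unfolding triangle_def by (metis cnxt_in_cyl)+
  have Sk: "kast_sign m N (i t) (k t) * kast_sign m N (k t) (j t) = 1" if t: "t < r" for t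
  proof -
    consider "k t = cnxt (j t)" "i t = cnxt (k t)" | "k t = cnxt (i t)" "j t = cnxt (k t)"
      using tri[OF t] unfolding triangle_def by metis
    then show ?thesis
    proof cases
      case 1
      then show ?thesis using kast_sign_cnxt(2)[OF N0 V'(1)[OF t]] kast_sign_cnxt(2)[OF N0 V'(2)[OF t]] by simp
    next
      case 2
      then show ?thesis using kast_sign_cnxt(1)[OF N0 V[OF t]] kast_sign_cnxt(1)[OF N0 V'(2)[OF t]] by simp
    qed
  qed
  have leg': "cleg N (i (Suc t mod r)) = j t" if "t < r" for t
    using cleg_in_cyl(3)[OF N0 V'(1)[OF that] leg(2)[OF that]] leg(1)[OF that] by simp
  note unit = kast_sign_unit[OF N L]
  obtain p' where p': "cyl_config m N (\<lambda>v. L v \<noteq> (v \<in> i ` {..<r} \<union> j ` {..<r}))"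
    "lists_matching M x (cyl_mate N (\<lambda>v. L v \<noteq> (v \<in> i ` {..<r} \<union> j ` {..<r}))) p'"
    "pf_term M (\<lambda>i j. kast_sign m N (x i) (x j)) p * pf_term M (\<lambda>i j. kast_sign m N (x i) (x j)) p' = 1"
    using ring_flip[where S = "kast_sign m N" and nxt = cnxt and leg = "cleg N" and V = "cyl_vertices m N",
        OF x p _ _ L r inj dis V V' tri leg(1) leg' kast_sign_skew[OF N0] unit Sk Sij Sleg] N0
    by auto
  have "pf_term M (\<lambda>i j. kast_sign m N (x i) (x j)) p' = pf_term M (\<lambda>i j. kast_sign m N (x i) (x j)) p"
    using pf_term_kast_sign_square[OF N x L p] p'(3) by (rule real_unit_inverse)
  then show ?thesis using p' by blast
qed

text \<open>\<open>I\<close> and \<open>O'\<close> are the rows in which the \<open>b\<close>-leg entering, respectively leaving, a column is occupied;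
  \<open>par I O' y\<close> tells whether the \<open>c\<close>-leg between the rows \<open>y - 1\<close> and \<open>y\<close> is occupied.\<close>

primrec par :: "nat set \<Rightarrow> nat set \<Rightarrow> nat \<Rightarrow> bool" where
  "par I O' 0 = False"
| "par I O' (Suc y) = ((par I O' y \<noteq> (y \<in> I)) \<noteq> (y \<in> O'))"

text \<open>The only candidate for a configuration with the given occupied \<open>b\<close>-legs:
  read upwards in a column, the parity condition at each triangle determines the
  \<open>a\<close>-leg and then the next \<open>c\<close>-leg.\<close>

fun cfg :: "nat \<Rightarrow> (int \<Rightarrow> nat set) \<Rightarrow> vertex \<Rightarrow> bool" where
  "cfg N s (BetaV Ca x y) = ((y \<in> s ((x - 1) mod int N)) = par (s ((x - 1) mod int N)) (s x) y)"
| "cfg N s (BetaV Cb x y) = (y \<in> s x)"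
| "cfg N s (BetaV Cc x y) = par (s ((x - 1) mod int N)) (s x) (Suc y)"
| "cfg N s (OmegaV Ca x y) = ((y \<in> s ((x - 1) mod int N)) = par (s ((x - 1) mod int N)) (s x) y)"
| "cfg N s (OmegaV Cb x y) = (y \<in> s ((x - 1) mod int N))"
| "cfg N s (OmegaV Cc x y) = par (s ((x - 1) mod int N)) (s x) y"

definition out_state :: "nat \<Rightarrow> (vertex \<Rightarrow> bool) \<Rightarrow> int \<Rightarrow> nat set" where
  "out_state m L x = {y. y < m \<and> L (BetaV Cb x y)}"

text \<open>\<open>par\<close> at height \<open>m\<close> would be an occupied \<open>c\<close>-leg
  leaving the top row, where there is no such edge.\<close>

definition compatible :: "nat \<Rightarrow> nat \<Rightarrow> (int \<Rightarrow> nat set) \<Rightarrow> bool" where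
  "compatible m N s \<longleftrightarrow> (\<forall>x\<in>{0..<int N}. \<not> par (s ((x - 1) mod int N)) (s x) m)"

lemma cyl_configD:
  assumes "N > 0" "cyl_config m N L"
  shows "v \<in> cyl_vertices m N \<Longrightarrow> has_leg m v \<Longrightarrow> L (cleg N v) = L v"
    and "v \<in> cyl_vertices m N \<Longrightarrow> L v = (L (cnxt v) = L (cnxt (cnxt v)))"
proof -
  have *: "L v \<Longrightarrow> L (cleg N v)" if "v \<in> cyl_vertices m N" for v
    using assms that unfolding leg_config_def by blast
  show "L (cleg N v) = L v" if v: "v \<in> cyl_vertices m N" "has_leg m v"
    using *[OF v(1)] *[OF cleg_in_cyl(1)[OF assms(1) v]] cleg_in_cyl(3)[OF assms(1) v] by auto
  show "v \<in> cyl_vertices m N \<Longrightarrow> L v = (L (cnxt v) = L (cnxt (cnxt v)))"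
    using assms unfolding leg_config_def by blast
qed

text \<open>Induction on the row. At the omega triangle the entering \<open>b\<close>-leg and the
  \<open>c\<close>-leg from below force the \<open>a\<close>-leg; at the beta triangle this and the
  leaving \<open>b\<close>-leg force the \<open>c\<close>-leg above.\<close>

lemma config_column:
  assumes N: "N > 0" and L: "cyl_config m N L" and x: "0 \<le> x" "x < int N"
  defines "I \<equiv> out_state m L ((x - 1) mod int N)" and "O' \<equiv> out_state m L x"
  shows "y < m \<Longrightarrow> L (OmegaV Cb x y) = (y \<in> I) \<and> L (OmegaV Cc x y) = par I O' y \<and>
      L (OmegaV Ca x y) = ((y \<in> I) = par I O' y) \<and> L (BetaV Ca x y) = ((y \<in> I) = par I O' y) \<and>
      L (BetaV Cc x y) = par I O' (Suc y)"
proof -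
  note D = cyl_configD[OF N L]
  have common: "L (OmegaV Cb x y) = (y \<in> I) \<and> L (OmegaV Cc x y) = par I O' y \<and>
      L (OmegaV Ca x y) = ((y \<in> I) = par I O' y) \<and> L (BetaV Ca x y) = ((y \<in> I) = par I O' y) \<and>
      L (BetaV Cc x y) = par I O' (Suc y)" if y: "y < m" and oc: "L (OmegaV Cc x y) = par I O' y" for y
  proof -
    have ob: "L (OmegaV Cb x y) = (y \<in> I)"
      using D(1)[of "OmegaV Cb x y"] N x y by (simp add: I_def out_state_def)
    have oa: "L (OmegaV Ca x y) = ((y \<in> I) = par I O' y)"
      using D(2)[of "OmegaV Ca x y"] N x y ob oc by simp
    have ba: "L (BetaV Ca x y) = ((y \<in> I) = par I O' y)"
      using D(1)[of "BetaV Ca x y"] N x y oa by simp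
    have "L (BetaV Cb x y) = (y \<in> O')" using y by (simp add: O'_def out_state_def)
    then have "L (BetaV Cc x y) = par I O' (Suc y)"
      using D(2)[of "BetaV Cc x y"] N x y ba by auto
    then show ?thesis using ob oc oa ba by blast
  qed
  show "y < m \<Longrightarrow> L (OmegaV Cb x y) = (y \<in> I) \<and> L (OmegaV Cc x y) = par I O' y \<and>
      L (OmegaV Ca x y) = ((y \<in> I) = par I O' y) \<and> L (BetaV Ca x y) = ((y \<in> I) = par I O' y) \<and>
      L (BetaV Cc x y) = par I O' (Suc y)"
  proof (induction y)
    case 0
    have "\<not> L (OmegaV Cc x 0)" using cyl_config_has_leg[OF N L, of "OmegaV Cc x 0"] N x 0 by auto
    then show ?case using 0 by (intro common) auto
  next
    case (Suc y)
    have "L (OmegaV Cc x (Suc y)) = L (BetaV Cc x y)"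
      using D(1)[of "BetaV Cc x y"] N x Suc.prems by simp
    also have "\<dots> = par I O' (Suc y)" using Suc by simp
    finally show ?case using Suc.prems by (intro common) auto
  qed
qed

lemma out_state_compatible:
  assumes N: "N > 0" and L: "cyl_config m N L"
  shows "compatible m N (out_state m L)"
  unfolding compatible_def
proof
  fix x assume x: "x \<in> {0..<int N}"
  show "\<not> par (out_state m L ((x - 1) mod int N)) (out_state m L x) m"
  proof (cases m)
    case (Suc k)
    have "\<not> L (BetaV Cc x k)" using cyl_config_has_leg[OF N L, of "BetaV Cc x k"] N x Suc by auto
    then show ?thesis using config_column[OF N L, of x k] x Suc by auto
  qed simp
qed

lemma config_eq_cfg:
  assumes N: "N > 0" and L: "cyl_config m N L" and v: "v \<in> cyl_vertices m N"
  shows "L v = cfg N (out_state m L) v"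
proof (cases v)
  case (BetaV s x y)
  then show ?thesis using config_column[OF N L, of x y] v N by (cases s) (auto simp: out_state_def)
next
  case (OmegaV s x y)
  then show ?thesis using config_column[OF N L, of x y] v N by (cases s) auto
qed

lemma cfg_config:
  assumes N: "N > 0" and s: "compatible m N s"
  shows "cyl_config m N (cfg N s)"
  unfolding leg_config_def
proof
  fix v assume v: "v \<in> cyl_vertices m N"
  have par: "\<not> par (s ((x - 1) mod int N)) (s x) m" if "0 \<le> x" "x < int N" for x
    using s that unfolding compatible_def by auto
  have h: "has_leg m v" if cv: "cfg N s v"
  proof (cases "(m, v)" rule: has_leg.cases)
    case (1 m' x y)
    then have "y < m" "0 \<le> x" "x < int N" "par (s ((x - 1) mod int N)) (s x) (Suc y)" using v N cv by auto
    then have "Suc y \<noteq> m" using par[of x] by metis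
    then show ?thesis using 1 \<open>y < m\<close> by simp
  next
    case (2 m' x y)
    then show ?thesis using cv by (cases y) auto
  qed auto
  have l: "cfg N s (cleg N v) = cfg N s v" if hl: "has_leg m v"
  proof (cases "\<exists>x y. v = OmegaV Cc x y")
    case True
    then obtain x y where "v = OmegaV Cc x y" by blast
    then show ?thesis using hl by (cases y) auto
  next
    case False
    then show ?thesis using v N by (cases "(N, v)" rule: cleg.cases) (auto simp: mod_pred_succ)
  qed
  have "cfg N s v = (cfg N s (cnxt v) = cfg N s (cnxt (cnxt v)))"
    by (cases "(N, v)" rule: cleg.cases) auto
  then show "(cfg N s v \<longrightarrow> cleg N v \<in> cyl_vertices m N \<and> cleg N (cleg N v) = v \<and> cfg N s (cleg N v)) \<and>
      cfg N s v = (cfg N s (cnxt v) = cfg N s (cnxt (cnxt v)))"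
    using h l cleg_in_cyl[OF N v] by blast
qed

lemma mate_cong:
  assumes "N > 0" "\<And>v. v \<in> cyl_vertices m N \<Longrightarrow> L v = L' v" "v \<in> cyl_vertices m N"
  shows "cyl_mate N L v = cyl_mate N L' v"
  using assms by (simp add: mate_def)

lemma lists_mate_cong:
  assumes N: "N > 0" and x: "bij_betw x {0..<2 * M} (cyl_vertices m N)"
    and eq: "\<And>v. v \<in> cyl_vertices m N \<Longrightarrow> L v = L' v" and p: "lists_matching M x (cyl_mate N L) p"
  shows "lists_matching M x (cyl_mate N L') p"
  unfolding lists_matching_def
proof (intro conjI allI impI)
  show pp: "p permutes {0..<2 * M}" using p by (simp add: lists_matching_def)
  fix i assume i: "i < M"
  have "p (2 * i) < 2 * M" using permutes_in_image[OF pp, of "2 * i"] i by simp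
  then have "x (p (2 * i)) \<in> cyl_vertices m N" using x by (auto simp: bij_betw_def)
  then show "x (p (2 * i + 1)) = cyl_mate N L' (x (p (2 * i)))"
    using p i mate_cong[OF N eq] by (simp add: lists_matching_def)
qed

section \<open>Hexagon flips and the flip around the cylinder\<close>

lemma nth_image_lessThan: "length xs = r \<Longrightarrow> (\<lambda>t. xs ! t) ` {..<r} = set xs"
  by (auto simp: set_conv_nth)

lemma all_less_6: "(\<forall>t<6. P t) \<longleftrightarrow> P 0 \<and> P 1 \<and> P 2 \<and> P 3 \<and> P 4 \<and> P (5::nat)"
  by (simp add: eval_nat_numeral All_less_Suc conj_ac)

lemma prod_less_6: "(\<Prod>t<6. f t) = f 0 * f 1 * f 2 * f 3 * f 4 * (f (5::nat) :: real)"
  by (simp add: eval_nat_numeral)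

text \<open>The six triangles around a hexagon form a ring. It contains two \<open>b\<close>-legs
  between the same two columns, traversed in opposite senses; either both or none is a
  \<open>z\<close>-edge, so the extra factor cancels.\<close>

lemma hexagon_flip:
  assumes N: "N > 1" and x: "bij_betw x {0..<2 * M} (cyl_vertices m N)" and p: "lists_matching M x (cyl_mate N L) p"
    and L: "cyl_config m N L" and c: "0 \<le> c" "c < int N" and y: "Suc y < m"
  shows "\<exists>L' p'. cyl_config m N L' \<and> lists_matching M x (cyl_mate N L') p' \<and>
      pf_term M (\<lambda>i j. kast_sign m N (x i) (x j)) p' = pf_term M (\<lambda>i j. kast_sign m N (x i) (x j)) p \<and>
      (\<forall>x' y'. L' (BetaV Cb x' y') = (L (BetaV Cb x' y') \<noteq> (x' = c \<and> (y' = y \<or> y' = Suc y))))"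
proof -
  define d where "d = (c + 1) mod int N"
  have d: "0 \<le> d" "d < int N" "d \<noteq> c" "(d - 1) mod int N = c"
  proof -
    show "0 \<le> d" "d < int N" using N by (auto simp: d_def)
    show "(d - 1) mod int N = c" unfolding d_def using c by (rule mod_pred_succ)
    show "d \<noteq> c" unfolding d_def using c N by (cases "c + 1 = int N") auto
  qed
  \<comment> \<open>Entry, exit and third vertex of the six triangles. The ring is run through in
    the sense in which every direct edge from entry to exit goes against its orientation, as the
    condition \<open>Sij\<close> demands.\<close>
  define iv jv kv where
    "iv = [BetaV Cc c y, OmegaV Cb d y, BetaV Ca d y, OmegaV Cc d (Suc y), BetaV Cb c (Suc y), OmegaV Ca c (Suc y)]"
    and "jv = [BetaV Cb c y, OmegaV Ca d y, BetaV Cc d y, OmegaV Cb d (Suc y), BetaV Ca c (Suc y), OmegaV Cc c (Suc y)]"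
    and "kv = [BetaV Ca c y, OmegaV Cc d y, BetaV Cb d y, OmegaV Ca d (Suc y), BetaV Cc c (Suc y), OmegaV Cb c (Suc y)]"
  have len: "length iv = 6" "length jv = 6" "length kv = 6" by (auto simp: iv_def jv_def kv_def)
  have dist: "distinct iv" "distinct jv" "distinct kv" using d(3) by (auto simp: iv_def jv_def kv_def)
  note im = nth_image_lessThan[OF len(1)] nth_image_lessThan[OF len(2)] nth_image_lessThan[OF len(3)]
  have inj: "inj_on (\<lambda>t. iv ! t) {..<6}" "inj_on (\<lambda>t. jv ! t) {..<6}" "inj_on (\<lambda>t. kv ! t) {..<6}"
    using dist len by (auto intro!: inj_on_nth)
  have dis: "(\<lambda>t. iv ! t) ` {..<6} \<inter> (\<lambda>t. jv ! t) ` {..<6} = {}" "(\<lambda>t. iv ! t) ` {..<6} \<inter> (\<lambda>t. kv ! t) ` {..<6} = {}"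
    "(\<lambda>t. jv ! t) ` {..<6} \<inter> (\<lambda>t. kv ! t) ` {..<6} = {}"
    unfolding im using d(3) by (auto simp: iv_def jv_def kv_def)
  have N0: "N > 0" using N by simp
  have a1: "\<forall>t<6. iv ! t \<in> cyl_vertices m N"
    unfolding all_less_6 using c d y N0 by (simp add: iv_def)
  have a2: "\<forall>t<6. triangle cnxt (iv ! t) (jv ! t) (kv ! t)"
    unfolding all_less_6 by (simp add: iv_def jv_def kv_def triangle_cnxt)
  have a3: "\<forall>t<6. cleg N (jv ! t) = iv ! (Suc t mod 6) \<and> has_leg m (jv ! t)"
    unfolding all_less_6 using d(4) y by (simp add: iv_def jv_def d_def[symmetric])
  have a4: "\<forall>t<6. kast_sign m N (iv ! t) (jv ! t) = -1"
    unfolding all_less_6 using c d y N0 by (simp add: iv_def jv_def kast_sign_corner)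
  have V: "BetaV s c y \<in> cyl_vertices m N" "BetaV s c (Suc y) \<in> cyl_vertices m N"
     "BetaV s d y \<in> cyl_vertices m N" "BetaV s d (Suc y) \<in> cyl_vertices m N" for s
    using c d y N0 by auto
  \<comment> \<open>The sign of a \<open>z\<close>-edge, present when the hexagon straddles the cut
    of the cylinder.\<close>
  let ?\<zeta> = "if c = int N - 1 then -1 else 1 :: real"
  have k: "kast_sign m N (BetaV Cb c y) (OmegaV Cb d y) = ?\<zeta>"
    "kast_sign m N (OmegaV Ca d y) (BetaV Ca d y) = -1"
    "kast_sign m N (BetaV Cc d y) (OmegaV Cc d (Suc y)) = 1"
    "kast_sign m N (OmegaV Cb d (Suc y)) (BetaV Cb c (Suc y)) = - ?\<zeta>"
    "kast_sign m N (BetaV Ca c (Suc y)) (OmegaV Ca c (Suc y)) = 1"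
    "kast_sign m N (OmegaV Cc c (Suc y)) (BetaV Cc c y) = -1"
    using kast_sign_cleg[OF N V(1), of Cb] kast_sign_cleg[OF N V(3), of Ca] kast_sign_cleg[OF N V(3), of Cc]
      kast_sign_cleg[OF N V(2), of Cb] kast_sign_cleg[OF N V(2), of Ca] kast_sign_cleg[OF N V(1), of Cc] y
    by (simp_all add: d_def)
  have "(\<Prod>t<6. kast_sign m N (jv ! t) (iv ! (Suc t mod 6))) =
      ?\<zeta> * -1 * 1 * (- ?\<zeta>) * 1 * -1"
    by (simp add: prod_less_6 iv_def jv_def k)
  then have a5: "(\<Prod>t<6. kast_sign m N (jv ! t) (iv ! (Suc t mod 6))) = -1" by auto
  obtain p' where "cyl_config m N (\<lambda>v. L v \<noteq> (v \<in> set iv \<union> set jv))"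
    "lists_matching M x (cyl_mate N (\<lambda>v. L v \<noteq> (v \<in> set iv \<union> set jv))) p'"
    "pf_term M (\<lambda>i j. kast_sign m N (x i) (x j)) p' = pf_term M (\<lambda>i j. kast_sign m N (x i) (x j)) p"
    using cyl_ring_flip[OF N x p L _ _ inj dis] a1 a2 a3 a4 a5 unfolding im by auto
  moreover have "BetaV Cb x' y' \<in> set iv \<union> set jv \<longleftrightarrow> x' = c \<and> (y' = y \<or> y' = Suc y)" for x' y'
    by (auto simp: iv_def jv_def)
  ultimately show ?thesis by blast
qed

text \<open>The ring consists of the \<open>2 N\<close> triangles of the bottom row. The
  \<open>N\<close> \<open>a\<close>-legs are traversed against their orientation and the
  \<open>b\<close>-legs along it, one of them a \<open>z\<close>-edge with sign \<open>-1\<close>.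
  The product \<open>- (-1)^N\<close> is \<open>-1\<close> because \<open>N\<close> is even: this is
  where \<open>z = -1\<close> and the parity of the circumference meet.\<close>

lemma loop_flip:
  assumes N: "N > 1" "even N" and x: "bij_betw x {0..<2 * M} (cyl_vertices m N)" and p: "lists_matching M x (cyl_mate N L) p"
    and L: "cyl_config m N L" and m: "m \<ge> 1" and Lc: "\<And>c. 0 \<le> c \<Longrightarrow> c < int N \<Longrightarrow> \<not> L (BetaV Cc c 0)"
  shows "\<exists>L' p'. cyl_config m N L' \<and> lists_matching M x (cyl_mate N L') p' \<and>
      pf_term M (\<lambda>i j. kast_sign m N (x i) (x j)) p' = pf_term M (\<lambda>i j. kast_sign m N (x i) (x j)) p \<and>
      (\<forall>c y. 0 \<le> c \<longrightarrow> c < int N \<longrightarrow> L' (BetaV Cb c y) = (L (BetaV Cb c y) \<noteq> (y = 0)))"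
proof -
  define i where "i t = (if even t then OmegaV Cb (int (t div 2)) 0 else BetaV Ca (int (t div 2)) 0)" for t
  define j where "j t = (if even t then OmegaV Ca (int (t div 2)) 0 else BetaV Cb (int (t div 2)) 0)" for t
  define k where "k t = (if even t then OmegaV Cc (int (t div 2)) 0 else BetaV Cc (int (t div 2)) 0)" for t
  define r where "r = 2 * N"
  have N0: "N > 0" using N by simp
  have half: "t div 2 < N" if "t < r" for t using that unfolding r_def by auto
  have inj: "inj_on i {..<r}" "inj_on j {..<r}" "inj_on k {..<r}"
    unfolding i_def j_def k_def inj_on_def by (auto split: if_splits elim!: evenE oddE)
  have dis: "i ` {..<r} \<inter> j ` {..<r} = {}" "i ` {..<r} \<inter> k ` {..<r} = {}" "j ` {..<r} \<inter> k ` {..<r} = {}"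
    unfolding i_def j_def k_def by (auto split: if_splits)
  have V: "i t \<in> cyl_vertices m N" "j t \<in> cyl_vertices m N" if "t < r" for t
    using half[OF that] m N0 by (auto simp: i_def j_def)
  have tri: "triangle cnxt (i t) (j t) (k t)" for t
    by (simp add: i_def j_def k_def triangle_cnxt)
  have leg: "cleg N (j t) = i (Suc t mod r)" if t: "t < r" for t
  proof (cases "even t")
    case True
    then have "Suc t < r" using t unfolding r_def by presburger
    then show ?thesis using True by (simp add: i_def j_def)
  next
    case False
    show ?thesis
    proof (cases "Suc t = r")
      case True
      then have "int (t div 2) + 1 = int N" using False unfolding r_def by presburger
      then show ?thesis using True False by (simp add: i_def j_def)
    next
      case F: False
      then have "Suc t < r" using t by simp
      moreover have "int (Suc t div 2) = int (t div 2) + 1" using False by presburger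
      moreover have "int (t div 2) + 1 < int N" using \<open>Suc t < r\<close> False unfolding r_def by presburger
      ultimately show ?thesis using False by (simp add: i_def j_def)
    qed
  qed
  have hl: "has_leg m (j t)" for t by (simp add: j_def)
  \<comment> \<open>All third vertices are \<open>c\<close>-corners without occupied leg, so every
    triangle is passed by a detour and no condition on direct edges arises.\<close>
  have Sij: "\<not> L (k t)" if "t < r" for t
    using half[OF that] Lc[of "int (t div 2)"] cyl_config_has_leg[OF N0 L, of "OmegaV Cc (int (t div 2)) 0"] m N0
    by (auto simp: k_def)
  have sg: "kast_sign m N (j t) (i (Suc t mod r)) = (if even t then -1 else if t = r - 1 then -1 else 1)" if t: "t < r" for t
  proof (cases "even t")
    case True
    have "BetaV Ca (int (t div 2)) 0 \<in> cyl_vertices m N" using half[OF t] m N0 by auto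
    then have "kast_sign m N (OmegaV Ca (int (t div 2)) 0) (BetaV Ca (int (t div 2)) 0) = -1"
      using kast_sign_cleg(2)[OF N(1), of "BetaV Ca (int (t div 2)) 0" m] by simp
    moreover have "i (Suc t mod r) = BetaV Ca (int (t div 2)) 0"
      using leg[OF t] True by (simp add: j_def)
    ultimately show ?thesis using True by (simp add: j_def)
  next
    case False
    have "int (t div 2) = int N - 1 \<longleftrightarrow> t = r - 1" using False t unfolding r_def by presburger
    then have "kast_sign m N (j t) (cleg N (j t)) = (if t = r - 1 then -1 else 1)"
      using kast_sign_cleg(1)[OF N(1) V(2)[OF t] hl] False by (simp add: j_def)
    then show ?thesis using leg[OF t] False by simp
  qed
  \<comment> \<open>Two factors per column, one for the \<open>a\<close>-leg and one for the
    \<open>b\<close>-leg; the exceptional last factor enters only at \<open>q = N\<close>.\<close>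
  have "(\<Prod>t<2 * q. if even t then -1 else if t = r - 1 then -1 else 1) = (if q = N then - ((-1) ^ q) else (-1 :: real) ^ q)"
    if "q \<le> N" for q
    using that
  proof (induction q)
    case 0 then show ?case using N0 by simp
  next
    case (Suc q)
    have "Suc (2 * q) = r - 1 \<longleftrightarrow> Suc q = N" unfolding r_def using N0 by presburger
    moreover have "(-1 :: real) ^ q = - ((-1) ^ N)" if "Suc q = N" unfolding that[symmetric] by simp
    ultimately show ?case using Suc by simp
  qed
  from this[of N] have prod: "(\<Prod>t<r. kast_sign m N (j t) (i (Suc t mod r))) = -1"
    using N(2) sg by (simp add: r_def[symmetric])
  have r: "r > 0" "even r" using N0 by (auto simp: r_def)
  obtain p' where P: "cyl_config m N (\<lambda>v. L v \<noteq> (v \<in> i ` {..<r} \<union> j ` {..<r}))"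
    "lists_matching M x (cyl_mate N (\<lambda>v. L v \<noteq> (v \<in> i ` {..<r} \<union> j ` {..<r}))) p'"
    "pf_term M (\<lambda>i j. kast_sign m N (x i) (x j)) p' = pf_term M (\<lambda>i j. kast_sign m N (x i) (x j)) p"
    using cyl_ring_flip[OF N(1) x p L r inj dis V(1) tri leg hl _ prod] Sij by blast
  have H: "BetaV Cb c y \<in> i ` {..<r} \<union> j ` {..<r} \<longleftrightarrow> y = 0" if "0 \<le> c" "c < int N" for c y
  proof
    assume "y = 0"
    have "BetaV Cb c 0 = j (2 * nat c + 1)" using that by (simp add: j_def)
    moreover have "2 * nat c + 1 < r" using that unfolding r_def by linarith
    ultimately show "BetaV Cb c y \<in> i ` {..<r} \<union> j ` {..<r}" using \<open>y = 0\<close> by blast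
  qed (auto simp: i_def j_def split: if_splits)
  show ?thesis
    by (rule exI[of _ "\<lambda>v. L v \<noteq> (v \<in> i ` {..<r} \<union> j ` {..<r})"], rule exI[of _ p'])
      (intro conjI P allI impI, simp only: H)
qed

lemma par_bottom: "I \<subseteq> {0} \<Longrightarrow> O' \<subseteq> {0} \<Longrightarrow> par I O' (Suc y) = ((0 \<in> I) \<noteq> (0 \<in> O'))"
  by (induction y) auto

lemma cfg_empty_agree:
  assumes N: "N > 0" and L: "cyl_config m N L" and e: "\<And>c y. 0 \<le> c \<Longrightarrow> c < int N \<Longrightarrow> y < m \<Longrightarrow> \<not> L (BetaV Cb c y)"
    and v: "v \<in> cyl_vertices m N"
  shows "L v = cfg N (\<lambda>_. {}) v"
proof -
  have o: "out_state m L c = {}" if "0 \<le> c" "c < int N" for c using e[OF that] by (auto simp: out_state_def)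
  have "cfg N (out_state m L) v = cfg N (\<lambda>_. {}) v"
    using v N o by (cases "(N, v)" rule: cleg.cases) auto
  then show ?thesis using config_eq_cfg[OF N L v] by simp
qed

text \<open>Hexagon flips push all occupied \<open>b\<close>-legs down to row \<open>0\<close>; then no \<open>c\<close>-leg is occupied, so the
  \<open>b\<close>-legs of row \<open>0\<close> are occupied in all columns or in none, and one flip around the cylinder removes them.\<close>

lemma matching_sign_constant:
  assumes N: "N > 1" "even N" and m: "m \<ge> 1" and x: "bij_betw x {0..<2 * M} (cyl_vertices m N)"
    and L: "cyl_config m N L" and p: "lists_matching M x (cyl_mate N L) p"
  shows "\<exists>p'. lists_matching M x (cyl_mate N (cfg N (\<lambda>_. {}))) p' \<and>
      pf_term M (\<lambda>i j. kast_sign m N (x i) (x j)) p' = pf_term M (\<lambda>i j. kast_sign m N (x i) (x j)) p"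
  using L p
\<comment> \<open>The measure is the total height of the occupied \<open>b\<close>-legs. A hexagon
  flip below an occupied leg empties row \<open>Suc y\<close> and at worst fills row
  \<open>y\<close> in the same column.\<close>
proof (induction "\<Sum>c\<in>{0..<int N}. \<Sum>(out_state m L c)" arbitrary: L p rule: less_induct)
  case less
  have N0: "N > 0" using N by simp
  show ?case
  proof (cases "\<exists>c y. 0 \<le> c \<and> c < int N \<and> Suc y < m \<and> L (BetaV Cb c (Suc y))")
    case True
    then obtain c y where c: "0 \<le> c" "c < int N" "Suc y < m" "L (BetaV Cb c (Suc y))" by blast
    obtain L' p' where L': "cyl_config m N L'" "lists_matching M x (cyl_mate N L') p'"
      "pf_term M (\<lambda>i j. kast_sign m N (x i) (x j)) p' = pf_term M (\<lambda>i j. kast_sign m N (x i) (x j)) p"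
      "\<And>x' y'. L' (BetaV Cb x' y') = (L (BetaV Cb x' y') \<noteq> (x' = c \<and> (y' = y \<or> y' = Suc y)))"
      using hexagon_flip[OF N(1) x less.prems(2,1) c(1,2,3)] by metis
    have other: "out_state m L' x' = out_state m L x'" if "x' \<noteq> c" for x'
      using L'(4) that by (auto simp: out_state_def)
    have fin: "finite (out_state m L x')" for L x' by (simp add: out_state_def)
    \<comment> \<open>An inclusion only, since row \<open>y\<close> is toggled and may have been
      occupied before.\<close>
    have "out_state m L' c \<subseteq> insert y (out_state m L c - {Suc y})"
      using L'(4)[of c] c by (auto simp: out_state_def)
    then have "\<Sum>(out_state m L' c) \<le> \<Sum>(insert y (out_state m L c - {Suc y}))"
      using fin by (intro sum_mono2) auto
    also have "\<dots> \<le> y + \<Sum>(out_state m L c - {Suc y})"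
      using fin by (cases "y \<in> out_state m L c - {Suc y}") (auto simp: insert_absorb)
    also have "\<dots> < Suc y + \<Sum>(out_state m L c - {Suc y})" by simp
    also have "\<dots> = \<Sum>(out_state m L c)"
      using sum.remove[OF fin, of "Suc y" L c "\<lambda>y. y"] c by (simp add: out_state_def)
    finally have "(\<Sum>c\<in>{0..<int N}. \<Sum>(out_state m L' c)) < (\<Sum>c\<in>{0..<int N}. \<Sum>(out_state m L c))"
      using other c by (intro sum_strict_mono_ex1) (auto intro!: bexI[of _ c], metis order.refl less_imp_le)
    from less.hyps[OF this L'(1,2)] show ?thesis using L'(3) by simp
  next
    case False
    have sub: "out_state m L c \<subseteq> {0}" if "0 \<le> c" "c < int N" for c
    proof
      fix y assume "y \<in> out_state m L c"
      then have "y < m" "L (BetaV Cb c y)" by (auto simp: out_state_def)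
      then show "y \<in> {0}" using False that by (cases y) auto
    qed
    obtain m' where m': "m = Suc m'" using m by (cases m) auto
    have step: "(0 \<in> out_state m L ((c - 1) mod int N)) = (0 \<in> out_state m L c)" if c: "0 \<le> c" "c < int N" for c
    proof -
      have "\<not> par (out_state m L ((c - 1) mod int N)) (out_state m L c) m"
        using out_state_compatible[OF N0 less.prems(1)] c by (simp add: compatible_def)
      moreover have "par (out_state m L ((c - 1) mod int N)) (out_state m L c) m
          = ((0 \<in> out_state m L ((c - 1) mod int N)) \<noteq> (0 \<in> out_state m L c))"
        unfolding m' by (rule par_bottom; unfold m'[symmetric], rule sub) (use N0 c in auto)
      ultimately show ?thesis by simp
    qed
    have const: "(0 \<in> out_state m L (int c)) = (0 \<in> out_state m L 0)" if "c < N" for c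
      using that
    proof (induction c)
      case (Suc c)
      then show ?case using step[of "int (Suc c)"] by simp
    qed simp
    have L0: "L (BetaV Cb c y) = (y = 0 \<and> 0 \<in> out_state m L 0)" if "0 \<le> c" "c < int N" "y < m" for c y
      using sub[OF that(1,2)] const[of "nat c"] that by (auto simp: out_state_def)
    show ?thesis
    proof (cases "0 \<in> out_state m L 0")
      case False
      then have "L v = cfg N (\<lambda>_. {}) v" if "v \<in> cyl_vertices m N" for v
        using that L0 by (intro cfg_empty_agree[OF N0 less.prems(1)]) auto
      then have "lists_matching M x (cyl_mate N (cfg N (\<lambda>_. {}))) p"
        using lists_mate_cong[OF N0 x _ less.prems(2)] by blast
      then show ?thesis by blast
    next
      case True
      have "\<not> L (BetaV Cc c 0)" if c: "0 \<le> c" "c < int N" for c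
      proof -
        have "par (out_state m L ((c - 1) mod int N)) (out_state m L c) (Suc 0) = False"
          using par_bottom[OF sub sub[OF c], of "c - 1" 0] step[OF c] N0 by simp
        then show ?thesis using config_column[OF N0 less.prems(1) c, of 0] m by simp
      qed
      then obtain L' p' where L': "cyl_config m N L'" "lists_matching M x (cyl_mate N L') p'"
        "pf_term M (\<lambda>i j. kast_sign m N (x i) (x j)) p' = pf_term M (\<lambda>i j. kast_sign m N (x i) (x j)) p"
        "\<And>c y. 0 \<le> c \<Longrightarrow> c < int N \<Longrightarrow> L' (BetaV Cb c y) = (L (BetaV Cb c y) \<noteq> (y = 0))"
        using loop_flip[OF N x less.prems(2,1) m] by metis
      have "L' v = cfg N (\<lambda>_. {}) v" if "v \<in> cyl_vertices m N" for v
        using that L0 True L'(4) by (intro cfg_empty_agree[OF N0 L'(1)]) auto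
      then have "lists_matching M x (cyl_mate N (cfg N (\<lambda>_. {}))) p'"
        using lists_mate_cong[OF N0 x _ L'(2)] by blast
      then show ?thesis using L'(3) by blast
    qed
  qed
qed

section \<open>Dimer sums as determinants\<close>

abbreviation "cyl_dimers m N \<equiv> dimer_configs (cyl_vertices m N) (cyl_edges m N)"

definition dimer_of :: "nat \<Rightarrow> nat \<Rightarrow> (vertex \<Rightarrow> bool) \<Rightarrow> vertex set set" where
  "dimer_of m N L = (\<lambda>v. {v, cyl_mate N L v}) ` cyl_vertices m N"

abbreviation "legs_of N D \<equiv> (\<lambda>v. {v, cleg N v} \<in> D)"

lemma cleg_ne: "cleg N v \<noteq> cnxt v" "cleg N v \<noteq> cnxt (cnxt v)" "cleg N v \<noteq> v"
  by (metis cnxt_simps(5) is_beta_cleg)+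

lemma cyl_edge_incident:
  assumes "N > 0" "e \<in> cyl_edges m N" "v \<in> e"
  shows "v \<in> cyl_vertices m N \<and> (e = {v, cnxt v} \<or> e = {v, cnxt (cnxt v)} \<or> has_leg m v \<and> e = {v, cleg N v})"
proof -
  obtain a b where ab: "e = {a, b}" "(a, b) \<in> cyl_arcs m N" using assms(2) unfolding edges_of_def by blast
  then have a: "a \<in> cyl_vertices m N" "b = cnxt a \<or> has_leg m a \<and> b = cleg N a"
    using cyl_arcs_iff[OF assms(1)] by blast+
  show ?thesis
  proof (cases "v = a")
    case True
    then show ?thesis using a ab by blast
  next
    case False
    then have v: "v = b" "e = {v, a}" using assms(3) ab by auto
    from a(2) show ?thesis
    proof
      assume b: "b = cnxt a"
      then have "a = cnxt (cnxt v)" using v by simp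
      then show ?thesis using a(1) v b assms(1) by simp
    next
      assume b: "has_leg m a \<and> b = cleg N a"
      then show ?thesis using cleg_in_cyl[OF assms(1) a(1)] v by simp
    qed
  qed
qed

lemma cyl_edge_intros:
  assumes "N > 0" "v \<in> cyl_vertices m N"
  shows "{v, cnxt v} \<in> cyl_edges m N" "{v, cnxt (cnxt v)} \<in> cyl_edges m N"
    "has_leg m v \<Longrightarrow> {v, cleg N v} \<in> cyl_edges m N"
proof -
  have e: "{a, b} \<in> cyl_edges m N" if "(a, b) \<in> cyl_arcs m N" for a b using that by (auto simp: edges_of_def)
  show "{v, cnxt v} \<in> cyl_edges m N" by (rule e) (use assms in \<open>simp add: cyl_arcs_iff\<close>)
  have "{cnxt (cnxt v), v} \<in> cyl_edges m N" by (rule e) (use assms in \<open>simp add: cyl_arcs_iff\<close>)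
  then show "{v, cnxt (cnxt v)} \<in> cyl_edges m N" by (simp add: insert_commute)
  assume h: "has_leg m v"
  show "{v, cleg N v} \<in> cyl_edges m N"
  proof (cases "is_beta v")
    case True
    show ?thesis by (rule e) (use True assms h in \<open>simp add: cyl_arcs_iff\<close>)
  next
    case False
    have "{cleg N v, v} \<in> cyl_edges m N"
      by (rule e) (use False assms(1) cleg_in_cyl[OF assms h] in \<open>simp add: cyl_arcs_iff\<close>)
    then show ?thesis by (simp add: insert_commute)
  qed
qed

lemma dimer_local:
  assumes N: "N > 0" and D: "D \<in> cyl_dimers m N" and v: "v \<in> cyl_vertices m N"
  shows "legs_of N D v \<Longrightarrow> has_leg m v"
    and "legs_of N D v \<or> {v, cnxt v} \<in> D \<or> {cnxt (cnxt v), v} \<in> D"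
    and "\<not> (legs_of N D v \<and> {v, cnxt v} \<in> D)" "\<not> (legs_of N D v \<and> {cnxt (cnxt v), v} \<in> D)"
      "\<not> ({v, cnxt v} \<in> D \<and> {cnxt (cnxt v), v} \<in> D)"
proof -
  have DE: "D \<subseteq> cyl_edges m N" and ex1: "\<exists>!e. e \<in> D \<and> v \<in> e"
    using D v by (auto simp: dimer_configs_def)
  have uniq: "e = e'" if "e \<in> D" "v \<in> e" "e' \<in> D" "v \<in> e'" for e e' using ex1 that by blast
  show "has_leg m v" if "legs_of N D v"
    using cyl_edge_incident[OF N, of "{v, cleg N v}" m v] that DE cleg_ne[of N v]
    by (auto simp: doubleton_eq_iff)
  obtain e where e: "e \<in> D" "v \<in> e" using ex1 by blast
  then show "legs_of N D v \<or> {v, cnxt v} \<in> D \<or> {cnxt (cnxt v), v} \<in> D"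
    using cyl_edge_incident[OF N, of e m v] DE by (auto simp: insert_commute)
  show "\<not> (legs_of N D v \<and> {v, cnxt v} \<in> D)"
    using uniq[of "{v, cleg N v}" "{v, cnxt v}"] cleg_ne[of N v] by (auto simp: doubleton_eq_iff)
  show "\<not> (legs_of N D v \<and> {cnxt (cnxt v), v} \<in> D)"
    using uniq[of "{v, cleg N v}" "{cnxt (cnxt v), v}"] cleg_ne[of N v] by (auto simp: doubleton_eq_iff)
  show "\<not> ({v, cnxt v} \<in> D \<and> {cnxt (cnxt v), v} \<in> D)"
    using uniq[of "{v, cnxt v}" "{cnxt (cnxt v), v}"] cnxt_simps(2,3,4)[of v] by (auto simp: doubleton_eq_iff)
qed

text \<open>At each vertex exactly one of the leg and the two triangle edges is occupied. Combining
  these conditions over the three corners of a triangle yields the parity condition and determines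
  the triangle edges from the legs.\<close>

lemma dimer_legs:
  assumes N: "N > 0" and D: "D \<in> cyl_dimers m N"
  shows "cyl_config m N (legs_of N D)" "D = dimer_of m N (legs_of N D)"
proof -
  let ?L = "legs_of N D" and ?X = "\<lambda>v. {v, cnxt v} \<in> D"
  have X: "?L v \<or> ?X v \<or> ?X (cnxt (cnxt v))" "\<not> (?L v \<and> ?X v)" "\<not> (?L v \<and> ?X (cnxt (cnxt v)))"
    "\<not> (?X v \<and> ?X (cnxt (cnxt v)))" if "v \<in> cyl_vertices m N" for v
    using dimer_local(2-5)[OF N D that] by simp_all
  show "cyl_config m N ?L"
    unfolding leg_config_def
  proof (intro ballI conjI impI)
    fix v assume v: "v \<in> cyl_vertices m N"
    show "?L v = (?L (cnxt v) = ?L (cnxt (cnxt v)))"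
      using X[OF v] X[of "cnxt v"] X[of "cnxt (cnxt v)"] v N by auto
    assume l: "?L v"
    have h: "has_leg m v" by (rule dimer_local(1)[OF N D v l])
    note c = cleg_in_cyl[OF N v h]
    show "cleg N v \<in> cyl_vertices m N" "cleg N (cleg N v) = v" using c by auto
    show "?L (cleg N v)" using l c(3) by (simp add: insert_commute)
  qed
  have mateD: "{v, cyl_mate N ?L v} \<in> D" if v: "v \<in> cyl_vertices m N" for v
    using X[OF v] X[of "cnxt v"] X[of "cnxt (cnxt v)"] v N
    by (auto simp: mate_def insert_commute)
  show "D = dimer_of m N ?L"
  proof
    show "dimer_of m N ?L \<subseteq> D" using mateD by (auto simp: dimer_of_def)
    show "D \<subseteq> dimer_of m N ?L"
    proof
      fix e assume e: "e \<in> D"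
      then have eE: "e \<in> cyl_edges m N" using D by (auto simp: dimer_configs_def)
      then obtain v where v: "v \<in> e" unfolding edges_of_def by blast
      have vV: "v \<in> cyl_vertices m N" using cyl_edge_incident[OF N eE v] by blast
      have "e = {v, cyl_mate N ?L v}" using D vV e v mateD[OF vV] unfolding dimer_configs_def by blast
      then show "e \<in> dimer_of m N ?L" using vV by (auto simp: dimer_of_def)
    qed
  qed
qed

lemma mate_props:
  assumes N: "N > 0" and L: "cyl_config m N L" and v: "v \<in> cyl_vertices m N"
  shows "cyl_mate N L v \<in> cyl_vertices m N" "cyl_mate N L (cyl_mate N L v) = v"
    "{v, cyl_mate N L v} \<in> cyl_edges m N" "cyl_mate N L v \<noteq> v" "cyl_mate N L v = cleg N v \<longleftrightarrow> L v"
proof -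
  have par: "L v = (L (cnxt v) = L (cnxt (cnxt v)))" by (rule cyl_configD(2)[OF N L v])
  have l: "cleg N v \<in> cyl_vertices m N" "cleg N (cleg N v) = v" "L (cleg N v)" if "L v"
    using L v that unfolding leg_config_def by blast+
  note h = cyl_config_has_leg[OF N L v]
  show "cyl_mate N L v \<in> cyl_vertices m N" using l v N by (simp add: mate_def)
  show "cyl_mate N L (cyl_mate N L v) = v" using l par by (auto simp: mate_def)
  show "{v, cyl_mate N L v} \<in> cyl_edges m N" using cyl_edge_intros[OF N v] h by (simp add: mate_def)
  show "cyl_mate N L v \<noteq> v" using cleg_ne(3) by (auto simp: mate_def)
  show "cyl_mate N L v = cleg N v \<longleftrightarrow> L v" using cleg_ne[of N v] by (auto simp: mate_def)
qed

lemma dimer_of_edge: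
  assumes N: "N > 0" and L: "cyl_config m N L" and e: "e \<in> dimer_of m N L" "v \<in> e"
  shows "v \<in> cyl_vertices m N" "e = {v, cyl_mate N L v}"
proof -
  obtain u where u: "u \<in> cyl_vertices m N" "e = {u, cyl_mate N L u}" using e(1) by (auto simp: dimer_of_def)
  note M = mate_props[OF N L u(1)]
  show "v \<in> cyl_vertices m N" "e = {v, cyl_mate N L v}" using e(2) u M(1,2) by auto
qed

lemma dimer_of_config:
  assumes N: "N > 0" and L: "cyl_config m N L"
  shows "dimer_of m N L \<in> cyl_dimers m N" "\<And>v. v \<in> cyl_vertices m N \<Longrightarrow> legs_of N (dimer_of m N L) v = L v"
proof -
  show "dimer_of m N L \<in> cyl_dimers m N"
    unfolding dimer_configs_def
  proof (intro CollectI conjI ballI)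
    show "dimer_of m N L \<subseteq> cyl_edges m N" using mate_props(3)[OF N L] by (auto simp: dimer_of_def)
    fix v assume v: "v \<in> cyl_vertices m N"
    show "\<exists>!e. e \<in> dimer_of m N L \<and> v \<in> e"
    proof (rule ex1I[of _ "{v, cyl_mate N L v}"])
      show "{v, cyl_mate N L v} \<in> dimer_of m N L \<and> v \<in> {v, cyl_mate N L v}" using v by (auto simp: dimer_of_def)
      show "e = {v, cyl_mate N L v}" if "e \<in> dimer_of m N L \<and> v \<in> e" for e
        using dimer_of_edge(2)[OF N L, of e v] that by blast
    qed
  qed
  fix v assume v: "v \<in> cyl_vertices m N"
  show "legs_of N (dimer_of m N L) v = L v"
  proof
    assume "legs_of N (dimer_of m N L) v"
    then have "{v, cleg N v} = {v, cyl_mate N L v}" using dimer_of_edge(2)[OF N L, of "{v, cleg N v}" v] by blast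
    then have "cyl_mate N L v = cleg N v" by (auto simp: doubleton_eq_iff)
    then show "L v" using mate_props(5)[OF N L v] by blast
  next
    assume "L v"
    then have "{v, cleg N v} = {v, cyl_mate N L v}" using mate_props(5)[OF N L v] by simp
    then show "legs_of N (dimer_of m N L) v" unfolding dimer_of_def using v by blast
  qed
qed

text \<open>Enumerating the pairs and ordering each one yields a map of the positions onto
  themselves; by finiteness it is a permutation.\<close>

lemma pairing_of_pair_partition:
  fixes D :: "nat set set"
  assumes two: "\<And>e. e \<in> D \<Longrightarrow> card e = 2" and dis: "\<And>e e'. e \<in> D \<Longrightarrow> e' \<in> D \<Longrightarrow> e \<inter> e' \<noteq> {} \<Longrightarrow> e = e'"
    and un: "\<Union>D = {0..<2 * M}"
  shows "\<exists>p. p permutes {0..<2 * M} \<and> pairing M p = D"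
proof -
  have fe: "finite e" "e \<noteq> {}" if "e \<in> D" for e using two[OF that] by (auto intro: card_ge_0_finite)
  have fD: "finite D" by (rule finite_UnionD) (simp add: un)
  have "card (\<Union>D) = (\<Sum>e\<in>D. card e)"
    by (rule card_Union_disjoint) (use dis fe in \<open>auto simp: pairwise_def disjnt_def\<close>)
  then have "2 * card D = 2 * M" using two un by simp
  then have cD: "card D = M" by simp
  obtain g where g: "bij_betw g {0..<M} D" using ex_bij_betw_nat_finite[OF fD] cD by blast
  have gD: "g i \<in> D" if "i < M" for i using g that by (auto simp: bij_betw_def)
  have mm: "e = {Min e, Max e}" if e: "e \<in> D" for e
  proof -
    obtain a b where ab: "e = {a, b}" using two[OF e] by (auto simp: card_2_iff)
    show ?thesis unfolding ab by (cases a b rule: linorder_cases) auto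
  qed
  \<comment> \<open>\<open>Min\<close> and \<open>Max\<close> serve merely to choose an order inside
    each pair.\<close>
  define p where "p j = (if j < 2 * M then if even j then Min (g (j div 2)) else Max (g (j div 2)) else j)" for j
  have peo: "p (2 * i) = Min (g i)" "p (2 * i + 1) = Max (g i)" if "i < M" for i using that by (auto simp: p_def)
  have pair: "{p (2 * i), p (2 * i + 1)} = g i" if "i < M" for i
    using mm[OF gD[OF that]] peo[OF that] by simp
  have pM: "pairing M p = D"
  proof -
    have "pairing M p = g ` {..<M}" unfolding pairing_def by (rule image_cong) (use pair in auto)
    then show ?thesis using g by (simp add: bij_betw_def lessThan_atLeast0)
  qed
  have sub: "{0..<2 * M} \<subseteq> p ` {0..<2 * M}"
  proof
    fix v assume "v \<in> {0..<2 * M}"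
    then obtain e where "e \<in> D" "v \<in> e" using un by blast
    then obtain i where i: "i < M" "v \<in> {p (2 * i), p (2 * i + 1)}" using pM by (auto simp: pairing_def)
    then have "v = p (2 * i) \<or> v = p (2 * i + 1)" by blast
    moreover have "2 * i \<in> {0..<2 * M}" "2 * i + 1 \<in> {0..<2 * M}" using i(1) by auto
    ultimately show "v \<in> p ` {0..<2 * M}" by blast
  qed
  have inj: "inj_on p {0..<2 * M}" by (rule finite_surj_inj[OF _ sub]) simp
  have "card (p ` {0..<2 * M}) = card {0..<2 * M}" by (rule card_image[OF inj])
  then have "p ` {0..<2 * M} = {0..<2 * M}"
    using card_subset_eq[OF _ sub] by simp
  then have "p permutes {0..<2 * M}" using inj by (intro bij_imp_permutes) (auto simp: bij_betw_def p_def)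
  then show ?thesis using pM by blast
qed

lemma bij_betw_vertex_at:
  assumes "N > 0"
  shows "bij_betw (vertex_at m N) {0..<2 * (3 * m * N)} (cyl_vertices m N)"
    "\<And>v. v \<in> cyl_vertices m N \<Longrightarrow> vertex_at m N (vertex_index m v) = v"
    "\<And>v. v \<in> cyl_vertices m N \<Longrightarrow> vertex_index m v < 2 * (3 * m * N)"
proof -
  note b = bij_betw_vertex_index[OF assms, of m]
  have e: "{..<6 * m * N} = {0..<2 * (3 * m * N)}" by auto
  show "bij_betw (vertex_at m N) {0..<2 * (3 * m * N)} (cyl_vertices m N)"
    unfolding vertex_at_def using bij_betw_the_inv_into[OF b] unfolding e .
  show "vertex_at m N (vertex_index m v) = v" if "v \<in> cyl_vertices m N" for v
    unfolding vertex_at_def using b that by (auto simp: bij_betw_def the_inv_into_f_f)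
  show "vertex_index m v < 2 * (3 * m * N)" if "v \<in> cyl_vertices m N" for v
  proof -
    have "vertex_index m v \<in> {..<6 * m * N}" using bij_betwE[OF b] that by blast
    then show ?thesis by simp
  qed
qed

lemma lists_iff_pairing:
  assumes N: "N > 0" and L: "cyl_config m N L" and x: "bij_betw x {0..<2 * M} (cyl_vertices m N)"
    and p: "p permutes {0..<2 * M}"
  shows "lists_matching M x (cyl_mate N L) p \<longleftrightarrow> pairing M (x \<circ> p) = dimer_of m N L"
proof -
  have xp: "bij_betw (x \<circ> p) {0..<2 * M} (cyl_vertices m N)"
    by (rule bij_betw_trans[OF permutes_imp_bij[OF p] x])
  have xpV: "x (p i) \<in> cyl_vertices m N" if "i < 2 * M" for i using xp that by (auto simp: bij_betw_def)
  show ?thesis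
  proof
    assume l: "lists_matching M x (cyl_mate N L) p"
    then have pr: "{x (p (2 * i)), x (p (2 * i + 1))} = {x (p (2 * i)), cyl_mate N L (x (p (2 * i)))}" if "i < M" for i
      using that by (simp add: lists_matching_def)
    show "pairing M (x \<circ> p) = dimer_of m N L"
    proof
      show "pairing M (x \<circ> p) \<subseteq> dimer_of m N L"
        using pr xpV by (auto simp: pairing_def dimer_of_def)
      show "dimer_of m N L \<subseteq> pairing M (x \<circ> p)"
      proof
        fix e assume "e \<in> dimer_of m N L"
        then obtain v where v: "v \<in> cyl_vertices m N" "e = {v, cyl_mate N L v}" by (auto simp: dimer_of_def)
        have "v \<in> (x \<circ> p) ` {0..<2 * M}" using bij_betw_imp_surj_on[OF xp] v(1) by blast
        then obtain j where j: "j < 2 * M" "v = x (p j)" by auto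
        define i where "i = j div 2"
        have i: "i < M" "j = 2 * i \<or> j = 2 * i + 1" using j(1) unfolding i_def by auto
        have "e = {x (p (2 * i)), x (p (2 * i + 1))}"
        proof (cases "j = 2 * i")
          case True
          then show ?thesis using pr[OF i(1)] v j by simp
        next
          case False
          then have j': "j = 2 * i + 1" using i by simp
          then have "v = cyl_mate N L (x (p (2 * i)))" using l i(1) j by (simp add: lists_matching_def)
          then have "cyl_mate N L v = x (p (2 * i))" using mate_props(2)[OF N L xpV[of "2 * i"]] i(1) by simp
          then show ?thesis using v(2) j(2) j' by (simp add: insert_commute)
        qed
        then show "e \<in> pairing M (x \<circ> p)" using i(1) by (auto simp: pairing_def)
      qed
    qed
  next
    assume P: "pairing M (x \<circ> p) = dimer_of m N L"
    show "lists_matching M x (cyl_mate N L) p"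
      unfolding lists_matching_def
    proof (intro conjI p allI impI)
      fix i assume i: "i < M"
      have "{x (p (2 * i)), x (p (2 * i + 1))} \<in> dimer_of m N L"
        unfolding P[symmetric] pairing_def using i by auto
      then have "{x (p (2 * i)), x (p (2 * i + 1))} = {x (p (2 * i)), cyl_mate N L (x (p (2 * i)))}"
        by (rule dimer_of_edge(2)[OF N L]) simp
      then show "x (p (2 * i + 1)) = cyl_mate N L (x (p (2 * i)))" by (auto simp: doubleton_eq_iff)
    qed
  qed
qed

lemma pairing_in_dimers:
  assumes N: "N > 0" and x: "bij_betw x {0..<2 * M} (cyl_vertices m N)" and p: "p permutes {0..<2 * M}"
    and e: "\<And>i. i < M \<Longrightarrow> {x (p (2 * i)), x (p (2 * i + 1))} \<in> cyl_edges m N"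
  shows "pairing M (x \<circ> p) \<in> cyl_dimers m N"
proof -
  have xp: "bij_betw (x \<circ> p) {0..<2 * M} (cyl_vertices m N)"
    by (rule bij_betw_trans[OF permutes_imp_bij[OF p] x])
  show ?thesis
    unfolding dimer_configs_def
  proof (intro CollectI conjI ballI)
    show "pairing M (x \<circ> p) \<subseteq> cyl_edges m N" using e by (auto simp: pairing_def)
    fix v assume "v \<in> cyl_vertices m N"
    then have "v \<in> (x \<circ> p) ` {0..<2 * M}" using bij_betw_imp_surj_on[OF xp] by blast
    then obtain j where j: "j < 2 * M" "v = (x \<circ> p) j" by auto
    define i where "i = j div 2"
    have i: "i < M" "j = 2 * i \<or> j = 2 * i + 1" using j(1) unfolding i_def by auto
    have vi: "v \<in> {(x \<circ> p) (2 * i), (x \<circ> p) (2 * i + 1)}" using i(2) j(2) by blast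
    show "\<exists>!e. e \<in> pairing M (x \<circ> p) \<and> v \<in> e"
    proof (rule ex1I[of _ "{(x \<circ> p) (2 * i), (x \<circ> p) (2 * i + 1)}"])
      show "{(x \<circ> p) (2 * i), (x \<circ> p) (2 * i + 1)} \<in> pairing M (x \<circ> p) \<and> v \<in> {(x \<circ> p) (2 * i), (x \<circ> p) (2 * i + 1)}"
        using vi i(1) unfolding pairing_def by blast
      fix f assume f: "f \<in> pairing M (x \<circ> p) \<and> v \<in> f"
      then obtain k where k: "k < M" "f = {(x \<circ> p) (2 * k), (x \<circ> p) (2 * k + 1)}" unfolding pairing_def by blast
      have "k = i" by (rule pairing_disjoint[OF bij_betw_imp_inj_on[OF xp] k(1) i(1)]) (use f k vi in blast)
      then show "f = {(x \<circ> p) (2 * i), (x \<circ> p) (2 * i + 1)}" using k by simp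
    qed
  qed
qed

text \<open>The weight is an arbitrary real function on edges, so that it can also be taken to
  vanish on some of them.\<close>

definition weighted_kast :: "nat \<Rightarrow> nat \<Rightarrow> (vertex set \<Rightarrow> real) \<Rightarrow> real mat" where
  "weighted_kast m N w = Matrix.mat (2 * (3 * m * N)) (2 * (3 * m * N))
     (\<lambda>(i, j). kast_sign m N (vertex_at m N i) (vertex_at m N j) * w {vertex_at m N i, vertex_at m N j})"

definition dimer_sum :: "nat \<Rightarrow> nat \<Rightarrow> (vertex set \<Rightarrow> real) \<Rightarrow> real" where
  "dimer_sum m N w = (\<Sum>D\<in>cyl_dimers m N. \<Prod>e\<in>D. w e)"

lemma finite_cyl_vertices: "N > 0 \<Longrightarrow> finite (cyl_vertices m N)"
  using bij_betw_finite[OF bij_betw_vertex_index[of N m]] by simp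

lemma finite_cyl_edges:
  assumes "N > 0"
  shows "finite (cyl_edges m N)"
proof (rule finite_subset)
  show "cyl_edges m N \<subseteq> Pow (cyl_vertices m N)"
    using cyl_edge_incident[OF assms] by blast
  show "finite (Pow (cyl_vertices m N))" using finite_cyl_vertices[OF assms] by simp
qed

lemma finite_cyl_dimers: "N > 0 \<Longrightarrow> finite (cyl_dimers m N)"
  by (rule finite_subset[of _ "Pow (cyl_edges m N)"]) (auto simp: dimer_configs_def finite_cyl_edges)

lemma cfg_empty_config: "N > 0 \<Longrightarrow> cyl_config m N (cfg N (\<lambda>_. {}))"
proof (rule cfg_config)
  have "\<not> par {} {} y" for y by (induction y) auto
  then show "compatible m N (\<lambda>_. {})" by (simp add: compatible_def)
qed

text \<open>Every listing of a dimer configuration has the same signed term: flips lead to a listing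
  of the reference configuration without altering it, and listings of one matching agree. As the
  weights play no part in this, the identity holds for all real weights.\<close>

theorem kasteleyn_det:
  assumes N: "N > 1" "even N" and m: "m \<ge> 1"
  shows "Determinant.det (weighted_kast m N w) = (dimer_sum m N w)\<^sup>2"
proof -
  define M where "M = 3 * m * N"
  define x where "x = vertex_at m N"
  define y where "y = vertex_index m"
  have N0: "N > 0" using N by simp
  have x: "bij_betw x {0..<2 * M} (cyl_vertices m N)" unfolding x_def M_def by (rule bij_betw_vertex_at[OF N0])
  have xy: "x (y v) = v" if "v \<in> cyl_vertices m N" for v
    unfolding x_def y_def using bij_betw_vertex_at(2)[OF N0 that] .
  have yM: "y v < 2 * M" if "v \<in> cyl_vertices m N" for v
    unfolding y_def M_def using bij_betw_vertex_at(3)[OF N0 that] .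
  have xV: "x i \<in> cyl_vertices m N" if "i < 2 * M" for i using x that by (auto simp: bij_betw_def)
  have yx: "y (x i) = i" if "i < 2 * M" for i
    using inj_onD[OF bij_betw_imp_inj_on[OF x], of "y (x i)" i] that yM[OF xV[OF that]] xy[OF xV[OF that]] by simp
  let ?S = "\<lambda>i j. kast_sign m N (x i) (x j)"
  let ?L0 = "cfg N (\<lambda>_. {})"
  have pl: "p i < 2 * M" if "p permutes {0..<2 * M}" "i < 2 * M" for p i
    using permutes_in_image[OF that(1), of i] that(2) by simp
  have Dv: "v \<in> cyl_vertices m N" if "D \<in> cyl_dimers m N" "e \<in> D" "v \<in> e" for D e v
    using that cyl_edge_incident[OF N0, of e m v] by (auto simp: dimer_configs_def)
  have x_y_image: "(`) x ` (`) y ` D = D" if D: "D \<in> cyl_dimers m N" for D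
  proof -
    have "x ` y ` e = e" if "e \<in> D" for e
    proof -
      have "x (y v) = v" if "v \<in> e" for v using xy Dv[OF D \<open>e \<in> D\<close> that] by blast
      then show ?thesis by (simp add: image_image)
    qed
    then show ?thesis by (simp add: image_image)
  qed
  have yxp: "(`) y ` pairing M (x \<circ> p) = pairing M p" if p: "p permutes {0..<2 * M}" for p
  proof -
    have "y ` {x (p (2 * i)), x (p (2 * i + 1))} = {p (2 * i), p (2 * i + 1)}" if "i < M" for i
      using yx[OF pl[OF p, of "2 * i"]] yx[OF pl[OF p, of "2 * i + 1"]] that by simp
    then show ?thesis unfolding pairing_def image_image by (intro image_cong) auto
  qed
  have listing: "\<exists>p. p permutes {0..<2 * M} \<and> pairing M p = (`) y ` D" if D: "D \<in> cyl_dimers m N" for D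
  proof (rule pairing_of_pair_partition)
    have inj: "inj_on y (cyl_vertices m N)" using xy by (rule inj_on_inverseI)
    have DL: "D = dimer_of m N (legs_of N D)" and L: "cyl_config m N (legs_of N D)"
      using dimer_legs[OF N0 D] by auto
    show "card e = 2" if e: "e \<in> (`) y ` D" for e
    proof -
      obtain f where f: "f \<in> D" "e = y ` f" using e by blast
      then obtain v where v: "v \<in> cyl_vertices m N" "f = {v, cyl_mate N (legs_of N D) v}"
        using DL unfolding dimer_of_def by blast
      have "card f = 2" using mate_props(4)[OF N0 L v(1)] v(2) by simp
      moreover have "inj_on y f" using inj Dv[OF D f(1)] by (auto intro: inj_on_subset)
      ultimately show ?thesis using f(2) by (simp add: card_image)
    qed
    show "e = e'" if ee: "e \<in> (`) y ` D" "e' \<in> (`) y ` D" "e \<inter> e' \<noteq> {}" for e e'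
    proof -
      obtain f f' where f: "f \<in> D" "e = y ` f" "f' \<in> D" "e' = y ` f'" using ee by blast
      then obtain v v' where v: "v \<in> f" "v' \<in> f'" "y v = y v'" using ee(3) by blast
      then have "v = v'" using inj Dv[OF D f(1) v(1)] Dv[OF D f(3) v(2)] by (auto simp: inj_on_def)
      then have "f = f'" using D f v Dv[OF D f(1) v(1)] unfolding dimer_configs_def by blast
      then show ?thesis using f by simp
    qed
    show "\<Union>((`) y ` D) = {0..<2 * M}"
    proof
      show "\<Union>((`) y ` D) \<subseteq> {0..<2 * M}" using Dv[OF D] yM by fastforce
      show "{0..<2 * M} \<subseteq> \<Union>((`) y ` D)"
      proof
        fix i assume i: "i \<in> {0..<2 * M}"
        then have "x i \<in> cyl_vertices m N" using xV by simp
        then obtain e where "e \<in> D" "x i \<in> e" using D unfolding dimer_configs_def by blast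
        moreover have "i = y (x i)" using yx i by simp
        ultimately show "i \<in> \<Union>((`) y ` D)" by blast
      qed
    qed
  qed
  have L0: "cyl_config m N ?L0" by (rule cfg_empty_config[OF N0])
  obtain p0 where p0: "p0 permutes {0..<2 * M}" "pairing M p0 = (`) y ` dimer_of m N ?L0"
    using listing[OF dimer_of_config(1)[OF N0 L0]] by blast
  have p0': "lists_matching M x (cyl_mate N ?L0) p0"
    unfolding lists_iff_pairing[OF N0 L0 x p0(1)]
    unfolding pairing_compose p0(2) by (rule x_y_image[OF dimer_of_config(1)[OF N0 L0]])
  \<comment> \<open>The common sign, read off from a listing of the configuration without occupied
    \<open>b\<close>-legs.\<close>
  define \<epsilon> where "\<epsilon> = pf_term M ?S p0"
  have skS: "?S j i = - ?S i j" for i j by (rule kast_sign_skew[OF N0])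
  have sign: "pf_term M ?S p = \<epsilon>" if p: "p permutes {0..<2 * M}" "pairing M (x \<circ> p) \<in> cyl_dimers m N" for p
  proof -
    note DL = dimer_legs[OF N0 p(2)]
    have "lists_matching M x (cyl_mate N (legs_of N (pairing M (x \<circ> p)))) p"
      unfolding lists_iff_pairing[OF N0 DL(1) x p(1)] by (rule DL(2))
    then obtain p' where p': "lists_matching M x (cyl_mate N ?L0) p'" "pf_term M ?S p' = pf_term M ?S p"
      using matching_sign_constant[OF N m x DL(1)] by blast
    have pp': "p' permutes {0..<2 * M}" using p'(1) by (simp add: lists_matching_def)
    have "pairing M (x \<circ> p') = pairing M (x \<circ> p0)"
      using p'(1) p0' lists_iff_pairing[OF N0 L0 x pp'] lists_iff_pairing[OF N0 L0 x p0(1)] by simp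
    then have "pairing M p' = pairing M p0" using yxp[OF pp'] yxp[OF p0(1)] by metis
    then have "pf_term M ?S p' = pf_term M ?S p0"
      by (rule pf_term_pairing_cong[where a = ?S, OF pp' p0(1)]) (rule skS)
    then show ?thesis using p'(2) unfolding \<epsilon>_def by simp
  qed
  define A where "A = weighted_kast m N w"
  have A: "A \<in> carrier_mat (2 * M) (2 * M)" unfolding A_def weighted_kast_def M_def by simp
  have Aij: "A $$ (i, j) = ?S i j * w {x i, x j}" if "i < 2 * M" "j < 2 * M" for i j
    using that unfolding A_def weighted_kast_def M_def x_def by simp
  have skA: "skew_mat A"
    unfolding skew_mat_def
  proof (intro allI impI)
    fix i j assume "i < dim_row A" "j < dim_row A"
    then have ij: "i < 2 * M" "j < 2 * M" using A by auto
    show "A $$ (j, i) = - A $$ (i, j)"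
      unfolding Aij[OF ij] Aij[OF ij(2,1)] using skS[of i j] by (simp add: insert_commute)
  qed
  have pfA: "pf_term M (\<lambda>i j. A $$ (i, j)) p = pf_term M ?S p * (\<Prod>e\<in>pairing M p. w (x ` e))"
    if p: "p permutes {0..<2 * M}" for p
  proof -
    have "(\<Prod>i<M. A $$ (p (2 * i), p (2 * i + 1)))
        = (\<Prod>i<M. ?S (p (2 * i)) (p (2 * i + 1)) * w (x ` {p (2 * i), p (2 * i + 1)}))"
      using pl[OF p] by (intro prod.cong refl) (simp add: Aij)
    then show ?thesis
      unfolding pf_term_def prod_pairing[OF permutes_inj_on[OF p]] prod.distrib by simp
  qed
  have "Determinant.det A = (\<Sum>D\<in>(`) ((`) y) ` cyl_dimers m N. \<Prod>e\<in>D. w (x ` e))\<^sup>2"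
  proof (rule det_eq_matching_sum_squared[OF A skA, where \<epsilon> = \<epsilon>])
    show "finite ((`) ((`) y) ` cyl_dimers m N)" by (intro finite_imageI finite_cyl_dimers[OF N0])
    show "\<exists>p. p permutes {0..<2 * M} \<and> pairing M p = D" if D: "D \<in> (`) ((`) y) ` cyl_dimers m N" for D
    proof -
      obtain D' where "D' \<in> cyl_dimers m N" "D = (`) y ` D'" using D by blast
      then show ?thesis using listing[of D'] by simp
    qed
    show "pf_term M (\<lambda>i j. A $$ (i, j)) p = \<epsilon> * (\<Prod>e\<in>pairing M p. w (x ` e))"
      if p: "p permutes {0..<2 * M}" "pairing M p \<in> (`) ((`) y) ` cyl_dimers m N" for p
    proof -
      obtain D where D: "D \<in> cyl_dimers m N" "pairing M p = (`) y ` D" using p(2) by blast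
      have "pairing M (x \<circ> p) = D" unfolding pairing_compose D(2) by (rule x_y_image[OF D(1)])
      then show ?thesis using pfA[OF p(1)] sign[OF p(1)] D(1) by simp
    qed
    show "pf_term M (\<lambda>i j. A $$ (i, j)) p = 0"
      if p: "p permutes {0..<2 * M}" "pairing M p \<notin> (`) ((`) y) ` cyl_dimers m N" for p
    proof (rule ccontr)
      assume "pf_term M (\<lambda>i j. A $$ (i, j)) p \<noteq> 0"
      \<comment> \<open>A nonvanishing term has a nonzero sign at every pair, so all its pairs are
        edges and it lists a dimer configuration after all.\<close>
      then have "pf_term M ?S p \<noteq> 0" using pfA[OF p(1)] by simp
      then have nz: "?S (p (2 * i)) (p (2 * i + 1)) \<noteq> 0" if "i < M" for i
        using that by (auto simp: pf_term_def prod_zero_iff)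
      have "pairing M (x \<circ> p) \<in> cyl_dimers m N"
      proof (rule pairing_in_dimers[OF N0 x p(1)])
        fix i assume "i < M"
        from nz[OF this] have "(x (p (2 * i)), x (p (2 * i + 1))) \<in> cyl_arcs m N \<or> (x (p (2 * i + 1)), x (p (2 * i))) \<in> cyl_arcs m N"
          by (auto simp: kast_sign_def split: if_splits)
        then show "{x (p (2 * i)), x (p (2 * i + 1))} \<in> cyl_edges m N"
          unfolding edges_of_def by blast
      qed
      then have "(`) y ` pairing M (x \<circ> p) \<in> (`) ((`) y) ` cyl_dimers m N" by (rule imageI)
      then show False using p(2) unfolding yxp[OF p(1)] by contradiction
    qed
    show "\<epsilon>\<^sup>2 = 1" unfolding \<epsilon>_def by (rule pf_term_kast_sign_square[OF N(1) x L0 p0'])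
  qed
  also have "(\<Sum>D\<in>(`) ((`) y) ` cyl_dimers m N. \<Prod>e\<in>D. w (x ` e)) = (\<Sum>D\<in>cyl_dimers m N. \<Prod>e\<in>(`) y ` D. w (x ` e))"
  proof -
    have "inj_on ((`) ((`) y)) (cyl_dimers m N)"
      by (rule inj_on_inverseI[where g = "(`) ((`) x)"]) (rule x_y_image)
    then show ?thesis by (simp add: sum.reindex)
  qed
  also have "\<dots> = dimer_sum m N w"
    unfolding dimer_sum_def
  proof (rule sum.cong[OF refl])
    fix D assume D: "D \<in> cyl_dimers m N"
    have xe: "x ` y ` e = e" if "e \<in> D" for e
    proof -
      have "x (y v) = v" if "v \<in> e" for v using xy Dv[OF D \<open>e \<in> D\<close> that] by blast
      then show ?thesis by (simp add: image_image)
    qed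
    have "inj_on ((`) y) D" using xe by (rule inj_on_inverseI)
    then show "(\<Prod>e\<in>(`) y ` D. w (x ` e)) = (\<Prod>e\<in>D. w e)"
      by (simp add: prod.reindex xe)
  qed
  finally show ?thesis unfolding A_def .
qed

section \<open>Prescribed edges and minors of the inverse\<close>

lemma endpoints_Cons: "endpoints ((u, v) # ps) = u # v # endpoints ps"
  by (simp add: endpoints_def)

lemma endpoints_nth:
  "length (endpoints ps) = 2 * length ps"
  "q < length ps \<Longrightarrow> {endpoints ps ! (2 * q), endpoints ps ! (2 * q + 1)} = map (\<lambda>(u, v). {u, v}) ps ! q"
  "q < length ps \<Longrightarrow> ps ! q = (endpoints ps ! (2 * q), endpoints ps ! (2 * q + 1))"
proof -
  have *: "length (endpoints ps) = 2 * length ps \<and>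
      (\<forall>q < length ps. ps ! q = (endpoints ps ! (2 * q), endpoints ps ! (2 * q + 1)))"
  proof (induction ps)
    case Nil
    show ?case by (simp add: endpoints_def)
  next
    case (Cons a ps)
    obtain u v where a: "a = (u, v)" by fastforce
    have "(a # ps) ! q = (endpoints (a # ps) ! (2 * q), endpoints (a # ps) ! (2 * q + 1))" if "q < length (a # ps)" for q
      using Cons that unfolding a endpoints_Cons by (cases q) auto
    then show ?case using Cons unfolding a endpoints_Cons by simp
  qed
  then show "length (endpoints ps) = 2 * length ps"
    and 3: "q < length ps \<Longrightarrow> ps ! q = (endpoints ps ! (2 * q), endpoints ps ! (2 * q + 1))" by blast+
  show "q < length ps \<Longrightarrow> {endpoints ps ! (2 * q), endpoints ps ! (2 * q + 1)} = map (\<lambda>(u, v). {u, v}) ps ! q"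
    using 3 by simp
qed

lemma cyl_edge_two:
  assumes "N > 0" "{u, v} \<in> cyl_edges m N"
  shows "u \<noteq> v" "u \<in> cyl_vertices m N" "v \<in> cyl_vertices m N"
proof -
  have i: "u \<in> cyl_vertices m N \<and> ({u, v} = {u, cnxt u} \<or> {u, v} = {u, cnxt (cnxt u)} \<or> has_leg m u \<and> {u, v} = {u, cleg N u})"
    by (rule cyl_edge_incident[OF assms]) simp
  then show "u \<in> cyl_vertices m N" by blast
  show "u \<noteq> v" using i not_sym[OF cnxt_simps(2)[of u]] not_sym[OF cnxt_simps(3)[of u]] not_sym[OF cleg_ne(3)[of N u]]
    by (auto simp: doubleton_eq_iff)
  show "v \<in> cyl_vertices m N" using cyl_edge_incident[OF assms, of v] by simp
qed

lemma dimer_unique_edge: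
  "D \<in> cyl_dimers m N \<Longrightarrow> v \<in> cyl_vertices m N \<Longrightarrow> e \<in> D \<Longrightarrow> f \<in> D \<Longrightarrow> v \<in> e \<Longrightarrow> v \<in> f \<Longrightarrow> e = f"
  unfolding dimer_configs_def by blast

definition dimer_event_sum :: "nat \<Rightarrow> nat \<Rightarrow> (vertex set \<Rightarrow> real) \<Rightarrow> (vertex set set \<Rightarrow> bool) \<Rightarrow> real" where
  "dimer_event_sum m N w P = (\<Sum>D | D \<in> cyl_dimers m N \<and> P D. \<Prod>e\<in>D. w e)"

lemma dimer_sum_pos:
  assumes N: "N > 0" and w: "\<And>e. e \<in> cyl_edges m N \<Longrightarrow> w e > 0"
  shows "dimer_sum m N w > 0"
  unfolding dimer_sum_def
proof (rule sum_pos)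
  show "finite (cyl_dimers m N)" by (rule finite_cyl_dimers[OF N])
  show "cyl_dimers m N \<noteq> {}" using dimer_of_config(1)[OF N cfg_empty_config[OF N]] by blast
  show "0 < (\<Prod>e\<in>D. w e)" if "D \<in> cyl_dimers m N" for D
    using that w by (intro prod_pos) (auto simp: dimer_configs_def)
qed

text \<open>A configuration containing \<open>F\<close> uses no other edge at the endpoints
  \<open>U\<close>, so all its weights survive. Otherwise some endpoint of a missing edge of
  \<open>F\<close> is covered by another edge, whose weight has been set to zero.\<close>

lemma dimer_sum_restrict:
  assumes N: "N > 0" and ps: "\<And>q. q < r \<Longrightarrow> {E (2 * q), E (2 * q + 1)} \<in> cyl_edges m N"
    and inj: "inj_on E {0..<2 * r}"
  defines "F \<equiv> pairing r E" and "U \<equiv> E ` {0..<2 * r}"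
  shows "dimer_sum m N (\<lambda>e. if e \<inter> U = {} \<or> e \<in> F then w e else 0) = dimer_event_sum m N w (\<lambda>D. F \<subseteq> D)"
proof -
  have FU: "\<exists>f\<in>F. u \<in> f" if "u \<in> U" for u
  proof -
    obtain s where s: "s < 2 * r" "u = E s" using \<open>u \<in> U\<close> by (auto simp: U_def)
    have "s div 2 < r" "s = 2 * (s div 2) \<or> s = 2 * (s div 2) + 1" using s(1) by auto
    then have "u \<in> {E (2 * (s div 2)), E (2 * (s div 2) + 1)}" using s(2) by (metis insertI1 insertI2)
    then show ?thesis unfolding F_def pairing_def using \<open>s div 2 < r\<close> by blast
  qed
  have Fdis: "f = g" if fg: "f \<in> F" "g \<in> F" "u \<in> f" "u \<in> g" for f g u
  proof -
    obtain a b where ab: "a < r" "f = {E (2 * a), E (2 * a + 1)}" "b < r" "g = {E (2 * b), E (2 * b + 1)}"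
      using fg(1,2) unfolding F_def pairing_def by blast
    have "a = b" by (rule pairing_disjoint[OF inj ab(1,3)]) (use fg ab in blast)
    then show ?thesis using ab by simp
  qed
  have FE: "F \<subseteq> cyl_edges m N" unfolding F_def pairing_def using ps by blast
  have Fin_U: "f \<subseteq> U" if "f \<in> F" for f using that unfolding F_def pairing_def U_def by auto
  have trm: "(\<Prod>e\<in>D. if e \<inter> U = {} \<or> e \<in> F then w e else 0) = (if F \<subseteq> D then \<Prod>e\<in>D. w e else 0)"
    if D: "D \<in> cyl_dimers m N" for D
  proof (cases "F \<subseteq> D")
    case True
    have "e \<inter> U = {} \<or> e \<in> F" if e: "e \<in> D" for e
    proof (rule ccontr)
      assume n: "\<not> (e \<inter> U = {} \<or> e \<in> F)"
      then obtain u where u: "u \<in> e" "u \<in> U" by blast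
      then obtain f where f: "f \<in> F" "u \<in> f" using FU by blast
      have "u \<in> cyl_vertices m N" using cyl_edge_incident[OF N, of f m u] f FE by blast
      then have "e = f" using dimer_unique_edge[OF D _ e, of u f] True f u by blast
      then show False using n f by blast
    qed
    then show ?thesis using True by (auto intro!: prod.cong)
  next
    case False
    then obtain f where f: "f \<in> F" "f \<notin> D" by blast
    then obtain q where q: "q < r" "f = {E (2 * q), E (2 * q + 1)}" unfolding F_def pairing_def by blast
    define u where "u = E (2 * q)"
    have u: "u \<in> f" using q by (simp add: u_def)
    have uV: "u \<in> cyl_vertices m N" using cyl_edge_incident[OF N, of f m u] f(1) FE u by blast
    then obtain e where e: "e \<in> D" "u \<in> e" using D unfolding dimer_configs_def by blast
    have "e \<notin> F" using Fdis[OF _ f(1) e(2) u] e f by blast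
    moreover have "e \<inter> U \<noteq> {}" using e(2) u Fin_U[OF f(1)] by blast
    ultimately have "\<exists>e\<in>D. (if e \<inter> U = {} \<or> e \<in> F then w e else 0) = 0" using e(1) by auto
    moreover have "finite D" using D finite_cyl_edges[OF N, of m] finite_subset unfolding dimer_configs_def by blast
    ultimately have "(\<Prod>e\<in>D. if e \<inter> U = {} \<or> e \<in> F then w e else 0) = 0" by (simp add: prod_zero_iff)
    then show ?thesis using False by simp
  qed
  show ?thesis
    unfolding dimer_sum_def dimer_event_sum_def
    using finite_cyl_dimers[OF N, of m] trm by (simp add: sum.If_cases Int_def)
qed

text \<open>For the restricted weights the matrix splits off the pairs of \<open>F\<close>. Its
  determinant is the square of the restricted sum by \<open>kasteleyn_det\<close>, and also the
  squared full sum times the squared prescribed weights times the minor of the inverse. All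
  quantities under the squares are nonnegative, so roots can be taken.\<close>

lemma cyl_minor_formula:
  assumes N: "N > 1" "even N" and m: "m \<ge> 1" and w: "\<And>e. e \<in> cyl_edges m N \<Longrightarrow> w e > 0"
    and ps: "\<And>u v. (u, v) \<in> set ps \<Longrightarrow> {u, v} \<in> cyl_edges m N"
    and dist: "distinct (map (\<lambda>(u, v). {u, v}) ps)"
  shows "(\<Prod>(u, v)\<leftarrow>ps. w {u, v}) *
      sqrt (Determinant.det (vertex_submatrix m (inv_mat (weighted_kast m N w)) (endpoints ps)))
    = dimer_event_sum m N w (\<lambda>D. set (map (\<lambda>(u, v). {u, v}) ps) \<subseteq> D) / dimer_sum m N w"
proof -
  define r where "r = length ps"
  define E where "E = (\<lambda>i. endpoints ps ! i)"
  define F where "F = set (map (\<lambda>(u, v). {u, v}) ps)"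
  have N0: "N > 0" using N by simp
  have en1: "length (endpoints ps) = 2 * r" unfolding r_def by (rule endpoints_nth(1))
  have en4: "{E (2 * q), E (2 * q + 1)} = map (\<lambda>(u, v). {u, v}) ps ! q" if "q < r" for q
    unfolding E_def using that unfolding r_def by (rule endpoints_nth(2))
  have en5: "ps ! q = (E (2 * q), E (2 * q + 1))" if "q < r" for q
    unfolding E_def using that unfolding r_def by (rule endpoints_nth(3))
  have edge: "{E (2 * q), E (2 * q + 1)} \<in> cyl_edges m N" if q: "q < r" for q
    using ps[of "E (2 * q)" "E (2 * q + 1)"] en5[OF q] q nth_mem[of q ps] by (simp add: r_def)
  have FE: "F = pairing r E"
  proof -
    have "F = (\<lambda>q. map (\<lambda>(u, v). {u, v}) ps ! q) ` {..<r}" 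
      unfolding F_def r_def by (metis length_map nth_image_lessThan)
    also have "\<dots> = pairing r E" unfolding pairing_def by (rule image_cong) (use en4 in auto)
    finally show ?thesis .
  qed
  have EV: "E s \<in> cyl_vertices m N" if s: "s < 2 * r" for s
  proof -
    have "s div 2 < r" "s = 2 * (s div 2) \<or> s = 2 * (s div 2) + 1" using s by auto
    then show ?thesis using cyl_edge_two(2,3)[OF N0 edge[of "s div 2"]] by metis
  qed
  have vsub: "vertex_submatrix m A (endpoints ps) = Matrix.mat (2 * r) (2 * r)
      (\<lambda>(i, j). A $$ (vertex_index m (E i), vertex_index m (E j)))" for A :: "real mat"
    unfolding vertex_submatrix_def en1 E_def by (rule refl)
  define Z where "Z = dimer_sum m N w"
  have Z: "Z > 0" unfolding Z_def by (rule dimer_sum_pos[OF N0 w])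
  define K where "K = weighted_kast m N w"
  have dK: "Determinant.det K = Z\<^sup>2" unfolding K_def Z_def by (rule kasteleyn_det[OF N m])
  show ?thesis
  proof (cases "inj_on E {0..<2 * r}")
    \<comment> \<open>Two distinct prescribed edges share an endpoint: the minor has two equal rows,
      and no dimer configuration contains both edges, so both sides are zero.\<close>
    case False
    then obtain s t where st: "s < 2 * r" "t < 2 * r" "s \<noteq> t" "E s = E t" by (auto simp: inj_on_def)
    have det0: "Determinant.det (vertex_submatrix m (inv_mat K) (endpoints ps)) = 0"
      unfolding vsub
    proof (rule det_identical_rows[OF _ st(3,1,2)])
      show "Matrix.row (Matrix.mat (2 * r) (2 * r) (\<lambda>(i, j). inv_mat K $$ (vertex_index m (E i), vertex_index m (E j)))) s
          = Matrix.row (Matrix.mat (2 * r) (2 * r) (\<lambda>(i, j). inv_mat K $$ (vertex_index m (E i), vertex_index m (E j)))) t"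
        using st by (intro eq_vecI) auto
    qed simp
    have empty: "{D. D \<in> cyl_dimers m N \<and> F \<subseteq> D} = {}"
    proof (rule ccontr)
      assume "{D. D \<in> cyl_dimers m N \<and> F \<subseteq> D} \<noteq> {}"
      then obtain D where D: "D \<in> cyl_dimers m N" "F \<subseteq> D" by blast
      define a b where "a = s div 2" and "b = t div 2"
      have ab: "a < r" "b < r" "s = 2 * a \<or> s = 2 * a + 1" "t = 2 * b \<or> t = 2 * b + 1"
        using st unfolding a_def b_def by auto
      let ?e = "{E (2 * a), E (2 * a + 1)}" and ?f = "{E (2 * b), E (2 * b + 1)}"
      have ef: "?e \<in> D" "?f \<in> D" using D(2) ab(1,2) unfolding FE pairing_def by blast+
      have "E s \<in> ?e" using ab(3) by auto
      moreover have "E s \<in> ?f" using ab(4) unfolding st(4) by auto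
      ultimately have "?e = ?f" using dimer_unique_edge[OF D(1) EV[OF st(1)] ef] by blast
      then have "map (\<lambda>(u, v). {u, v}) ps ! a = map (\<lambda>(u, v). {u, v}) ps ! b"
        using en4[OF ab(1)] en4[OF ab(2)] by simp
      then have "a = b" using dist ab(1,2) by (simp add: nth_eq_iff_index_eq r_def del: nth_map)
      then have "E (2 * a) = E (2 * a + 1)" using ab st(3,4) by auto
      then show False using cyl_edge_two(1)[OF N0 edge[OF ab(1)]] by simp
    qed
    have "dimer_event_sum m N w (\<lambda>D. F \<subseteq> D) = 0" unfolding dimer_event_sum_def empty by simp
    then show ?thesis unfolding K_def[symmetric] F_def[symmetric] det0 by simp
  next
    case inj: True
    define U where "U = E ` {0..<2 * r}"
    define w' where "w' e = (if e \<inter> U = {} \<or> e \<in> F then w e else 0)" for e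
    define K' where "K' = weighted_kast m N w'"
    define x where "x = vertex_at m N"
    let ?n = "2 * (3 * m * N)"
    define us where "us = map (vertex_index m) (endpoints ps)"
    have us_len: "length us = 2 * r" unfolding us_def using en1 by simp
    have us_nth: "us ! s = vertex_index m (E s)" if "s < 2 * r" for s
      unfolding us_def E_def using that en1 by simp
    have x_us: "x (us ! s) = E s" if "s < 2 * r" for s
      unfolding x_def us_nth[OF that] by (rule bij_betw_vertex_at(2)[OF N0 EV[OF that]])
    have us_lt: "us ! s < ?n" if "s < 2 * r" for s unfolding us_nth[OF that] by (rule bij_betw_vertex_at(3)[OF N0 EV[OF that]])
    have us_dist: "distinct us"
      unfolding distinct_conv_nth us_len
    proof (intro allI impI)
      fix s t assume "s < 2 * r" "t < 2 * r" "s \<noteq> t"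
      then show "us ! s \<noteq> us ! t" using inj x_us by (metis atLeastLessThan_iff inj_onD zero_le)
    qed
    have us_sub: "set us \<subseteq> {0..<?n}" using us_lt us_len by (auto simp: in_set_conv_nth)
    have x_inj: "inj_on x {0..<?n}" using bij_betw_vertex_at(1)[OF N0] unfolding x_def bij_betw_def by blast
    have us_in: "i \<in> set us \<longleftrightarrow> x i \<in> U" if i: "i < ?n" for i
    proof
      assume "i \<in> set us"
      then show "x i \<in> U" using x_us us_len by (auto simp: in_set_conv_nth U_def)
    next
      assume "x i \<in> U"
      then obtain s where s: "s < 2 * r" "x i = E s" by (auto simp: U_def)
      then have "x i = x (us ! s)" using x_us by simp
      then have "i = us ! s" using inj_onD[OF x_inj, of i "us ! s"] i us_lt[OF s(1)] by simp
      then show "i \<in> set us" using s us_len by (metis nth_mem)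
    qed
    have FU: "f \<subseteq> U" if "f \<in> F" for f using that unfolding FE pairing_def U_def by auto
    have Kc: "K \<in> carrier_mat ?n ?n" "K' \<in> carrier_mat ?n ?n"
      unfolding K_def K'_def weighted_kast_def by simp_all
    have Kij: "K $$ (i, j) = kast_sign m N (x i) (x j) * w {x i, x j}"
      "K' $$ (i, j) = kast_sign m N (x i) (x j) * w' {x i, x j}" if "i < ?n" "j < ?n" for i j
      using that unfolding K_def K'_def weighted_kast_def x_def by simp_all
    \<comment> \<open>The matrix entry at the prescribed edge in its listed direction; its sign
      depends on that direction and disappears in the square.\<close>
    define c where "c q = kast_sign m N (E (2 * q)) (E (2 * q + 1)) * w {E (2 * q), E (2 * q + 1)}" for q
    have dis: "q = q'" if "q < r" "q' < r" "{E (2 * q), E (2 * q + 1)} \<inter> {E (2 * q'), E (2 * q' + 1)} \<noteq> {}" for q q'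
      using pairing_disjoint[OF inj that] .
    have bl: "K' $$ (us ! s, us ! t) = block_skew r c $$ (s, t)" if st: "s < 2 * r" "t < 2 * r" for s t
    proof -
      have e: "K' $$ (us ! s, us ! t) = kast_sign m N (E s) (E t) * w' {E s, E t}"
        using Kij(2)[OF us_lt[OF st(1)] us_lt[OF st(2)]] x_us st by simp
      define a b where "a = s div 2" and "b = t div 2"
      have ab: "a < r" "b < r" "s = 2 * a \<or> s = 2 * a + 1" "t = 2 * b \<or> t = 2 * b + 1"
        using st unfolding a_def b_def by auto
      have sk: "kast_sign m N (E t) (E s) = - kast_sign m N (E s) (E t)" for s t by (rule kast_sign_skew[OF N0])
      show ?thesis
      proof (cases "a = b")
        case True
        have inF: "{E (2 * a), E (2 * a + 1)} \<in> F" unfolding FE pairing_def using ab(1) by blast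
        then have w'a: "w' {E (2 * a), E (2 * a + 1)} = w {E (2 * a), E (2 * a + 1)}"
          "w' {E (2 * a + 1), E (2 * a)} = w {E (2 * a), E (2 * a + 1)}" by (simp_all add: w'_def insert_commute)
        have bs: "block_skew r c $$ (s, t) = (if s < t then c a else if t < s then - c a else 0)"
          using st True unfolding a_def b_def by (simp add: block_skew_def)
        consider "s = t" | "s = 2 * a" "t = 2 * a + 1" | "s = 2 * a + 1" "t = 2 * a" using ab(3,4) True by auto
        then show ?thesis
        proof cases
          case 1
          then show ?thesis using e bs sk[of s s] by simp
        next
          case 2
          then show ?thesis unfolding e bs c_def using w'a by simp
        next
          case 3
          then show ?thesis unfolding e bs c_def using w'a sk[of "2 * a" "2 * a + 1"] by simp
        qed
      next
        case False
        have "{E s, E t} \<notin> F"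
        proof
          assume "{E s, E t} \<in> F"
          then obtain q where q: "q < r" "{E s, E t} = {E (2 * q), E (2 * q + 1)}" unfolding FE pairing_def by blast
          have "E s \<in> {E (2 * a), E (2 * a + 1)}" "E t \<in> {E (2 * b), E (2 * b + 1)}" using ab(3,4) by blast+
          then have "a = q" "b = q" using dis[OF ab(1) q(1)] dis[OF ab(2) q(1)] q(2) by blast+
          then show False using False by simp
        qed
        moreover have "{E s, E t} \<inter> U \<noteq> {}" using st(1) unfolding U_def by auto
        ultimately have "w' {E s, E t} = 0" unfolding w'_def by auto
        then show ?thesis using e st False unfolding a_def b_def by (simp add: block_skew_def)
      qed
    qed
    have dets: "Determinant.det K' = Determinant.det K * (\<Prod>q<r. c q)\<^sup>2 *
        Determinant.det (Matrix.mat (2 * r) (2 * r) (\<lambda>(i, j). inv_mat K $$ (us ! i, us ! j)))"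
    proof (rule det_inverse_minor[OF Kc(1) _ us_dist us_sub us_len Kc(2) _ _ bl])
      show "Determinant.det K \<noteq> 0" using dK Z by simp
      show "K' $$ (i, j) = K $$ (i, j)" if "i < ?n" "j < ?n" "i \<notin> set us" "j \<notin> set us" for i j
      proof -
        have "{x i, x j} \<inter> U = {}" using that us_in by blast
        then show ?thesis unfolding Kij[OF that(1,2)] by (simp add: w'_def)
      qed
      show "K' $$ (i, j) = 0" if ij: "i < ?n" "j < ?n" "(i \<in> set us) \<noteq> (j \<in> set us)" for i j
      proof -
        have "{x i, x j} \<inter> U \<noteq> {}" "\<not> {x i, x j} \<subseteq> U" using ij us_in by blast+
        then have "w' {x i, x j} = 0" using FU by (auto simp: w'_def)
        then show ?thesis unfolding Kij[OF ij(1,2)] by simp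
      qed
    qed
    have sub: "Matrix.mat (2 * r) (2 * r) (\<lambda>(i, j). inv_mat K $$ (us ! i, us ! j)) = vertex_submatrix m (inv_mat K) (endpoints ps)"
      unfolding vsub by (rule eq_matI) (simp_all add: us_nth)
    define ZF where "ZF = dimer_event_sum m N w (\<lambda>D. F \<subseteq> D)"
    have "dimer_sum m N w' = ZF"
      unfolding w'_def ZF_def FE U_def by (rule dimer_sum_restrict[OF N0 edge inj])
    then have dK': "Determinant.det K' = ZF\<^sup>2" unfolding K'_def kasteleyn_det[OF N m] by simp
    define p where "p = (\<Prod>q<r. w {E (2 * q), E (2 * q + 1)})"
    have "(\<Prod>q<r. c q)\<^sup>2 = p\<^sup>2"
    proof -
      have "(c q)\<^sup>2 = (w {E (2 * q), E (2 * q + 1)})\<^sup>2" if q: "q < r" for q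
      proof -
        have "(E (2 * q), E (2 * q + 1)) \<in> cyl_arcs m N \<or> (E (2 * q + 1), E (2 * q)) \<in> cyl_arcs m N"
          using edge[OF q] unfolding edges_of_def by (auto simp: doubleton_eq_iff)
        then have "(kast_sign m N (E (2 * q)) (E (2 * q + 1)))\<^sup>2 = 1"
          using cyl_arcs_asym[OF N0] by (auto simp: kast_sign_def)
        then show ?thesis unfolding c_def by (simp add: power_mult_distrib)
      qed
      then show ?thesis unfolding p_def prod_power_distrib by simp
    qed
    then have eq: "ZF\<^sup>2 = Z\<^sup>2 * p\<^sup>2 * Determinant.det (vertex_submatrix m (inv_mat K) (endpoints ps))"
      using dets unfolding dK dK' sub by simp
    have p: "p > 0" unfolding p_def by (rule prod_pos) (use w edge in auto)
    have ZF: "ZF \<ge> 0" unfolding ZF_def dimer_event_sum_def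
    proof (rule sum_nonneg)
      fix D assume "D \<in> {D \<in> cyl_dimers m N. F \<subseteq> D}"
      then have "D \<subseteq> cyl_edges m N" by (auto simp: dimer_configs_def)
      then show "0 \<le> (\<Prod>e\<in>D. w e)" using w by (intro prod_nonneg) (auto intro: less_imp_le)
    qed
    have "Determinant.det (vertex_submatrix m (inv_mat K) (endpoints ps)) = (ZF / (Z * p))\<^sup>2"
      using eq Z p by (simp add: field_simps power_mult_distrib)
    then have "sqrt (Determinant.det (vertex_submatrix m (inv_mat K) (endpoints ps))) = ZF / (Z * p)"
      using ZF Z p by simp
    moreover have "(\<Prod>(u, v)\<leftarrow>ps. w {u, v}) = p"
    proof -
      have "(\<Prod>(u, v)\<leftarrow>ps. w {u, v}) = (\<Prod>q<r. (\<lambda>(u, v). w {u, v}) (ps ! q))"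
        by (simp add: prod.list_conv_set_nth r_def lessThan_atLeast0)
      also have "\<dots> = p" unfolding p_def by (rule prod.cong[OF refl]) (use en5 in auto)
      finally show ?thesis .
    qed
    ultimately show ?thesis unfolding K_def[symmetric] F_def[symmetric] ZF_def[symmetric] Z_def[symmetric]
      using p by simp
  qed
qed

section \<open>Boltzmann probabilities as ratios of dimer sums\<close>

lemma measure_boltzmann:
  assumes fin: "finite (dimer_configs V E)" and nn: "\<And>D. D \<in> dimer_configs V E \<Longrightarrow> (\<Prod>e\<in>D. w e) \<ge> 0"
    and Z: "(\<Sum>D\<in>dimer_configs V E. \<Prod>e\<in>D. w e) > 0" and X: "X \<subseteq> dimer_configs V E"
  shows "measure (boltzmann_measure V E w) X = (\<Sum>D\<in>X. \<Prod>e\<in>D. w e) / (\<Sum>D\<in>dimer_configs V E. \<Prod>e\<in>D. w e)"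
proof -
  let ?Z = "\<Sum>D\<in>dimer_configs V E. \<Prod>e\<in>D. w e"
  have q: "(\<Prod>e\<in>D. w e) / ?Z \<ge> 0" if "D \<in> X" for D using nn X that Z by (intro divide_nonneg_pos) auto
  have "emeasure (boltzmann_measure V E w) X = (\<Sum>D\<in>X. ennreal ((\<Prod>e\<in>D. w e) / ?Z))"
    unfolding boltzmann_measure_def by (rule emeasure_point_measure_finite[OF fin X])
  also have "\<dots> = ennreal (\<Sum>D\<in>X. (\<Prod>e\<in>D. w e) / ?Z)" by (rule sum_ennreal[OF q])
  finally have "measure (boltzmann_measure V E w) X = (\<Sum>D\<in>X. (\<Prod>e\<in>D. w e) / ?Z)"
    using q by (simp add: measure_def sum_nonneg)
  then show ?thesis by (simp add: sum_divide_distrib)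
qed

lemma space_boltzmann: "space (boltzmann_measure V E w) = dimer_configs V E"
  by (simp add: boltzmann_measure_def space_point_measure)

lemma cyl_weight_pos:
  assumes "fisher_band_weight m n W" "n dvd N" "e \<in> cyl_edges m N"
  shows "cyl_weight m N W e > 0"
proof -
  obtain u v where "e = {u, v}" "(u, v) \<in> cyl_arcs m N" using assms(3) unfolding edges_of_def by blast
  then obtain u' v' where uv: "(u', v') \<in> band_arcs m" "e = reduce N ` {u', v'}" unfolding cyl_arcs_def by auto
  then have b: "{u', v'} \<in> band_edges m" unfolding edges_of_def by blast
  have "cyl_weight m N W e = W {u', v'}" unfolding uv(2) by (rule cyl_weight_reduce[OF assms(1,2) b])
  then show ?thesis using assms(1) b by (simp add: fisher_band_weight_def)
qed

lemma measure_cyl_boltzmann: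
  assumes N: "N > 0" and W: "fisher_band_weight m n W" "n dvd N"
  shows "measure (cyl_boltzmann m N W) {D \<in> space (cyl_boltzmann m N W). P D}
       = dimer_event_sum m N (cyl_weight m N W) P / dimer_sum m N (cyl_weight m N W)"
proof -
  note pos = cyl_weight_pos[OF W]
  have nn: "(\<Prod>e\<in>D. cyl_weight m N W e) \<ge> 0" if "D \<in> cyl_dimers m N" for D
    using that pos by (intro prod_nonneg) (auto simp: dimer_configs_def intro!: less_imp_le)
  show ?thesis
    unfolding cyl_boltzmann_def space_boltzmann dimer_event_sum_def dimer_sum_def
    by (rule measure_boltzmann[OF finite_cyl_dimers[OF N] nn dimer_sum_pos[OF N pos, unfolded dimer_sum_def]]) auto
qed

lemma kast_mat_eq: "kast_mat m N W (-1) = weighted_kast m N (cyl_weight m N W)"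
  unfolding kast_mat_def weighted_kast_def by (rule eq_matI) (simp_all add: kast_entry_sign)

section \<open>A Perron limit for two positive blocks\<close>

definition mat_vec :: "'s set \<Rightarrow> ('s \<Rightarrow> 's \<Rightarrow> real) \<Rightarrow> ('s \<Rightarrow> real) \<Rightarrow> 's \<Rightarrow> real" where
  "mat_vec S A f s = (\<Sum>u\<in>S. A s u * f u)"

definition kmult :: "'s set \<Rightarrow> ('s \<Rightarrow> 's \<Rightarrow> real) \<Rightarrow> ('s \<Rightarrow> 's \<Rightarrow> real) \<Rightarrow> 's \<Rightarrow> 's \<Rightarrow> real" where
  "kmult S A B s t = (\<Sum>u\<in>S. A s u * B u t)"

primrec kpow :: "'s set \<Rightarrow> ('s \<Rightarrow> 's \<Rightarrow> real) \<Rightarrow> nat \<Rightarrow> 's \<Rightarrow> 's \<Rightarrow> real" where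
  "kpow S A 0 = (\<lambda>s t. if s = t then 1 else 0)"
| "kpow S A (Suc l) = kmult S A (kpow S A l)"

lemma mat_vec_pos:
  assumes "finite S" "S \<noteq> {}" "\<And>u. u \<in> S \<Longrightarrow> A s u > 0" "\<And>u. u \<in> S \<Longrightarrow> f u > 0"
  shows "mat_vec S A f s > 0"
  unfolding mat_vec_def using assms by (intro sum_pos) auto

lemma funpow_mat_vec: "(mat_vec S A ^^ Suc l) f s = (\<Sum>u\<in>S. A s u * (mat_vec S A ^^ l) f u)"
  by (simp add: mat_vec_def[of S A "(mat_vec S A ^^ l) f"])

text \<open>The new ratio at \<open>s\<close> is an average of the old ratios with probability
  weights \<open>p s\<close>. Any two of these distributions satisfy
  \<open>p s' \<ge> k\<^sup>2 * p s\<close>, so they share mass \<open>k\<^sup>2\<close> and the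
  oscillation shrinks by the factor \<open>1 - k\<^sup>2\<close>: a Doeblin type
  contraction.\<close>

lemma ratio_step:
  fixes A :: "'s \<Rightarrow> 's \<Rightarrow> real"
  assumes S: "finite S" "S \<noteq> {}" and A: "\<And>s u. s \<in> S \<Longrightarrow> u \<in> S \<Longrightarrow> A s u > 0"
    and k: "0 < k" "k \<le> 1" "\<And>s s' u. s \<in> S \<Longrightarrow> s' \<in> S \<Longrightarrow> u \<in> S \<Longrightarrow> k * A s u \<le> A s' u"
    and G: "\<And>u. u \<in> S \<Longrightarrow> G u > 0"
    and lo: "\<And>u. u \<in> S \<Longrightarrow> lo \<le> F u / G u" and hi: "\<And>u. u \<in> S \<Longrightarrow> F u / G u \<le> hi"
    and s: "s \<in> S" "s' \<in> S"
  defines "h \<equiv> \<lambda>s. mat_vec S A F s / mat_vec S A G s"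
  shows "lo \<le> h s" "h s \<le> hi" "h s - h s' \<le> (1 - k\<^sup>2) * (hi - lo)"
proof -
  define p where "p s u = A s u * G u / mat_vec S A G s" for s u
  have mG: "mat_vec S A G s > 0" if "s \<in> S" for s by (rule mat_vec_pos) (use S A G that in auto)
  have p0: "p s u \<ge> 0" if "s \<in> S" "u \<in> S" for s u
    unfolding p_def using A[OF that] G[OF that(2)] mG[OF that(1)] by simp
  have p1: "(\<Sum>u\<in>S. p s u) = 1" if "s \<in> S" for s
    unfolding p_def sum_divide_distrib[symmetric] using mG[OF that] by (simp add: mat_vec_def)
  have hp: "h s = (\<Sum>u\<in>S. p s u * (F u / G u))" for s
  proof -
    have "(\<Sum>u\<in>S. p s u * (F u / G u)) = (\<Sum>u\<in>S. A s u * F u / mat_vec S A G s)"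
      by (rule sum.cong) (use G in \<open>auto simp: p_def less_imp_neq[symmetric]\<close>)
    then show ?thesis by (simp add: h_def mat_vec_def sum_divide_distrib)
  qed
  have ge: "lo \<le> h s" if s: "s \<in> S" for s
  proof -
    have "(\<Sum>u\<in>S. p s u * lo) \<le> h s"
      unfolding hp by (intro sum_mono mult_left_mono lo p0 s)
    then show ?thesis using p1[OF s] by (simp flip: sum_distrib_right)
  qed
  have le: "h s \<le> hi" if s: "s \<in> S" for s
  proof -
    have "h s \<le> (\<Sum>u\<in>S. p s u * hi)"
      unfolding hp by (intro sum_mono mult_left_mono hi p0 s)
    then show ?thesis using p1[OF s] by (simp flip: sum_distrib_right)
  qed
  \<comment> \<open>One factor \<open>k\<close> comes from comparing the entries of the two rows,
    the other from comparing their normalisations.\<close>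
  have pp: "k\<^sup>2 * p s u \<le> p s' u" if u: "u \<in> S" for u
  proof -
    have "k * mat_vec S A G s' \<le> mat_vec S A G s"
      unfolding mat_vec_def sum_distrib_left mult.assoc[symmetric]
      by (intro sum_mono mult_right_mono k(3) s) (use G in \<open>auto intro: less_imp_le\<close>)
    moreover have "k * (A s u * G u) \<le> A s' u * G u"
      using mult_right_mono[OF k(3)[OF s u], of "G u"] G[OF u] by (simp add: mult.assoc)
    moreover have "0 \<le> A s' u * G u" "0 \<le> k * mat_vec S A G s'"
      using k(1) A[OF s(2) u] G[OF u] mG[OF s(2)] by simp_all
    ultimately have "(k * (A s u * G u)) * (k * mat_vec S A G s') \<le> (A s' u * G u) * mat_vec S A G s"
      by (metis mult_mono)
    then show ?thesis unfolding p_def using mG[OF s(1)] mG[OF s(2)]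
      by (simp add: divide_simps power2_eq_square mult_ac)
  qed
  \<comment> \<open>The coefficients are nonnegative with total mass \<open>1 - k\<^sup>2\<close>,
    so replacing the ratios by \<open>lo\<close> bounds the sum from below.\<close>
  have "(\<Sum>u\<in>S. (p s' u - k\<^sup>2 * p s u) * lo) \<le> (\<Sum>u\<in>S. (p s' u - k\<^sup>2 * p s u) * (F u / G u))"
    by (intro sum_mono mult_left_mono lo) (use pp in auto)
  also have "\<dots> = h s' - k\<^sup>2 * h s"
    unfolding hp by (simp only: sum_subtractf left_diff_distrib sum_distrib_left mult.assoc)
  also have "(\<Sum>u\<in>S. (p s' u - k\<^sup>2 * p s u) * lo) = (1 - k\<^sup>2) * lo"
    using p1[OF s(1)] p1[OF s(2)] by (simp add: sum_subtractf flip: sum_distrib_right sum_distrib_left)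
  finally have 1: "(1 - k\<^sup>2) * lo \<le> h s' - k\<^sup>2 * h s" .
  have "(1 - k\<^sup>2) * h s \<le> (1 - k\<^sup>2) * hi"
    by (rule mult_left_mono[OF le[OF s(1)]]) (use k in \<open>simp add: power_le_one\<close>)
  then show "h s - h s' \<le> (1 - k\<^sup>2) * (hi - lo)" using 1 by (simp add: algebra_simps)
  show "lo \<le> h s" "h s \<le> hi" using ge le s by auto
qed

text \<open>The minimum of the ratios increases, the maximum decreases and their difference decays
  geometrically; the limit therefore does not depend on \<open>s\<close>. It is positive because the
  initial minimum is.\<close>

lemma ratio_limit:
  fixes A :: "'s \<Rightarrow> 's \<Rightarrow> real"
  assumes S: "finite S" "S \<noteq> {}" and A: "\<And>s u. s \<in> S \<Longrightarrow> u \<in> S \<Longrightarrow> A s u > 0"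
    and f: "\<And>u. u \<in> S \<Longrightarrow> f u > 0" and g: "\<And>u. u \<in> S \<Longrightarrow> g u > 0"
  shows "\<exists>c>0. \<forall>s\<in>S. (\<lambda>l. (mat_vec S A ^^ l) f s / (mat_vec S A ^^ l) g s) \<longlonglongrightarrow> c"
proof -
  define a where "a = Min ((\<lambda>(s, u). A s u) ` (S \<times> S))"
  define b where "b = Max ((\<lambda>(s, u). A s u) ` (S \<times> S))"
  have fin: "finite ((\<lambda>(s, u). A s u) ` (S \<times> S))" "(\<lambda>(s, u). A s u) ` (S \<times> S) \<noteq> {}" using S by auto
  have ab: "a \<le> A s u" "A s u \<le> b" if "s \<in> S" "u \<in> S" for s u
    unfolding a_def b_def using fin that by (auto intro!: Min_le Max_ge)
  have "a \<in> (\<lambda>(s, u). A s u) ` (S \<times> S)" unfolding a_def by (rule Min_in[OF fin])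
  then have a: "a > 0" using A by auto
  obtain s0 where s0: "s0 \<in> S" using S(2) by blast
  have b: "b > 0" "a \<le> b" using ab[OF s0 s0] a by linarith+
  \<comment> \<open>Least over greatest entry of \<open>A\<close>, which makes any two rows
    comparable.\<close>
  define k where "k = a / b"
  have k: "0 < k" "k \<le> 1" unfolding k_def using a b by auto
  have kA: "k * A s u \<le> A s' u" if "s \<in> S" "s' \<in> S" "u \<in> S" for s s' u
  proof -
    have "k * A s u \<le> k * b" using ab(2)[OF that(1,3)] k by (intro mult_left_mono) auto
    also have "\<dots> = a" using b by (simp add: k_def)
    also have "\<dots> \<le> A s' u" by (rule ab(1)[OF that(2,3)])
    finally show ?thesis .
  qed
  define F G where "F l = (mat_vec S A ^^ l) f" and "G l = (mat_vec S A ^^ l) g" for l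
  have FS: "F (Suc l) = mat_vec S A (F l)" "G (Suc l) = mat_vec S A (G l)" for l by (auto simp: F_def G_def)
  have Gp: "u \<in> S \<Longrightarrow> G l u > 0" for l u
    by (induction l arbitrary: u) (auto simp: FS intro!: mat_vec_pos S A, simp add: G_def g)
  have Fp: "u \<in> S \<Longrightarrow> F l u > 0" for l u
    by (induction l arbitrary: u) (auto simp: FS intro!: mat_vec_pos S A, simp add: F_def f)
  define h where "h l s = F l s / G l s" for l s
  define lo hi where "lo l = Min (h l ` S)" and "hi l = Max (h l ` S)" for l
  have lh: "lo l \<le> h l s" "h l s \<le> hi l" if "s \<in> S" for l s
    unfolding lo_def hi_def using S that by auto
  have att: "\<exists>s\<in>S. lo l = h l s" "\<exists>s\<in>S. hi l = h l s" for l
  proof -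
    have "finite (h l ` S)" "h l ` S \<noteq> {}" using S by auto
    from Min_in[OF this] Max_in[OF this] show "\<exists>s\<in>S. lo l = h l s" "\<exists>s\<in>S. hi l = h l s"
      unfolding lo_def hi_def by blast+
  qed
  have step: "lo l \<le> h (Suc l) s" "h (Suc l) s \<le> hi l" "h (Suc l) s - h (Suc l) s' \<le> (1 - k\<^sup>2) * (hi l - lo l)"
    if "s \<in> S" "s' \<in> S" for l s s'
    unfolding h_def FS
    by (rule ratio_step[OF S A k kA Gp lh[unfolded h_def] that]; assumption)+
  have loS: "lo l \<le> lo (Suc l)" for l using att(1)[of "Suc l"] step(1) by metis
  have hiS: "hi (Suc l) \<le> hi l" for l using att(2)[of "Suc l"] step(2) by metis
  have osc: "hi l - lo l \<le> (1 - k\<^sup>2) ^ l * (hi 0 - lo 0)" for l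
  proof (induction l)
    case (Suc l)
    obtain s s' where "s \<in> S" "s' \<in> S" "hi (Suc l) = h (Suc l) s" "lo (Suc l) = h (Suc l) s'" using att by metis
    then have "hi (Suc l) - lo (Suc l) \<le> (1 - k\<^sup>2) * (hi l - lo l)" using step(3) by simp
    also have "\<dots> \<le> (1 - k\<^sup>2) * ((1 - k\<^sup>2) ^ l * (hi 0 - lo 0))"
      by (rule mult_left_mono[OF Suc]) (use k in \<open>simp add: power_le_one\<close>)
    finally show ?case by simp
  qed simp
  have lohi: "lo l \<le> hi l" for l using lh[OF s0, of l] by simp
  have inc: "incseq lo" and dec: "decseq hi" using loS hiS by (auto intro: incseq_SucI decseq_SucI)
  have "lo l \<le> hi 0" for l using lohi[of l] decseqD[OF dec, of 0 l] by simp
  then obtain c where c: "lo \<longlonglongrightarrow> c" "\<forall>i. lo i \<le> c" using incseq_convergent[OF inc] by blast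
  have "k\<^sup>2 \<le> 1" "0 < k\<^sup>2" using k by (simp_all add: power_le_one)
  then have "\<bar>1 - k\<^sup>2\<bar> < 1" by linarith
  then have g0: "(\<lambda>l. (1 - k\<^sup>2) ^ l * (hi 0 - lo 0)) \<longlonglongrightarrow> 0"
    by (intro tendsto_mult_left_zero LIMSEQ_abs_realpow_zero2)
  have d0: "(\<lambda>l. hi l - lo l) \<longlonglongrightarrow> 0"
  proof (rule real_tendsto_sandwich[OF _ _ tendsto_const g0])
    show "\<forall>\<^sub>F l in sequentially. 0 \<le> hi l - lo l" using lohi by (simp add: eventually_sequentially)
    show "\<forall>\<^sub>F l in sequentially. hi l - lo l \<le> (1 - k\<^sup>2) ^ l * (hi 0 - lo 0)"
      by (rule always_eventually) (rule allI, rule osc)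
  qed
  have hc: "hi \<longlonglongrightarrow> c" using tendsto_add[OF d0 c(1)] by simp
  have "lo 0 > 0" using att(1)[of 0] Fp Gp by (auto simp: h_def)
  then have "c > 0" using c(2)[rule_format, of 0] by linarith
  moreover have "(\<lambda>l. h l s) \<longlonglongrightarrow> c" if "s \<in> S" for s
    by (rule real_tendsto_sandwich[OF _ _ c(1) hc]) (rule always_eventually, rule allI, rule lh[OF that])+
  ultimately show ?thesis unfolding h_def F_def G_def by blast
qed

lemma kpow_Suc_right:
  assumes "finite S" "s \<in> S" "t \<in> S"
  shows "kpow S A (Suc l) s t = (\<Sum>u\<in>S. kpow S A l s u * A u t)"
  using assms(2)
proof (induction l arbitrary: s)
  case 0
  have "(\<Sum>u\<in>S. A s u * (if u = t then 1 else 0)) = (\<Sum>u\<in>S. if u = t then A s u else 0)"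
    "(\<Sum>u\<in>S. (if s = u then 1 else 0) * A u t) = (\<Sum>u\<in>S. if s = u then A u t else 0)"
    by (auto intro!: sum.cong)
  then show ?case using assms 0 by (simp add: kmult_def)
next
  case (Suc l)
  have "kpow S A (Suc (Suc l)) s t = (\<Sum>v\<in>S. A s v * (\<Sum>u\<in>S. kpow S A l v u * A u t))"
    unfolding kpow.simps(2)[of S A "Suc l"] kmult_def[of S A "kpow S A (Suc l)"] using Suc.IH by (intro sum.cong) auto
  also have "\<dots> = (\<Sum>v\<in>S. \<Sum>u\<in>S. A s v * kpow S A l v u * A u t)"
    by (simp add: sum_distrib_left mult.assoc)
  also have "\<dots> = (\<Sum>u\<in>S. \<Sum>v\<in>S. A s v * kpow S A l v u * A u t)" by (rule sum.swap)
  also have "\<dots> = (\<Sum>u\<in>S. kpow S A (Suc l) s u * A u t)" by (simp add: kmult_def sum_distrib_right)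
  finally show ?case .
qed

text \<open>No spectral theory enters. Ratios of rows of the powers converge to a vector
  \<open>r\<close>, which turns out to be an eigenvector; comparing each column of \<open>A\<close>
  with \<open>r\<close> under iteration then gives the growth of every entry.\<close>

lemma perron_limit:
  fixes A :: "'s \<Rightarrow> 's \<Rightarrow> real"
  assumes S: "finite S" "S \<noteq> {}" and A: "\<And>s u. s \<in> S \<Longrightarrow> u \<in> S \<Longrightarrow> A s u > 0"
  shows "\<exists>lam>0. \<exists>L. \<forall>s\<in>S. \<forall>t\<in>S. L s t > 0 \<and> (\<lambda>l. kpow S A l s t / lam ^ l) \<longlonglongrightarrow> L s t"
proof -
  obtain s0 where s0: "s0 \<in> S" using S(2) by blast
  have row: "kpow S A (Suc l) s t = (mat_vec S (\<lambda>t u. A u t) ^^ l) (A s) t" if "s \<in> S" "t \<in> S" for l s t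
    using that(2)
  proof (induction l arbitrary: t)
    case 0
    have "(\<Sum>u\<in>S. A s u * (if u = t then 1 else 0)) = (\<Sum>u\<in>S. if u = t then A s u else 0)"
      by (auto intro!: sum.cong)
    then show ?case using 0 S by (simp add: kmult_def)
  next
    case (Suc l)
    have "kpow S A (Suc (Suc l)) s t = (\<Sum>u\<in>S. kpow S A (Suc l) s u * A u t)"
      by (rule kpow_Suc_right[OF S(1) that(1) Suc.prems])
    also have "\<dots> = (\<Sum>u\<in>S. A u t * (mat_vec S (\<lambda>t u. A u t) ^^ l) (A s) u)"
      using Suc.IH by (intro sum.cong) (auto simp: mult.commute)
    finally show ?case unfolding funpow_mat_vec .
  qed
  have col: "kpow S A (Suc l) s t = (mat_vec S A ^^ l) (\<lambda>s. A s t) s" if "s \<in> S" "t \<in> S" for l s t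
    using that(1)
  proof (induction l arbitrary: s)
    case 0
    have "(\<Sum>u\<in>S. A s u * (if u = t then 1 else 0)) = (\<Sum>u\<in>S. if u = t then A s u else 0)"
      by (auto intro!: sum.cong)
    then show ?case using that S by (simp add: kmult_def)
  next
    case (Suc l)
    have "kpow S A (Suc (Suc l)) s t = (\<Sum>u\<in>S. A s u * kpow S A (Suc l) u t)" by (simp add: kmult_def)
    also have "\<dots> = (\<Sum>u\<in>S. A s u * (mat_vec S A ^^ l) (\<lambda>s. A s t) u)"
      using Suc.IH by (intro sum.cong refl arg_cong2[where f = "(*)"])
    finally show ?case unfolding funpow_mat_vec .
  qed
  have kp: "kpow S A (Suc l) s t > 0" if "s \<in> S" "t \<in> S" for l s t
    using that(1)
  proof (induction l arbitrary: s)
    case 0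
    then show ?case using col[OF 0 that(2), of 0] A that by simp
  next
    case (Suc l)
    have "mat_vec S A (\<lambda>u. kpow S A (Suc l) u t) s > 0" by (rule mat_vec_pos[OF S]) (use A Suc in auto)
    then show ?case by (simp add: kmult_def mat_vec_def)
  qed
  \<comment> \<open>\<open>ratio_limit\<close> for the transposed matrix: the limiting ratio of row
    \<open>s\<close> to row \<open>s0\<close> is the same in all columns.\<close>
  have "\<exists>c>0. \<forall>t\<in>S. (\<lambda>l. kpow S A (Suc l) s t / kpow S A (Suc l) s0 t) \<longlonglongrightarrow> c" if s: "s \<in> S" for s
  proof -
    have "\<exists>c>0. \<forall>t\<in>S. (\<lambda>l. (mat_vec S (\<lambda>t u. A u t) ^^ l) (A s) t / (mat_vec S (\<lambda>t u. A u t) ^^ l) (A s0) t) \<longlonglongrightarrow> c"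
      by (rule ratio_limit[OF S]) (use A s s0 in auto)
    then obtain c where "c > 0" "\<forall>t\<in>S. (\<lambda>l. (mat_vec S (\<lambda>t u. A u t) ^^ l) (A s) t / (mat_vec S (\<lambda>t u. A u t) ^^ l) (A s0) t) \<longlonglongrightarrow> c"
      by blast
    then show ?thesis by (intro exI[of _ c] conjI ballI) (simp_all only: row[OF s] row[OF s0])
  qed
  then obtain r where r: "\<And>s. s \<in> S \<Longrightarrow> r s > 0"
    "\<And>s t. s \<in> S \<Longrightarrow> t \<in> S \<Longrightarrow> (\<lambda>l. kpow S A (Suc l) s t / kpow S A (Suc l) s0 t) \<longlonglongrightarrow> r s"
    by metis
  define lam where "lam = mat_vec S A r s0"
  have lp: "lam > 0" unfolding lam_def by (rule mat_vec_pos[OF S]) (use A s0 r in auto)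
  define x where "x l u = kpow S A (Suc l) u s0 / kpow S A (Suc l) s0 s0" for l u
  have xr: "(\<lambda>l. x l u) \<longlonglongrightarrow> r u" if "u \<in> S" for u unfolding x_def by (rule r(2)[OF that s0])
  \<comment> \<open>By definition of \<open>x\<close>, applying \<open>A\<close> to
    \<open>x l\<close> gives a multiple of \<open>x (Suc l)\<close> with the value at
    \<open>s0\<close> as factor; passing to the limit yields the eigenvalue equation.\<close>
  have eig: "mat_vec S A r s = lam * r s" if s: "s \<in> S" for s
  proof -
    have lim: "(\<lambda>l. mat_vec S A (x l) s) \<longlonglongrightarrow> mat_vec S A r s" for s
      unfolding mat_vec_def by (intro tendsto_sum tendsto_mult tendsto_const xr)
    have m: "mat_vec S A (x l) s = kpow S A (Suc (Suc l)) s s0 / kpow S A (Suc l) s0 s0" for l s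
      unfolding mat_vec_def x_def kpow.simps(2)[of S A "Suc l"] kmult_def[of S A "kpow S A (Suc l)"]
      by (simp only: sum_divide_distrib times_divide_eq_right)
    have "mat_vec S A (x l) s = x (Suc l) s * mat_vec S A (x l) s0" for l
      unfolding m x_def using kp[OF s0 s0, of "Suc l"] by (simp del: kpow.simps)
    then have "(\<lambda>l. x (Suc l) s * mat_vec S A (x l) s0) \<longlonglongrightarrow> mat_vec S A r s" using lim[of s] by simp
    moreover have "(\<lambda>l. x (Suc l) s * mat_vec S A (x l) s0) \<longlonglongrightarrow> r s * lam"
      unfolding lam_def by (intro tendsto_mult lim LIMSEQ_Suc xr s)
    ultimately show ?thesis using LIMSEQ_unique by (metis mult.commute)
  qed
  have rp: "(mat_vec S A ^^ l) r s = lam ^ l * r s" if "s \<in> S" for l s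
    using that
  proof (induction l arbitrary: s)
    case (Suc l)
    have "(mat_vec S A ^^ Suc l) r s = (\<Sum>u\<in>S. A s u * (lam ^ l * r u))"
      unfolding funpow_mat_vec using Suc.IH by simp
    also have "\<dots> = lam ^ l * mat_vec S A r s" by (simp add: mat_vec_def sum_distrib_left mult_ac)
    finally show ?case using eig[OF Suc.prems] by simp
  qed simp
  \<comment> \<open>Iterates of \<open>r\<close> are exactly \<open>lam ^ l * r\<close>, so the
    comparison with \<open>r\<close> reveals the exponential rate of each column.\<close>
  have "\<forall>t\<in>S. \<exists>c. c > 0 \<and> (\<forall>s\<in>S. (\<lambda>l. (mat_vec S A ^^ l) (\<lambda>s. A s t) s / (mat_vec S A ^^ l) r s) \<longlonglongrightarrow> c)"
  proof
    fix t assume "t \<in> S"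
    then show "\<exists>c. c > 0 \<and> (\<forall>s\<in>S. (\<lambda>l. (mat_vec S A ^^ l) (\<lambda>s. A s t) s / (mat_vec S A ^^ l) r s) \<longlonglongrightarrow> c)"
      by (intro ratio_limit[OF S A] A r(1))
  qed
  from bchoice[OF this] obtain c where c': "\<forall>t\<in>S. c t > 0 \<and>
    (\<forall>s\<in>S. (\<lambda>l. (mat_vec S A ^^ l) (\<lambda>s. A s t) s / (mat_vec S A ^^ l) r s) \<longlonglongrightarrow> c t)" by blast
  have c: "c t > 0" "\<And>s. s \<in> S \<Longrightarrow> (\<lambda>l. (mat_vec S A ^^ l) (\<lambda>s. A s t) s / (mat_vec S A ^^ l) r s) \<longlonglongrightarrow> c t"
    if "t \<in> S" for t using bspec[OF c' that] by blast+
  have "c t * r s / lam > 0 \<and> (\<lambda>l. kpow S A l s t / lam ^ l) \<longlonglongrightarrow> c t * r s / lam" if st: "s \<in> S" "t \<in> S" for s t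
  proof
    show "c t * r s / lam > 0" using c(1)[OF st(2)] r(1)[OF st(1)] lp by simp
    have "kpow S A (Suc l) s t / lam ^ Suc l
        = (mat_vec S A ^^ l) (\<lambda>s. A s t) s / (mat_vec S A ^^ l) r s * r s / lam" for l
      unfolding col[OF st] rp[OF st(1)] using lp r(1)[OF st(1)] by simp
    moreover have "(\<lambda>l. (mat_vec S A ^^ l) (\<lambda>s. A s t) s / (mat_vec S A ^^ l) r s * r s / lam) \<longlonglongrightarrow> c t * r s / lam"
      by (intro tendsto_divide tendsto_mult tendsto_const c(2)[OF st(2,1)]) (use lp in simp)
    ultimately have "(\<lambda>l. kpow S A (Suc l) s t / lam ^ Suc l) \<longlonglongrightarrow> c t * r s / lam" by simp
    then show "(\<lambda>l. kpow S A l s t / lam ^ l) \<longlonglongrightarrow> c t * r s / lam" by (rule LIMSEQ_imp_Suc)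
  qed
  then show ?thesis using lp by (intro exI[of _ lam] conjI exI[of _ "\<lambda>s t. c t * r s / lam"]) auto
qed

lemma kpow_block:
  assumes "finite S0" "finite S1" "S0 \<inter> S1 = {}"
    and z: "\<And>s u. s \<in> S0 \<Longrightarrow> u \<in> S1 \<Longrightarrow> A s u = 0"
  shows "s \<in> S0 \<Longrightarrow> t \<in> S0 \<Longrightarrow> kpow (S0 \<union> S1) A l s t = kpow S0 A l s t"
    and "s \<in> S0 \<Longrightarrow> t \<in> S1 \<Longrightarrow> kpow (S0 \<union> S1) A l s t = 0"
proof -
  have split: "kpow (S0 \<union> S1) A (Suc l) s t = (\<Sum>u\<in>S0. A s u * kpow (S0 \<union> S1) A l u t)" if "s \<in> S0" for l s t
    using assms that by (simp add: kmult_def sum.union_disjoint)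
  show "s \<in> S0 \<Longrightarrow> t \<in> S0 \<Longrightarrow> kpow (S0 \<union> S1) A l s t = kpow S0 A l s t"
  proof (induction l arbitrary: s)
    case (Suc l)
    then show ?case unfolding split[OF Suc.prems(1)] by (simp add: kmult_def)
  qed simp
  show "s \<in> S0 \<Longrightarrow> t \<in> S1 \<Longrightarrow> kpow (S0 \<union> S1) A l s t = 0"
  proof (induction l arbitrary: s)
    case 0
    then show ?case using assms(3) by auto
  next
    case (Suc l)
    then show ?case unfolding split[OF Suc.prems(1)] by simp
  qed
qed

text \<open>Normalised by the larger eigenvalue, the dominated block tends to zero and a dominant
  one to a positive limit; in a tie both survive. This suffices for a positive limit of the
  trace.\<close>

lemma perron_limit_two_blocks:
  fixes A :: "'s \<Rightarrow> 's \<Rightarrow> real"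
  assumes S: "finite S0" "S0 \<noteq> {}" "finite S1" "S1 \<noteq> {}" "S0 \<inter> S1 = {}"
    and pos: "\<And>s u. s \<in> S0 \<Longrightarrow> u \<in> S0 \<Longrightarrow> A s u > 0" "\<And>s u. s \<in> S1 \<Longrightarrow> u \<in> S1 \<Longrightarrow> A s u > 0"
    and zero: "\<And>s u. s \<in> S0 \<Longrightarrow> u \<in> S1 \<Longrightarrow> A s u = 0" "\<And>s u. s \<in> S1 \<Longrightarrow> u \<in> S0 \<Longrightarrow> A s u = 0"
  shows "\<exists>lam>0. \<exists>L. (\<Sum>s\<in>S0 \<union> S1. L s s) > 0 \<and>
    (\<forall>s\<in>S0 \<union> S1. \<forall>t\<in>S0 \<union> S1. (\<lambda>l. kpow (S0 \<union> S1) A l s t / lam ^ l) \<longlonglongrightarrow> L s t)"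
proof -
  obtain lam0 L0 where 0: "lam0 > 0" "\<And>s t. s \<in> S0 \<Longrightarrow> t \<in> S0 \<Longrightarrow> L0 s t > 0"
    "\<And>s t. s \<in> S0 \<Longrightarrow> t \<in> S0 \<Longrightarrow> (\<lambda>l. kpow S0 A l s t / lam0 ^ l) \<longlonglongrightarrow> L0 s t"
    using perron_limit[where A = A, OF S(1,2) pos(1)] by metis
  obtain lam1 L1 where 1: "lam1 > 0" "\<And>s t. s \<in> S1 \<Longrightarrow> t \<in> S1 \<Longrightarrow> L1 s t > 0"
    "\<And>s t. s \<in> S1 \<Longrightarrow> t \<in> S1 \<Longrightarrow> (\<lambda>l. kpow S1 A l s t / lam1 ^ l) \<longlonglongrightarrow> L1 s t"
    using perron_limit[where A = A, OF S(3,4) pos(2)] by metis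
  define lam where "lam = max lam0 lam1"
  have lp: "lam > 0" unfolding lam_def using 0 by simp
  \<comment> \<open>The limit of \<open>(\<mu> / lam) ^ l\<close>, which is \<open>1\<close> for a
    dominant block and \<open>0\<close> otherwise.\<close>
  define w where "w \<mu> = (if \<mu> = lam then 1 else 0 :: real)" for \<mu>
  have wl: "(\<lambda>l. (\<mu> / lam) ^ l) \<longlonglongrightarrow> w \<mu>" if "0 < \<mu>" "\<mu> \<le> lam" for \<mu>
  proof (cases "\<mu> = lam")
    case True
    then show ?thesis using lp by (simp add: w_def)
  next
    case False
    then have "\<mu> / lam < 1" "0 \<le> \<mu> / lam" using that lp by auto
    then show ?thesis using False LIMSEQ_realpow_zero[of "\<mu> / lam"] by (simp add: w_def)
  qed
  have scale: "(\<lambda>l. K l / lam ^ l) \<longlonglongrightarrow> c * w \<mu>" if "(\<lambda>l. K l / \<mu> ^ l) \<longlonglongrightarrow> c" "0 < \<mu>" "\<mu> \<le> lam" for K :: "nat \<Rightarrow> real" and c \<mu>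
  proof -
    have "K l / lam ^ l = K l / \<mu> ^ l * (\<mu> / lam) ^ l" for l using that(2) by (simp add: power_divide)
    then show ?thesis by (simp only:) (rule tendsto_mult[OF that(1) wl[OF that(2,3)]])
  qed
  have le: "lam0 \<le> lam" "lam1 \<le> lam" unfolding lam_def by auto
  have dis': "S1 \<inter> S0 = {}" using S(5) by auto
  have b0: "kpow (S0 \<union> S1) A l s t = kpow S0 A l s t" if "s \<in> S0" "t \<in> S0" for s t l
    by (rule kpow_block(1)[OF S(1,3,5) _ that]) (rule zero(1))
  have b01: "kpow (S0 \<union> S1) A l s t = 0" if "s \<in> S0" "t \<in> S1" for s t l
    by (rule kpow_block(2)[OF S(1,3,5) _ that]) (rule zero(1))
  have b1: "kpow (S0 \<union> S1) A l s t = kpow S1 A l s t" if "s \<in> S1" "t \<in> S1" for s t l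
    unfolding Un_commute[of S0 S1] by (rule kpow_block(1)[OF S(3,1) dis' _ that]) (rule zero(2))
  have b10: "kpow (S0 \<union> S1) A l s t = 0" if "s \<in> S1" "t \<in> S0" for s t l
    unfolding Un_commute[of S0 S1] by (rule kpow_block(2)[OF S(3,1) dis' _ that]) (rule zero(2))
  define L where "L s t = (if s \<in> S0 \<and> t \<in> S0 then L0 s t * w lam0 else if s \<in> S1 \<and> t \<in> S1 then L1 s t * w lam1 else 0)" for s t
  have lim: "(\<lambda>l. kpow (S0 \<union> S1) A l s t / lam ^ l) \<longlonglongrightarrow> L s t" if st: "s \<in> S0 \<union> S1" "t \<in> S0 \<union> S1" for s t
  proof -
    consider "s \<in> S0" "t \<in> S0" | "s \<in> S0" "t \<in> S1" | "s \<in> S1" "t \<in> S0" | "s \<in> S1" "t \<in> S1" using st by blast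
    then show ?thesis
    proof cases
      case 1
      then show ?thesis using scale[OF 0(3)[OF 1] 0(1) le(1)] b0[OF 1] by (simp add: L_def)
    next
      case 2
      then have "L s t = 0" using S(5) by (auto simp: L_def)
      then show ?thesis using b01[OF 2] by simp
    next
      case 3
      then have "L s t = 0" using S(5) by (auto simp: L_def)
      then show ?thesis using b10[OF 3] by simp
    next
      case 4
      then have "L s t = L1 s t * w lam1" using S(5) by (auto simp: L_def)
      then show ?thesis using scale[OF 1(3)[OF 4] 1(1) le(2)] b1[OF 4] by simp
    qed
  qed
  obtain s0 s1 where s: "s0 \<in> S0" "s1 \<in> S1" using S by blast
  \<comment> \<open>A state in a block that attains the maximum, so that its diagonal limit is
    positive.\<close>
  define v where "v = (if lam0 = lam then s0 else s1)"
  have "lam1 = lam" if "lam0 \<noteq> lam" using that unfolding lam_def by (auto simp: max_def split: if_splits)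
  moreover have "s1 \<notin> S0" using s S(5) by blast
  ultimately have v: "v \<in> S0 \<union> S1" "L v v > 0"
    using s 0(2)[OF s(1) s(1)] 1(2)[OF s(2) s(2)] by (auto simp: L_def v_def w_def)
  have nn: "L u u \<ge> 0" for u
    using 0(2)[of u u] 1(2)[of u u] by (auto simp: L_def w_def intro: less_imp_le)
  have "finite (S0 \<union> S1)" using S by simp
  then have "(\<Sum>s\<in>S0 \<union> S1. L s s) > 0" using v(1,2) nn by (rule sum_pos2)
  then show ?thesis using lim lp by blast
qed

section \<open>Products of transfer matrices and sums over paths\<close>

primrec kprod :: "'s set \<Rightarrow> (int \<Rightarrow> 's \<Rightarrow> 's \<Rightarrow> real) \<Rightarrow> int \<Rightarrow> nat \<Rightarrow> 's \<Rightarrow> 's \<Rightarrow> real" where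
  "kprod S T a 0 = (\<lambda>s t. if s = t then 1 else 0)"
| "kprod S T a (Suc l) = kmult S (T a) (kprod S T (a + 1) l)"

lemma kmult_id_left: "finite S \<Longrightarrow> s \<in> S \<Longrightarrow> kmult S (\<lambda>s t. if s = t then 1 else 0) B s t = B s t"
proof -
  assume "finite S" "s \<in> S"
  have "(\<Sum>u\<in>S. (if s = u then 1 else 0) * B u t) = (\<Sum>u\<in>S. if s = u then B u t else 0)"
    by (rule sum.cong) auto
  then show ?thesis using \<open>finite S\<close> \<open>s \<in> S\<close> by (simp add: kmult_def)
qed

lemma kmult_id_right: "finite S \<Longrightarrow> t \<in> S \<Longrightarrow> kmult S B (\<lambda>s t. if s = t then 1 else 0) s t = B s t"
proof -
  assume "finite S" "t \<in> S"
  have "(\<Sum>u\<in>S. B s u * (if u = t then 1 else 0)) = (\<Sum>u\<in>S. if u = t then B s u else 0)"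
    by (rule sum.cong) auto
  then show ?thesis using \<open>finite S\<close> \<open>t \<in> S\<close> by (simp add: kmult_def)
qed

lemma kmult_cong:
  assumes "\<And>u. u \<in> S \<Longrightarrow> A s u = A' s u" "\<And>u. u \<in> S \<Longrightarrow> B u t = B' u t"
  shows "kmult S A B s t = kmult S A' B' s t"
  unfolding kmult_def using assms by (intro sum.cong) auto

lemma kmult_assoc: "kmult S (kmult S A B) C = kmult S A (kmult S B C)"
proof (intro ext)
  fix s t
  have "(\<Sum>u\<in>S. \<Sum>v\<in>S. A s v * B v u * C u t) = (\<Sum>v\<in>S. \<Sum>u\<in>S. A s v * B v u * C u t)" by (rule sum.swap)
  then show "kmult S (kmult S A B) C s t = kmult S A (kmult S B C) s t"
    by (simp add: kmult_def sum_distrib_left sum_distrib_right mult.assoc)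
qed

lemma trace_kmult_commute: "(\<Sum>s\<in>S. kmult S A B s s) = (\<Sum>s\<in>S. kmult S B A s s)"
  unfolding kmult_def by (subst sum.swap) (simp add: mult.commute)

lemma kprod_cong:
  assumes "\<And>i s t. i < l \<Longrightarrow> s \<in> S \<Longrightarrow> t \<in> S \<Longrightarrow> T (a + int i) s t = T' (a' + int i) s t"
  shows "s \<in> S \<Longrightarrow> t \<in> S \<Longrightarrow> kprod S T a l s t = kprod S T' a' l s t"
  using assms
proof (induction l arbitrary: a a' s)
  case (Suc l)
  have h: "T a s u = T' a' s u" if "u \<in> S" for u using Suc.prems(3)[of 0 s u] that Suc.prems(1) by simp
  have t: "kprod S T (a + 1) l u t = kprod S T' (a' + 1) l u t" if "u \<in> S" for u
  proof (rule Suc.IH[OF that Suc.prems(2)])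
    fix i s t assume "i < l" "s \<in> S" "t \<in> S"
    then show "T (a + 1 + int i) s t = T' (a' + 1 + int i) s t"
      using Suc.prems(3)[of "Suc i" s t] by (simp add: algebra_simps)
  qed
  show ?case unfolding kprod.simps by (rule kmult_cong) (use h t in auto)
qed simp

lemma kprod_add:
  assumes "finite S"
  shows "s \<in> S \<Longrightarrow> kprod S T a (k + l) s t = kmult S (kprod S T a k) (kprod S T (a + int k) l) s t"
proof (induction k arbitrary: a s)
  case 0
  then show ?case using kmult_id_left[OF assms] by simp
next
  case (Suc k)
  have "kprod S T a (Suc k + l) s t = kmult S (T a) (kprod S T (a + 1) (k + l)) s t" by simp
  also have "\<dots> = kmult S (T a) (kmult S (kprod S T (a + 1) k) (kprod S T (a + 1 + int k) l)) s t"
    by (rule kmult_cong) (use Suc.IH in auto)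
  also have "\<dots> = kmult S (kprod S T a (Suc k)) (kprod S T (a + int (Suc k)) l) s t"
    by (simp add: kmult_assoc algebra_simps)
  finally show ?case .
qed

lemma kprod_periodic:
  assumes S: "finite S" and per: "\<And>x s t. T (x + int n) s t = T x s t"
  shows "s \<in> S \<Longrightarrow> t \<in> S \<Longrightarrow> kprod S T (a * int n) (l * n) s t = kpow S (kprod S T 0 n) l s t"
proof (induction l arbitrary: a s)
  case (Suc l)
  have per': "T (x + int k * int n) s t = T x s t" for x k s t
  proof (induction k)
    case (Suc k)
    then show ?case using per[of "x + int k * int n" s t] by (simp add: algebra_simps)
  qed simp
  have shift: "T (x + a * int n) s t = T x s t" for x s t
  proof (cases "a \<ge> 0")
    case True
    then show ?thesis using per'[of x "nat a" s t] by simp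
  next
    case False
    then show ?thesis using per'[of "x + a * int n" "nat (- a)" s t] by (simp add: algebra_simps)
  qed
  have "kprod S T (a * int n) (Suc l * n) s t
      = kmult S (kprod S T (a * int n) n) (kprod S T (a * int n + int n) (l * n)) s t"
    using kprod_add[OF S Suc.prems(1), of T "a * int n" n "l * n" t] by simp
  also have "\<dots> = kmult S (kprod S T 0 n) (kpow S (kprod S T 0 n) l) s t"
  proof (rule kmult_cong)
    fix u assume u: "u \<in> S"
    show "kprod S T (a * int n) n s u = kprod S T 0 n s u"
      by (rule kprod_cong) (use Suc.prems u shift in \<open>auto simp: add.commute\<close>)
    show "kprod S T (a * int n + int n) (l * n) u t = kpow S (kprod S T 0 n) l u t"
      using Suc.IH[OF u Suc.prems(2), of "a + 1"] by (simp add: algebra_simps)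
  qed
  finally show ?case by simp
qed simp

lemma kprod_Suc_right:
  assumes "finite S" "s \<in> S" "t \<in> S"
  shows "kprod S T a (Suc l) s t = (\<Sum>u\<in>S. kprod S T a l s u * T (a + int l) u t)"
proof -
  have "kprod S T a (l + Suc 0) s t = kmult S (kprod S T a l) (kprod S T (a + int l) (Suc 0)) s t"
    by (rule kprod_add) (use assms in auto)
  also have "\<dots> = kmult S (kprod S T a l) (T (a + int l)) s t"
    by (rule kmult_cong) (use assms kmult_id_right in auto)
  finally show ?thesis by (simp add: kmult_def)
qed

lemma sum_PiE_lessThan_Suc:
  fixes F :: "(nat \<Rightarrow> 's) \<Rightarrow> real"
  shows "(\<Sum>s\<in>{..<Suc N} \<rightarrow>\<^sub>E S. F s) = (\<Sum>b\<in>S. \<Sum>s\<in>{..<N} \<rightarrow>\<^sub>E S. F (s(N := b)))"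
proof -
  have "(\<Sum>s\<in>{..<Suc N} \<rightarrow>\<^sub>E S. F s) = (\<Sum>s\<in>(\<lambda>(y, g). g(N := y)) ` (S \<times> ({..<N} \<rightarrow>\<^sub>E S)). F s)"
    by (simp add: lessThan_Suc PiE_insert_eq)
  also have "\<dots> = (\<Sum>p\<in>S \<times> ({..<N} \<rightarrow>\<^sub>E S). F ((\<lambda>(y, g). g(N := y)) p))"
    by (subst sum.reindex) (auto intro!: inj_combinator simp: o_def)
  also have "\<dots> = (\<Sum>b\<in>S. \<Sum>s\<in>{..<N} \<rightarrow>\<^sub>E S. F (s(N := b)))"
    by (simp add: sum.cartesian_product case_prod_beta)
  finally show ?thesis .
qed

text \<open>The function \<open>f\<close> of the last state is general because the induction step
  absorbs the last factor into it.\<close>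

lemma path_sum:
  assumes S: "finite S"
  shows "a \<in> S \<Longrightarrow> (\<Sum>s\<in>{..<N} \<rightarrow>\<^sub>E S. (\<Prod>t<N. T (int t) (if t = 0 then a else s (t - 1)) (s t)) *
      f (if N = 0 then a else s (N - 1))) = (\<Sum>b\<in>S. kprod S T 0 N a b * f b)"
proof (induction N arbitrary: f)
  case 0
  have "(\<Sum>b\<in>S. (if a = b then 1 else 0) * f b) = (\<Sum>b\<in>S. if a = b then f b else 0)" by (rule sum.cong) auto
  then show ?case using 0 S by simp
next
  case (Suc N)
  let ?pr = "\<lambda>s t. if t = 0 then a else s (t - 1)"
  have "(\<Sum>s\<in>{..<Suc N} \<rightarrow>\<^sub>E S. (\<Prod>t<Suc N. T (int t) (?pr s t) (s t)) * f (?pr s (Suc N)))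
      = (\<Sum>b\<in>S. \<Sum>s\<in>{..<N} \<rightarrow>\<^sub>E S. (\<Prod>t<N. T (int t) (?pr s t) (s t)) * (T (int N) (?pr s N) b * f b))"
    unfolding sum_PiE_lessThan_Suc
  proof (intro sum.cong refl)
    fix b s
    have nn: "N > 0 \<Longrightarrow> N - Suc 0 \<noteq> N" by simp
    have "(\<Prod>t<N. T (int t) (?pr (s(N := b)) t) ((s(N := b)) t)) = (\<Prod>t<N. T (int t) (?pr s t) (s t))"
      by (rule prod.cong) auto
    then show "(\<Prod>t<Suc N. T (int t) (?pr (s(N := b)) t) ((s(N := b)) t)) * f (?pr (s(N := b)) (Suc N))
        = (\<Prod>t<N. T (int t) (?pr s t) (s t)) * (T (int N) (?pr s N) b * f b)" using nn by (cases "N = 0") simp_all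
  qed
  also have "\<dots> = (\<Sum>b\<in>S. \<Sum>c\<in>S. kprod S T 0 N a c * (T (int N) c b * f b))"
    using Suc.IH[OF Suc.prems, of "\<lambda>c. T (int N) c b * f b" for b] by simp
  also have "\<dots> = (\<Sum>b\<in>S. kprod S T 0 (Suc N) a b * f b)"
  proof (rule sum.cong[OF refl])
    fix b assume b: "b \<in> S"
    show "(\<Sum>c\<in>S. kprod S T 0 N a c * (T (int N) c b * f b)) = kprod S T 0 (Suc N) a b * f b"
      unfolding kprod_Suc_right[OF S Suc.prems b] by (simp add: sum_distrib_right mult.assoc)
  qed
  finally show ?case by simp
qed

lemma mult_if: "x * (if c then 1 else 0) = (if c then x else (0 :: real))"
  by simp

text \<open>Closing the path amounts to using the indicator of the starting state as
  \<open>f\<close>; summation over the starting state gives a trace.\<close>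

lemma closed_path_sum:
  assumes S: "finite S" and N: "N > 0"
  shows "(\<Sum>s\<in>{..<N} \<rightarrow>\<^sub>E S. \<Prod>t<N. T (int t) (s (if t = 0 then N - 1 else t - 1)) (s t)) = (\<Sum>a\<in>S. kprod S T 0 N a a)"
proof -
  have "(\<Sum>a\<in>S. kprod S T 0 N a a) = (\<Sum>a\<in>S. \<Sum>b\<in>S. kprod S T 0 N a b * (if b = a then 1 else 0))"
    using S by (intro sum.cong refl) (simp add: if_distrib cong: if_cong)
  also have "\<dots> = (\<Sum>a\<in>S. \<Sum>s\<in>{..<N} \<rightarrow>\<^sub>E S. (\<Prod>t<N. T (int t) (if t = 0 then a else s (t - 1)) (s t)) *
      (if s (N - 1) = a then 1 else 0))"
  proof (rule sum.cong[OF refl])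
    fix a assume "a \<in> S"
    from path_sum[OF S this, where N = N and T = T and f = "\<lambda>b. if b = a then 1 else 0"]
    show "(\<Sum>b\<in>S. kprod S T 0 N a b * (if b = a then 1 else 0)) = (\<Sum>s\<in>{..<N} \<rightarrow>\<^sub>E S.
        (\<Prod>t<N. T (int t) (if t = 0 then a else s (t - 1)) (s t)) * (if s (N - 1) = a then 1 else 0))"
      using N by simp
  qed
  also have "\<dots> = (\<Sum>s\<in>{..<N} \<rightarrow>\<^sub>E S. \<Sum>a\<in>S. (\<Prod>t<N. T (int t) (if t = 0 then a else s (t - 1)) (s t)) *
      (if s (N - 1) = a then 1 else 0))" by (rule sum.swap)
  also have "\<dots> = (\<Sum>s\<in>{..<N} \<rightarrow>\<^sub>E S. \<Prod>t<N. T (int t) (s (if t = 0 then N - 1 else t - 1)) (s t))"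
  proof (rule sum.cong[OF refl])
    fix s assume s: "s \<in> {..<N} \<rightarrow>\<^sub>E S"
    have sN: "s (N - 1) \<in> S" by (rule PiE_mem[OF s]) (use N in simp)
    have "(\<Sum>a\<in>S. (\<Prod>t<N. T (int t) (if t = 0 then a else s (t - 1)) (s t)) * (if s (N - 1) = a then 1 else 0))
        = (\<Sum>a\<in>S. if s (N - 1) = a then \<Prod>t<N. T (int t) (if t = 0 then a else s (t - 1)) (s t) else 0)"
      unfolding mult_if ..
    also have "\<dots> = (\<Prod>t<N. T (int t) (if t = 0 then s (N - 1) else s (t - 1)) (s t))"
      unfolding sum.delta'[OF S] using sN by (simp only: if_True)
    also have "\<dots> = (\<Prod>t<N. T (int t) (s (if t = 0 then N - 1 else t - 1)) (s t))"
      unfolding if_distrib[of s] ..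
    finally show "(\<Sum>a\<in>S. (\<Prod>t<N. T (int t) (if t = 0 then a else s (t - 1)) (s t)) * (if s (N - 1) = a then 1 else 0))
        = (\<Prod>t<N. T (int t) (s (if t = 0 then N - 1 else t - 1)) (s t))" .
  qed
  finally show ?thesis by simp
qed

text \<open>\<open>A\<close> is the transfer matrix of one period and \<open>B\<close> that of a
  window of \<open>2 q\<close> periods carrying the event. Normalising numerator and denominator by
  their own powers of \<open>lam\<close> leaves the constant factor
  \<open>lam ^ (2 * q)\<close>.\<close>

lemma trace_ratio_convergent:
  fixes A B :: "'s \<Rightarrow> 's \<Rightarrow> real"
  assumes S: "finite S0" "S0 \<noteq> {}" "finite S1" "S1 \<noteq> {}" "S0 \<inter> S1 = {}"
    and pos: "\<And>s u. s \<in> S0 \<Longrightarrow> u \<in> S0 \<Longrightarrow> A s u > 0" "\<And>s u. s \<in> S1 \<Longrightarrow> u \<in> S1 \<Longrightarrow> A s u > 0"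
    and zero: "\<And>s u. s \<in> S0 \<Longrightarrow> u \<in> S1 \<Longrightarrow> A s u = 0" "\<And>s u. s \<in> S1 \<Longrightarrow> u \<in> S0 \<Longrightarrow> A s u = 0"
  defines "S \<equiv> S0 \<union> S1"
  shows "convergent (\<lambda>l. (\<Sum>s\<in>S. kmult S (kpow S A (2 * l - 2 * q)) B s s) / (\<Sum>s\<in>S. kpow S A (2 * l) s s))"
proof -
  obtain lam L where L: "lam > 0" "(\<Sum>s\<in>S. L s s) > 0"
    "\<And>s t. s \<in> S \<Longrightarrow> t \<in> S \<Longrightarrow> (\<lambda>l. kpow S A l s t / lam ^ l) \<longlonglongrightarrow> L s t"
    using perron_limit_two_blocks[where A = A, OF S pos zero] unfolding S_def by blast
  have f1: "filterlim (\<lambda>l::nat. 2 * l) sequentially sequentially"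
    by (rule filterlim_subseq) (simp add: strict_mono_def)
  have f2: "filterlim (\<lambda>l::nat. 2 * l - 2 * q) sequentially sequentially"
    unfolding filterlim_at_top
  proof
    fix Z :: nat
    show "\<forall>\<^sub>F l in sequentially. Z \<le> 2 * l - 2 * q"
      unfolding eventually_sequentially by (intro exI[of _ "Z + q"]) auto
  qed
  have den: "(\<lambda>l. \<Sum>s\<in>S. kpow S A (2 * l) s s / lam ^ (2 * l)) \<longlonglongrightarrow> (\<Sum>s\<in>S. L s s)"
    by (intro tendsto_sum filterlim_compose[OF L(3) f1])
  have num: "(\<lambda>l. \<Sum>s\<in>S. \<Sum>u\<in>S. kpow S A (2 * l - 2 * q) s u / lam ^ (2 * l - 2 * q) * B u s)
      \<longlonglongrightarrow> (\<Sum>s\<in>S. \<Sum>u\<in>S. L s u * B u s)"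
    by (intro tendsto_sum tendsto_mult tendsto_const filterlim_compose[OF L(3) f2])
  have lim: "(\<lambda>l. (\<Sum>s\<in>S. \<Sum>u\<in>S. kpow S A (2 * l - 2 * q) s u / lam ^ (2 * l - 2 * q) * B u s) /
      (\<Sum>s\<in>S. kpow S A (2 * l) s s / lam ^ (2 * l)) / lam ^ (2 * q))
      \<longlonglongrightarrow> (\<Sum>s\<in>S. \<Sum>u\<in>S. L s u * B u s) / (\<Sum>s\<in>S. L s s) / lam ^ (2 * q)"
    by (intro tendsto_divide num den tendsto_const) (use L in auto)
  have "\<forall>\<^sub>F l in sequentially.
      (\<Sum>s\<in>S. \<Sum>u\<in>S. kpow S A (2 * l - 2 * q) s u / lam ^ (2 * l - 2 * q) * B u s) /
      (\<Sum>s\<in>S. kpow S A (2 * l) s s / lam ^ (2 * l)) / lam ^ (2 * q)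
      = (\<Sum>s\<in>S. kmult S (kpow S A (2 * l - 2 * q)) B s s) / (\<Sum>s\<in>S. kpow S A (2 * l) s s)"
    unfolding eventually_sequentially
  proof (intro exI[of _ q] allI impI)
    fix l assume l: "q \<le> l"
    have 1: "(\<Sum>s\<in>S. \<Sum>u\<in>S. kpow S A (2 * l - 2 * q) s u / lam ^ (2 * l - 2 * q) * B u s)
        = (\<Sum>s\<in>S. kmult S (kpow S A (2 * l - 2 * q)) B s s) / lam ^ (2 * l - 2 * q)"
      by (simp add: kmult_def sum_divide_distrib)
    have 2: "(\<Sum>s\<in>S. kpow S A (2 * l) s s / lam ^ (2 * l)) = (\<Sum>s\<in>S. kpow S A (2 * l) s s) / lam ^ (2 * l)"
      by (simp add: sum_divide_distrib)
    have "lam ^ (2 * l) = lam ^ (2 * l - 2 * q) * lam ^ (2 * q)" using l by (simp flip: power_add)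
    then show "(\<Sum>s\<in>S. \<Sum>u\<in>S. kpow S A (2 * l - 2 * q) s u / lam ^ (2 * l - 2 * q) * B u s) /
      (\<Sum>s\<in>S. kpow S A (2 * l) s s / lam ^ (2 * l)) / lam ^ (2 * q)
      = (\<Sum>s\<in>S. kmult S (kpow S A (2 * l - 2 * q)) B s s) / (\<Sum>s\<in>S. kpow S A (2 * l) s s)"
      unfolding 1 2 using L(1) by simp
  qed
  from Lim_transform_eventually[OF lim this] show ?thesis by (auto simp: convergent_def)
qed

section \<open>Local events on the cylinder\<close>

primrec column :: "vertex \<Rightarrow> int" where
  "column (BetaV s x y) = x"
| "column (OmegaV s x y) = x"

fun loc :: "nat set \<Rightarrow> nat set \<Rightarrow> vertex \<Rightarrow> bool" where
  "loc I O' (BetaV Ca x y) = ((y \<in> I) = par I O' y)"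
| "loc I O' (BetaV Cb x y) = (y \<in> O')"
| "loc I O' (BetaV Cc x y) = par I O' (Suc y)"
| "loc I O' (OmegaV Ca x y) = ((y \<in> I) = par I O' y)"
| "loc I O' (OmegaV Cb x y) = (y \<in> I)"
| "loc I O' (OmegaV Cc x y) = par I O' y"

fun band_leg :: "vertex \<Rightarrow> vertex" where
  "band_leg (BetaV Ca x y) = OmegaV Ca x y"
| "band_leg (BetaV Cb x y) = OmegaV Cb (x + 1) y"
| "band_leg (BetaV Cc x y) = OmegaV Cc x (y + 1)"
| "band_leg v = v"

text \<open>An edge is coded by the column \<open>x\<close> of its tail, the tail moved to column \<open>0\<close>, and a flag that
  tells a leg from an edge of a triangle.\<close>

definition edge_codes :: "nat \<Rightarrow> (vertex \<times> bool) set" where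
  "edge_codes m = {(u, b). u \<in> cyl_vertices m 1 \<and> (b \<longrightarrow> is_beta u \<and> has_leg m u)}"

text \<open>A triangle edge is occupied exactly when neither of its ends is matched by its leg; the
  third corner then is, by parity.\<close>

definition present :: "nat set \<Rightarrow> nat set \<Rightarrow> vertex \<times> bool \<Rightarrow> bool" where
  "present I O' q = (if snd q then loc I O' (fst q) else \<not> loc I O' (fst q) \<and> \<not> loc I O' (cnxt (fst q)))"

definition band_edge :: "int \<Rightarrow> vertex \<times> bool \<Rightarrow> vertex set" where
  "band_edge x q = (let v = translate x (fst q) in {v, if snd q then band_leg v else cnxt v})"

definition cyl_edge :: "nat \<Rightarrow> int \<Rightarrow> vertex \<times> bool \<Rightarrow> vertex set" where
  "cyl_edge N x q = (let v = translate x (fst q) in {v, if snd q then cleg N v else cnxt v})"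

lemma cfg_loc: "cfg N s v = loc (s ((column v - 1) mod int N)) (s (column v)) v"
  by (cases "(N, v)" rule: cleg.cases) simp_all

lemma loc_map_x [simp]: "loc I O' (map_x f v) = loc I O' v"
  by (cases "(0 :: nat, v)" rule: cleg.cases) simp_all

lemma cnxt_translate: "cnxt (translate x v) = translate x (cnxt v)"
  by (cases v) simp_all

lemma column_map_x [simp]: "column (map_x f v) = f (column v)"
  by (cases v) simp_all

lemma column_cnxt [simp]: "column (cnxt v) = column v"
  by (cases v) simp_all

lemma is_beta_map_x [simp]: "is_beta (map_x f v) = is_beta v"
  by (cases v) simp_all

lemma has_leg_map_x [simp]: "has_leg m (map_x f v) = has_leg m v"
  by (cases "(m, v)" rule: has_leg.cases) simp_all

lemma cyl_vertices_one:
  "cyl_vertices m (Suc 0) = {BetaV s 0 y | s y. y < m} \<union> {OmegaV s 0 y | s y. y < m}"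
proof -
  have "0 \<le> x \<and> x < int (Suc 0) \<and> P \<longleftrightarrow> x = 0 \<and> P" for x P by auto
  then show ?thesis by (subst cyl_vertices_eq[OF zero_less_Suc]) simp
qed

lemma cyl_one: "v \<in> cyl_vertices m 1 \<Longrightarrow> column v = 0"
  by (auto simp: cyl_vertices_one)

lemma translate_in_cyl:
  assumes "N > 0" "v \<in> cyl_vertices m 1" "0 \<le> x" "x < int N"
  shows "translate x v \<in> cyl_vertices m N"
  using assms by (auto simp: cyl_vertices_eq)

lemma reduce_band_edge:
  assumes "N > 0" "q \<in> edge_codes m"
  shows "reduce N ` band_edge x q = cyl_edge N (x mod int N) q"
proof -
  obtain u b where q: "q = (u, b)" by fastforce
  have u: "u \<in> cyl_vertices m 1" "b \<longrightarrow> is_beta u" using assms(2) by (auto simp: q edge_codes_def)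
  have 1: "reduce N (translate x u) = translate (x mod int N) u" using u(1) by (auto simp: cyl_vertices_one)
  have 2: "reduce N (cnxt (translate x u)) = cnxt (translate (x mod int N) u)" using u(1) by (auto simp: cyl_vertices_one)
  have 3: "reduce N (band_leg (translate x u)) = cleg N (translate (x mod int N) u)" if "is_beta u"
    using u(1) that by (cases "(N, u)" rule: cleg.cases) (auto simp: cyl_vertices_one mod_add_left_eq)
  show ?thesis using 1 2 3 u(2) by (simp add: q band_edge_def cyl_edge_def Let_def)
qed

lemma band_edge_in: "q \<in> edge_codes m \<Longrightarrow> band_edge x q \<in> band_edges m"
proof -
  assume q: "q \<in> edge_codes m"
  obtain u b where ub: "q = (u, b)" by fastforce
  have u: "u \<in> cyl_vertices m 1" "b \<longrightarrow> is_beta u \<and> has_leg m u" using q by (auto simp: ub edge_codes_def)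
  have "(translate x u, cnxt (translate x u)) \<in> band_arcs m"
    using u(1) by (auto simp: cyl_vertices_one band_arcs_def)
  moreover have "(translate x u, band_leg (translate x u)) \<in> band_arcs m" if "is_beta u" "has_leg m u"
    using u(1) that by (cases "(0 :: nat, u)" rule: cleg.cases) (auto simp: cyl_vertices_one band_arcs_def)
  ultimately show ?thesis using u(2) unfolding ub band_edge_def edges_of_def Let_def by auto
qed

lemma band_edge_ex:
  assumes "e \<in> band_edges m"
  shows "\<exists>x q. q \<in> edge_codes m \<and> e = band_edge x q"
proof -
  have *: "\<exists>x q. q \<in> edge_codes m \<and> {v, v'} = band_edge x q"
    if "v = translate (column v) u" "u \<in> cyl_vertices m 1" "v' = cnxt v \<or> is_beta u \<and> has_leg m u \<and> v' = band_leg v" for u v v'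
  proof (cases "v' = cnxt v")
    case True
    have "{v, v'} = band_edge (column v) (u, False)" using that True by (auto simp: band_edge_def)
    then show ?thesis using that(2) by (intro exI[of _ "column v"] exI[of _ "(u, False)"]) (simp add: edge_codes_def)
  next
    case False
    then have h: "is_beta u" "has_leg m u" "v' = band_leg v" using that(3) by auto
    have "{v, v'} = band_edge (column v) (u, True)" using that(1) h(3) by (auto simp: band_edge_def)
    then show ?thesis using that(2) h by (intro exI[of _ "column v"] exI[of _ "(u, True)"]) (simp add: edge_codes_def)
  qed
  obtain v v' where e: "e = {v, v'}" "(v, v') \<in> band_arcs m" using assms unfolding edges_of_def by blast
  show ?thesis unfolding e(1)
    by (rule *[of v "translate (- column v) v"]) (use e(2) in \<open>auto simp: band_arcs_def cyl_vertices_one\<close>)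
qed

text \<open>The tail of an edge can be recovered: of the two ends of a leg it is the beta end, and
  in a triangle the orientation singles it out. Hence each edge has one code, and products over
  edges factor by columns.\<close>

lemma cyl_edge_bij:
  assumes N: "N > 0"
  shows "bij_betw (\<lambda>(x, q). cyl_edge N x q) ({0..<int N} \<times> edge_codes m) (cyl_edges m N)"
proof -
  have inj: "x = x' \<and> q = q'" if q: "q \<in> edge_codes m" "q' \<in> edge_codes m" and e: "cyl_edge N x q = cyl_edge N x' q'" for x x' q q'
  proof -
    obtain u b u' b' where ub: "q = (u, b)" "q' = (u', b')" by fastforce
    have u: "column u = 0" "column u' = 0" "b \<longrightarrow> is_beta u" "b' \<longrightarrow> is_beta u'"
      using q cyl_one by (auto simp: ub edge_codes_def)
    let ?v = "translate x u" and ?v' = "translate x' u'"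
    have ee: "{?v, if b then cleg N ?v else cnxt ?v} = {?v', if b' then cleg N ?v' else cnxt ?v'}"
      using e by (simp add: ub cyl_edge_def Let_def)
    have "?v = ?v' \<and> b = b'"
    proof (cases "b = b'")
      case False
      then show ?thesis using ee u(3,4) is_beta_cleg[of N ?v] is_beta_cleg[of N ?v']
        by (auto simp: doubleton_eq_iff split: if_splits simp del: is_beta_cleg; metis cnxt_simps(5) is_beta_map_x)
    next
      case True
      show ?thesis
      proof (cases b)
        case True
        then show ?thesis using ee \<open>b = b'\<close> u(3,4) is_beta_cleg[of N ?v] is_beta_cleg[of N ?v']
          by (auto simp: doubleton_eq_iff simp del: is_beta_cleg)
      next
        case False
        then show ?thesis using ee \<open>b = b'\<close> by (auto simp: doubleton_eq_iff; metis cnxt_simps(3))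
      qed
    qed
    then have v: "?v = ?v'" "b = b'" by auto
    have "x = x'" using arg_cong[OF v(1), of column] u by simp
    moreover have "u = u'"
    proof -
      have "translate (- x) ?v = u" "translate (- x) ?v' = u'" using \<open>x = x'\<close> by (cases u; cases u'; simp)+
      then show ?thesis using v(1) by metis
    qed
    ultimately show ?thesis using v(2) by (simp add: ub)
  qed
  have ran: "cyl_edge N x q \<in> cyl_edges m N" if x: "x \<in> {0..<int N}" and q: "q \<in> edge_codes m" for x q
  proof -
    have v: "translate x (fst q) \<in> cyl_vertices m N" using translate_in_cyl[OF N, of "fst q" m x] x q by (auto simp: edge_codes_def)
    show ?thesis using cyl_edge_intros[OF N v] q by (auto simp: cyl_edge_def edge_codes_def Let_def)
  qed
  have sur: "\<exists>x\<in>{0..<int N}. \<exists>q\<in>edge_codes m. e = cyl_edge N x q" if e: "e \<in> cyl_edges m N" for e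
  proof -
    obtain v v' where vv: "e = {v, v'}" "v \<in> cyl_vertices m N" "v' = cnxt v \<or> is_beta v \<and> has_leg m v \<and> v' = cleg N v"
      using e cyl_arcs_iff[OF N] unfolding edges_of_def by blast
    define u where "u = translate (- column v) v"
    have "is_beta u = is_beta v" "has_leg m u = has_leg m v" unfolding u_def by simp_all
    moreover have "translate (column v) u = v" "u \<in> cyl_vertices m 1" "column v \<in> {0..<int N}"
      using vv(2) N unfolding u_def by (auto simp: cyl_vertices_eq)
    ultimately have u: "translate (column v) u = v" "is_beta u = is_beta v" "has_leg m u = has_leg m v" "u \<in> cyl_vertices m 1" "column v \<in> {0..<int N}"
      by auto
    show ?thesis
    proof (cases "v' = cnxt v")
      case True
      then show ?thesis using u vv(1) by (intro bexI[of _ "column v"] bexI[of _ "(u, False)"]) (auto simp: cyl_edge_def edge_codes_def)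
    next
      case False
      then show ?thesis using u vv by (intro bexI[of _ "column v"] bexI[of _ "(u, True)"]) (auto simp: cyl_edge_def edge_codes_def)
    qed
  qed
  show ?thesis
    unfolding bij_betw_def
  proof
    show "inj_on (\<lambda>(x, q). cyl_edge N x q) ({0..<int N} \<times> edge_codes m)"
    proof (rule inj_onI)
      fix p p' assume p: "p \<in> {0..<int N} \<times> edge_codes m" "p' \<in> {0..<int N} \<times> edge_codes m"
        "(case p of (x, q) \<Rightarrow> cyl_edge N x q) = (case p' of (x, q) \<Rightarrow> cyl_edge N x q)"
      obtain x q where "p = (x, q)" by (cases p)
      moreover obtain x' q' where "p' = (x', q')" by (cases p')
      ultimately have xq: "p = (x, q)" "p' = (x', q')" by auto
      have "x = x' \<and> q = q'" by (rule inj) (use p in \<open>auto simp: xq\<close>)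
      then show "p = p'" by (simp add: xq)
    qed
    show "(\<lambda>(x, q). cyl_edge N x q) ` ({0..<int N} \<times> edge_codes m) = cyl_edges m N"
    proof (rule subset_antisym)
      show "(\<lambda>(x, q). cyl_edge N x q) ` ({0..<int N} \<times> edge_codes m) \<subseteq> cyl_edges m N"
        using ran by (simp add: image_subset_iff)
      show "cyl_edges m N \<subseteq> (\<lambda>(x, q). cyl_edge N x q) ` ({0..<int N} \<times> edge_codes m)"
      proof
        fix e assume "e \<in> cyl_edges m N"
        then obtain x q where "x \<in> {0..<int N}" "q \<in> edge_codes m" "e = cyl_edge N x q" using sur by blast
        then show "e \<in> (\<lambda>(x, q). cyl_edge N x q) ` ({0..<int N} \<times> edge_codes m)"
          by (intro image_eqI[of _ _ "(x, q)"]) simp_all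
      qed
    qed
  qed
qed

text \<open>Whether an edge occurs depends only on the states entering and leaving the column of its
  tail. This locality is what makes the transfer matrix possible.\<close>

lemma cyl_edge_in_dimer:
  assumes N: "N > 0" and s: "compatible m N s" and x: "x \<in> {0..<int N}" and q: "q \<in> edge_codes m"
  shows "cyl_edge N x q \<in> dimer_of m N (cfg N s) \<longleftrightarrow> present (s ((x - 1) mod int N)) (s x) q"
proof -
  obtain u b where ub: "q = (u, b)" by fastforce
  have u: "column u = 0" "u \<in> cyl_vertices m 1" using q cyl_one by (auto simp: ub edge_codes_def)
  define v where "v = translate x u"
  have v: "v \<in> cyl_vertices m N" unfolding v_def using translate_in_cyl[OF N u(2)] x by simp
  note L = cfg_config[OF N s]
  have Lv: "cfg N s v = loc (s ((x - 1) mod int N)) (s x) u"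
    "cfg N s (cnxt v) = loc (s ((x - 1) mod int N)) (s x) (cnxt u)"
    unfolding cfg_loc by (simp_all add: v_def u cnxt_translate)
  have "{v, cnxt v} \<in> dimer_of m N (cfg N s) \<longleftrightarrow> cyl_mate N (cfg N s) v = cnxt v"
  proof
    assume "{v, cnxt v} \<in> dimer_of m N (cfg N s)"
    then have "{v, cnxt v} = {v, cyl_mate N (cfg N s) v}" by (rule dimer_of_edge(2)[OF N L]) simp
    then show "cyl_mate N (cfg N s) v = cnxt v" by (auto simp: doubleton_eq_iff)
  next
    assume "cyl_mate N (cfg N s) v = cnxt v"
    then show "{v, cnxt v} \<in> dimer_of m N (cfg N s)" unfolding dimer_of_def using v by force
  qed
  moreover have "cyl_mate N (cfg N s) v = cnxt v \<longleftrightarrow> \<not> cfg N s v \<and> \<not> cfg N s (cnxt v)"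
    using cleg_ne(1)[of N v] cnxt_simps(4)[of v] by (simp add: mate_def)
  ultimately show ?thesis using dimer_of_config(2)[OF N L v] Lv
    by (simp add: ub cyl_edge_def present_def Let_def v_def[symmetric])
qed

lemma dimer_of_cong:
  assumes "N > 0" "\<And>v. v \<in> cyl_vertices m N \<Longrightarrow> L v = L' v"
  shows "dimer_of m N L = dimer_of m N L'"
  unfolding dimer_of_def by (rule image_cong) (use mate_cong[OF assms] in auto)

lemma cfg_cong:
  assumes "N > 0" "\<And>x. 0 \<le> x \<Longrightarrow> x < int N \<Longrightarrow> s x = s' x" "v \<in> cyl_vertices m N"
  shows "cfg N s v = cfg N s' v"
proof -
  have "0 \<le> column v" "column v < int N" using assms(1,3) by (auto simp: cyl_vertices_eq)
  then show ?thesis unfolding cfg_loc using assms(1,2) by simp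
qed

lemma compatible_cong:
  assumes "N > 0" "\<And>x. 0 \<le> x \<Longrightarrow> x < int N \<Longrightarrow> s x = s' x"
  shows "compatible m N s = compatible m N s'"
  unfolding compatible_def using assms by (intro ball_cong) auto

text \<open>Dimer configurations correspond to cyclic sequences of states through
  \<open>out_state\<close> and \<open>cfg\<close>; functions that are undefined outside the columns
  make the correspondence one to one.\<close>

lemma dimer_event_sum_states:
  assumes N: "N > 0"
  shows "dimer_event_sum m N w P =
    (\<Sum>s | s \<in> {..<N} \<rightarrow>\<^sub>E Pow {..<m} \<and> compatible m N (\<lambda>x. s (nat x)) \<and> P (dimer_of m N (cfg N (\<lambda>x. s (nat x)))).
       \<Prod>e\<in>dimer_of m N (cfg N (\<lambda>x. s (nat x))). w e)"
  unfolding dimer_event_sum_def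
proof (rule sum.reindex_bij_witness[where i = "\<lambda>s. dimer_of m N (cfg N (\<lambda>x. s (nat x)))"
      and j = "\<lambda>D. \<lambda>t\<in>{..<N}. out_state m (legs_of N D) (int t)"])
  fix D assume D: "D \<in> {D. D \<in> cyl_dimers m N \<and> P D}"
  let ?s = "\<lambda>t\<in>{..<N}. out_state m (legs_of N D) (int t)"
  have D': "D \<in> cyl_dimers m N" "P D" using D by auto
  note L = dimer_legs[OF N D'(1)]
  have s: "?s (nat x) = out_state m (legs_of N D) x" if "0 \<le> x" "x < int N" for x using that by auto
  have "dimer_of m N (cfg N (\<lambda>x. ?s (nat x))) = dimer_of m N (cfg N (out_state m (legs_of N D)))"
    by (rule dimer_of_cong[OF N]) (rule cfg_cong[OF N s])
  also have "\<dots> = dimer_of m N (legs_of N D)"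
    by (rule dimer_of_cong[OF N]) (rule config_eq_cfg[OF N L(1), symmetric])
  finally show 1: "dimer_of m N (cfg N (\<lambda>x. ?s (nat x))) = D" using L(2) by simp
  show "(\<Prod>e\<in>dimer_of m N (cfg N (\<lambda>x. ?s (nat x))). w e) = prod w D" unfolding 1 ..
  have "compatible m N (\<lambda>x. ?s (nat x)) = compatible m N (out_state m (legs_of N D))"
    by (rule compatible_cong[OF N s])
  then have "compatible m N (\<lambda>x. ?s (nat x))"
    using out_state_compatible[OF N L(1)] by (simp only:)
  moreover have "?s \<in> {..<N} \<rightarrow>\<^sub>E Pow {..<m}" by (auto simp: out_state_def)
  ultimately show "?s \<in> {s. s \<in> {..<N} \<rightarrow>\<^sub>E Pow {..<m} \<and> compatible m N (\<lambda>x. s (nat x)) \<and> P (dimer_of m N (cfg N (\<lambda>x. s (nat x))))}"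
    using 1 D'(2) by simp
next
  fix s assume "s \<in> {s. s \<in> {..<N} \<rightarrow>\<^sub>E Pow {..<m} \<and> compatible m N (\<lambda>x. s (nat x)) \<and> P (dimer_of m N (cfg N (\<lambda>x. s (nat x))))}"
  then have s: "s \<in> {..<N} \<rightarrow>\<^sub>E Pow {..<m}" "compatible m N (\<lambda>x. s (nat x))" "P (dimer_of m N (cfg N (\<lambda>x. s (nat x))))" by auto
  note C = dimer_of_config[OF N cfg_config[OF N s(2)]]
  show "dimer_of m N (cfg N (\<lambda>x. s (nat x))) \<in> {D. D \<in> cyl_dimers m N \<and> P D}" using C(1) s(3) by simp
  show "(\<lambda>t\<in>{..<N}. out_state m (legs_of N (dimer_of m N (cfg N (\<lambda>x. s (nat x))))) (int t)) = s"
  proof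
    fix t
    show "(\<lambda>t\<in>{..<N}. out_state m (legs_of N (dimer_of m N (cfg N (\<lambda>x. s (nat x))))) (int t)) t = s t"
    proof (cases "t < N")
      case True
      have "y \<in> out_state m (legs_of N (dimer_of m N (cfg N (\<lambda>x. s (nat x))))) (int t) \<longleftrightarrow> y < m \<and> y \<in> s t" for y
        unfolding out_state_def using C(2)[of "BetaV Cb (int t) y"] True N by (cases "y < m") simp_all
      moreover have "s t \<subseteq> {..<m}" using PiE_mem[OF s(1), of t] True by simp
      ultimately show ?thesis using True by auto
    next
      case False
      then show ?thesis using PiE_arb[OF s(1), of t] by simp
    qed
  qed
qed

section \<open>Transfer matrices with local constraints\<close>

definition column_weight :: "nat \<Rightarrow> (vertex set \<Rightarrow> real) \<Rightarrow> int \<Rightarrow> nat set \<Rightarrow> nat set \<Rightarrow> real" where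
  "column_weight m W x I O' = (\<Prod>q\<in>edge_codes m. if present I O' q then W (band_edge x q) else 1)"

text \<open>A constraint \<open>(x, q, b)\<close> asks that the edge with code \<open>(x, q)\<close> be present or absent
  according to \<open>b\<close>.\<close>

definition transfer ::
    "nat \<Rightarrow> (vertex set \<Rightarrow> real) \<Rightarrow> (int \<times> (vertex \<times> bool) \<times> bool) set \<Rightarrow> int \<Rightarrow> nat set \<Rightarrow> nat set \<Rightarrow> real" where
  "transfer m W C x I O' =
     (if \<not> par I O' m \<and> (\<forall>(x', q, b)\<in>C. x' = x \<longrightarrow> present I O' q = b) then column_weight m W x I O' else 0)"

definition cyl_event :: "nat \<Rightarrow> (int \<times> (vertex \<times> bool) \<times> bool) set \<Rightarrow> vertex set set \<Rightarrow> bool" where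
  "cyl_event N C D \<longleftrightarrow> (\<forall>(x, q, b)\<in>C. (cyl_edge N (x mod int N) q \<in> D) = b)"

lemma prod_if_zero:
  fixes f :: "'i \<Rightarrow> real"
  assumes "finite A"
  shows "(\<Prod>t\<in>A. if c t then f t else 0) = (if \<forall>t\<in>A. c t then \<Prod>t\<in>A. f t else 0)"
proof (cases "\<forall>t\<in>A. c t")
  case False
  then have "\<exists>t\<in>A. (if c t then f t else 0) = 0" by auto
  then have "(\<Prod>t\<in>A. if c t then f t else 0) = 0" using assms by (simp add: prod_zero_iff)
  then show ?thesis unfolding if_not_P[OF False] .
qed simp

lemma dimer_weight_columns:
  assumes N: "N > 0" and W: "fisher_band_weight m n W" "n dvd N" and s: "compatible m N s"
  shows "(\<Prod>e\<in>dimer_of m N (cfg N s). cyl_weight m N W e)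
       = (\<Prod>t<N. column_weight m W (int t) (s ((int t - 1) mod int N)) (s (int t)))"
proof -
  let ?D = "dimer_of m N (cfg N s)" and ?w = "cyl_weight m N W"
  have DE: "?D \<subseteq> cyl_edges m N" using dimer_of_config(1)[OF N cfg_config[OF N s]] by (simp add: dimer_configs_def)
  have "(\<Prod>e\<in>?D. ?w e) = (\<Prod>e\<in>cyl_edges m N. if e \<in> ?D then ?w e else 1)"
    using DE finite_cyl_edges[OF N, of m] by (simp add: prod.inter_restrict[symmetric] Int_absorb1)
  also have "\<dots> = (\<Prod>p\<in>{0..<int N} \<times> edge_codes m.
      if (case p of (x, q) \<Rightarrow> cyl_edge N x q) \<in> ?D then ?w (case p of (x, q) \<Rightarrow> cyl_edge N x q) else 1)"
    by (rule prod.reindex_bij_betw[OF cyl_edge_bij[OF N], symmetric])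
  also have "\<dots> = (\<Prod>p\<in>{0..<int N} \<times> edge_codes m. case p of (x, q) \<Rightarrow>
      if present (s ((x - 1) mod int N)) (s x) q then W (band_edge x q) else 1)"
  proof (rule prod.cong[OF refl])
    fix p assume p: "p \<in> {0..<int N} \<times> edge_codes m"
    obtain x q where xq: "p = (x, q)" by (cases p)
    have x: "x \<in> {0..<int N}" and q: "q \<in> edge_codes m" using p by (auto simp: xq)
    have "?w (cyl_edge N x q) = W (band_edge x q)"
      using cyl_weight_reduce[OF W band_edge_in[OF q, of x]] reduce_band_edge[OF N q, of x] x by simp
    then show "(if (case p of (x, q) \<Rightarrow> cyl_edge N x q) \<in> ?D then ?w (case p of (x, q) \<Rightarrow> cyl_edge N x q) else 1)
        = (case p of (x, q) \<Rightarrow> if present (s ((x - 1) mod int N)) (s x) q then W (band_edge x q) else 1)"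
      using cyl_edge_in_dimer[OF N s x q] by (simp add: xq)
  qed
  also have "\<dots> = (\<Prod>x\<in>{0..<int N}. column_weight m W x (s ((x - 1) mod int N)) (s x))"
    unfolding column_weight_def by (rule prod.cartesian_product[symmetric])
  also have "\<dots> = (\<Prod>t<N. column_weight m W (int t) (s ((int t - 1) mod int N)) (s (int t)))"
  proof (rule prod.reindex_bij_betw[symmetric])
    show "bij_betw int {..<N} {0..<int N}"
      by (rule bij_betw_byWitness[where f' = nat]) auto
  qed
  finally show ?thesis .
qed

text \<open>The compatibility condition, the event and the weight all split into one factor for each
  pair of neighbouring columns; the sum over cyclic sequences is then a trace.\<close>

lemma dimer_event_sum_trace:
  assumes N: "N > 0" and W: "fisher_band_weight m n W" "n dvd N" and C: "\<And>x q b. (x, q, b) \<in> C \<Longrightarrow> q \<in> edge_codes m"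
  defines "T \<equiv> \<lambda>x I O'. if \<not> par I O' m \<and> (\<forall>(x', q, b)\<in>C. x' mod int N = x \<longrightarrow> present I O' q = b)
     then column_weight m W x I O' else 0"
  shows "dimer_event_sum m N (cyl_weight m N W) (cyl_event N C) = (\<Sum>a\<in>Pow {..<m}. kprod (Pow {..<m}) T 0 N a a)"
proof -
  let ?S = "Pow {..<m}"
  let ?pr = "\<lambda>t. if t = 0 then N - 1 else t - 1"
  have pr: "nat ((int t - 1) mod int N) = ?pr t" if "t < N" for t
  proof (cases t)
    case 0
    have "(- 1) mod int N = int N - 1" using N by (intro zmod_minus1) simp
    then show ?thesis using 0 N by simp
  next
    case (Suc k)
    then show ?thesis using that by simp
  qed
  have "dimer_event_sum m N (cyl_weight m N W) (cyl_event N C)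
      = (\<Sum>s\<in>{..<N} \<rightarrow>\<^sub>E ?S. if compatible m N (\<lambda>x. s (nat x)) \<and> cyl_event N C (dimer_of m N (cfg N (\<lambda>x. s (nat x))))
          then \<Prod>e\<in>dimer_of m N (cfg N (\<lambda>x. s (nat x))). cyl_weight m N W e else 0)"
    unfolding dimer_event_sum_states[OF N]
    by (subst sum.inter_filter[symmetric]) (auto intro!: finite_PiE)
  also have "\<dots> = (\<Sum>s\<in>{..<N} \<rightarrow>\<^sub>E ?S. \<Prod>t<N. T (int t) (s (?pr t)) (s t))"
  proof (rule sum.cong[OF refl])
    fix s assume "s \<in> {..<N} \<rightarrow>\<^sub>E ?S"
    let ?s = "\<lambda>x. s (nat x)"
    define c where "c t \<longleftrightarrow> \<not> par (s (?pr t)) (s t) m \<and> (\<forall>(x', q, b)\<in>C. x' mod int N = int t \<longrightarrow> present (s (?pr t)) (s t) q = b)" for t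
    have comp: "compatible m N ?s \<longleftrightarrow> (\<forall>t<N. \<not> par (s (?pr t)) (s t) m)"
    proof
      assume a: "compatible m N ?s"
      show "\<forall>t<N. \<not> par (s (?pr t)) (s t) m"
      proof (intro allI impI)
        fix t assume t: "t < N"
        have "\<not> par (?s ((int t - 1) mod int N)) (?s (int t)) m" using a[unfolded compatible_def, THEN bspec, of "int t"] t by simp
        then show "\<not> par (s (?pr t)) (s t) m" unfolding pr[OF t] by simp
      qed
    next
      assume a: "\<forall>t<N. \<not> par (s (?pr t)) (s t) m"
      show "compatible m N ?s" unfolding compatible_def
      proof
        fix x assume x: "x \<in> {0..<int N}"
        then have t: "nat x < N" "int (nat x) = x" by auto
        show "\<not> par (?s ((x - 1) mod int N)) (?s x) m" using a t pr[OF t(1)] unfolding t(2) by metis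
      qed
    qed
    have ev: "cyl_event N C (dimer_of m N (cfg N ?s)) \<longleftrightarrow>
        (\<forall>t<N. \<forall>(x', q, b)\<in>C. x' mod int N = int t \<longrightarrow> present (s (?pr t)) (s t) q = b)" if co: "compatible m N ?s"
    proof -
      have e: "(cyl_edge N (x mod int N) q \<in> dimer_of m N (cfg N ?s)) = present (s (?pr t)) (s t) q"
        if "(x, q, b) \<in> C" "x mod int N = int t" "t < N" for x q b t
        using cyl_edge_in_dimer[OF N co _ C[OF that(1)], of "int t"] that(2,3) pr[OF that(3)] by simp
      have "\<exists>t<N. x mod int N = int t" for x using N
        by (intro exI[of _ "nat (x mod int N)"]) (simp add: nat_less_iff)
      then show ?thesis unfolding cyl_event_def using e by fastforce
    qed
    have cond: "compatible m N ?s \<and> cyl_event N C (dimer_of m N (cfg N ?s)) \<longleftrightarrow> (\<forall>t\<in>{..<N}. c t)"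
    proof (cases "compatible m N ?s")
      case True
      then show ?thesis using comp ev[OF True] unfolding c_def by blast
    next
      case False
      then show ?thesis using comp unfolding c_def by blast
    qed
    have w: "(\<Prod>e\<in>dimer_of m N (cfg N ?s). cyl_weight m N W e) = (\<Prod>t<N. column_weight m W (int t) (s (?pr t)) (s t))"
      if co: "compatible m N ?s"
      unfolding dimer_weight_columns[OF N W co] by (rule prod.cong) (simp_all add: pr)
    have "(\<Prod>t<N. T (int t) (s (?pr t)) (s t)) = (\<Prod>t<N. if c t then column_weight m W (int t) (s (?pr t)) (s t) else 0)"
      unfolding T_def c_def ..
    also have "\<dots> = (if \<forall>t\<in>{..<N}. c t then \<Prod>t<N. column_weight m W (int t) (s (?pr t)) (s t) else 0)"
      by (rule prod_if_zero) simp
    finally show "(if compatible m N ?s \<and> cyl_event N C (dimer_of m N (cfg N ?s))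
          then \<Prod>e\<in>dimer_of m N (cfg N ?s). cyl_weight m N W e else 0) = (\<Prod>t<N. T (int t) (s (?pr t)) (s t))"
      using cond w by (simp only:) (metis (no_types, lifting))
  qed
  also have "\<dots> = (\<Sum>a\<in>?S. kprod ?S T 0 N a a)" by (rule closed_path_sum) (use N in auto)
  finally show ?thesis .
qed

lemma band_edge_translate: "q \<in> edge_codes m \<Longrightarrow> band_edge (x + d) q = translate d ` band_edge x q"
proof -
  assume q: "q \<in> edge_codes m"
  obtain u b where ub: "q = (u, b)" by fastforce
  have t: "translate d (translate x v) = translate (x + d) v" for v by (cases v) simp_all
  have "band_leg (translate (x + d) u) = translate d (band_leg (translate x u))"
    by (cases "(0 :: nat, u)" rule: cleg.cases) simp_all
  then show ?thesis by (simp add: ub band_edge_def Let_def t cnxt_translate)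
qed

lemma column_weight_periodic:
  assumes "fisher_band_weight m n W" "int n dvd d"
  shows "column_weight m W (x + d) I O' = column_weight m W x I O'"
  unfolding column_weight_def
proof (rule prod.cong[OF refl])
  fix q assume q: "q \<in> edge_codes m"
  have "W (band_edge (x + d) q) = W (band_edge x q)"
    unfolding band_edge_translate[OF q] by (rule weight_translate[OF assms(1) band_edge_in[OF q] assms(2)])
  then show "(if present I O' q then W (band_edge (x + d) q) else 1) = (if present I O' q then W (band_edge x q) else 1)"
    by simp
qed

lemma column_weight_pos:
  assumes "fisher_band_weight m n W"
  shows "column_weight m W x I O' > 0"
  unfolding column_weight_def
  using assms band_edge_in by (intro prod_pos) (auto simp: fisher_band_weight_def)

text \<open>At height \<open>m\<close> the condition at the top row says that the two states have
  equal parity: the origin of the two blocks.\<close>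

lemma par_card: "par I O' y \<longleftrightarrow> odd (card (I \<inter> {..<y}) + card (O' \<inter> {..<y}))"
proof (induction y)
  case (Suc y)
  have "card (J \<inter> {..<Suc y}) = card (J \<inter> {..<y}) + (if y \<in> J then 1 else 0)" for J
    by (simp add: lessThan_Suc Int_insert_right)
  then show ?case using Suc by auto
qed simp

text \<open>A path that stays at \<open>s\<close> until the last step shows positivity within a
  class, and no step leaves a class.\<close>

lemma kprod_classes:
  fixes T :: "int \<Rightarrow> 's \<Rightarrow> 's \<Rightarrow> real"
  assumes S: "finite S" and pos: "\<And>x s u. s \<in> S \<Longrightarrow> u \<in> S \<Longrightarrow> c s = c u \<Longrightarrow> T x s u > 0"
    and zero: "\<And>x s u. s \<in> S \<Longrightarrow> u \<in> S \<Longrightarrow> c s \<noteq> c u \<Longrightarrow> T x s u = 0"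
  shows "s \<in> S \<Longrightarrow> t \<in> S \<Longrightarrow> (c s = c t \<longrightarrow> kprod S T a (Suc l) s t > 0) \<and> (c s \<noteq> c t \<longrightarrow> kprod S T a (Suc l) s t = 0)"
proof (induction l arbitrary: a s)
  case 0
  have "kprod S T a (Suc 0) s t = T a s t" using kmult_id_right[OF S 0(2), of "T a" s] by simp
  then show ?case using pos[OF 0] zero[OF 0] by auto
next
  case (Suc l)
  have e: "kprod S T a (Suc (Suc l)) s t = (\<Sum>u\<in>S. T a s u * kprod S T (a + 1) (Suc l) u t)"
    by (simp add: kmult_def)
  have IH: "(c u = c t \<longrightarrow> kprod S T (a + 1) (Suc l) u t > 0) \<and> (c u \<noteq> c t \<longrightarrow> kprod S T (a + 1) (Suc l) u t = 0)"
    if "u \<in> S" for u by (rule Suc.IH[OF that Suc.prems(2)])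
  show ?case
  proof (intro conjI impI)
    assume ct: "c s = c t"
    show "kprod S T a (Suc (Suc l)) s t > 0"
      unfolding e
    proof (rule sum_pos2[OF S Suc.prems(1)])
      show "0 < T a s s * kprod S T (a + 1) (Suc l) s t"
        using pos[OF Suc.prems(1,1), of a] IH[OF Suc.prems(1)] ct by simp
      show "0 \<le> T a s u * kprod S T (a + 1) (Suc l) u t" if u: "u \<in> S" for u
        using pos[OF Suc.prems(1) u, of a] zero[OF Suc.prems(1) u, of a] IH[OF u]
        by (cases "c s = c u"; cases "c u = c t") (auto simp del: kprod.simps intro!: mult_nonneg_nonneg less_imp_le)
    qed
  next
    assume ct: "c s \<noteq> c t"
    show "kprod S T a (Suc (Suc l)) s t = 0"
      unfolding e
    proof (rule sum.neutral, rule ballI)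
      fix u assume u: "u \<in> S"
      show "T a s u * kprod S T (a + 1) (Suc l) u t = 0"
        using zero[OF Suc.prems(1) u, of a] IH[OF u] ct by (cases "c s = c u") (auto simp del: kprod.simps)
    qed
  qed
qed

text \<open>A finite set of constraints lies within a fixed number of columns on both sides of
  \<open>0\<close>. The rest of the cylinder is an unconstrained power of the period matrix, so
  \<open>trace_ratio_convergent\<close> applies.\<close>

lemma local_event_convergent:
  assumes m: "m \<ge> 1" and n: "n \<ge> 1" and W: "fisher_band_weight m n W"
    and fC: "finite C" and C: "\<And>x q b. (x, q, b) \<in> C \<Longrightarrow> q \<in> edge_codes m"
  shows "convergent (\<lambda>l. dimer_event_sum m (2 * l * n) (cyl_weight m (2 * l * n) W) (cyl_event (2 * l * n) C)
    / dimer_sum m (2 * l * n) (cyl_weight m (2 * l * n) W))"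
proof -
  let ?S = "Pow {..<m}"
  define S0 S1 where "S0 = {s \<in> ?S. even (card s)}" and "S1 = {s \<in> ?S. odd (card s)}"
  have SS: "S0 \<union> S1 = ?S" "S0 \<inter> S1 = {}" unfolding S0_def S1_def by auto
  have fS: "finite ?S" by simp
  have fin: "finite S0" "finite S1" unfolding S0_def S1_def by auto
  have ne: "S0 \<noteq> {}" "S1 \<noteq> {}"
  proof -
    have "{} \<in> S0" unfolding S0_def by simp
    then show "S0 \<noteq> {}" by blast
    have "{0} \<in> S1" unfolding S1_def using m by simp
    then show "S1 \<noteq> {}" by blast
  qed
  define T0 where "T0 = transfer m W {}"
  define Tc where "Tc = transfer m W C"
  define A where "A = kprod ?S T0 0 n"
  have parS: "par I O' m \<longleftrightarrow> even (card I) \<noteq> even (card O')" if "I \<in> ?S" "O' \<in> ?S" for I O'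
    using that by (simp add: par_card Int_absorb2)
  have T0p: "T0 x s u > 0" if "s \<in> ?S" "u \<in> ?S" "even (card s) = even (card u)" for x s u
    using parS[OF that(1,2)] that(3) column_weight_pos[OF W] by (simp add: T0_def transfer_def)
  have T0z: "T0 x s u = 0" if "s \<in> ?S" "u \<in> ?S" "even (card s) \<noteq> even (card u)" for x s u
    using parS[OF that(1,2)] that(3) by (simp add: T0_def transfer_def)
  obtain n' where n': "n = Suc n'" using n by (cases n) auto
  have Acl: "(even (card s) = even (card t) \<longrightarrow> A s t > 0) \<and> (even (card s) \<noteq> even (card t) \<longrightarrow> A s t = 0)"
    if "s \<in> ?S" "t \<in> ?S" for s t
    unfolding A_def n' by (rule kprod_classes[where c = "\<lambda>s. even (card s)" and T = T0, OF fS T0p T0z that])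
  have Apos: "A s u > 0" if "s \<in> S0" "u \<in> S0" for s u using Acl[of s u] that by (simp add: S0_def)
  have Apos1: "A s u > 0" if "s \<in> S1" "u \<in> S1" for s u using Acl[of s u] that by (simp add: S1_def)
  have Az: "A s u = 0" if "s \<in> S0" "u \<in> S1" for s u using Acl[of s u] that by (simp add: S0_def S1_def)
  have Az1: "A s u = 0" if "s \<in> S1" "u \<in> S0" for s u using Acl[of s u] that by (simp add: S0_def S1_def)
  obtain K where K: "\<And>x q b. (x, q, b) \<in> C \<Longrightarrow> nat \<bar>x\<bar> \<le> K"
  proof -
    have "finite ((\<lambda>(x, q, b). nat \<bar>x\<bar>) ` C)" using fC by simp
    then obtain K where "\<forall>k\<in>(\<lambda>(x, q, b). nat \<bar>x\<bar>) ` C. k \<le> K" using finite_nat_set_iff_bounded_le by blast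
    then show thesis by (intro that[of K]) force
  qed
  \<comment> \<open>With \<open>n\<close> at least \<open>1\<close>, the half width
    \<open>h = k * n\<close> exceeds all column indices in \<open>C\<close> in absolute value and is
    a whole number of periods.\<close>
  define k where "k = Suc K"
  define h where "h = k * n"
  have kC: "- int h < x \<and> x < int h" if "(x, q, b) \<in> C" for x q b
  proof -
    have "\<bar>x\<bar> \<le> int K" using K[OF that] by linarith
    also have "int K < int h"
    proof -
      have "k * 1 \<le> k * n" using n by (intro mult_le_mono2) simp
      then have "K < h" unfolding h_def k_def mult_1_right Suc_le_eq .
      then show ?thesis by simp
    qed
    finally show ?thesis by linarith
  qed
  \<comment> \<open>The constrained window in its natural position on the band, from column
    \<open>- h\<close> to column \<open>h - 1\<close>.\<close>
  define B where "B = kmult ?S (kprod ?S Tc (- int h) h) (kprod ?S Tc 0 h)"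
  have per: "T0 (x + int n) s t = T0 x s t" for x s t
    unfolding T0_def transfer_def using column_weight_periodic[OF W, of "int n"] by simp
  have lim: "convergent (\<lambda>l. (\<Sum>s\<in>?S. kmult ?S (kpow ?S A (2 * l - 2 * k)) B s s) / (\<Sum>s\<in>?S. kpow ?S A (2 * l) s s))"
    by (rule trace_ratio_convergent[where A = A and ?S0.0 = S0 and ?S1.0 = S1 and q = k and B = B, unfolded SS(1)])
      (fact fin ne SS(2) Apos Apos1 Az Az1)+
  have eq: "dimer_event_sum m (2 * l * n) (cyl_weight m (2 * l * n) W) (cyl_event (2 * l * n) C)
      / dimer_sum m (2 * l * n) (cyl_weight m (2 * l * n) W)
      = (\<Sum>s\<in>?S. kmult ?S (kpow ?S A (2 * l - 2 * k)) B s s) / (\<Sum>s\<in>?S. kpow ?S A (2 * l) s s)"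
    if l: "l \<ge> k" for l
  proof -
    define N where "N = 2 * l * n"
    have k1: "k \<ge> 1" unfolding k_def by simp
    have N0: "N > 0" unfolding N_def using l k1 n by simp
    have nN: "n dvd N" unfolding N_def by simp
    have Nh: "N = h + ((2 * l - 2 * k) * n + h)"
    proof -
      have "2 * l = k + ((2 * l - 2 * k) + k)" using l by simp
      then have "2 * l * n = (k + ((2 * l - 2 * k) + k)) * n" by simp
      then show ?thesis unfolding N_def h_def by (simp only: add_mult_distrib)
    qed
    then have kN: "2 * int h \<le> int N" by linarith
    have den: "dimer_sum m N (cyl_weight m N W) = (\<Sum>s\<in>?S. kpow ?S A (2 * l) s s)"
    proof -
      have "dimer_sum m N (cyl_weight m N W) = dimer_event_sum m N (cyl_weight m N W) (cyl_event N {})"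
        by (simp add: dimer_sum_def dimer_event_sum_def cyl_event_def)
      also have "\<dots> = (\<Sum>a\<in>?S. kprod ?S (\<lambda>x I O'. if \<not> par I O' m \<and> (\<forall>(x', q, b)\<in>{}. x' mod int N = x \<longrightarrow> present I O' q = b)
          then column_weight m W x I O' else 0) 0 N a a)"
        by (rule dimer_event_sum_trace[OF N0 W nN]) simp
      also have "\<dots> = (\<Sum>a\<in>?S. kprod ?S T0 0 N a a)"
        by (intro sum.cong refl kprod_cong) (auto simp: T0_def transfer_def)
      also have "\<dots> = (\<Sum>s\<in>?S. kpow ?S A (2 * l) s s)"
        unfolding A_def N_def using kprod_periodic[where T = T0 and a = 0, OF fS per] by simp
      finally show ?thesis .
    qed
    define Tt where "Tt = (\<lambda>x I O'. if \<not> par I O' m \<and> (\<forall>(x', q, b)\<in>C. x' mod int N = x \<longrightarrow> present I O' q = b)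
      then column_weight m W x I O' else 0)"
    have md: "x mod int N = (if x \<ge> 0 then x else x + int N)" if "(x, q, b) \<in> C" for x q b
    proof (cases "x \<ge> 0")
      case True
      then show ?thesis using kC[OF that] kN mod_pos_pos_trivial[of x "int N"] by auto
    next
      case False
      have "x mod int N = (x + int N) mod int N" by simp
      also have "\<dots> = x + int N" using False kC[OF that] kN by (intro mod_pos_pos_trivial) linarith+
      finally show ?thesis using False by simp
    qed
    have t1: "Tt (int i) s t = Tc (int i) s t" if i: "i < h" for i s t
    proof -
      have "(x mod int N = int i) = (x = int i)" if "(x, q, b) \<in> C" for x q b
        unfolding md[OF that] using kC[OF that] kN i by auto
      then have "(\<forall>(x', q, b)\<in>C. x' mod int N = int i \<longrightarrow> present s t q = b) = (\<forall>(x', q, b)\<in>C. x' = int i \<longrightarrow> present s t q = b)"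
        by blast
      then show ?thesis unfolding Tt_def Tc_def transfer_def by simp
    qed
    have t2: "Tt (int h + int i) s t = T0 (int h + int i) s t" if i: "i < (2 * l - 2 * k) * n" for i s t
    proof -
      have "int h + int i < int N - int h" using i Nh by linarith
      then have "x mod int N \<noteq> int h + int i" if "(x, q, b) \<in> C" for x q b
        unfolding md[OF that] using kC[OF that] by auto
      then have "\<forall>(x', q, b)\<in>C. x' mod int N = int h + int i \<longrightarrow> present s t q = b" by blast
      then show ?thesis unfolding Tt_def T0_def transfer_def by simp
    qed
    \<comment> \<open>On the cylinder the negative columns of the window are the last
      \<open>h\<close> columns; the weights agree because \<open>n\<close> divides
      \<open>N\<close>.\<close>
    have t3: "Tt (int N - int h + int i) s t = Tc (- int h + int i) s t" if i: "i < h" for i s t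
    proof -
      have "(x mod int N = int N - int h + int i) = (x = - int h + int i)" if "(x, q, b) \<in> C" for x q b
        unfolding md[OF that] using kC[OF that] kN i by auto
      then have "(\<forall>(x', q, b)\<in>C. x' mod int N = int N - int h + int i \<longrightarrow> present s t q = b)
          = (\<forall>(x', q, b)\<in>C. x' = - int h + int i \<longrightarrow> present s t q = b)"
        by blast
      moreover have "column_weight m W (int N - int h + int i) s t = column_weight m W (- int h + int i) s t"
        using column_weight_periodic[OF W, of "int N" "- int h + int i" s t] nN by (simp add: algebra_simps)
      ultimately show ?thesis unfolding Tt_def Tc_def transfer_def by simp
    qed
    have split: "kprod ?S Tt 0 N a a = kmult ?S (kprod ?S Tc 0 h)
        (kmult ?S (kpow ?S A (2 * l - 2 * k)) (kprod ?S Tc (- int h) h)) a a" if a: "a \<in> ?S" for a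
    proof -
      have st: "0 + int h + int ((2 * l - 2 * k) * n) = int N - int h" using Nh by linarith
      have "kprod ?S Tt 0 N a a = kmult ?S (kprod ?S Tt 0 h) (kprod ?S Tt (0 + int h) ((2 * l - 2 * k) * n + h)) a a"
        by (subst Nh, rule kprod_add[OF fS a])
      also have "\<dots> = kmult ?S (kprod ?S Tc 0 h)
        (kmult ?S (kpow ?S A (2 * l - 2 * k)) (kprod ?S Tc (- int h) h)) a a"
      proof (rule kmult_cong)
        fix u assume u: "u \<in> ?S"
        show "kprod ?S Tt 0 h a u = kprod ?S Tc 0 h a u"
          by (rule kprod_cong[OF _ a u]) (use t1 in simp)
        have "kprod ?S Tt (0 + int h) ((2 * l - 2 * k) * n + h) u a
            = kmult ?S (kprod ?S Tt (0 + int h) ((2 * l - 2 * k) * n))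
                (kprod ?S Tt (0 + int h + int ((2 * l - 2 * k) * n)) h) u a"
          by (rule kprod_add[OF fS u])
        also have "\<dots> = kmult ?S (kpow ?S A (2 * l - 2 * k)) (kprod ?S Tc (- int h) h) u a"
        proof (rule kmult_cong)
          fix v assume v: "v \<in> ?S"
          have "kprod ?S Tt (0 + int h) ((2 * l - 2 * k) * n) u v = kprod ?S T0 (int h) ((2 * l - 2 * k) * n) u v"
            by (rule kprod_cong[OF _ u v]) (use t2 in simp)
          also have "\<dots> = kpow ?S A (2 * l - 2 * k) u v"
            using kprod_periodic[where T = T0 and a = "int k", OF fS per u v] by (simp add: A_def h_def)
          finally show "kprod ?S Tt (0 + int h) ((2 * l - 2 * k) * n) u v = kpow ?S A (2 * l - 2 * k) u v" .
          show "kprod ?S Tt (0 + int h + int ((2 * l - 2 * k) * n)) h v a = kprod ?S Tc (- int h) h v a"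
            unfolding st by (rule kprod_cong[OF _ v a]) (rule t3)
        qed
        finally show "kprod ?S Tt (0 + int h) ((2 * l - 2 * k) * n + h) u a
            = kmult ?S (kpow ?S A (2 * l - 2 * k)) (kprod ?S Tc (- int h) h) u a" .
      qed
      finally show ?thesis .
    qed
    have "dimer_event_sum m N (cyl_weight m N W) (cyl_event N C) = (\<Sum>a\<in>?S. kprod ?S Tt 0 N a a)"
      unfolding Tt_def by (rule dimer_event_sum_trace[OF N0 W nN C])
    also have "\<dots> = (\<Sum>a\<in>?S. kmult ?S (kprod ?S Tc 0 h)
        (kmult ?S (kpow ?S A (2 * l - 2 * k)) (kprod ?S Tc (- int h) h)) a a)"
      by (rule sum.cong[OF refl split])
    \<comment> \<open>Cyclicity of the trace rejoins the two halves of the window, which the cut at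
      column \<open>0\<close> had separated.\<close>
    also have "\<dots> = (\<Sum>a\<in>?S. kmult ?S (kpow ?S A (2 * l - 2 * k)) B a a)"
      unfolding trace_kmult_commute[of ?S "kprod ?S Tc 0 h"] kmult_assoc B_def ..
    finally show ?thesis unfolding den[unfolded N_def] N_def by simp
  qed
  have "\<forall>\<^sub>F l in sequentially.
      (\<Sum>s\<in>?S. kmult ?S (kpow ?S A (2 * l - 2 * k)) B s s) / (\<Sum>s\<in>?S. kpow ?S A (2 * l) s s)
      = dimer_event_sum m (2 * l * n) (cyl_weight m (2 * l * n) W) (cyl_event (2 * l * n) C)
        / dimer_sum m (2 * l * n) (cyl_weight m (2 * l * n) W)"
    unfolding eventually_sequentially by (rule exI[of _ k]) (use eq in simp)
  from Lim_transform_eventually[OF _ this] lim show ?thesis unfolding convergent_def by blast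
qed

section \<open>The limit measure\<close>

text \<open>Limits of finite-dimensional laws are again consistent, since consistency consists of
  finite sums. The extension theorem for real coordinates then applies to the indicator vectors, and
  the result is carried back to random sets.\<close>

lemma bit_process_exists:
  fixes E :: "'e set" and \<mu> :: "nat \<Rightarrow> 'c measure" and X :: "nat \<Rightarrow> 'e \<Rightarrow> 'c \<Rightarrow> bool"
  assumes prob: "\<And>l. prob_space (\<mu> l)" and sets: "\<And>l. sets (\<mu> l) = Pow (space (\<mu> l))"
    and conv: "\<And>J T. finite J \<Longrightarrow> J \<subseteq> E \<Longrightarrow> T \<subseteq> J \<Longrightarrow>
      convergent (\<lambda>l. measure (\<mu> l) {D \<in> space (\<mu> l). \<forall>e\<in>J. X l e D = (e \<in> T)})"
  shows "\<exists>M. prob_space M \<and> space M = Pow E \<and>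
    (\<forall>J T. finite J \<longrightarrow> J \<subseteq> E \<longrightarrow> T \<subseteq> J \<longrightarrow> {S. S \<subseteq> E \<and> S \<inter> J = T} \<in> sets M \<and>
      (\<lambda>l. measure (\<mu> l) {D \<in> space (\<mu> l). \<forall>e\<in>J. X l e D = (e \<in> T)})
        \<longlonglongrightarrow> measure M {S. S \<subseteq> E \<and> S \<inter> J = T})"
proof -
  define r where "r l J T = measure (\<mu> l) {D \<in> space (\<mu> l). \<forall>e\<in>J. X l e D = (e \<in> T)}" for l J T
  define q where "q J T = lim (\<lambda>l. r l J T)" for J T
  have rq: "(\<lambda>l. r l J T) \<longlonglongrightarrow> q J T" if "finite J" "J \<subseteq> E" "T \<subseteq> J" for J T
    using conv[OF that] unfolding q_def r_def by (simp add: convergent_LIMSEQ_iff)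
  \<comment> \<open>Consistency before the limit: the pattern \<open>T\<close> on \<open>J\<close>
    is the disjoint union of all its extensions to \<open>H\<close>.\<close>
  have rsum: "r l J T = (\<Sum>T' | T' \<subseteq> H \<and> T' \<inter> J = T. r l H T')" if "J \<subseteq> H" "finite H" "T \<subseteq> J" for l J H T
  proof -
    interpret prob_space "\<mu> l" by (rule prob)
    let ?A = "\<lambda>T'. {D \<in> space (\<mu> l). \<forall>e\<in>H. X l e D = (e \<in> T')}"
    have "{D \<in> space (\<mu> l). \<forall>e\<in>J. X l e D = (e \<in> T)} = (\<Union>T'\<in>{T'. T' \<subseteq> H \<and> T' \<inter> J = T}. ?A T')" (is "?L = ?R")
    proof (rule subset_antisym)
      show "?L \<subseteq> ?R"
      proof
        fix D assume D: "D \<in> ?L"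
        have "{e \<in> H. X l e D} \<subseteq> H \<and> {e \<in> H. X l e D} \<inter> J = T" using D that(1,3) by blast
        moreover have "D \<in> ?A {e \<in> H. X l e D}" using D by blast
        ultimately show "D \<in> ?R" by blast
      qed
      show "?R \<subseteq> ?L" using that(1) by blast
    qed
    moreover have "measure (\<mu> l) ?R = (\<Sum>T' | T' \<subseteq> H \<and> T' \<inter> J = T. measure (\<mu> l) (?A T'))"
    proof (rule finite_measure_finite_Union)
      show "finite {T'. T' \<subseteq> H \<and> T' \<inter> J = T}"
        by (rule finite_subset[of _ "Pow H"]) (use that(2) in auto)
      show "?A ` {T'. T' \<subseteq> H \<and> T' \<inter> J = T} \<subseteq> sets (\<mu> l)" unfolding sets by auto
      have "?A T1 \<inter> ?A T2 = {}" if "T1 \<subseteq> H" "T2 \<subseteq> H" "T1 \<noteq> T2" for T1 T2 using that by blast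
      then show "disjoint_family_on ?A {T'. T' \<subseteq> H \<and> T' \<inter> J = T}" unfolding disjoint_family_on_def by simp
    qed
    ultimately show ?thesis unfolding r_def by simp
  qed
  have qsum: "q J T = (\<Sum>T' | T' \<subseteq> H \<and> T' \<inter> J = T. q H T')" if "J \<subseteq> H" "finite H" "H \<subseteq> E" "T \<subseteq> J" for J H T
  proof -
    have "(\<lambda>l. \<Sum>T' | T' \<subseteq> H \<and> T' \<inter> J = T. r l H T') \<longlonglongrightarrow> (\<Sum>T' | T' \<subseteq> H \<and> T' \<inter> J = T. q H T')"
      by (rule tendsto_sum) (use that rq in auto)
    then have "(\<lambda>l. r l J T) \<longlonglongrightarrow> (\<Sum>T' | T' \<subseteq> H \<and> T' \<inter> J = T. q H T')"
      using rsum[OF that(1,2,4)] by simp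
    moreover have "(\<lambda>l. r l J T) \<longlonglongrightarrow> q J T" using rq[of J T] that finite_subset by blast
    ultimately show ?thesis by (rule LIMSEQ_unique[THEN sym])
  qed
  have qnn: "q J T \<ge> 0" if "finite J" "J \<subseteq> E" "T \<subseteq> J" for J T
    by (rule tendsto_lowerbound[OF rq[OF that]]) (simp_all add: r_def)
  have qtot: "(\<Sum>T\<in>Pow H. q H T) = 1" if "finite H" "H \<subseteq> E" for H
  proof -
    have "r l {} {} = 1" for l unfolding r_def using prob_space.prob_space[OF prob] by simp
    then have "(\<lambda>l. 1) \<longlonglongrightarrow> q {} {}" using rq[of "{}" "{}"] by simp
    then have "q {} {} = 1" by (rule LIMSEQ_unique) simp
    then show ?thesis using qsum[of "{}" H "{}"] that by (simp add: Pow_def)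
  qed
  \<comment> \<open>A probability mass function by type for every \<open>J\<close>, so each
    \<open>Q J\<close> below is a probability measure without further conditions; for finite
    \<open>J\<close> in \<open>E\<close> its values are the limits \<open>q\<close>.\<close>
  define p where "p J = embed_pmf (\<lambda>T. if T \<subseteq> J then q J T else 0)" for J
  have pmfp: "pmf (p J) T = (if T \<subseteq> J then q J T else 0)" if "finite J" "J \<subseteq> E" for J T
    unfolding p_def
  proof (rule pmf_embed_pmf)
    show "0 \<le> (if T \<subseteq> J then q J T else 0)" for T using qnn[OF that] by simp
    have "(\<integral>\<^sup>+T. ennreal (if T \<subseteq> J then q J T else 0) \<partial>count_space UNIV)
        = (\<Sum>T\<in>Pow J. ennreal (if T \<subseteq> J then q J T else 0))"
      by (rule nn_integral_count_space') (use that in auto)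
    also have "\<dots> = (\<Sum>T\<in>Pow J. ennreal (q J T))" by (rule sum.cong) auto
    also have "\<dots> = 1" using qtot[OF that] qnn[OF that] by (subst sum_ennreal) auto
    finally show "(\<integral>\<^sup>+T. ennreal (if T \<subseteq> J then q J T else 0) \<partial>count_space UNIV) = 1" .
  qed
  have pmap: "p J = map_pmf (\<lambda>T. T \<inter> J) (p H)" if "J \<subseteq> H" "finite H" "H \<subseteq> E" for J H
  proof (rule pmf_eqI)
    fix T
    have J: "finite J" "J \<subseteq> E" using that finite_subset by auto
    have "pmf (map_pmf (\<lambda>T. T \<inter> J) (p H)) T = measure (p H) ((\<lambda>T. T \<inter> J) -` {T})" by (rule pmf_map)
    also have "\<dots> = measure (p H) {T'. T' \<subseteq> H \<and> T' \<inter> J = T}"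
      by (rule measure_prob_cong_0) (auto simp: pmfp[OF that(2,3)])
    also have "\<dots> = (\<Sum>T' | T' \<subseteq> H \<and> T' \<inter> J = T. pmf (p H) T')"
      by (rule measure_measure_pmf_finite) (rule finite_subset[of _ "Pow H"], use that in auto)
    also have "\<dots> = (\<Sum>T' | T' \<subseteq> H \<and> T' \<inter> J = T. q H T')" by (rule sum.cong) (auto simp: pmfp[OF that(2,3)])
    also have "\<dots> = pmf (p J) T"
    proof (cases "T \<subseteq> J")
      case True
      then show ?thesis using qsum[OF that True] pmfp[OF J] by simp
    next
      case False
      then have "{T'. T' \<subseteq> H \<and> T' \<inter> J = T} = {}" by blast
      then show ?thesis using pmfp[OF J] False by (simp only: sum.empty if_False)
    qed
    finally show "pmf (p J) T = pmf (map_pmf (\<lambda>T. T \<inter> J) (p H)) T" by simp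
  qed
  \<comment> \<open>Sets are coded by real indicator functions, because the extension theorem is
    applied to copies of the real line.\<close>
  define b where "b J T = restrict (indicat_real T) J" for J and T :: "'e set"
  let ?B = "\<lambda>J. PiM J (\<lambda>_. borel :: real measure)"
  define Q where "Q J = distr (measure_pmf (p J)) (?B J) (b J)" for J
  have bm: "b J \<in> measurable (measure_pmf (p K)) (?B J)" for J K by (auto simp: space_PiM b_def)
  have bm': "b J \<in> measurable (count_space UNIV) (?B J)" for J by (auto simp: space_PiM b_def)
  interpret polish_projective E Q
  proof (intro polish_projective.intro projective_family.intro)
    show "prob_space (Q J)" for J
      unfolding Q_def by (rule prob_space.prob_space_distr[OF prob_space_measure_pmf bm])
    fix J H assume JH: "J \<subseteq> H" "finite H" "H \<subseteq> E"
    have "Q J = distr (distr (measure_pmf (p H)) (count_space UNIV) (\<lambda>T. T \<inter> J)) (?B J) (b J)"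
      unfolding Q_def pmap[OF JH] map_pmf_rep_eq ..
    also have "\<dots> = distr (measure_pmf (p H)) (?B J) (b J \<circ> (\<lambda>T. T \<inter> J))" by (rule distr_distr[OF bm']) simp
    also have "b J \<circ> (\<lambda>T. T \<inter> J) = (\<lambda>f. restrict f J) \<circ> b H"
      using JH(1) by (auto simp: b_def fun_eq_iff restrict_def indicator_def)
    also have "distr (measure_pmf (p H)) (?B J) ((\<lambda>f. restrict f J) \<circ> b H) = distr (Q H) (?B J) (\<lambda>f. restrict f J)"
      unfolding Q_def by (rule distr_distr[symmetric, OF measurable_restrict_subset[OF JH(1)] bm])
    finally show "Q J = distr (Q H) (?B J) (\<lambda>f. restrict f J)" .
  qed
  define G where "G = {{S. S \<subseteq> E \<and> e \<in> S} | e. e \<in> E}"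
  \<comment> \<open>Decoding is total: any coordinate other than \<open>1\<close> counts as absence,
    so no null set of bad points needs to be removed.\<close>
  define g where "g = (\<lambda>\<omega>. {e \<in> E. \<omega> e = (1 :: real)})"
  have G: "G \<subseteq> Pow (Pow E)" unfolding G_def by auto
  have gm: "g \<in> measurable lim (sigma (Pow E) G)"
  proof (rule measurable_measure_of[OF G])
    show "g \<in> space lim \<rightarrow> Pow E" unfolding g_def by auto
    fix Y assume "Y \<in> G"
    then obtain e where e: "e \<in> E" "Y = {S. S \<subseteq> E \<and> e \<in> S}" unfolding G_def by blast
    have "g -` Y \<inter> space lim = (\<lambda>\<omega>. \<omega> e) -` {1} \<inter> space (?B E)" unfolding e(2) g_def using e(1) by auto
    also have "\<dots> \<in> sets (?B E)" by (rule measurable_sets[OF measurable_component_singleton[OF e(1)]]) simp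
    finally show "g -` Y \<inter> space lim \<in> sets lim" by simp
  qed
  define M where "M = distr lim (sigma (Pow E) G) g"
  have spM: "space M = Pow E" unfolding M_def by (simp add: space_measure_of[OF G])
  have sM: "sets M = sigma_sets (Pow E) G" unfolding M_def by (simp add: sets_measure_of[OF G])
  have gen: "{S. S \<subseteq> E \<and> e \<in> S} \<in> sets M" if "e \<in> E" for e
    unfolding sM by (rule sigma_sets.Basic) (use that in \<open>auto simp: G_def\<close>)
  have evM: "{S. S \<subseteq> E \<and> S \<inter> J = T} \<in> sets M" if J: "finite J" "J \<subseteq> E" "T \<subseteq> J" for J T
  proof -
    have "{S \<in> space M. \<forall>e\<in>J. (e \<in> S) = (e \<in> T)} \<in> sets M"
    proof (rule sets.sets_Collect_finite_All[OF _ J(1)])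
      fix e assume e: "e \<in> J"
      have "{S \<in> space M. e \<in> S} = {S. S \<subseteq> E \<and> e \<in> S}" unfolding spM by auto
      then have a: "{S \<in> space M. e \<in> S} \<in> sets M" using gen[of e] e J by auto
      show "{S \<in> space M. (e \<in> S) = (e \<in> T)} \<in> sets M"
        using a sets.sets_Collect_neg[OF a] by (cases "e \<in> T") simp_all
    qed
    moreover have "{S \<in> space M. \<forall>e\<in>J. (e \<in> S) = (e \<in> T)} = {S. S \<subseteq> E \<and> S \<inter> J = T}" unfolding spM using J by auto
    ultimately show ?thesis by simp
  qed
  have meas: "measure M {S. S \<subseteq> E \<and> S \<inter> J = T} = q J T" if J: "finite J" "J \<subseteq> E" "T \<subseteq> J" for J T
  proof -
    \<comment> \<open>The box of the pattern \<open>T\<close>, with absence represented by the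
      complement of \<open>{1}\<close> in accordance with \<open>g\<close>.\<close>
    define Y where "Y = Pi\<^sub>E J (\<lambda>e. if e \<in> T then {1 :: real} else - {1})"
    have Y: "Y \<in> sets (?B J)" unfolding Y_def by (rule sets_PiM_I_finite[OF J(1)]) auto
    have gY: "g \<omega> \<inter> J = T \<longleftrightarrow> restrict \<omega> J \<in> Y" for \<omega>
    proof -
      have "g \<omega> \<inter> J = T \<longleftrightarrow> (\<forall>e\<in>J. (\<omega> e = 1) = (e \<in> T))" unfolding g_def using J by blast
      also have "\<dots> \<longleftrightarrow> restrict \<omega> J \<in> Y" unfolding Y_def by (auto simp: PiE_iff split: if_splits)
      finally show ?thesis .
    qed
    have "measure M {S. S \<subseteq> E \<and> S \<inter> J = T} = measure lim (g -` {S. S \<subseteq> E \<and> S \<inter> J = T} \<inter> space lim)"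
      unfolding M_def by (rule measure_distr[OF gm]) (use evM[OF J] in \<open>simp add: M_def\<close>)
    also have "g -` {S. S \<subseteq> E \<and> S \<inter> J = T} \<inter> space lim = prod_emb E (\<lambda>_. borel) J Y"
      using gY by (auto simp: prod_emb_def space_PiM g_def)
    also have "measure lim (prod_emb E (\<lambda>_. borel) J Y) = measure (Q J) Y" by (rule measure_lim_emb[OF J(2,1) Y])
    also have "\<dots> = measure (p J) (b J -` Y)" unfolding Q_def using measure_distr[OF bm Y] by simp
    also have "\<dots> = measure (p J) {T}"
    proof (rule measure_prob_cong_0)
      have *: "b J S \<in> Y \<longleftrightarrow> (\<forall>e\<in>J. (e \<in> S) = (e \<in> T))" for S
        unfolding Y_def b_def by (auto simp: PiE_iff indicator_def split: if_splits)
      show "pmf (p J) S = 0" if "S \<in> b J -` Y - {T}" for S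
      proof -
        have "\<not> S \<subseteq> J" using that *[of S] J(3) by blast
        then show ?thesis by (simp add: pmfp[OF J(1,2)])
      qed
      show "pmf (p J) S = 0" if "S \<in> {T} - b J -` Y" for S using that *[of S] by auto
    qed
    also have "\<dots> = q J T" using pmfp[OF J(1,2)] J(3) by (simp add: measure_pmf_single)
    finally show ?thesis .
  qed
  have pM: "prob_space M" unfolding M_def by (rule P.prob_space_distr[OF gm])
  have lM: "(\<lambda>l. measure (\<mu> l) {D \<in> space (\<mu> l). \<forall>e\<in>J. X l e D = (e \<in> T)})
      \<longlonglongrightarrow> measure M {S. S \<subseteq> E \<and> S \<inter> J = T}" if "finite J" "J \<subseteq> E" "T \<subseteq> J" for J T
    using rq[OF that] unfolding meas[OF that] r_def .
  show ?thesis
    by (intro exI[of _ M] conjI allI impI) (fact pM, fact spM, (rule evM, assumption+), (rule lM, assumption+))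
qed

section \<open>Edges at a vertex under reduction to the cylinder\<close>

lemma translate_fixed: "translate d u = u \<longleftrightarrow> d = 0"
  by (cases u) auto

lemma shape_translate: "shape (translate d u) = shape u"
  by (cases u) auto

lemma reduce_translate: "int N dvd d \<Longrightarrow> reduce N (translate d u) = reduce N u"
  by (cases u) (auto elim!: dvdE)

lemma arc_shape_neq: "(u, v) \<in> band_arcs m \<Longrightarrow> shape u \<noteq> shape v"
  using arcs_not_opposite[of u v m u v] by metis

text \<open>Two lifts of one edge differ by a translation. As the two ends of an edge have different
  shapes, a common vertex must occupy the same end in both lifts, and the translation is trivial. No
  lower bound on the circumference enters.\<close>

lemma reduce_inj_incident:
  assumes e: "e \<in> band_edges m" "e' \<in> band_edges m" and v: "v \<in> e" "v \<in> e'"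
    and eq: "reduce N ` e = reduce N ` e'"
  shows "e = e'"
proof -
  obtain u w where uw: "e = {u, w}" "(u, w) \<in> band_arcs m" using e(1) unfolding edges_of_def by blast
  obtain u' w' where uw': "e' = {u', w'}" "(u', w') \<in> band_arcs m" using e(2) unfolding edges_of_def by blast
  obtain d where d: "u' = translate d u" "w' = translate d w"
    using arc_lift_unique[OF uw(2) uw'(2)] eq uw(1) uw'(1) by auto
  have "shape u \<noteq> shape w" by (rule arc_shape_neq[OF uw(2)])
  then have "translate d u = u \<or> translate d w = w"
    using v shape_translate[of d u] shape_translate[of d w] unfolding uw(1) uw'(1) d by auto
  then have "d = 0" by (auto simp: translate_fixed)
  then show ?thesis using uw(1) uw'(1) d by simp
qed

lemma reduce_incident_surj:
  assumes e: "e \<in> cyl_edges m N" and v: "reduce N v \<in> e"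
  shows "\<exists>e'. e' \<in> band_edges m \<and> v \<in> e' \<and> reduce N ` e' = e"
proof -
  obtain u w where uw: "e = {reduce N u, reduce N w}" "(u, w) \<in> band_arcs m"
    using e unfolding edges_of_def cyl_arcs_def by auto
  have b: "{u, w} \<in> band_edges m" using uw(2) unfolding edges_of_def by blast
  obtain d where d: "int N dvd d" "v = translate d u \<or> v = translate d w"
    using v reduce_eqD[of N u v] reduce_eqD[of N w v] unfolding uw(1) by (metis insertE singletonD)
  have "reduce N ` translate d ` {u, w} = e" using reduce_translate[OF d(1)] by (simp add: uw(1))
  then show ?thesis using translate_edge[OF b, of d] d(2) by (intro exI[of _ "translate d ` {u, w}"]) auto
qed

text \<open>Reduction to circumference \<open>1\<close> is injective on the edges at
  \<open>v\<close> and has a finite range.\<close>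

lemma finite_incident: "finite {e \<in> band_edges m. v \<in> e}"
proof (rule finite_imageD)
  have "reduce 1 ` e \<in> cyl_edges m 1" if "e \<in> band_edges m" for e
    using that unfolding edges_of_def cyl_arcs_def by force
  then have "(\<lambda>e. reduce 1 ` e) ` {e \<in> band_edges m. v \<in> e} \<subseteq> cyl_edges m 1" by (simp add: image_subset_iff)
  then show "finite ((\<lambda>e. reduce 1 ` e) ` {e \<in> band_edges m. v \<in> e})"
    by (rule finite_subset) (simp add: finite_cyl_edges)
  show "inj_on (\<lambda>e. reduce 1 ` e) {e \<in> band_edges m. v \<in> e}"
  proof (rule inj_onI)
    fix e e' assume "e \<in> {e \<in> band_edges m. v \<in> e}" "e' \<in> {e \<in> band_edges m. v \<in> e}" "reduce 1 ` e = reduce 1 ` e'"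
    then show "e = e'" by (intro reduce_inj_incident[of e m e' v 1]) simp_all
  qed
qed

text \<open>Reduction is a bijection from the band edges at \<open>v\<close> to the cylinder edges
  at its image, so the vertex condition holds for every circumference and not merely in the
  limit.\<close>

lemma cyl_dimer_incident:
  assumes v: "v \<in> band_vertices m" and D: "D \<in> cyl_dimers m N"
  shows "\<exists>!e. e \<in> {e \<in> band_edges m. v \<in> e} \<and> reduce N ` e \<in> D"
proof -
  have "reduce N v \<in> cyl_vertices m N" using v unfolding cyl_vertices_def by blast
  then obtain e where e: "e \<in> D" "reduce N v \<in> e" "\<And>e'. e' \<in> D \<Longrightarrow> reduce N v \<in> e' \<Longrightarrow> e' = e"
    using D unfolding dimer_configs_def by blast
  have "D \<subseteq> cyl_edges m N" using D unfolding dimer_configs_def by simp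
  then have "e \<in> cyl_edges m N" using e(1) by (rule subsetD)
  then obtain e' where e': "e' \<in> band_edges m" "v \<in> e'" "reduce N ` e' = e"
    using reduce_incident_surj[OF _ e(2)] by blast
  show ?thesis
  proof (rule ex1I[of _ e'])
    show "e' \<in> {e \<in> band_edges m. v \<in> e} \<and> reduce N ` e' \<in> D" using e' e(1) by simp
    fix f assume f: "f \<in> {e \<in> band_edges m. v \<in> e} \<and> reduce N ` f \<in> D"
    then have "reduce N ` f = e" by (intro e(3)) auto
    then show "f = e'" using reduce_inj_incident[of f m e' v N] f e' by simp
  qed
qed

lemma countable_band_vertices: "countable (band_vertices m)"
proof (rule countable_subset)
  show "band_vertices m \<subseteq> (\<Union>s\<in>{Ca, Cb, Cc}. range (\<lambda>(x, y). BetaV s x y) \<union> range (\<lambda>(x, y). OmegaV s x y))"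
  proof
    fix v assume "v \<in> band_vertices m"
    have s: "s \<in> {Ca, Cb, Cc}" for s by (cases s) simp_all
    show "v \<in> (\<Union>s\<in>{Ca, Cb, Cc}. range (\<lambda>(x, y). BetaV s x y) \<union> range (\<lambda>(x, y). OmegaV s x y))"
    proof (cases v)
      case (BetaV s x y)
      then have "v \<in> range (\<lambda>(x, y). BetaV s x y)" by (intro image_eqI[of _ _ "(x, y)"]) simp_all
      then show ?thesis using s[of s] by blast
    next
      case (OmegaV s x y)
      then have "v \<in> range (\<lambda>(x, y). OmegaV s x y)" by (intro image_eqI[of _ _ "(x, y)"]) simp_all
      then show ?thesis using s[of s] by blast
    qed
  qed
qed simp

lemma prob_space_cyl_boltzmann:
  assumes N: "N > 0" and W: "fisher_band_weight m n W" "n dvd N"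
  shows "prob_space (cyl_boltzmann m N W)"
proof
  let ?M = "cyl_boltzmann m N W"
  have "dimer_sum m N (cyl_weight m N W) > 0" by (rule dimer_sum_pos[OF N cyl_weight_pos[OF W]])
  then have "measure ?M (space ?M) = 1"
    using measure_cyl_boltzmann[OF N W, of "\<lambda>_. True"] by (simp add: dimer_event_sum_def dimer_sum_def)
  then show "emeasure ?M (space ?M) = 1"
    unfolding measure_def by (metis emeasure_eq_ennreal_measure enn2real_top ennreal_1 measure_def zero_neq_one)
qed

text \<open>The extension theorem only gives a random set of edges. The condition at one vertex is
  an event on finitely many edges of probability one on each cylinder, hence also in the limit;
  there are countably many vertices, so almost every set is a dimer configuration.\<close>

lemma weak_limit_exists:
  assumes m: "m \<ge> 1" and n: "n \<ge> 1" and W: "fisher_band_weight m n W"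
  shows "\<exists>P. weak_limit m (\<lambda>l. 2 * l * n) (\<lambda>l. cyl_boltzmann m (2 * l * n) W) P"
proof -
  let ?E = "band_edges m" and ?V = "band_vertices m"
  define N where "N l = 2 * l * n" for l
  let ?\<mu> = "\<lambda>l. cyl_boltzmann m (N l) W"
  \<comment> \<open>At \<open>l = 0\<close> the circumference is \<open>0\<close>; the sequence is
    therefore taken from \<open>l = 1\<close> on and the shift undone at the end.\<close>
  have N: "N (Suc l) > 0" "n dvd N l" for l using n by (simp_all add: N_def)
  have sp: "space (?\<mu> l) = cyl_dimers m (N l)" for l by (simp add: cyl_boltzmann_def space_boltzmann)
  have pr: "prob_space (?\<mu> (Suc l))" for l by (rule prob_space_cyl_boltzmann[OF N(1) W N(2)])
  have sets: "sets (?\<mu> l) = Pow (space (?\<mu> l))" for l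
    by (simp add: cyl_boltzmann_def boltzmann_measure_def sets_point_measure space_point_measure)
  have conv: "convergent (\<lambda>l. measure (?\<mu> (Suc l)) {D \<in> space (?\<mu> (Suc l)). \<forall>e\<in>J. (reduce (N (Suc l)) ` e \<in> D) = (e \<in> T)})"
    if J: "finite J" "J \<subseteq> ?E" for J T
  proof -
    have "\<exists>x q. q \<in> edge_codes m \<and> e = band_edge x q" if "e \<in> J" for e using band_edge_ex J(2) that by blast
    then obtain x q where xq: "\<And>e. e \<in> J \<Longrightarrow> q e \<in> edge_codes m \<and> e = band_edge (x e) (q e)" by metis
    define C where "C = (\<lambda>e. (x e, q e, e \<in> T)) ` J"
    have "measure (?\<mu> (Suc l)) {D \<in> space (?\<mu> (Suc l)). \<forall>e\<in>J. (reduce (N (Suc l)) ` e \<in> D) = (e \<in> T)}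
        = dimer_event_sum m (N (Suc l)) (cyl_weight m (N (Suc l)) W) (cyl_event (N (Suc l)) C)
          / dimer_sum m (N (Suc l)) (cyl_weight m (N (Suc l)) W)" for l
    proof -
      have "(\<forall>e\<in>J. (reduce (N (Suc l)) ` e \<in> D) = (e \<in> T)) \<longleftrightarrow> cyl_event (N (Suc l)) C D" for D
      proof -
        have "reduce (N (Suc l)) ` e = cyl_edge (N (Suc l)) (x e mod int (N (Suc l))) (q e)" if "e \<in> J" for e
          using reduce_band_edge[OF N(1), of "q e" m l "x e"] xq[OF that] by metis
        then show ?thesis unfolding cyl_event_def C_def by simp
      qed
      then show ?thesis using measure_cyl_boltzmann[OF N(1) W N(2)] by simp
    qed
    moreover have "convergent (\<lambda>l. dimer_event_sum m (N l) (cyl_weight m (N l) W) (cyl_event (N l) C)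
          / dimer_sum m (N l) (cyl_weight m (N l) W))"
      unfolding N_def by (rule local_event_convergent[OF m n W]) (use J(1) xq in \<open>auto simp: C_def\<close>)
    ultimately show ?thesis by (subst (asm) convergent_Suc_iff[symmetric]) simp
  qed
  have "\<exists>M. prob_space M \<and> space M = Pow ?E \<and>
    (\<forall>J T. finite J \<longrightarrow> J \<subseteq> ?E \<longrightarrow> T \<subseteq> J \<longrightarrow> {S. S \<subseteq> ?E \<and> S \<inter> J = T} \<in> sets M \<and>
      (\<lambda>l. measure (?\<mu> (Suc l)) {D \<in> space (?\<mu> (Suc l)). \<forall>e\<in>J. (reduce (N (Suc l)) ` e \<in> D) = (e \<in> T)})
        \<longlonglongrightarrow> measure M {S. S \<subseteq> ?E \<and> S \<inter> J = T})"
    by (rule bit_process_exists[where E = ?E and \<mu> = "\<lambda>l. ?\<mu> (Suc l)" and X = "\<lambda>l e D. reduce (N (Suc l)) ` e \<in> D", OF pr sets])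
      (rule conv)
  then obtain M where MM: "prob_space M \<and> space M = Pow ?E \<and>
    (\<forall>J T. finite J \<longrightarrow> J \<subseteq> ?E \<longrightarrow> T \<subseteq> J \<longrightarrow> {S. S \<subseteq> ?E \<and> S \<inter> J = T} \<in> sets M \<and>
      (\<lambda>l. measure (?\<mu> (Suc l)) {D \<in> space (?\<mu> (Suc l)). \<forall>e\<in>J. (reduce (N (Suc l)) ` e \<in> D) = (e \<in> T)})
        \<longlonglongrightarrow> measure M {S. S \<subseteq> ?E \<and> S \<inter> J = T})" ..
  note M = MM[THEN conjunct1] MM[THEN conjunct2, THEN conjunct1]
  note Mev = MM[THEN conjunct2, THEN conjunct2, rule_format, THEN conjunct1]
  note Mlim = MM[THEN conjunct2, THEN conjunct2, rule_format, THEN conjunct2]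
  interpret M: prob_space M by (rule M(1))
  let ?\<Omega> = "dimer_configs ?V ?E"
  \<comment> \<open>The condition at \<open>v\<close> is the disjoint union, over the finitely many
    incident edges, of the events that exactly this edge is present at \<open>v\<close>.\<close>
  have vertex: "{S \<in> space M. \<exists>!e. e \<in> S \<and> v \<in> e} \<in> sets M \<and> measure M {S \<in> space M. \<exists>!e. e \<in> S \<and> v \<in> e} = 1"
    if v: "v \<in> ?V" for v
  proof -
    define I where "I = {e \<in> ?E. v \<in> e}"
    have I: "finite I" "I \<subseteq> ?E" unfolding I_def using finite_incident by auto
    let ?A = "\<lambda>e. {S. S \<subseteq> ?E \<and> S \<inter> I = {e}}"
    have As: "?A e \<in> sets M" if "e \<in> I" for e using Mev[OF I, of "{e}"] that by simp
    have dis: "disjoint_family_on ?A I" unfolding disjoint_family_on_def by auto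
    have ex1: "(\<exists>!e. e \<in> S \<and> v \<in> e) \<longleftrightarrow> (\<exists>e\<in>I. S \<inter> I = {e})" if S: "S \<subseteq> ?E" for S
    proof
      assume "\<exists>!e. e \<in> S \<and> v \<in> e"
      then obtain e where e: "e \<in> S" "v \<in> e" "\<And>f. f \<in> S \<Longrightarrow> v \<in> f \<Longrightarrow> f = e" by blast
      have "e \<in> I" using e(1,2) S unfolding I_def by blast
      moreover have "S \<inter> I = {e}" using e \<open>e \<in> I\<close> unfolding I_def by blast
      ultimately show "\<exists>e\<in>I. S \<inter> I = {e}" by blast
    next
      assume "\<exists>e\<in>I. S \<inter> I = {e}"
      then obtain e where e: "S \<inter> I = {e}" by blast
      show "\<exists>!e. e \<in> S \<and> v \<in> e"
      proof (rule ex1I[of _ e])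
        show "e \<in> S \<and> v \<in> e" using e unfolding I_def by blast
        show "f = e" if "f \<in> S \<and> v \<in> f" for f
        proof -
          have "f \<in> S \<inter> I" using that S unfolding I_def by blast
          then show ?thesis unfolding e by simp
        qed
      qed
    qed
    have eq: "{S \<in> space M. \<exists>!e. e \<in> S \<and> v \<in> e} = (\<Union>e\<in>I. ?A e)"
    proof (rule Set.set_eqI)
      fix S
      have "S \<in> {S \<in> space M. \<exists>!e. e \<in> S \<and> v \<in> e} \<longleftrightarrow> S \<subseteq> ?E \<and> (\<exists>e\<in>I. S \<inter> I = {e})"
        unfolding M(2) mem_Collect_eq Pow_iff by (rule conj_cong[OF refl ex1])
      also have "\<dots> \<longleftrightarrow> S \<in> (\<Union>e\<in>I. ?A e)" unfolding UN_iff mem_Collect_eq by (simp only: Set.bex_simps)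
      finally show "S \<in> {S \<in> space M. \<exists>!e. e \<in> S \<and> v \<in> e} \<longleftrightarrow> S \<in> (\<Union>e\<in>I. ?A e)" .
    qed
    \<comment> \<open>On each cylinder these events partition the whole space; the sum of their
      limits is therefore \<open>1\<close>.\<close>
    have one: "(\<Sum>e\<in>I. measure (?\<mu> (Suc l)) {D \<in> space (?\<mu> (Suc l)). \<forall>f\<in>I. (reduce (N (Suc l)) ` f \<in> D) = (f \<in> {e})}) = 1" for l
    proof -
      interpret pl: prob_space "?\<mu> (Suc l)" by (rule pr)
      let ?B = "\<lambda>e. {D \<in> space (?\<mu> (Suc l)). \<forall>f\<in>I. (reduce (N (Suc l)) ` f \<in> D) = (f \<in> {e})}"
      have "(\<Union>e\<in>I. ?B e) = space (?\<mu> (Suc l))"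
      proof (rule subset_antisym)
        show "space (?\<mu> (Suc l)) \<subseteq> (\<Union>e\<in>I. ?B e)"
        proof
          fix D assume D: "D \<in> space (?\<mu> (Suc l))"
          then have "\<exists>!e. e \<in> I \<and> reduce (N (Suc l)) ` e \<in> D"
            using cyl_dimer_incident[OF v] unfolding sp I_def by blast
          then obtain e where "(e \<in> I \<and> reduce (N (Suc l)) ` e \<in> D) \<and>
            (\<forall>f. f \<in> I \<and> reduce (N (Suc l)) ` f \<in> D \<longrightarrow> f = e)" unfolding Ex1_def by (rule exE)
          then have e: "e \<in> I" "reduce (N (Suc l)) ` e \<in> D"
            "\<And>f. f \<in> I \<Longrightarrow> reduce (N (Suc l)) ` f \<in> D \<Longrightarrow> f = e" by simp_all
          have "(reduce (N (Suc l)) ` f \<in> D) = (f \<in> {e})" if "f \<in> I" for f using e that by blast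
          then have "D \<in> ?B e" using D by simp
          then show "D \<in> (\<Union>e\<in>I. ?B e)" using e(1) by blast
        qed
      qed auto
      moreover have "measure (?\<mu> (Suc l)) (\<Union>e\<in>I. ?B e) = (\<Sum>e\<in>I. measure (?\<mu> (Suc l)) (?B e))"
      proof (rule pl.finite_measure_finite_Union[OF I(1)])
        show "?B ` I \<subseteq> sets (?\<mu> (Suc l))" unfolding sets by auto
        have "?B e \<inter> ?B f = {}" if "e \<in> I" "f \<in> I" "e \<noteq> f" for e f using that by blast
        then show "disjoint_family_on ?B I" unfolding disjoint_family_on_def by simp
      qed
      ultimately show ?thesis using pl.prob_space by simp
    qed
    have "(\<lambda>l. \<Sum>e\<in>I. measure (?\<mu> (Suc l)) {D \<in> space (?\<mu> (Suc l)). \<forall>f\<in>I. (reduce (N (Suc l)) ` f \<in> D) = (f \<in> {e})})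
        \<longlonglongrightarrow> (\<Sum>e\<in>I. measure M (?A e))"
      by (rule tendsto_sum, rule Mlim[OF I]) simp
    then have "(\<lambda>l. 1) \<longlonglongrightarrow> (\<Sum>e\<in>I. measure M (?A e))" unfolding one .
    then have "(\<Sum>e\<in>I. measure M (?A e)) = 1" by (simp add: LIMSEQ_const_iff)
    moreover have "measure M (\<Union>e\<in>I. ?A e) = (\<Sum>e\<in>I. measure M (?A e))"
      by (rule M.finite_measure_finite_Union[OF I(1) _ dis]) (use As in blast)
    moreover have "(\<Union>e\<in>I. ?A e) \<in> sets M" by (rule sets.finite_UN[OF I(1) As])
    ultimately show ?thesis unfolding eq by simp
  qed
  have \<Omega>eq: "?\<Omega> = {S \<in> space M. \<forall>v\<in>?V. \<exists>!e. e \<in> S \<and> v \<in> e}" unfolding M(2) dimer_configs_def by auto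
  have \<Omega>s: "?\<Omega> \<in> sets M" unfolding \<Omega>eq
    by (rule sets.sets_Collect_countable_All'[OF _ countable_band_vertices]) (use vertex in blast)
  have "AE S in M. \<forall>v\<in>?V. S \<in> {S \<in> space M. \<exists>!e. e \<in> S \<and> v \<in> e}"
    using vertex M.AE_in_set_eq_1 by (subst AE_ball_countable[OF countable_band_vertices]) blast
  then have ae: "AE S in M. S \<in> ?\<Omega>" using AE_space by eventually_elim (simp add: \<Omega>eq)
  then have "measure M ?\<Omega> = 1" using M.AE_in_set_eq_1[OF \<Omega>s] by blast
  then have "?\<Omega> \<noteq> {}" by auto
  then obtain D0 where D0: "D0 \<in> ?\<Omega>" by blast
  \<comment> \<open>Moves the exceptional null set to an arbitrary configuration \<open>D0\<close>,
    so that the law can be pushed forward to the space of dimer configurations. \<open>D0\<close>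
    exists because that space has measure one.\<close>
  define h where "h S = (if S \<in> ?\<Omega> then S else D0)" for S
  define G where "G = {{D \<in> ?\<Omega>. e \<in> D} | e. e \<in> ?E}"
  have G: "G \<subseteq> Pow ?\<Omega>" unfolding G_def by auto
  have bd: "band_dimer_space m = sigma ?\<Omega> G" unfolding band_dimer_space_def G_def Let_def ..
  have spB: "space (band_dimer_space m) = ?\<Omega>" unfolding bd by (rule space_measure_of[OF G])
  have edge: "{S \<in> space M. e \<in> S} \<in> sets M" if "e \<in> ?E" for e
  proof -
    have "{S \<in> space M. e \<in> S} = {S. S \<subseteq> ?E \<and> S \<inter> {e} = {e}}" unfolding M(2) by auto
    then show ?thesis using Mev[of "{e}" "{e}"] that by simp
  qed
  have hm: "h \<in> measurable M (band_dimer_space m)" unfolding bd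
  proof (rule measurable_measure_of[OF G])
    show "h \<in> space M \<rightarrow> ?\<Omega>" unfolding h_def using D0 by auto
    fix Y assume "Y \<in> G"
    then obtain e where e: "e \<in> ?E" "Y = {D \<in> ?\<Omega>. e \<in> D}" unfolding G_def by blast
    have "h -` Y \<inter> space M = ({S \<in> space M. e \<in> S} \<inter> ?\<Omega>) \<union> (if e \<in> D0 then space M - ?\<Omega> else {})"
      unfolding e(2) h_def using D0 by auto
    also have "\<dots> \<in> sets M" using edge[OF e(1)] \<Omega>s by auto
    finally show "h -` Y \<inter> space M \<in> sets M" .
  qed
  define P where "P = distr M (band_dimer_space m) h"
  have "(\<lambda>l. measure (?\<mu> l) (all_occur (?\<mu> l) ((\<lambda>e. reduce (N l) ` e) ` F))) \<longlonglongrightarrow> measure P (all_occur P F)"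
    if F: "finite F" "F \<subseteq> ?E" for F
  proof -
    have "{D \<in> space (band_dimer_space m). \<forall>e\<in>F. e \<in> D} \<in> sets (band_dimer_space m)"
    proof (rule sets.sets_Collect_finite_All[OF _ F(1)])
      fix e assume "e \<in> F"
      then have "{D \<in> ?\<Omega>. e \<in> D} \<in> G" using F(2) unfolding G_def by blast
      then show "{D \<in> space (band_dimer_space m). e \<in> D} \<in> sets (band_dimer_space m)"
        unfolding spB unfolding bd by (simp add: sets_measure_of[OF G])
    qed
    then have ev: "all_occur P F \<in> sets (band_dimer_space m)"
      unfolding all_occur_def P_def subset_eq by simp
    have "measure P (all_occur P F) = measure M (h -` all_occur P F \<inter> space M)"
      unfolding P_def by (rule measure_distr[OF hm]) (use ev in \<open>simp add: P_def\<close>)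
    \<comment> \<open>The retraction \<open>h\<close> is the identity almost everywhere, so the
      event has the probability of the corresponding pattern of the random set.\<close>
    also have "\<dots> = measure M {S. S \<subseteq> ?E \<and> S \<inter> F = F}"
    proof (rule measure_eq_AE)
      show "AE S in M. (S \<in> h -` all_occur P F \<inter> space M) = (S \<in> {S. S \<subseteq> ?E \<and> S \<inter> F = F})"
        using ae AE_space
      proof eventually_elim
        case (elim S)
        then have "h S = S" "S \<subseteq> ?E" "S \<in> space P" by (auto simp: h_def M(2) P_def spB)
        then show ?case using elim(2) by (auto simp: all_occur_def)
      qed
      show "h -` all_occur P F \<inter> space M \<in> sets M" by (rule measurable_sets[OF hm ev])
      show "{S. S \<subseteq> ?E \<and> S \<inter> F = F} \<in> sets M" by (rule Mev[OF F]) simp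
    qed
    finally have lim: "measure P (all_occur P F) = measure M {S. S \<subseteq> ?E \<and> S \<inter> F = F}" .
    have "{D \<in> space (?\<mu> l). \<forall>e\<in>F. (reduce (N l) ` e \<in> D) = (e \<in> F)} = all_occur (?\<mu> l) ((\<lambda>e. reduce (N l) ` e) ` F)" for l
      unfolding all_occur_def by auto
    then have "(\<lambda>l. measure (?\<mu> (Suc l)) (all_occur (?\<mu> (Suc l)) ((\<lambda>e. reduce (N (Suc l)) ` e) ` F)))
        \<longlonglongrightarrow> measure P (all_occur P F)"
      using Mlim[OF F subset_refl] unfolding lim by simp
    then show ?thesis by (rule LIMSEQ_imp_Suc)
  qed
  moreover have "prob_space P" "space P = space (band_dimer_space m)" "sets P = sets (band_dimer_space m)"
    unfolding P_def using M.prob_space_distr[OF hm] by simp_all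
  ultimately have "weak_limit m N ?\<mu> P" unfolding weak_limit_def by blast
  moreover have "N = (\<lambda>l. 2 * l * n)" unfolding N_def ..
  ultimately show ?thesis by (intro exI[of _ P]) simp
qed

section \<open>Identification of the limit probabilities\<close>

lemma reduce_inj_bounded:
  assumes uv: "reduce N u = reduce N v" and K: "\<bar>column u\<bar> \<le> int K" "\<bar>column v\<bar> \<le> int K" "2 * K < N"
  shows "u = v"
proof -
  obtain d where d: "int N dvd d" "v = translate d u" using reduce_eqD[OF uv] by blast
  have "\<bar>d\<bar> < int N" using K unfolding d(2) column_map_x by linarith
  then have "d = 0" using d(1) dvd_imp_le_int[of d "int N"] by linarith
  then show ?thesis using d(2) by simp
qed

lemma endpoints_map_prod: "endpoints (map (map_prod f f) ps) = map f (endpoints ps)"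
  by (induction ps) (auto simp: endpoints_def)

lemma invertible_kast_mat:
  assumes N: "N > 1" "even N" and m: "m \<ge> 1" and W: "fisher_band_weight m n W" "n dvd N"
  shows "invertible_mat (kast_mat m N W (- 1 :: real))"
proof -
  let ?K = "kast_mat m N W (- 1 :: real)"
  have "dimer_sum m N (cyl_weight m N W) > 0" by (rule dimer_sum_pos[OF _ cyl_weight_pos[OF W]]) (use N in simp)
  then have det: "Determinant.det ?K \<noteq> 0" unfolding kast_mat_eq kasteleyn_det[OF N m] by simp
  have K: "?K \<in> carrier_mat (6 * m * N) (6 * m * N)" unfolding kast_mat_def by simp
  note inv = inv_mat_right[OF K det]
  show ?thesis unfolding invertible_mat_def inverts_mat_def square_mat.simps
    using inv K by (intro conjI exI[of _ "inv_mat ?K"]) auto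
qed

text \<open>Exact at finite circumference: injectivity on the endpoints keeps the reduced edges
  distinct, and reduction preserves the weights, so \<open>cyl_minor_formula\<close> applies to the
  reduced list.\<close>

lemma cyl_boltzmann_minor:
  assumes N: "N > 1" "even N" and m: "m \<ge> 1" and W: "fisher_band_weight m n W" "n dvd N"
    and ps: "\<And>u v. (u, v) \<in> set ps \<Longrightarrow> {u, v} \<in> band_edges m"
    and dist: "distinct (map (\<lambda>(u, v). {u, v}) ps)" and inj: "inj_on (reduce N) (set (endpoints ps))"
  shows "(\<Prod>(u, v)\<leftarrow>ps. W {u, v}) *
      sqrt (Determinant.det (vertex_submatrix m (inv_mat (kast_mat m N W (- 1))) (map (reduce N) (endpoints ps))))
    = measure (cyl_boltzmann m N W)
        (all_occur (cyl_boltzmann m N W) ((\<lambda>e. reduce N ` e) ` set (map (\<lambda>(u, v). {u, v}) ps)))"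
proof -
  have N0: "N > 0" using N by simp
  define ps' where "ps' = map (map_prod (reduce N) (reduce N)) ps"
  have mp: "map (\<lambda>(u, v). {u, v}) ps' = map (\<lambda>e. reduce N ` e) (map (\<lambda>(u, v). {u, v}) ps)"
    unfolding ps'_def map_map by (rule map_cong) auto
  have sub: "{u, v} \<subseteq> set (endpoints ps)" if "(u, v) \<in> set ps" for u v
    using that unfolding endpoints_def by auto
  have "inj_on (\<lambda>e. reduce N ` e) (set (map (\<lambda>(u, v). {u, v}) ps))"
  proof (rule inj_onI)
    fix e e' assume e: "e \<in> set (map (\<lambda>(u, v). {u, v}) ps)" "e' \<in> set (map (\<lambda>(u, v). {u, v}) ps)"
      and eq: "reduce N ` e = reduce N ` e'"
    have "e \<subseteq> set (endpoints ps)" "e' \<subseteq> set (endpoints ps)" using e sub by auto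
    then show "e = e'" using inj_on_image_eq_iff[OF inj] eq by blast
  qed
  then have dist': "distinct (map (\<lambda>(u, v). {u, v}) ps')" unfolding mp using dist by (simp only: distinct_map)
  have E': "{u, v} \<in> cyl_edges m N" if p: "(u, v) \<in> set ps'" for u v
  proof -
    obtain a b where ab: "(a, b) \<in> set ps" "u = reduce N a" "v = reduce N b"
      using p unfolding ps'_def by auto
    obtain c d where cd: "{a, b} = {c, d}" "(c, d) \<in> band_arcs m" using ps[OF ab(1)] unfolding edges_of_def by blast
    have "{u, v} = reduce N ` {a, b}" using ab by simp
    then have "{u, v} = {reduce N c, reduce N d}" unfolding cd(1) by simp
    moreover have "(reduce N c, reduce N d) \<in> cyl_arcs m N" unfolding cyl_arcs_def using cd(2) by force
    ultimately show ?thesis unfolding edges_of_def by blast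
  qed
  have pr: "(\<Prod>(u, v)\<leftarrow>ps'. cyl_weight m N W {u, v}) = (\<Prod>(u, v)\<leftarrow>ps. W {u, v})"
  proof -
    have "cyl_weight m N W {reduce N u, reduce N v} = W {u, v}" if "(u, v) \<in> set ps" for u v
      using cyl_weight_reduce[OF W ps[OF that]] by simp
    then have "map (\<lambda>(u, v). cyl_weight m N W {u, v}) ps' = map (\<lambda>(u, v). W {u, v}) ps"
      unfolding ps'_def map_map by (intro map_cong) auto
    then show ?thesis by (rule arg_cong)
  qed
  have en: "endpoints ps' = map (reduce N) (endpoints ps)" unfolding ps'_def by (rule endpoints_map_prod)
  note formula = cyl_minor_formula[where w = "cyl_weight m N W", OF N m cyl_weight_pos[OF W] E' dist']
  show ?thesis
    using formula unfolding pr en mp set_map[of "\<lambda>e. reduce N ` e"] all_occur_def measure_cyl_boltzmann[OF N0 W] kast_mat_eq .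
qed

text \<open>\<open>inv_mat\<close> is a genuine inverse only for an invertible matrix, so
  invertibility is asserted for each \<open>l \<ge> 1\<close>. The formula is claimed for every weak
  limit and thus does not refer to a particular construction of it.\<close>

theorem proposition3p5:
  fixes m n :: nat and W :: "vertex set \<Rightarrow> real"
  assumes "m \<ge> 1" and "n \<ge> 2" and "even n"
    and "fisher_band_weight m n W"
  defines "N \<equiv> \<lambda>l. 2 * l * n"
  defines "\<mu> \<equiv> \<lambda>l. cyl_boltzmann m (N l) W"
  defines "K \<equiv> \<lambda>l. kast_mat m (N l) W (-1 :: real)"
  shows "(\<forall>l\<ge>1. invertible_mat (K l)) \<and>
    (\<exists>P. weak_limit m N \<mu> P) \<and>
    (\<forall>P. weak_limit m N \<mu> P \<longrightarrow>
      (\<forall>ps. (\<forall>(u, v) \<in> set ps. {u, v} \<in> band_edges m) \<longrightarrow>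
            distinct (map (\<lambda>(u, v). {u, v}) ps) \<longrightarrow>
        (\<lambda>l. (\<Prod>(u, v)\<leftarrow>ps. W {u, v}) *
              sqrt (Determinant.det (vertex_submatrix m (inv_mat (K l))
                      (map (reduce (N l)) (endpoints ps)))))
          \<longlonglongrightarrow> measure P (all_occur P (set (map (\<lambda>(u, v). {u, v}) ps)))))"
proof (intro conjI allI impI)
  note m = assms(1) and W = assms(4)
  have N: "even (N l)" "n dvd N l" for l unfolding N_def by simp_all
  \<comment> \<open>Since \<open>l < N l\<close>, taking \<open>l \<ge> 2 * k + 1\<close> makes the
    circumference exceed twice the largest column index \<open>k\<close> among the endpoints, and
    reduction is injective on them.\<close>
  have lN: "l < N l" if "l \<ge> 1" for l
  proof -
    have "l * 1 < l * (2 * n)" using that assms(2) by (intro mult_strict_left_mono) auto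
    then show ?thesis unfolding N_def by (simp add: mult.commute mult.left_commute)
  qed
  show "invertible_mat (K l)" if "l \<ge> 1" for l
    unfolding K_def by (rule invertible_kast_mat[OF _ N(1) m W N(2)]) (use lN[OF that] that in simp)
  show "\<exists>P. weak_limit m N \<mu> P"
    unfolding N_def \<mu>_def by (rule weak_limit_exists[OF m _ W]) (use assms(2) in simp)
  fix P ps
  assume wl: "weak_limit m N \<mu> P" and ps: "\<forall>(u, v) \<in> set ps. {u, v} \<in> band_edges m"
    and dist: "distinct (map (\<lambda>(u, v). {u, v}) ps)"
  let ?F = "set (map (\<lambda>(u, v). {u, v}) ps)"
  have ps': "{u, v} \<in> band_edges m" if "(u, v) \<in> set ps" for u v using ps that by auto
  then have F: "finite ?F" "?F \<subseteq> band_edges m" by auto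
  have conv: "(\<lambda>l. measure (\<mu> l) (all_occur (\<mu> l) ((\<lambda>e. reduce (N l) ` e) ` ?F))) \<longlonglongrightarrow> measure P (all_occur P ?F)"
    using wl F unfolding weak_limit_def by blast
  have "finite ((\<lambda>u. nat \<bar>column u\<bar>) ` set (endpoints ps))" by simp
  then obtain k where "\<forall>j\<in>(\<lambda>u. nat \<bar>column u\<bar>) ` set (endpoints ps). j \<le> k"
    using finite_nat_set_iff_bounded_le by blast
  then have k: "\<bar>column u\<bar> \<le> int k" if "u \<in> set (endpoints ps)" for u using that by force
  have eq: "measure (\<mu> l) (all_occur (\<mu> l) ((\<lambda>e. reduce (N l) ` e) ` ?F)) = (\<Prod>(u, v)\<leftarrow>ps. W {u, v}) *
      sqrt (Determinant.det (vertex_submatrix m (inv_mat (K l)) (map (reduce (N l)) (endpoints ps))))"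
    if l: "l \<ge> 2 * k + 1" for l
  proof -
    have "inj_on (reduce (N l)) (set (endpoints ps))"
    proof (rule inj_onI)
      fix u v assume "u \<in> set (endpoints ps)" "v \<in> set (endpoints ps)" "reduce (N l) u = reduce (N l) v"
      then show "u = v" using reduce_inj_bounded[of "N l" u v k] k lN[of l] l by simp
    qed
    moreover have "N l > 1" using lN[of l] l by simp
    ultimately show ?thesis
      unfolding K_def \<mu>_def using cyl_boltzmann_minor[OF _ N(1) m W N(2) ps' dist] by simp
  qed
  have "\<forall>\<^sub>F l in sequentially. measure (\<mu> l) (all_occur (\<mu> l) ((\<lambda>e. reduce (N l) ` e) ` ?F)) = (\<Prod>(u, v)\<leftarrow>ps. W {u, v}) *
      sqrt (Determinant.det (vertex_submatrix m (inv_mat (K l)) (map (reduce (N l)) (endpoints ps))))"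
    unfolding eventually_sequentially using eq by blast
  with conv show "(\<lambda>l. (\<Prod>(u, v)\<leftarrow>ps. W {u, v}) *
      sqrt (Determinant.det (vertex_submatrix m (inv_mat (K l)) (map (reduce (N l)) (endpoints ps)))))
        \<longlonglongrightarrow> measure P (all_occur P ?F)"
    by (rule Lim_transform_eventually)
qed

end
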